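(* Let $L,\kappa,\alpha_0,\alpha_1,\beta_0,\beta_1,T\in(0,\infty)$, $p,r\in\mathbb N$, $\mathfrak q\in[2,\infty)$, $a\in C(\mathbb R,\mathbb R)$. For every $d\in\mathbb N_0$ let $f_d\in C(\mathbb R^{\max\{d,1\}},\mathbb R)$. For every $d\in\mathbb N$ let $\nu_d\colon\mathcal B(\mathbb R^d)\to[0,1]$ be a probability measure with $\int_{\mathbb R^d}\|y\|^{p^2\mathfrak q}\,\nu_d(dy)\le\kappa d^{rp^2\mathfrak q}$. Let $\mathfrak J\in\mathbf N$ satisfy $\mathcal H(\mathfrak J)=1$ and $\mathcal R_a(\mathfrak J)=\mathrm{id}_{\mathbb R}$. Let $(\mathbf F_{d,\varepsilon})_{(d,\varepsilon)\in\mathbb N_0\times(0,1]}\subseteq\mathbf N$ satisfy for all $d\in\mathbb N_0$, $x\in\mathbb R^{\max\{d,1\}}$, $\varepsilon\in(0,1]$ that $\mathcal R_a(\mathbf F_{d,\varepsilon})\in C(\mathbb R^{\max\{d,1\}},\mathbb R)$, $$\varepsilon^{\alpha_{\min\{d,1\}}}\mathcal L(\mathbf F_{d,\varepsilon})+\varepsilon^{\beta_{\min\{d,1\}}}|||\mathcal D(\mathbf F_{d,\varepsilon})|||\le\kappa(\max\{d,1\})^p,$$ $$\varepsilon|(\mathcal R_a(\mathbf F_{d,\varepsilon}))(x)|+|f_d(x)-(\mathcal R_a(\mathbf F_{d,\varepsilon}))(x)|\le\varepsilon\kappa(\max\{d,1\})^p(1+\|x\|)^p,$$ and assume for all $v,w\in\mathbb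 R$, $\varepsilon\in(0,1]$ that $\max\{|f_0(v)-f_0(w)|,|(\mathcal R_a(\mathbf F_{0,\varepsilon}))(v)-(\mathcal R_a(\mathbf F_{0,\varepsilon}))(w)|\}\le L|v-w|$. Then (i) for every $d\in\mathbb N$ there exists a unique at most polynomially growing viscosity solution $u_d\in C([0,T]\times\mathbb R^d,\mathbb R)$ of $(\tfrac{\partial}{\partial t}u_d)(t,x)+\tfrac12(\Delta_xu_d)(t,x)+f_0(u_d(t,x))=0$ for $(t,x)\in(0,T)\times\mathbb R^d$ with $u_d(T,x)=f_d(x)$ for $x\in\mathbb R^d$, and (ii) there exist $(\mathbf U_{d,\varepsilon})_{(d,\varepsilon)\in\mathbb N\times(0,1]}\subseteq\mathbf N$ and $\eta\colon(0,\infty)\to\mathbb R$ such that for all $d\in\mathbb N$, $\varepsilon\in(0,1]$, $\delta\in(0,\infty)$ it holds that $\mathcal R_a(\mathbf U_{d,\varepsilon})\in C(\mathbb R^d,\mathbb R)$, $$\mathcal P(\mathbf U_{d,\varepsilon})\le\eta(\delta)\,d^{\,3p+2(2+\delta)(2rp+p+2)p+(rp+p+1)p(\max\{\alpha_0,\alpha_1\}+2\max\{\beta_0,\beta_1\})}\,\varepsilon^{-(2(2+\delta)+\max\{\alpha_0,\alpha_1\}+2\max\{\beta_0,\beta_1\})},$$ and $\bigl[\int_{\mathbb R^d}|u_d(0,x)-(\mathcal R_a(\mathbf U_{d,\varepsilon}))(x)|^{\mathfrak q}\,\nu_d(dx)\bigr]^{1/\mathfrak q}\le\varepsilon$.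
   Context: Artificial neural networks (ANNs). Let $\mathbb N=\{1,2,\dots\}$, $\mathbb N_0=\mathbb N\cup\{0\}$, and $\mathbf N=\bigcup_{L\in\mathbb N}\bigcup_{l_0,\dots,l_L\in\mathbb N}\prod_{k=1}^L(\mathbb R^{l_k\times l_{k-1}}\times\mathbb R^{l_k})$. For $\Phi=((W_1,B_1),\dots,(W_L,B_L))\in\prod_{k=1}^L(\mathbb R^{l_k\times l_{k-1}}\times\mathbb R^{l_k})$ set $\mathcal P(\Phi)=\sum_{k=1}^Ll_k(l_{k-1}+1)$, $\mathcal L(\Phi)=L$, $\mathcal I(\Phi)=l_0$, $\mathcal O(\Phi)=l_L$, $\mathcal H(\Phi)=L-1$, $\mathcal D(\Phi)=(l_0,l_1,\dots,l_L)$, and for $n\in\mathbb N_0$ let $\mathbb D_n(\Phi)=l_n$ if $n\le L$ and $\mathbb D_n(\Phi)=0$ if $n>L$. For $x=(x_1,\dots,x_m)\in\mathbb R^m$, $\|x\|=(\sum_i|x_i|^2)^{1/2}$ and $|||x|||=\max_i|x_i|$. For $a\in C(\mathbb R,\mathbb R)$ the realization $\mathcal R_a(\Phi)\in C(\mathbb R^{l_0},\mathbb R^{l_L})$ is defined by $(\mathcal R_a(\Phi))(x_0)=W_Lx_{L-1}+B_L$, where $x_k=\mathfrak M_{a,l_k}(W_kx_{k-1}+B_k)$ for $k=1,\dots,L-1$ and $\mathfrak M_{a,m}(y_1,\dots,y_m)=(a(y_1),\dots,a(y_m))$. $\mathcal B(\mathbb R^d)$ is the Borel $\sigma$-algebra.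 *)

theory Defs
  imports "HOL-Probability.Probability"
begin

text \<open>R^d is represented as the extensional functions on the index set {..<d}
 (the space of the product measure PiM {..<d} (\<lambda>_. lborel)), with the product topology.\<close>

definition Rd :: "nat \<Rightarrow> (nat \<Rightarrow> real) set" where
  "Rd d = PiE {..<d} (\<lambda>_. UNIV)"

definition enorm :: "nat \<Rightarrow> (nat \<Rightarrow> real) \<Rightarrow> real" where
  "enorm d x = sqrt (\<Sum>i<d. (x i)^2)"

definition vec1 :: "real \<Rightarrow> (nat \<Rightarrow> real)" where
  "vec1 v = restrict (\<lambda>_. v) {..<1}"

text \<open>A network is a list of layers (W_k, B_k); W_k is given as a list of l_k rows,
 each of length l_{k-1}; B_k is a list of length l_k.\<close>

type_synonym ann = "(real list list \<times> real list) list"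

definition ann_dims :: "ann \<Rightarrow> nat list" where
  "ann_dims \<Phi> = length (hd (fst (hd \<Phi>))) # map (\<lambda>(W, B). length W) \<Phi>"

definition is_ann :: "ann \<Rightarrow> bool" where
  "is_ann \<Phi> \<longleftrightarrow> \<Phi> \<noteq> [] \<and> hd (fst (hd \<Phi>)) \<noteq> [] \<and>
     (\<forall>k<length \<Phi>. fst (\<Phi> ! k) \<noteq> [] \<and> length (snd (\<Phi> ! k)) = length (fst (\<Phi> ! k)) \<and>
        (\<forall>row \<in> set (fst (\<Phi> ! k)). length row = ann_dims \<Phi> ! k))"

definition ann_L :: "ann \<Rightarrow> nat" where "ann_L \<Phi> = length \<Phi>"
definition ann_H :: "ann \<Rightarrow> nat" where "ann_H \<Phi> = length \<Phi> - 1"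
definition ann_I :: "ann \<Rightarrow> nat" where "ann_I \<Phi> = hd (ann_dims \<Phi>)"
definition ann_O :: "ann \<Rightarrow> nat" where "ann_O \<Phi> = last (ann_dims \<Phi>)"

definition ann_P :: "ann \<Rightarrow> nat" where
  "ann_P \<Phi> = (\<Sum>k\<in>{1..ann_L \<Phi>}. ann_dims \<Phi> ! k * (ann_dims \<Phi> ! (k - 1) + 1))"

definition ann_Dmax :: "ann \<Rightarrow> nat" where
  "ann_Dmax \<Phi> = Max (set (ann_dims \<Phi>))"

definition affine :: "real list list \<Rightarrow> real list \<Rightarrow> (nat \<Rightarrow> real) \<Rightarrow> (nat \<Rightarrow> real)" where
  "affine W B x = (\<lambda>i. if i < length W then (\<Sum>j<length (W ! i). W ! i ! j * x j) + B ! i else 0)"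

fun realize :: "(real \<Rightarrow> real) \<Rightarrow> ann \<Rightarrow> (nat \<Rightarrow> real) \<Rightarrow> (nat \<Rightarrow> real)" where
  "realize a [] x = x"
| "realize a [(W, B)] x = affine W B x"
| "realize a ((W, B) # rest) x = realize a rest (\<lambda>i. a (affine W B x i))"

definition realize1 :: "(real \<Rightarrow> real) \<Rightarrow> ann \<Rightarrow> (nat \<Rightarrow> real) \<Rightarrow> real" where
  "realize1 a \<Phi> x = realize a \<Phi> x 0"

definition is_C12 :: "nat \<Rightarrow> real \<Rightarrow> (real \<Rightarrow> (nat \<Rightarrow> real) \<Rightarrow> real) \<Rightarrow> (real \<Rightarrow> (nat \<Rightarrow> real) \<Rightarrow> real)
   \<Rightarrow> (nat \<Rightarrow> real \<Rightarrow> (nat \<Rightarrow> real) \<Rightarrow> real) \<Rightarrow> (nat \<Rightarrow> nat \<Rightarrow> real \<Rightarrow> (nat \<Rightarrow> real) \<Rightarrow> real) \<Rightarrow> bool" where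
  "is_C12 d T \<phi> \<phi>t \<phi>x \<phi>xx \<longleftrightarrow>
     (\<forall>t x. t \<in> {0<..<T} \<longrightarrow> x \<in> Rd d \<longrightarrow>
        ((\<lambda>s. \<phi> s x) has_real_derivative \<phi>t t x) (at t) \<and>
        (\<forall>i<d. ((\<lambda>s. \<phi> t (x(i := s))) has_real_derivative \<phi>x i t x) (at (x i)) \<and>
           (\<forall>j<d. ((\<lambda>s. \<phi>x i t (x(j := s))) has_real_derivative \<phi>xx i j t x) (at (x j))))) \<and>
     continuous_on ({0<..<T} \<times> Rd d) (\<lambda>(t, x). \<phi> t x) \<and>
     continuous_on ({0<..<T} \<times> Rd d) (\<lambda>(t, x). \<phi>t t x) \<and>
     (\<forall>i<d. continuous_on ({0<..<T} \<times> Rd d) (\<lambda>(t, x). \<phi>x i t x)) \<and>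
     (\<forall>i<d. \<forall>j<d. continuous_on ({0<..<T} \<times> Rd d) (\<lambda>(t, x). \<phi>xx i j t x))"

definition visc_sub :: "nat \<Rightarrow> real \<Rightarrow> (real \<Rightarrow> real) \<Rightarrow> (real \<Rightarrow> (nat \<Rightarrow> real) \<Rightarrow> real) \<Rightarrow> bool" where
  "visc_sub d T g u \<longleftrightarrow>
     (\<forall>t x \<phi> \<phi>t \<phi>x \<phi>xx. t \<in> {0<..<T} \<longrightarrow> x \<in> Rd d \<longrightarrow> is_C12 d T \<phi> \<phi>t \<phi>x \<phi>xx \<longrightarrow>
        (\<forall>s y. s \<in> {0<..<T} \<longrightarrow> y \<in> Rd d \<longrightarrow> u s y \<le> \<phi> s y) \<longrightarrow> \<phi> t x = u t x \<longrightarrow>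
        \<phi>t t x + (1/2) * (\<Sum>i<d. \<phi>xx i i t x) + g (u t x) \<ge> 0)"

definition visc_super :: "nat \<Rightarrow> real \<Rightarrow> (real \<Rightarrow> real) \<Rightarrow> (real \<Rightarrow> (nat \<Rightarrow> real) \<Rightarrow> real) \<Rightarrow> bool" where
  "visc_super d T g u \<longleftrightarrow>
     (\<forall>t x \<phi> \<phi>t \<phi>x \<phi>xx. t \<in> {0<..<T} \<longrightarrow> x \<in> Rd d \<longrightarrow> is_C12 d T \<phi> \<phi>t \<phi>x \<phi>xx \<longrightarrow>
        (\<forall>s y. s \<in> {0<..<T} \<longrightarrow> y \<in> Rd d \<longrightarrow> u s y \<ge> \<phi> s y) \<longrightarrow> \<phi> t x = u t x \<longrightarrow>
        \<phi>t t x + (1/2) * (\<Sum>i<d. \<phi>xx i i t x) + g (u t x) \<le> 0)"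

definition is_pg_visc_solution :: "nat \<Rightarrow> real \<Rightarrow> (real \<Rightarrow> real) \<Rightarrow> ((nat \<Rightarrow> real) \<Rightarrow> real)
    \<Rightarrow> (real \<Rightarrow> (nat \<Rightarrow> real) \<Rightarrow> real) \<Rightarrow> bool" where
  "is_pg_visc_solution d T g h u \<longleftrightarrow>
     continuous_on ({0..T} \<times> Rd d) (\<lambda>(t, x). u t x) \<and>
     (\<exists>c::real. \<forall>t x. t \<in> {0..T} \<longrightarrow> x \<in> Rd d \<longrightarrow> \<bar>u t x\<bar> \<le> c * (1 + enorm d x) powr c) \<and>
     visc_sub d T g u \<and> visc_super d T g u \<and>
     (\<forall>x \<in> Rd d. u T x = h x)"

end

(* The solution u is constructed as the fixed point of Duhamel's formula
   u(t,x) = E h(x + W_{T-t}) + int_t^T E f(u(s, x + W_{s-t})) ds; only the Gaussian law of each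
   W_s is used, never a Brownian path.  The function u is a viscosity solution because the same
   formula with the kernel times shifted by eps is classical and converges locally uniformly.  For
   uniqueness, a viscosity solution v is compared with these classical approximations for the
   linear problem with source f(v), which shows that v itself is a fixed point.
   For the networks, h and f are replaced by networks and u is approximated by multilevel Picard
   iteration.  The samples are not random: they are chosen one at a time so that the q-th moment of
   the Monte Carlo error, measured in L^q of (time weight) x (Gauss) x nu, is no worse than
   average.  The time weight exp(lam t) with lam of order M^(q/2) turns the Volterra structure into a
   contraction with factor M^(-1/2), so that n levels with M^n samples give the error B^n M^(-n/2).
   Taking M of order n^(2/q) and n minimal for the accuracy eps gives the cost eps^(-2(2+delta)). *)

theory Submission
 imports Defs
begin

text \<open>The recursion has to close in one norm. A sample of the Duhamel term at
  \<open>(t, x + W_t)\<close> looks at \<open>(s, x + W_s)\<close> with \<open>s > t\<close>; by the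
  semigroup property the position again follows a Brownian motion started with law
  \<open>nu\<close>, so only the time variable remains to be estimated, and there the weight acts.
  Choosing the samples one at a time turns each level into a fixed function: later levels reuse it
  without any independence, and the only probability space is \<open>gauss_time d\<close>. The
  weight has mass up to \<open>exp (lam * T) / lam\<close>, with \<open>lam\<close> proportional to
  \<open>M powr (q / 2)\<close>. It may grow only exponentially in the number \<open>n\<close> of
  levels, hence \<open>M powr (q / 2) <= n\<close>; since \<open>M\<close> still tends to infinity,
  \<open>M powr (delta * n)\<close> beats every \<open>B ^ n\<close>. No constant may depend on
  \<open>d\<close>. Growth is therefore measured by \<open>sqrt d\<close> plus the norm, whose
  relative Gaussian moments are free of the dimension. Replacing the data by networks costs an error
  of order \<open>p\<close> in \<open>u\<close>, and \<open>u\<close> itself grows with order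
  \<open>p\<close>. This is the origin of the exponent \<open>p * p\<close> and of the moment of
  order \<open>p^2 * q\<close>.\<close>

abbreviation (input) nint where "nint == nn_integral"
abbreviation (input) lint where "lint == lebesgue_integral"


section \<open>Moments and derandomised Monte Carlo averages\<close>

text \<open>Convexity in tangent-line form, from which every Jensen-type estimate below is derived.
  After division by \<open>b powr q\<close> it is Bernoulli's inequality at
  \<open>t = a / b\<close>.\<close>

lemma powr_tangent:
 fixes a b q :: real
 assumes q: "q >= 1" and a: "a >= 0" and b: "b >= 0"
 shows "b powr q + q * b powr (q - 1) * (a - b) <= a powr q"
proof (cases "b = 0")
 case True
 then show ?thesis by simp
next
 case False
 with b have b: "b > 0" by simp
 have bern: "1 + q * (t - 1) <= t powr q" if t: "t > 0" for t :: real
 proof (cases t "1::real" rule: linorder_cases)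
  case greater
  have "\<exists>z. z > 1 \<and> z < t \<and> t powr q - 1 powr q = (t - 1) * (q * z powr (q - 1))"
   by (rule MVT2) (use greater in \<open>auto intro!: derivative_eq_intros\<close>)
  then obtain z where z: "z > 1" "t powr q - 1 = (t - 1) * (q * z powr (q - 1))" by auto
  have "1 <= z powr (q - 1)" using z q by (simp add: ge_one_powr_ge_zero)
  then have "(t - 1) * (q * 1) <= (t - 1) * (q * z powr (q - 1))"
   using greater q by (intro mult_left_mono) auto
  with z show ?thesis by (simp add: algebra_simps)
 next
  case less
  have "\<exists>z. z > t \<and> z < 1 \<and> 1 powr q - t powr q = (1 - t) * (q * z powr (q - 1))"
   by (rule MVT2) (use less t in \<open>auto intro!: derivative_eq_intros\<close>)
  then obtain z where z: "z > t" "z < 1" "1 - t powr q = (1 - t) * (q * z powr (q - 1))" by auto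
  have "z powr (q - 1) <= 1" using z q t by (intro powr_le1) auto
  then have "(1 - t) * (q * z powr (q - 1)) <= (1 - t) * (q * 1)"
   using less q by (intro mult_left_mono) auto
  with z show ?thesis by (simp add: algebra_simps)
 qed simp
 show ?thesis
 proof (cases "a = 0")
  case True
  have "b powr q = b powr (q - 1) * b"
   using b powr_add[of b "q - 1" 1] by simp
  then show ?thesis using True q b by (simp add: algebra_simps)
 next
  case False
  with a have "a / b > 0" using b by simp
  from bern[OF this] have "b powr q * (1 + q * (a / b - 1)) <= b powr q * (a / b) powr q"
   by (intro mult_left_mono) auto
  also have "... = a powr q"
   using a b by (simp add: powr_divide)
  finally have *: "b powr q * (1 + q * (a / b - 1)) <= a powr q" .
  have e: "b powr q = b powr (q - 1) * b"
   using b powr_add[of b "q - 1" 1] by simp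
  have "b powr q * (1 + q * (a / b - 1)) = b powr q + q * b powr (q - 1) * (a - b)"
   unfolding e using b by (simp add: field_simps)
  with * show ?thesis by simp
 qed
qed

text \<open>Jensen with the weights \<open>a / (a + b)\<close> and \<open>b / (a + b)\<close>: the
  tangents at the common mean \<open>c\<close> are added, and their linear parts cancel.\<close>

lemma powr_convex_split:
 fixes x y a b q :: real
 assumes q: "q >= 1" and "a > 0" "b > 0" "x >= 0" "y >= 0"
 shows "(x + y) powr q <= (a + b) powr (q - 1) * (a * (x / a) powr q + b * (y / b) powr q)"
proof -
 define c where "c = (x + y) / (a + b)"
 have c: "c >= 0" "x + y = (a + b) * c" using assms by (auto simp: c_def)
 have "c powr q + q * c powr (q - 1) * (x / a - c) <= (x / a) powr q"
  "c powr q + q * c powr (q - 1) * (y / b - c) <= (y / b) powr q"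
  using assms c by (auto intro!: powr_tangent)
 then have "a * (c powr q + q * c powr (q - 1) * (x / a - c)) + b * (c powr q + q * c powr (q - 1) * (y / b - c))
   <= a * (x / a) powr q + b * (y / b) powr q"
  using assms by (intro add_mono mult_left_mono) auto
 also have "a * (c powr q + q * c powr (q - 1) * (x / a - c)) + b * (c powr q + q * c powr (q - 1) * (y / b - c))
  = (a + b) * c powr q + q * c powr (q - 1) * ((x + y) - (a + b) * c)"
  using assms by (simp add: field_simps)
 also have "... = (a + b) * c powr q" using c by simp
 finally have *: "(a + b) * c powr q <= a * (x / a) powr q + b * (y / b) powr q" .
 have "(x + y) powr q = (a + b) powr (q - 1) * ((a + b) * c powr q)"
  using assms c powr_add[of "a + b" "q - 1" 1] by (simp add: powr_mult)
 also have "... <= (a + b) powr (q - 1) * (a * (x / a) powr q + b * (y / b) powr q)"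
  by (rule mult_left_mono[OF *]) simp
 finally show ?thesis .
qed

lemma abs_add_powr_le:
 fixes x y q :: real
 assumes "q >= 0"
 shows "abs (x + y) powr q <= 2 powr q * (abs x powr q + abs y powr q)"
proof -
 have "abs (x + y) powr q <= (2 * max (abs x) (abs y)) powr q"
  by (rule powr_mono2) (use assms in auto)
 also have "... = 2 powr q * max (abs x) (abs y) powr q" by (simp add: powr_mult)
 also have "... <= 2 powr q * (abs x powr q + abs y powr q)"
  by (rule mult_left_mono) (auto simp: max_def)
 finally show ?thesis .
qed

text \<open>A bound for the norm rather than the norm itself: measurability and finiteness travel
  with it, and estimates combine without any real-valued integral.\<close>

definition Lq_le :: "'a measure => real => ('a => real) => real => bool" where
 "Lq_le M q f a \<longleftrightarrow> f \<in> borel_measurable M \<and> 0 <= a \<and>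
   (nint M (%x. ennreal (abs (f x) powr q))) <= ennreal (a powr q)"

lemma Lq_leD:
 assumes "Lq_le M q f a"
 shows "f \<in> borel_measurable M" "0 <= a"
  "(nint M (%x. ennreal (abs (f x) powr q))) <= ennreal (a powr q)"
 using assms by (auto simp: Lq_le_def)

lemma Lq_le_mono: "Lq_le M q f a ==> a <= b ==> q > 0 ==> Lq_le M q f b"
 unfolding Lq_le_def by (meson ennreal_leI less_imp_le order_trans powr_mono2)

lemma Lq_le_dom:
 assumes "Lq_le M q g a" "f \<in> borel_measurable M" "!!x. x \<in> space M ==> abs (f x) <= abs (g x)" "q > 0"
 shows "Lq_le M q f a"
proof -
 have "(nint M (%x. ennreal (abs (f x) powr q))) <= (nint M (%x. ennreal (abs (g x) powr q)))"
  using assms by (intro nn_integral_mono ennreal_leI powr_mono2) auto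
 with assms show ?thesis by (auto simp: Lq_le_def)
qed

lemma Lq_le_cmult:
 assumes "Lq_le M q f a"
 shows "Lq_le M q (%x. c * f x) (abs c * a)"
proof -
 note f = Lq_leD[OF assms]
 have [measurable]: "f \<in> borel_measurable M" by fact
 have "(nint M (%x. ennreal (abs (c * f x) powr q))) = ennreal (abs c powr q) * (nint M (%x. ennreal (abs (f x) powr q)))"
  by (subst nn_integral_cmult[symmetric]) (auto simp: abs_mult powr_mult ennreal_mult)
 also have "... <= ennreal (abs c powr q) * ennreal (a powr q)"
  by (rule mult_left_mono) (use f in auto)
 also have "... = ennreal ((abs c * a) powr q)"
  using f by (simp add: powr_mult ennreal_mult)
 finally show ?thesis using f by (auto simp: Lq_le_def)
qed

lemma Lq_le_zero: "Lq_le M q (%x. 0) 0"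
 by (auto simp: Lq_le_def)

text \<open>Minkowski's inequality. With the two bounds \<open>a\<close> and \<open>b\<close> as
  weights, the right-hand side of \<open>powr_convex_split\<close> integrates to at most
  \<open>(a + b) powr q\<close>.\<close>

lemma Lq_le_add:
 assumes f: "Lq_le M q f a" and g: "Lq_le M q g b" and q: "q >= 1"
 shows "Lq_le M q (%x. f x + g x) (a + b)"
proof -
 note fD = Lq_leD[OF f] and gD = Lq_leD[OF g]
 have [measurable]: "f \<in> borel_measurable M" "g \<in> borel_measurable M" by fact+
 have zero: "(nint M (%x. ennreal (abs (F x + G x) powr q))) <= ennreal (c powr q)"
  if [measurable]: "F \<in> borel_measurable M" "G \<in> borel_measurable M"
  and F: "(nint M (%x. ennreal (abs (F x) powr q))) <= ennreal (0 powr q)"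
  and G: "(nint M (%x. ennreal (abs (G x) powr q))) <= ennreal (c powr q)" for F G c
 proof -
  have "(nint M (%x. ennreal (abs (F x) powr q))) = 0" using F by simp
  then have "AE x in M. F x = 0"
   by (subst (asm) nn_integral_0_iff_AE) auto
  then have "(nint M (%x. ennreal (abs (F x + G x) powr q))) = (nint M (%x. ennreal (abs (G x) powr q)))"
   by (intro nn_integral_cong_AE) auto
  with G show ?thesis by simp
 qed
 have "(nint M (%x. ennreal (abs (f x + g x) powr q))) <= ennreal ((a + b) powr q)"
 proof (cases "a = 0 \<or> b = 0")
  case True
  then show ?thesis
   using zero[of f g b] zero[of g f a] fD gD by (auto simp: add.commute)
 next
  case False
  with fD gD have ab: "a > 0" "b > 0" by auto
  let ?A = "(a + b) powr (q - 1) * a * a powr - q" and ?B = "(a + b) powr (q - 1) * b * b powr - q"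
  have "(nint M (%x. ennreal (abs (f x + g x) powr q))) \<le>
    (nint M (%x. ennreal ?A * ennreal (abs (f x) powr q) + ennreal ?B * ennreal (abs (g x) powr q)))"
  proof (intro nn_integral_mono)
   fix x
   have "abs (f x + g x) powr q <= (abs (f x) + abs (g x)) powr q"
    by (rule powr_mono2) (use q in auto)
   also have "... <= (a + b) powr (q - 1) * (a * (abs (f x) / a) powr q + b * (abs (g x) / b) powr q)"
    by (rule powr_convex_split) (use q ab in auto)
   also have "... = ?A * abs (f x) powr q + ?B * abs (g x) powr q"
    using ab by (simp add: powr_divide powr_minus field_simps)
   finally show "ennreal (abs (f x + g x) powr q) <= ennreal ?A * ennreal (abs (f x) powr q) + ennreal ?B * ennreal (abs (g x) powr q)"
    using ab by (simp flip: ennreal_mult ennreal_plus)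
  qed
  also have "... = ennreal ?A * (nint M (%x. ennreal (abs (f x) powr q))) + ennreal ?B * (nint M (%x. ennreal (abs (g x) powr q)))"
   by (simp add: nn_integral_add nn_integral_cmult)
  also have "... <= ennreal ?A * ennreal (a powr q) + ennreal ?B * ennreal (b powr q)"
   by (intro add_mono mult_left_mono fD gD) auto
  also have "... = ennreal ((a + b) powr (q - 1) * (a + b))"
   using ab by (simp flip: ennreal_mult ennreal_plus add: powr_minus field_simps)
  also have "(a + b) powr (q - 1) * (a + b) = (a + b) powr q"
   using ab powr_add[of "a + b" "q - 1" 1] by simp
  finally show ?thesis .
 qed
 with fD gD show ?thesis by (auto simp: Lq_le_def)
qed

lemma Lq_le_sum:
 assumes "finite I" "!!i. i \<in> I ==> Lq_le M q (f i) (a i)" "q >= 1"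
 shows "Lq_le M q (%x. \<Sum>i\<in>I. f i x) (\<Sum>i\<in>I. a i)"
 using assms(1,2) by (induction) (auto intro!: Lq_le_zero Lq_le_add assms(3))

lemma (in prob_space) integrable_of_powr:
 fixes X :: "'a => real"
 assumes [measurable]: "X \<in> borel_measurable M" and X: "integrable M (%x. abs (X x) powr q)" and q: "q >= 1"
 shows "integrable M X"
proof (rule Bochner_Integration.integrable_bound)
 show "integrable M (%x. 1 + abs (X x) powr q)" using X by auto
 have "abs (X x) <= 1 + abs (X x) powr q" for x
 proof (cases "abs (X x) <= 1")
  case True
  then show ?thesis by (meson add_increasing2 powr_ge_zero)
 next
  case False
  then show ?thesis using powr_mono[of 1 q "abs (X x)"] q by auto
 qed
 then show "AE x in M. norm (X x) <= norm (1 + abs (X x) powr q)" by auto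
qed auto

text \<open>The tangent at the mean \<open>b\<close> of \<open>abs X\<close>, integrated: its linear
  term has expectation zero.\<close>

lemma (in prob_space) expectation_powr_le:
 fixes X :: "'a => real"
 assumes [measurable]: "X \<in> borel_measurable M" and X: "integrable M (%x. abs (X x) powr q)" and q: "q >= 1"
 shows "abs (expectation X) powr q <= expectation (%x. abs (X x) powr q)"
proof -
 have i: "integrable M X" by (rule integrable_of_powr[OF _ X q]) simp
 define b where "b = expectation (%x. abs (X x))"
 have b: "b >= 0" unfolding b_def by (auto intro!: integral_nonneg_AE)
 have "abs (expectation X) <= b" unfolding b_def by (rule integral_abs_bound)
 then have "abs (expectation X) powr q <= b powr q" by (intro powr_mono2) (use q in auto)
 also have "... = expectation (%x. b powr q + q * b powr (q - 1) * (abs (X x) - b))"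
  using i by (simp add: prob_space flip: b_def)
 also have "... <= expectation (%x. abs (X x) powr q)"
  using i X b q by (intro integral_mono powr_tangent) auto
 finally show ?thesis .
qed

text \<open>Homogeneity reduces the claim to \<open>u = y / x\<close>. For
  \<open>abs u <= 1/2\<close> it is Taylor's formula at 1, for larger \<open>u\<close> every term is
  dominated by \<open>abs u powr q\<close>. The part linear in \<open>y\<close> is kept exact
  because it is the one that averages to zero later.\<close>

lemma powr_second_order:
 fixes q :: real
 assumes q: "q >= 2"
 shows "\<exists>C>0. \<forall>x y. abs (x + y) powr q \<le>
  abs x powr q + q * abs x powr (q - 1) * sgn x * y + C * (abs x powr (q - 2) * y\<^sup>2 + abs y powr q)"
proof -
 define C1 where "C1 = q * (q - 1) * (3/2) powr (q - 2)"
 define C2 where "C2 = 3 powr q + q * 2 powr (q - 1)"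
 define C where "C = C1 + C2 + 1"
 have C1: "C1 >= 0" and C2: "C2 >= 0" using q by (auto simp: C1_def C2_def)
 have small: "abs (1 + u) powr q <= 1 + q * u + C1 * u\<^sup>2" if u: "abs u <= 1/2" for u :: real
 proof (cases "u = 0")
  case False
  define diff :: "nat => real => real" where
   "diff m x = (if m = 0 then x powr q else if m = 1 then q * x powr (q - 1) else q * (q - 1) * x powr (q - 2))" for m x
  have "\<exists>t. (if 1 + u < 1 then 1 + u < t \<and> t < 1 else 1 < t \<and> t < 1 + u) \<and>
   (1 + u) powr q = (\<Sum>m<2. diff m 1 / fact m * (1 + u - 1) ^ m) + diff 2 t / fact 2 * (1 + u - 1) ^ 2"
  proof (rule Taylor)
   show "\<forall>m t. m < 2 \<and> 1/2 <= t \<and> t <= 3/2 --> DERIV (diff m) t :> diff (Suc m) t"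
   proof -
    have "diff 0 = (%x. x powr q)" "diff (Suc 0) = (%x. q * x powr (q - 1))"
     by (simp_all add: diff_def fun_eq_iff)
    then show ?thesis
     by (auto simp: less_2_cases_iff diff_def intro!: derivative_eq_intros)
   qed
  qed (use u False in \<open>auto simp: diff_def\<close>)
  then obtain t where t: "if 1 + u < 1 then 1 + u < t \<and> t < 1 else 1 < t \<and> t < 1 + u"
   "(1 + u) powr q = (\<Sum>m<2. diff m 1 / fact m * u ^ m) + diff 2 t / fact 2 * u ^ 2" by auto
  have tr: "0 < t" "t <= 3/2" using t(1) u by (auto split: if_splits)
  have "diff 2 t / fact 2 <= C1"
  proof -
   have "t powr (q - 2) <= (3/2) powr (q - 2)" using tr q by (intro powr_mono2) auto
   then have "q * (q - 1) * t powr (q - 2) <= C1" unfolding C1_def using q by (intro mult_left_mono) auto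
   moreover have "q * (q - 1) * t powr (q - 2) >= 0" using q by auto
   ultimately show ?thesis by (simp add: diff_def fact_2)
  qed
  then have "diff 2 t / fact 2 * u ^ 2 <= C1 * u\<^sup>2" by (rule mult_right_mono) auto
  moreover have "(\<Sum>m<2. diff m 1 / fact m * u ^ m) = 1 + q * u"
   by (simp add: numeral_2_eq_2 diff_def)
  moreover have "abs (1 + u) = 1 + u" using u by auto
  ultimately show ?thesis using t(2) by simp
 qed simp
 have large: "abs (1 + u) powr q <= 1 + q * u + C2 * abs u powr q" if u: "abs u > 1/2" for u :: real
 proof -
  have "abs (1 + u) powr q <= (3 * abs u) powr q" by (rule powr_mono2) (use u q in auto)
  also have "... = 3 powr q * abs u powr q" by (simp add: powr_mult)
  finally have 1: "abs (1 + u) powr q <= 3 powr q * abs u powr q" .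
  have "1 <= (2 * abs u) powr (q - 1)" using u q by (intro ge_one_powr_ge_zero) auto
  then have "abs u * 1 <= abs u * (2 * abs u) powr (q - 1)" by (intro mult_left_mono) auto
  also have "... = 2 powr (q - 1) * abs u powr q"
   using u powr_add[of "abs u" "q - 1" 1] by (simp add: powr_mult)
  finally have "q * abs u <= q * (2 powr (q - 1) * abs u powr q)" using q by (intro mult_left_mono) auto
  moreover have "- (q * abs u) <= q * u"
  proof -
   have "q * (- abs u) <= q * u" using q by (intro mult_left_mono) auto
   then show ?thesis by simp
  qed
  ultimately show ?thesis using 1 by (simp add: C2_def algebra_simps)
 qed
 have unit: "abs (1 + u) powr q <= 1 + q * u + C * (u\<^sup>2 + abs u powr q)" for u :: real
 proof -
  have "C1 * u\<^sup>2 <= C * u\<^sup>2" "C2 * abs u powr q <= C * abs u powr q" "0 <= C * u\<^sup>2" "0 <= C * abs u powr q"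
   using C1 C2 unfolding C_def by (auto intro!: mult_right_mono)
  then show ?thesis
   using small[of u] large[of u] by (cases "abs u <= 1/2") (auto simp: distrib_left)
 qed
 show ?thesis
 proof (intro exI[of _ C] conjI allI)
  show "C > 0" using C1 C2 by (simp add: C_def)
  fix x y :: real
  show "abs (x + y) powr q \<le>
   abs x powr q + q * abs x powr (q - 1) * sgn x * y + C * (abs x powr (q - 2) * y\<^sup>2 + abs y powr q)"
  proof (cases "x = 0")
   case True
   have "1 <= C" using C1 C2 by (simp add: C_def)
   then have "1 * abs y powr q <= C * abs y powr q" by (intro mult_right_mono) auto
   then show ?thesis using True by simp
  next
   case False
   then have a: "abs x > 0" by simp
   have e1: "abs x powr q = abs x powr (q - 1) * abs x"
    using a powr_add[of "abs x" "q - 1" 1] by simp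
   have e2: "abs x powr q = abs x powr (q - 2) * x\<^sup>2"
    using a powr_add[of "abs x" "q - 2" 2] by simp
   have "abs (x + y) = abs x * abs (1 + y / x)"
    using False by (simp add: field_simps flip: abs_mult)
   then have "abs (x + y) powr q = abs x powr q * abs (1 + y / x) powr q" by (simp add: powr_mult)
   also have "... <= abs x powr q * (1 + q * (y / x) + C * ((y / x)\<^sup>2 + abs (y / x) powr q))"
    by (rule mult_left_mono[OF unit]) simp
   also have "... = abs x powr q + q * (abs x powr q * (y / x))
     + C * (abs x powr q * (y / x)\<^sup>2 + abs x powr q * abs (y / x) powr q)"
    by (simp add: algebra_simps)
   also have "abs x powr q * (y / x) = abs x powr (q - 1) * sgn x * y"
    unfolding e1 using False by (simp add: sgn_if)
   also have "abs x powr q * (y / x)\<^sup>2 = abs x powr (q - 2) * y\<^sup>2"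
    unfolding e2 using False by (simp add: power_divide)
   also have "abs x powr q * abs (y / x) powr q = abs y powr q"
    using False by (simp add: powr_divide)
   finally show ?thesis by (simp add: mult.assoc)
  qed
 qed
qed

text \<open>The mixed term is split with a weight depending on \<open>k\<close>. The loss
  \<open>1 / (2 * k)\<close> and the price \<open>k powr (q/2 - 1)\<close> are matched to the
  increments of \<open>k powr (q/2)\<close>, so that \<open>k\<close> steps accumulate no more than
  this power.\<close>

lemma powr_second_order_step:
 fixes q :: real
 assumes q: "q >= 2"
 shows "\<exists>C>0. \<forall>x y. \<forall>k::nat\<ge>1. abs (x + y) powr q \<le>
  (1 + 1 / (2 * real k)) * abs x powr q + q * abs x powr (q - 1) * sgn x * y + C * real k powr (q/2 - 1) * abs y powr q"
proof -
 obtain C0 where C0: "C0 > 0" "!!x y. abs (x + y) powr q \<le>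
  abs x powr q + q * abs x powr (q - 1) * sgn x * y + C0 * (abs x powr (q - 2) * y\<^sup>2 + abs y powr q)"
  using powr_second_order[OF q] by auto
 define C where "C = C0 * (2 * C0) powr (q/2 - 1) + C0"
 show ?thesis
 proof (intro exI[of _ C] conjI allI impI)
  show "C > 0" using C0 by (auto simp: C_def intro!: add_nonneg_pos)
  fix x y :: real and k :: nat assume k: "k >= 1"
  have k1: "1 <= real k powr (q/2 - 1)" using k q by (intro ge_one_powr_ge_zero) auto
  \<comment> \<open>A case distinction in place of Young's inequality: either \<open>y^2\<close> is
    so small that the mixed term is at most \<open>abs x powr q / (2 * k)\<close>, or
    \<open>x^2\<close> is below a multiple of \<open>k * y^2\<close> and the mixed term is charged
    to \<open>abs y powr q\<close>.\<close>
  have young: "C0 * (abs x powr (q - 2) * y\<^sup>2) \<le>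
    abs x powr q / (2 * real k) + C0 * (2 * C0) powr (q/2 - 1) * real k powr (q/2 - 1) * abs y powr q"
  proof (cases "2 * k * C0 * y\<^sup>2 <= x\<^sup>2")
   case True
   have "C0 * (abs x powr (q - 2) * y\<^sup>2) = abs x powr (q - 2) * (2 * k * C0 * y\<^sup>2) / (2 * k)"
    using k by simp
   also have "... <= abs x powr (q - 2) * x\<^sup>2 / (2 * k)"
    by (intro divide_right_mono mult_left_mono True) auto
   also have "abs x powr (q - 2) * x\<^sup>2 = abs x powr q"
    using powr_add[of "abs x" "q - 2" 2] by (cases "x = 0") auto
   finally show ?thesis using C0 by (auto intro!: add_increasing2)
  next
   case False
   have "abs x powr (q - 2) = (x\<^sup>2) powr (q/2 - 1)"
   proof (cases "x = 0")
    case False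
    then have "x\<^sup>2 = abs x powr 2" by simp
    then show ?thesis using powr_powr[of "abs x" 2 "q/2 - 1"] by (simp add: algebra_simps)
   qed simp
   also have "... <= (2 * k * C0 * y\<^sup>2) powr (q/2 - 1)"
    by (rule powr_mono2) (use False q in auto)
   also have "... = (2 * C0) powr (q/2 - 1) * real k powr (q/2 - 1) * (y\<^sup>2) powr (q/2 - 1)"
    using C0 by (simp add: powr_mult mult_ac)
   finally have "C0 * (abs x powr (q - 2) * y\<^sup>2) \<le>
    C0 * ((2 * C0) powr (q/2 - 1) * real k powr (q/2 - 1) * (y\<^sup>2) powr (q/2 - 1) * y\<^sup>2)"
    using C0 by (intro mult_left_mono mult_right_mono) auto
   also have "(y\<^sup>2) powr (q/2 - 1) * y\<^sup>2 = abs y powr q"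
   proof (cases "y = 0")
    case False
    have "y\<^sup>2 = abs y powr 2" using False by simp
    then show ?thesis using powr_powr[of "abs y" 2 "q/2 - 1"] powr_add[of "abs y" "q - 2" 2] by (simp add: algebra_simps)
   qed simp
   then have "C0 * ((2 * C0) powr (q/2 - 1) * real k powr (q/2 - 1) * (y\<^sup>2) powr (q/2 - 1) * y\<^sup>2)
    = C0 * (2 * C0) powr (q/2 - 1) * real k powr (q/2 - 1) * abs y powr q" by (simp add: mult.assoc)
   finally show ?thesis by (auto intro!: add_increasing)
  qed
  have "C0 * abs y powr q * 1 <= C0 * abs y powr q * real k powr (q/2 - 1)"
   using C0 k1 by (intro mult_left_mono) auto
  then show "abs (x + y) powr q \<le>
   (1 + 1 / (2 * real k)) * abs x powr q + q * abs x powr (q - 1) * sgn x * y + C * real k powr (q/2 - 1) * abs y powr q"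
   using C0(2)[of x y] young unfolding C_def by (simp add: algebra_simps)
 qed
qed

text \<open>The first-moment method, the only means by which samples are picked.\<close>

lemma (in prob_space) exists_le_of_nn_integral_le:
 assumes [measurable]: "f \<in> borel_measurable M" and le: "(nint M (%x. f x)) <= ennreal c"
 shows "\<exists>x\<in>space M. f x <= ennreal c"
proof (rule ccontr)
 assume "\<not> ?thesis"
 then have gt: "!!x. x \<in> space M ==> f x > ennreal c" by (auto simp: not_le)
 have "(nint M (%x. ennreal c)) < (nint M (%x. f x))"
 proof (rule nn_integral_less)
  show "\<not> (AE x in M. f x <= ennreal c)"
  proof
   assume "AE x in M. f x <= ennreal c"
   with AE_space have "AE x in M. False" by eventually_elim (use gt leD in blast)
   then show False by simp
  qed
 qed (use gt in \<open>auto simp: emeasure_space_1 less_imp_le\<close>)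
 with le show False by (simp add: emeasure_space_1)
qed

text \<open>Choosing the samples one after another, each no worse than average for the \<open>q\<close>-th moment of the
 partial sum, makes the term of first order vanish on average.\<close>

lemma derandomised_sum:
 fixes q :: real
 assumes q: "q >= 2"
 shows "\<exists>D>0. \<forall>(Th :: 'b measure) (mu :: 'c measure) X s.
   prob_space Th --> sigma_finite_measure mu -->
   (%(th, y). X th y) \<in> borel_measurable (Th \<Otimes>\<^sub>M mu) -->
   (\<forall>y\<in>space mu. integrable Th (%th. abs (X th y) powr q) \<and> (lint Th (%th. X th y)) = 0) -->
   s >= 0 --> (nint mu (%y. nint Th (%th. ennreal (abs (X th y) powr q)))) <= ennreal s -->
   (\<forall>k\<ge>1. \<exists>ths::nat => 'b. (\<forall>i<k. ths i \<in> space Th) \<and>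
    (nint mu (%y. ennreal (abs (\<Sum>i<k. X (ths i) y) powr q))) <= ennreal (D * s * real k powr (q / 2)))"
proof -
 obtain C where C: "C > 0" "!!x y k. k >= (1::nat) ==> abs (x + y) powr q \<le>
  (1 + 1 / (2 * real k)) * abs x powr q + q * abs x powr (q - 1) * sgn x * y + C * real k powr (q/2 - 1) * abs y powr q"
  using powr_second_order_step[OF q] by blast
 \<comment> \<open>This value gives \<open>D / 2 + C <= D\<close>, which is what the induction step
   requires.\<close>
 define D where "D = 1 + 2 * C"
 show ?thesis
 proof (intro exI[of _ D] conjI allI impI)
  show "D > 0" using C by (simp add: D_def)
  fix Th :: "'b measure" and mu :: "'c measure" and X s and k :: nat
  assume "prob_space Th" "sigma_finite_measure mu"
   and X[measurable]: "(%(th, y). X th y) \<in> borel_measurable (Th \<Otimes>\<^sub>M mu)"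
   and X0: "\<forall>y\<in>space mu. integrable Th (%th. abs (X th y) powr q) \<and> (lint Th (%th. X th y)) = 0"
   and s: "s >= 0" "(nint mu (%y. nint Th (%th. ennreal (abs (X th y) powr q)))) <= ennreal s"
   and "k >= 1"
  interpret T: prob_space Th by fact
  interpret M: sigma_finite_measure mu by fact
  interpret P: pair_sigma_finite Th mu ..
  have meas1[measurable]: "X th \<in> borel_measurable mu" if "th \<in> space Th" for th
   using measurable_compose[OF measurable_Pair1'[OF that] X] by simp
  have meas2[measurable]: "(%th. X th y) \<in> borel_measurable Th" if "y \<in> space mu" for y
   using measurable_compose[OF measurable_Pair2'[OF that] X] by simp
  have int1: "integrable Th (%th. X th y)" if "y \<in> space mu" for y
   by (rule T.integrable_of_powr[of _ q]) (use X0 q that in auto)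
  show "\<exists>ths. (\<forall>i<k. ths i \<in> space Th) \<and>
    (nint mu (%y. ennreal (abs (\<Sum>i<k. X (ths i) y) powr q))) <= ennreal (D * s * real k powr (q / 2))"
   using \<open>k >= 1\<close>
  proof (induction k rule: dec_induct)
   case base
   have "\<exists>th\<in>space Th. (nint mu (%y. ennreal (abs (X th y) powr q))) <= ennreal s"
    by (rule T.exists_le_of_nn_integral_le) (use s in \<open>simp_all add: P.Fubini'\<close>)
   then obtain th where th: "th \<in> space Th" "(nint mu (%y. ennreal (abs (X th y) powr q))) <= ennreal s" by auto
   have "ennreal s <= ennreal (D * s)"
    using s C by (intro ennreal_leI) (simp add: D_def distrib_right)
   with th show ?case by (intro exI[of _ "%_. th"]) auto
  next
   case (step k)
   then obtain ths where ths: "!!i. i < k ==> ths i \<in> space Th"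
    and a: "(nint mu (%y. ennreal (abs (\<Sum>i<k. X (ths i) y) powr q))) <= ennreal (D * s * real k powr (q / 2))" by auto
   define S where "S y = (\<Sum>i<k. X (ths i) y)" for y
   have [measurable]: "S \<in> borel_measurable mu" unfolding S_def using ths by auto
   let ?a = "1 + 1 / (2 * real k)" and ?b = "C * real k powr (q/2 - 1)"
   have k: "k >= 1" by fact
   have pt: "(nint Th (%th. ennreal (abs (S y + X th y) powr q))) \<le>
     ennreal ?a * ennreal (abs (S y) powr q) + ennreal ?b * (nint Th (%th. ennreal (abs (X th y) powr q)))"
    if y: "y \<in> space mu" for y
   proof -
    note [measurable] = meas2[OF y]
    have i: "integrable Th (%th. abs (S y + X th y) powr q)"
    proof (rule Bochner_Integration.integrable_bound)
     show "integrable Th (%th. 2 powr q * (abs (S y) powr q + abs (X th y) powr q))"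
      using X0 y by auto
     show "AE th in Th. norm (abs (S y + X th y) powr q) <= norm (2 powr q * (abs (S y) powr q + abs (X th y) powr q))"
      using abs_add_powr_le[of q "S y"] q by (auto simp: abs_mult)
    qed simp
    have "(nint Th (%th. ennreal (abs (S y + X th y) powr q))) = ennreal (lint Th (%th. abs (S y + X th y) powr q))"
     by (rule nn_integral_eq_integral[OF i]) auto
    also have "... <= ennreal (lint Th (%th. ?a * abs (S y) powr q + q * abs (S y) powr (q - 1) * sgn (S y) * X th y + ?b * abs (X th y) powr q))"
     by (intro ennreal_leI integral_mono i C(2) k) (use X0 y int1 in auto)
    also have "(lint Th (%th. ?a * abs (S y) powr q + q * abs (S y) powr (q - 1) * sgn (S y) * X th y + ?b * abs (X th y) powr q))
     = ?a * abs (S y) powr q + ?b * (lint Th (%th. abs (X th y) powr q))"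
     using X0 y int1[OF y] by (simp add: T.prob_space)
    also have "ennreal ... = ennreal ?a * ennreal (abs (S y) powr q) + ennreal ?b * (nint Th (%th. ennreal (abs (X th y) powr q)))"
     using C X0 y by (subst nn_integral_eq_integral) (auto simp flip: ennreal_mult ennreal_plus intro!: integral_nonneg_AE)
    finally show ?thesis .
   qed
   let ?c = "?a * (D * s * real k powr (q / 2)) + ?b * s"
   have "\<exists>th\<in>space Th. (nint mu (%y. ennreal (abs (S y + X th y) powr q))) <= ennreal ?c"
   proof (rule T.exists_le_of_nn_integral_le)
    have "(nint Th (%th. nint mu (%y. ennreal (abs (S y + X th y) powr q)))) = (nint mu (%y. nint Th (%th. ennreal (abs (S y + X th y) powr q))))"
     by (rule P.Fubini'[symmetric]) measurable
    also have "... <= (nint mu (%y. ennreal ?a * ennreal (abs (S y) powr q) + ennreal ?b * (nint Th (%th. ennreal (abs (X th y) powr q)))))"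
     by (intro nn_integral_mono pt)
    also have "... = ennreal ?a * (nint mu (%y. ennreal (abs (S y) powr q))) + ennreal ?b * (nint mu (%y. (nint Th (%th. ennreal (abs (X th y) powr q)))))"
     by (simp add: nn_integral_add nn_integral_cmult)
    also have "... <= ennreal ?a * ennreal (D * s * real k powr (q / 2)) + ennreal ?b * ennreal s"
     using a s by (intro add_mono mult_left_mono) (auto simp: S_def)
    also have "... = ennreal ?c"
     using C s by (simp flip: ennreal_mult ennreal_plus add: D_def)
    finally show "(nint Th (%th. nint mu (%y. ennreal (abs (S y + X th y) powr q)))) <= ennreal ?c" .
   qed measurable
   then obtain th where th: "th \<in> space Th" "(nint mu (%y. ennreal (abs (S y + X th y) powr q))) <= ennreal ?c" by auto
   have kk: "real k powr (q/2) = real k powr (q/2 - 1) * real k"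
    using k powr_add[of "real k" "q/2 - 1" 1] by simp
   \<comment> \<open>A lower bound for the increment of \<open>k powr (q/2)\<close>, from the
     tangent at \<open>k\<close> with exponent \<open>q/2 >= 1\<close>; it pays for both error terms
     of the step.\<close>
   have "real k powr (q/2) + q/2 * real k powr (q/2 - 1) * (real (Suc k) - real k) <= real (Suc k) powr (q/2)"
    by (rule powr_tangent) (use q in auto)
   then have bern: "real k powr (q/2) + q/2 * real k powr (q/2 - 1) <= real (Suc k) powr (q/2)" by simp
   have "?c = D * s * real k powr (q/2) + (D / 2 + C) * s * real k powr (q/2 - 1)"
    using k by (simp add: kk field_simps)
   also have "... <= D * s * real k powr (q/2) + D * (q/2) * s * real k powr (q/2 - 1)"
   proof -
    have "D / 2 + C <= D * 1" using C by (simp add: D_def)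
    also have "... <= D * (q/2)" using q C by (intro mult_left_mono) (auto simp: D_def)
    finally show ?thesis using s by (intro add_mono mult_right_mono order_refl) auto
   qed
   also have "... = D * s * (real k powr (q/2) + q/2 * real k powr (q/2 - 1))" by (simp add: algebra_simps)
   also have "... <= D * s * real (Suc k) powr (q/2)"
    using bern C s by (intro mult_left_mono) (auto simp: D_def)
   finally have c: "?c <= D * s * real (Suc k) powr (q/2)" .
   show ?case
   proof (intro exI[of _ "ths(k := th)"] conjI)
    have "(\<Sum>i<Suc k. X ((ths(k := th)) i) y) = S y + X th y" for y by (simp add: S_def)
    with th(2) c show "(nint mu (%y. ennreal (abs (\<Sum>i<Suc k. X ((ths(k := th)) i) y) powr q))) <= ennreal (D * s * real (Suc k) powr (q / 2))"
     by (auto intro: order_trans ennreal_leI)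
   qed (use th ths in \<open>auto simp: less_Suc_eq\<close>)
  qed
 qed
qed

text \<open>The previous lemma applied to \<open>X\<close> minus its mean, where centring costs the
  factor \<open>2 * 2 powr q\<close>. One choice of samples serves all \<open>y\<close> at once
  because the error is integrated over \<open>mu\<close>; the rate \<open>1 / sqrt k\<close> is the
  same as for independent samples.\<close>

lemma derandomised_Monte_Carlo:
 fixes q :: real
 assumes q: "q >= 2"
 shows "\<exists>D>0. \<forall>(Th :: 'b measure) (mu :: 'c measure) X s (k::nat).
   prob_space Th --> sigma_finite_measure mu -->
   (%(th, y). X th y) \<in> borel_measurable (Th \<Otimes>\<^sub>M mu) -->
   (\<forall>y\<in>space mu. integrable Th (%th. abs (X th y) powr q)) -->
   s >= 0 --> (nint mu (%y. nint Th (%th. ennreal (abs (X th y) powr q)))) <= ennreal (s powr q) --> k >= 1 -->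
   (\<exists>ths::nat => 'b. (\<forall>i<k. ths i \<in> space Th) \<and>
    Lq_le mu q (%y. (\<Sum>i<k. X (ths i) y) / real k - (lint Th (%th. X th y))) (D * s / sqrt (real k)))"
proof -
 obtain D where D: "D > 0" and *: "\<forall>(Th :: 'b measure) (mu :: 'c measure) X s.
   prob_space Th --> sigma_finite_measure mu -->
   (%(th, y). X th y) \<in> borel_measurable (Th \<Otimes>\<^sub>M mu) -->
   (\<forall>y\<in>space mu. integrable Th (%th. abs (X th y) powr q) \<and> (lint Th (%th. X th y)) = 0) -->
   s >= 0 --> (nint mu (%y. nint Th (%th. ennreal (abs (X th y) powr q)))) <= ennreal s -->
   (\<forall>k\<ge>1. \<exists>ths::nat => 'b. (\<forall>i<k. ths i \<in> space Th) \<and>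
    (nint mu (%y. ennreal (abs (\<Sum>i<k. X (ths i) y) powr q))) <= ennreal (D * s * real k powr (q / 2)))"
  using derandomised_sum[OF q, where 'b = 'b and 'c = 'c] by (elim exE conjE) (rule that)
 \<comment> \<open>The \<open>q\<close>-th root converts the constant for moments into one for
   norms.\<close>
 define E where "E = (D * (2 * 2 powr q)) powr (1 / q)"
 have Eq: "E powr q = D * (2 * 2 powr q)" using D q by (simp add: E_def powr_powr)
 have E: "E > 0" using D by (simp add: E_def)
 show ?thesis
 proof (intro exI[of _ E] conjI allI impI)
  show "E > 0" by fact
  fix Th :: "'b measure" and mu :: "'c measure" and X s and k :: nat
  assume pr: "prob_space Th" and sf: "sigma_finite_measure mu"
   and X[measurable]: "(%(th, y). X th y) \<in> borel_measurable (Th \<Otimes>\<^sub>M mu)"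
   and X0: "\<forall>y\<in>space mu. integrable Th (%th. abs (X th y) powr q)"
   and s: "s >= 0" "(nint mu (%y. nint Th (%th. ennreal (abs (X th y) powr q)))) <= ennreal (s powr q)"
   and k: "k >= 1"
  interpret T: prob_space Th by fact
  interpret M: sigma_finite_measure mu by fact
  interpret P: pair_sigma_finite Th mu ..
  have meas1[measurable]: "X th \<in> borel_measurable mu" if "th \<in> space Th" for th
   using measurable_compose[OF measurable_Pair1'[OF that] X] by simp
  have meas2: "(%th. X th y) \<in> borel_measurable Th" if "y \<in> space mu" for y
   using measurable_compose[OF measurable_Pair2'[OF that] X] by simp
  have int1: "integrable Th (%th. X th y)" if "y \<in> space mu" for y
   by (rule T.integrable_of_powr[of _ q]) (use X0 q that meas2 in auto)
  define m where "m y = (lint Th (%th. X th y))" for y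
  have [measurable]: "m \<in> borel_measurable mu"
   unfolding m_def by measurable
  define Y where "Y th y = X th y - m y" for th y
  have Ym[measurable]: "(%(th, y). Y th y) \<in> borel_measurable (Th \<Otimes>\<^sub>M mu)"
   unfolding Y_def by measurable
  have Y2: "(%th. Y th y) \<in> borel_measurable Th" if "y \<in> space mu" for y
   unfolding Y_def using meas2[OF that] by simp
  have Yb: "abs (Y th y) powr q <= 2 powr q * (abs (X th y) powr q + abs (m y) powr q)" for th y
   using abs_add_powr_le[of q "X th y" "- m y"] q by (simp add: Y_def)
  have Yi: "integrable Th (%th. abs (Y th y) powr q)" if y: "y \<in> space mu" for y
  proof (rule Bochner_Integration.integrable_bound)
   show "integrable Th (%th. 2 powr q * (abs (X th y) powr q + abs (m y) powr q))"
    using X0 y by auto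
  qed (use Yb Y2[OF y] in \<open>auto simp: abs_mult\<close>)
  have Ypt: "(nint Th (%th. ennreal (abs (Y th y) powr q))) <= ennreal (2 * 2 powr q) * (nint Th (%th. ennreal (abs (X th y) powr q)))"
   if y: "y \<in> space mu" for y
  proof -
   have "(nint Th (%th. ennreal (abs (Y th y) powr q))) = ennreal (lint Th (%th. abs (Y th y) powr q))"
    by (rule nn_integral_eq_integral[OF Yi[OF y]]) auto
   also have "... <= ennreal (lint Th (%th. 2 powr q * (abs (X th y) powr q + abs (m y) powr q)))"
    by (intro ennreal_leI integral_mono Yi y Yb) (use X0 y in auto)
   also have "(lint Th (%th. 2 powr q * (abs (X th y) powr q + abs (m y) powr q))) = 2 powr q * ((lint Th (%th. abs (X th y) powr q)) + abs (m y) powr q)"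
    using X0 y by (simp add: T.prob_space)
   also have "abs (m y) powr q <= (lint Th (%th. abs (X th y) powr q))"
    unfolding m_def by (rule T.expectation_powr_le) (use X0 y meas2 q in auto)
   then have "ennreal (2 powr q * ((lint Th (%th. abs (X th y) powr q)) + abs (m y) powr q)) \<le>
     ennreal ((2 * 2 powr q) * (lint Th (%th. abs (X th y) powr q)))"
    by (intro ennreal_leI) simp
   also have "... = ennreal (2 * 2 powr q) * (nint Th (%th. ennreal (abs (X th y) powr q)))"
    using X0 y by (subst nn_integral_eq_integral) (auto simp: ennreal_mult)
   finally show ?thesis .
  qed
  have Ys: "(nint mu (%y. nint Th (%th. ennreal (abs (Y th y) powr q)))) <= ennreal (2 * 2 powr q * s powr q)"
  proof -
   have "(nint mu (%y. nint Th (%th. ennreal (abs (Y th y) powr q)))) \<le>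
     (nint mu (%y. ennreal (2 * 2 powr q) * (nint Th (%th. ennreal (abs (X th y) powr q)))))"
    by (intro nn_integral_mono Ypt)
   also have "... = ennreal (2 * 2 powr q) * (nint mu (%y. (nint Th (%th. ennreal (abs (X th y) powr q)))))"
    by (rule nn_integral_cmult) measurable
   also have "... <= ennreal (2 * 2 powr q) * ennreal (s powr q)"
    by (rule mult_left_mono[OF s(2)]) simp
   finally show ?thesis by (simp flip: ennreal_mult)
  qed
  have "\<exists>ths::nat => 'b. (\<forall>i<k. ths i \<in> space Th) \<and>
    (nint mu (%y. ennreal (abs (\<Sum>i<k. Y (ths i) y) powr q))) <= ennreal (D * (2 * 2 powr q * s powr q) * real k powr (q / 2))"
  proof (rule *[rule_format, OF pr sf Ym _ _ Ys k])
   have "(lint Th (%th. Y th y)) = 0" if "y \<in> space mu" for y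
    unfolding Y_def using int1[OF that] by (simp add: T.prob_space m_def)
   with Yi show "integrable Th (%th. abs (Y th y) powr q) \<and> (lint Th (%th. Y th y)) = 0" if "y \<in> space mu" for y
    using that by auto
  qed simp
  then obtain ths where ths: "!!i. i < k ==> ths i \<in> space Th"
   and a: "(nint mu (%y. ennreal (abs (\<Sum>i<k. Y (ths i) y) powr q))) <= ennreal (D * (2 * 2 powr q * s powr q) * real k powr (q / 2))"
   by auto
  have kp: "real k > 0" using k by simp
  have eq: "D * (2 * 2 powr q * s powr q) * real k powr (q / 2) = (E * s * sqrt (real k)) powr q"
  proof -
   have "sqrt (real k) powr q = real k powr (q / 2)"
    using kp by (simp add: powr_half_sqrt[symmetric] powr_powr)
   then show ?thesis using E s by (simp add: powr_mult Eq)
  qed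
  have "Lq_le mu q (%y. \<Sum>i<k. Y (ths i) y) (E * s * sqrt (real k))"
   unfolding Lq_le_def using a E s ths by (auto simp: eq Y_def intro!: borel_measurable_sum borel_measurable_diff)
  from Lq_le_cmult[OF this, of "1 / real k"]
  have "Lq_le mu q (%y. 1 / real k * (\<Sum>i<k. Y (ths i) y)) (1 / real k * (E * s * sqrt (real k)))" by simp
  also have "1 / real k * (E * s * sqrt (real k)) = E * s / sqrt (real k)"
   using kp by (simp add: field_simps)
  also have "(%y. 1 / real k * (\<Sum>i<k. Y (ths i) y)) = (%y. (\<Sum>i<k. X (ths i) y) / real k - m y)"
   using kp by (auto simp: Y_def sum_subtractf field_simps)
  finally have "Lq_le mu q (%y. (\<Sum>i<k. X (ths i) y) / real k - (lint Th (%th. X th y))) (E * s / sqrt (real k))"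
   unfolding m_def .
  with ths show "\<exists>ths::nat => 'b. (\<forall>i<k. ths i \<in> space Th) \<and>
    Lq_le mu q (%y. (\<Sum>i<k. X (ths i) y) / real k - (lint Th (%th. X th y))) (E * s / sqrt (real k))" by blast
 qed
qed

section \<open>Gaussian averages\<close>

text \<open>The restriction makes the result extensional, hence a point of \<open>Rd d\<close> for
  arbitrary \<open>x\<close> and \<open>z\<close>. With \<open>z\<close> standard Gaussian and
  \<open>c = sqrt t\<close> this is a Brownian motion at time \<open>t\<close> started in
  \<open>x\<close>.\<close>

definition gshift :: "nat => (nat => real) => real => (nat => real) => (nat => real)" where
 "gshift d x c z = (\<lambda>i\<in>{..<d}. x i + c * z i)"

text \<open>A Gaussian increment has length of order \<open>sqrt d\<close>. Adding this to the norm
  makes the increment comparable to the weight itself in every dimension.\<close>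

definition wgt :: "nat => (nat => real) => real" where
 "wgt d x = sqrt (real d) + enorm d x"

abbreviation stdn :: "real measure" where
 "stdn \<equiv> density lborel (%x. ennreal (std_normal_density x))"

definition gauss :: "nat => (nat => real) measure" where
 "gauss d = PiM {..<d} (%_. stdn)"

definition unit_time :: "real measure" where
 "unit_time = restrict_space lborel {0..1}"

text \<open>The law of one Monte Carlo sample: a Gaussian direction and a uniform fraction of the
  remaining time.\<close>

definition gauss_time :: "nat => ((nat => real) \<times> real) measure" where
 "gauss_time d = gauss d \<Otimes>\<^sub>M unit_time"

lemma prob_space_stdn: "prob_space stdn"
 by (rule prob_space_normal_density) simp

lemma sets_gauss[measurable_cong]: "sets (gauss d) = sets (PiM {..<d} (%_. borel))"
 unfolding gauss_def by (intro sets_PiM_cong) auto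

lemma space_gauss: "space (gauss d) = Rd d"
 by (simp add: gauss_def space_PiM Rd_def)

lemma prob_space_gauss: "prob_space (gauss d)"
 unfolding gauss_def by (intro prob_space_PiM prob_space_stdn)

lemma prob_space_unit_time: "prob_space unit_time"
 by (auto intro!: prob_spaceI simp: unit_time_def emeasure_restrict_space space_restrict_space)

lemma space_unit_time: "space unit_time = {0..1}"
 by (simp add: unit_time_def space_restrict_space)

lemma prob_space_gauss_time: "prob_space (gauss_time d)"
proof -
 interpret A: prob_space "gauss d" by (rule prob_space_gauss)
 interpret B: prob_space unit_time by (rule prob_space_unit_time)
 interpret pair_prob_space "gauss d" unit_time ..
 show ?thesis unfolding gauss_time_def by unfold_locales
qed

lemma space_gauss_time: "space (gauss_time d) = Rd d \<times> {0..1}"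
 by (simp add: gauss_time_def space_pair_measure space_gauss space_unit_time)

text \<open>Bridge between the product sigma-algebra on extensional functions, on which the measures
  live, and the Borel sets of all functions, with which continuity arguments work. Outside
  \<open>I\<close> every coordinate is the constant \<open>undefined\<close>.\<close>

lemma measurable_PiM_borel_id:
 "(%x. x) \<in> measurable (PiM I (%_. borel :: real measure)) (borel :: ('i::countable => real) measure)"
proof (rule measurable_coordinatewise_then_product)
 fix i
 show "(%x. x i) \<in> borel_measurable (Pi\<^sub>M I (%_. borel :: real measure))"
 proof (cases "i \<in> I")
  case False
  then have "!!w. w \<in> space (Pi\<^sub>M I (%_. borel :: real measure)) ==> w i = undefined"
   by (auto simp: space_PiM PiE_def extensional_def)
  then show ?thesis by (subst measurable_cong[where g = "%_. undefined"]) auto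
 qed simp
qed

lemma measurable_gauss_id: "(%x. x) \<in> borel_measurable (gauss d)"
 using measurable_PiM_borel_id[of "{..<d}"] by (simp add: measurable_cong_sets[OF sets_gauss refl])

lemma measurable_unit_time_id: "(%x. x) \<in> borel_measurable unit_time"
 by (simp add: unit_time_def measurable_restrict_space1)

lemma measurable_gauss_time_fst[measurable]: "fst \<in> borel_measurable (gauss_time d)"
 using measurable_compose[OF measurable_fst[of "gauss d" unit_time] measurable_gauss_id]
 unfolding gauss_time_def by (simp add: comp_def)

lemma measurable_gauss_time_snd[measurable]: "snd \<in> borel_measurable (gauss_time d)"
 using measurable_compose[OF measurable_snd[of "gauss d" unit_time] measurable_unit_time_id]
 unfolding gauss_time_def by (simp add: comp_def)

section \<open>Continuity, measurability and growth of the shift and the weight\<close>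

lemma shift_in_Rd[simp, intro]: "gshift d x c z \<in> Rd d"
 by (simp add: gshift_def Rd_def)

lemma continuous_on_coord:
 fixes f :: "'a::topological_space => 'i => 'b::topological_space"
 assumes "continuous_on S f"
 shows "continuous_on S (%p. f p i)"
 by (rule continuous_on_compose2[OF continuous_on_product_coordinates assms]) simp

lemma continuous_on_enorm[continuous_intros]:
 "continuous_on S f ==> continuous_on S (%p. enorm d (f p))"
 unfolding enorm_def
 by (intro continuous_on_real_sqrt continuous_on_sum continuous_on_power) (rule continuous_on_coord)

lemma continuous_on_shift[continuous_intros]:
 assumes "continuous_on S f" "continuous_on S c" "continuous_on S g"
 shows "continuous_on S (%p. gshift d (f p) (c p) (g p))"
proof (rule continuous_on_coordinatewise_then_product)
 fix i
 show "continuous_on S (%p. gshift d (f p) (c p) (g p) i)"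
  using continuous_on_coord[OF assms(1), of i] continuous_on_coord[OF assms(3), of i] assms(2)
  by (cases "i < d") (auto simp: gshift_def intro!: continuous_on_add continuous_on_mult)
qed

lemma continuous_on_restrict_fun[continuous_intros]:
 assumes "continuous_on S (f :: 'a::topological_space => 'i => 'b::topological_space)"
 shows "continuous_on S (%p. restrict (f p) I)"
proof (rule continuous_on_coordinatewise_then_product)
 fix i
 show "continuous_on S (%p. restrict (f p) I i)"
  using continuous_on_coord[OF assms, of i] by (cases "i \<in> I") auto
qed

lemma measurable_shift[measurable (raw)]:
 fixes f g :: "'a => nat => real"
 assumes f: "f \<in> borel_measurable M" and c: "c \<in> borel_measurable M" and g: "g \<in> borel_measurable M"
 shows "(%p. gshift d (f p) (c p) (g p)) \<in> borel_measurable M"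
proof -
 have "continuous_on UNIV (%w::(nat => real) \<times> real \<times> (nat => real). gshift d (fst w) (fst (snd w)) (snd (snd w)))"
  by (intro continuous_intros)
 from borel_measurable_continuous_on[OF this, of "%p. (f p, c p, g p)" M]
 show ?thesis using f c g by (auto intro!: borel_measurable_Pair)
qed

lemma continuous_on_wgt[continuous_intros]:
 "continuous_on S f ==> continuous_on S (%p. wgt d (f p))"
 unfolding wgt_def by (intro continuous_on_add continuous_on_const continuous_on_enorm)

lemma borel_measurable_wgt[measurable (raw)]:
 "f \<in> borel_measurable M ==> (%p. wgt d (f p)) \<in> borel_measurable M"
 by (rule borel_measurable_continuous_on[OF continuous_on_wgt[OF continuous_on_id]])

lemma enorm_nonneg[simp]: "0 <= enorm d x"
 by (auto simp: enorm_def intro!: sum_nonneg)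

lemma wgt_ge_1: "d >= 1 ==> 1 <= wgt d x"
proof -
 assume "d >= 1"
 then have "1 <= sqrt (real d)" by simp
 then show ?thesis using enorm_nonneg[of d x] unfolding wgt_def by linarith
qed

lemma wgt_ge_one_plus: "d >= 1 ==> 1 + enorm d x <= wgt d x"
 unfolding wgt_def by simp

lemma enorm_restrict[simp]: "enorm d (restrict x {..<d}) = enorm d x"
 by (simp add: enorm_def)

lemma wgt_restrict[simp]: "wgt d (restrict x {..<d}) = wgt d x"
 by (simp add: wgt_def)

lemma enorm_shift_le: "enorm d (gshift d x c z) <= enorm d x + abs c * enorm d z"
proof -
 have "enorm d (gshift d x c z) = L2_set (%i. x i + c * z i) {..<d}"
  by (simp add: enorm_def L2_set_def gshift_def)
 also have "... <= L2_set x {..<d} + L2_set (%i. c * z i) {..<d}" by (rule L2_set_triangle_ineq)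
 also have "L2_set (%i. c * z i) {..<d} = abs c * L2_set z {..<d}"
  by (simp add: L2_set_def power_mult_distrib real_sqrt_mult flip: sum_distrib_left)
 finally show ?thesis by (simp add: enorm_def L2_set_def)
qed

text \<open>Because \<open>sqrt d <= wgt d x\<close>, the additive increment becomes a factor. It
  contains the norm of \<open>z\<close> only divided by \<open>sqrt d\<close>, a quantity with
  dimension-free moments.\<close>

lemma wgt_shift_le:
 assumes "d >= 1"
 shows "wgt d (gshift d x c z) <= wgt d x * (1 + abs c * enorm d z / sqrt (real d))"
proof -
 have s: "sqrt (real d) > 0" using assms by simp
 have "sqrt (real d) * (abs c * enorm d z / sqrt (real d)) <= wgt d x * (abs c * enorm d z / sqrt (real d))"
  by (rule mult_right_mono) (auto simp: wgt_def)
 then have "abs c * enorm d z <= wgt d x * (abs c * enorm d z / sqrt (real d))" using s by simp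
 then show ?thesis using enorm_shift_le[of d x c z] by (simp add: wgt_def distrib_left)
qed

lemma wgt_shift_le':
 assumes "d >= 1"
 shows "wgt d (gshift d x c z) <= wgt d x * ((1 + abs c) * (1 + enorm d z))"
proof -
 have "wgt d (gshift d x c z) <= wgt d x * (1 + abs c * enorm d z / sqrt (real d))"
  by (rule wgt_shift_le[OF assms])
 also have "... <= wgt d x * ((1 + abs c) * (1 + enorm d z))"
 proof (rule mult_left_mono)
  have "abs c * enorm d z / sqrt (real d) <= abs c * enorm d z / 1"
   by (rule divide_left_mono) (use assms in auto)
  moreover have "1 + abs c * enorm d z <= (1 + abs c) * (1 + enorm d z)"
   by (auto simp: algebra_simps)
  ultimately show "1 + abs c * enorm d z / sqrt (real d) <= (1 + abs c) * (1 + enorm d z)" by simp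
 qed (use wgt_ge_1[OF assms, of x] in auto)
 finally show ?thesis .
qed

text \<open>The tangent inequalities at the mean are summed, and the linear terms cancel.\<close>

lemma power_mean:
 fixes a :: "nat => real"
 assumes a: "!!i. i < d ==> a i >= 0" and d: "d >= 1"
 shows "((\<Sum>i<d. a i) / d) ^ m <= (\<Sum>i<d. a i ^ m) / d"
proof (cases "m = 0")
 case True
 then show ?thesis using d by simp
next
 case False
 define b where "b = (\<Sum>i<d. a i) / d"
 have b: "b >= 0" using a by (auto simp: b_def intro!: sum_nonneg divide_nonneg_nonneg)
 have pw: "y powr real m = y ^ m" if "y >= 0" for y :: real
  using that False by (cases "y = 0") (auto simp: powr_realpow)
 have "b ^ m + m * b powr (m - 1) * (a i - b) <= a i ^ m" if "i < d" for i
  using powr_tangent[of "real m" "a i" b] a[OF that] b False by (simp add: pw)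
 then have "(\<Sum>i<d. b ^ m + m * b powr (m - 1) * (a i - b)) <= (\<Sum>i<d. a i ^ m)"
  by (intro sum_mono) auto
 also have "(\<Sum>i<d. b ^ m + m * b powr (m - 1) * (a i - b)) = d * b ^ m + m * b powr (m - 1) * ((\<Sum>i<d. a i) - d * b)"
  by (simp add: sum.distrib sum_subtractf flip: sum_distrib_left)
 also have "(\<Sum>i<d. a i) - d * b = 0" using d by (simp add: b_def)
 finally show ?thesis using d by (simp add: b_def field_simps)
qed

section \<open>Gaussian moments of the weight\<close>

lemma distr_gauss_component:
 assumes "i < d" shows "distr (gauss d) borel (%z. z i) = stdn"
proof -
 have "distr (gauss d) stdn (%z. z i) = stdn"
  unfolding gauss_def by (rule distr_PiM_component) (use assms prob_space_stdn in auto)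
 moreover have "distr (gauss d) stdn (%z. z i) = distr (gauss d) borel (%z. z i)"
  by (rule distr_cong) auto
 ultimately show ?thesis by simp
qed

lemma gauss_coord_measurable: "i < d ==> (%z. z i) \<in> borel_measurable (gauss d)"
 unfolding gauss_def by measurable

definition normal_mom :: "nat => real" where
 "normal_mom m = (lint stdn (%y. y ^ (2 * m)))"

lemma stdn_moment: "integrable stdn (%y. y ^ k)"
 using integrable_std_normal_moment[of k]
 by (subst integrable_density) auto

lemma gauss_coord_moment:
 assumes "i < d"
 shows "integrable (gauss d) (%z. z i ^ k)" "(lint (gauss d) (%z. z i ^ (2 * m))) = normal_mom m"
proof -
 note [measurable] = gauss_coord_measurable[OF assms]
 show "integrable (gauss d) (%z. z i ^ k)"
  using stdn_moment[of k] unfolding distr_gauss_component[OF assms, symmetric]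
  by (subst (asm) integrable_distr_eq) auto
 show "(lint (gauss d) (%z. z i ^ (2 * m))) = normal_mom m"
  unfolding normal_mom_def distr_gauss_component[OF assms, symmetric]
  by (subst integral_distr) auto
qed

lemma normal_mom_nonneg: "normal_mom m >= 0"
 unfolding normal_mom_def by (intro integral_nonneg_AE) (auto simp: zero_le_even_power)

text \<open>The constant does not depend on the dimension: this is why \<open>sqrt d\<close> is built into the weight.\<close>

definition wgt_const :: "real => real => real" where
 "wgt_const s R = 4 ^ nat \<lceil>s\<rceil> * (1 + R ^ (2 * nat \<lceil>s\<rceil>) * normal_mom (nat \<lceil>s\<rceil>))"

lemma wgt_const_ge_1: "wgt_const s R >= 1"
proof -
 have "1 * 1 <= wgt_const s R" unfolding wgt_const_def
  by (intro mult_mono) (auto simp: normal_mom_nonneg zero_le_even_power)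
 then show ?thesis by simp
qed

text \<open>The exponent is raised to the even integer \<open>2 * m\<close>, so that the norm enters
  as the \<open>m\<close>-th power of the mean of the squared coordinates. By
  \<open>power_mean\<close> this is at most the mean of the \<open>2 * m\<close>-th powers, whose
  expectation is a one-dimensional moment.\<close>

lemma wgt_gauss:
 assumes d: "d >= 1" and s: "s >= 0" and c: "abs c <= R"
 shows "integrable (gauss d) (%z. wgt d (gshift d x c z) powr s)" (is ?I)
  "(lint (gauss d) (%z. wgt d (gshift d x c z) powr s)) <= wgt_const s R * wgt d x powr s" (is ?B)
proof -
 define m where "m = nat \<lceil>s\<rceil>"
 have m: "s <= real (2 * m)" using s unfolding m_def by linarith
 interpret prob_space "gauss d" by (rule prob_space_gauss)
 define g where "g z = 4 ^ m * (1 + R ^ (2 * m) * ((\<Sum>i<d. z i ^ (2 * m)) / d))" for z :: "nat => real"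
 have gi: "integrable (gauss d) g"
 proof -
  have "integrable (gauss d) (%z. \<Sum>i<d. z i ^ (2 * m))"
   by (intro Bochner_Integration.integrable_sum gauss_coord_moment) simp
  then show ?thesis unfolding g_def by simp
 qed
 have "expectation g = 4 ^ m * (1 + R ^ (2 * m) * ((\<Sum>i<d. expectation (%z. z i ^ (2 * m))) / d))"
 proof -
  have i: "integrable (gauss d) (%z. \<Sum>i<d. z i ^ (2 * m))"
   by (intro Bochner_Integration.integrable_sum gauss_coord_moment) simp
  have "expectation (%z. \<Sum>i<d. z i ^ (2 * m)) = (\<Sum>i<d. expectation (%z. z i ^ (2 * m)))"
   by (intro Bochner_Integration.integral_sum gauss_coord_moment) simp
  with i show ?thesis unfolding g_def by (simp add: prob_space)
 qed
 also have "... = wgt_const s R"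
  using d gauss_coord_moment by (simp add: wgt_const_def m_def)
 finally have ge: "expectation g = wgt_const s R" .
 have g1: "(1 + y) powr s <= 4 ^ m * (1 + y ^ (2 * m))" if "y >= 0" for y :: real
 proof -
  have "(1 + y) powr s <= (1 + y) powr real (2 * m)" using that m by (intro powr_mono) auto
  also have "... = (1 + y) ^ (2 * m)" using that by (subst powr_realpow) auto
  also have "... <= (2 * max 1 y) ^ (2 * m)" using that by (intro power_mono) auto
  also have "... = 4 ^ m * max 1 y ^ (2 * m)" by (simp add: power_mult_distrib power_mult)
  also have "... <= 4 ^ m * (1 + y ^ (2 * m))" using that by (intro mult_left_mono) (auto simp: max_def)
  finally show ?thesis .
 qed
 have pt: "wgt d (gshift d x c z) powr s <= wgt d x powr s * g z" for z
 proof -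
  let ?y = "abs c * enorm d z / sqrt (real d)"
  have "wgt d (gshift d x c z) powr s <= (wgt d x * (1 + ?y)) powr s"
   using wgt_ge_1[OF d] s by (intro powr_mono2 wgt_shift_le d) (auto intro: order_trans[OF zero_le_one])
  also have "... = wgt d x powr s * (1 + ?y) powr s" by (simp add: powr_mult)
  also have "... <= wgt d x powr s * g z"
  proof (rule mult_left_mono)
   have "?y ^ (2 * m) = c ^ (2 * m) * ((\<Sum>i<d. (z i)\<^sup>2) / d) ^ m"
    by (simp add: power_mult power_mult_distrib power_divide enorm_def sum_nonneg)
   also have "... <= R ^ (2 * m) * ((\<Sum>i<d. ((z i)\<^sup>2) ^ m) / d)"
   proof (rule mult_mono)
    have "abs c ^ (2 * m) <= R ^ (2 * m)" using c by (intro power_mono) auto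
    then show "c ^ (2 * m) <= R ^ (2 * m)" by (simp add: power_mult)
   qed (use d in \<open>auto intro!: power_mean sum_nonneg divide_nonneg_nonneg zero_le_power[where a = "sum f A / n" for f A n] simp: zero_le_even_power\<close>)
   finally have y: "?y ^ (2 * m) <= R ^ (2 * m) * ((\<Sum>i<d. z i ^ (2 * m)) / d)" by (simp add: power_mult)
   have "(1 + ?y) powr s <= 4 ^ m * (1 + ?y ^ (2 * m))" by (rule g1) auto
   also have "... <= g z" unfolding g_def by (intro mult_left_mono add_left_mono y) auto
   finally show "(1 + ?y) powr s <= g z" .
  qed simp
  finally show ?thesis .
 qed
 show I: ?I
 proof (rule Bochner_Integration.integrable_bound)
  show "integrable (gauss d) (%z. wgt d x powr s * g z)" using gi by simp
  show "AE z in gauss d. norm (wgt d (gshift d x c z) powr s) <= norm (wgt d x powr s * g z)"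
   using pt by (auto intro!: AE_I2) (metis abs_ge_self order_trans)
  show "(%z. wgt d (gshift d x c z) powr s) \<in> borel_measurable (gauss d)"
   by (intro powr_real_measurable borel_measurable_wgt measurable_shift measurable_gauss_id borel_measurable_const)
 qed
 have "(lint (gauss d) (%z. wgt d (gshift d x c z) powr s)) <= (lint (gauss d) (%z. wgt d x powr s * g z))"
  by (intro integral_mono I pt) (use gi in auto)
 then show ?B using ge by (simp add: mult.commute)
qed

lemma nn_wgt_gauss:
 assumes d: "d >= 1" and s: "s >= 0" and c: "abs c <= R"
 shows "(nint (gauss d) (%z. ennreal (wgt d (gshift d x c z) powr s))) <= ennreal (wgt_const s R * wgt d x powr s)"
 using wgt_gauss[OF assms, of x] by (subst nn_integral_eq_integral) (auto intro!: ennreal_leI)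

lemma integrable_gauss_enorm:
 assumes d: "d >= 1" and s: "s >= 0"
 shows "integrable (gauss d) (%z. (1 + enorm d z) powr s)"
proof (rule Bochner_Integration.integrable_bound[OF wgt_gauss(1)[OF d s order_refl, where x = "%_. 0" and c = 1]])
 have "(1 + enorm d z) powr s <= wgt d (gshift d (%_. 0) 1 z) powr s" for z
 proof (rule powr_mono2)
  have "enorm d (gshift d (%_. 0) 1 z) = enorm d z" by (simp add: gshift_def enorm_def)
  then show "1 + enorm d z <= wgt d (gshift d (%_. 0) 1 z)" using wgt_ge_one_plus[OF d] by metis
 qed (use s in \<open>auto simp: add_nonneg_nonneg\<close>)
 then show "AE z in gauss d. norm ((1 + enorm d z) powr s) <= norm (wgt d (gshift d (%_. 0) 1 z) powr s)" by auto
 have "(%z. (1 + enorm d z) powr s) \<in> borel_measurable (gauss d)"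
  unfolding enorm_def by measurable
 then show "(%z. (1 + enorm d z) powr s) \<in> borel_measurable (gauss d)" .
qed

text \<open>Dominated convergence along sequences. A bound of product form suffices because the
  continuous factor \<open>b\<close> stays bounded along a convergent sequence of
  parameters.\<close>

lemma continuous_on_parametric_integral:
 fixes k :: "'p::metric_space => 'm => real"
 assumes meas: "!!p. p \<in> S ==> k p \<in> borel_measurable M"
  and cont: "!!th. th \<in> space M ==> continuous_on S (%p. k p th)"
  and bnd: "!!p th. p \<in> S ==> th \<in> space M ==> abs (k p th) <= b p * W th"
  and b: "continuous_on S b" and W: "integrable M W"
 shows "continuous_on S (%p. lint M (%th. k p th))"
 unfolding continuous_on_sequentially comp_def
proof (intro allI ballI impI, elim conjE)
 fix x p assume p: "p \<in> S" and x: "\<forall>n. x n \<in> S" and lim: "x \<longlonglongrightarrow> p"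
 have "(%n. b (x n)) \<longlonglongrightarrow> b p"
  using b p x lim unfolding continuous_on_sequentially comp_def by blast
 then have "Bseq (%n. b (x n))" by (intro convergent_imp_Bseq convergentI)
 then obtain B where B: "!!n. abs (b (x n)) <= B" unfolding Bseq_def by auto
 show "(%n. lint M (%th. k (x n) th)) \<longlonglongrightarrow> (lint M (%th. k p th))"
 proof (rule integral_dominated_convergence)
  show "integrable M (%th. B * abs (W th))" using W by auto
  show "AE th in M. (%n. k (x n) th) \<longlonglongrightarrow> k p th"
   using cont p x lim unfolding continuous_on_sequentially comp_def by (intro AE_I2) blast
  show "AE th in M. norm (k (x n) th) <= B * abs (W th)" for n
  proof (intro AE_I2)
   fix th assume "th \<in> space M"
   then have "abs (k (x n) th) <= b (x n) * W th" using x bnd by blast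
   also have "... <= abs (b (x n)) * abs (W th)" by (metis abs_ge_self abs_mult)
   also have "... <= B * abs (W th)" using B by (intro mult_right_mono) auto
   finally show "norm (k (x n) th) <= B * abs (W th)" by simp
  qed
 qed (use meas p x in auto)
qed

subsection \<open>The semigroup property\<close>

lemma nn_integral_stdn_affine:
 assumes [measurable]: "f \<in> borel_measurable borel" and c: "c > 0"
 shows "(nint stdn (%a. f (m + c * a))) = (nint lborel (%y. ennreal (normal_density m c y) * f y))"
proof -
 have "(nint lborel (%y. ennreal (normal_density m c y) * f y)) =
   ennreal (abs c) * (nint lborel (%a. ennreal (normal_density m c (m + c * a)) * f (m + c * a)))"
  by (rule nn_integral_real_affine) (use c in auto)
 also have "... = (nint lborel (%a. ennreal (abs c) * (ennreal (normal_density m c (m + c * a)) * f (m + c * a))))"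
  by (rule nn_integral_cmult[symmetric]) measurable
 also have "... = (nint lborel (%a. ennreal (std_normal_density a) * f (m + c * a)))"
 proof (intro nn_integral_cong)
  fix a
  have "abs c * normal_density m c (m + c * a) = std_normal_density a"
   using c by (simp add: normal_density_def real_sqrt_mult power_mult_distrib)
  then show "ennreal (abs c) * (ennreal (normal_density m c (m + c * a)) * f (m + c * a)) = ennreal (std_normal_density a) * f (m + c * a)"
   by (metis abs_ge_zero ennreal_mult mult.assoc normal_density_nonneg)
 qed
 also have "... = (nint stdn (%a. f (m + c * a)))"
  by (subst nn_integral_density) auto
 finally show ?thesis ..
qed

text \<open>After rescaling both integrals to centred normal densities, Tonelli exposes their
  convolution.\<close>

lemma stdn_add:
 assumes [measurable]: "f \<in> borel_measurable borel" and "sg > 0" "tau > 0"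
 shows "(nint stdn (%a. nint stdn (%b. f (x + sqrt sg * a + sqrt tau * b)))) = (nint stdn (%a. f (x + sqrt (sg + tau) * a)))"
proof -
 have "(nint stdn (%a. nint stdn (%b. f (x + sqrt sg * a + sqrt tau * b))))
  = (nint stdn (%a. nint lborel (%v. ennreal (normal_density 0 (sqrt tau) v) * f (x + (0 + sqrt sg * a) + v))))"
  using nn_integral_stdn_affine[of "%v. f (x + sqrt sg * a + v)" "sqrt tau" 0 for a] assms by simp
 also have "... = (nint lborel (%u. ennreal (normal_density 0 (sqrt sg) u) *
   (nint lborel (%v. ennreal (normal_density 0 (sqrt tau) v) * f (x + u + v)))))"
  by (rule nn_integral_stdn_affine) (use assms in auto)
 also have "... = (nint lborel (%u. ennreal (normal_density 0 (sqrt sg) u) *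
   (nint lborel (%w. ennreal (normal_density 0 (sqrt tau) (w - u)) * f (x + w)))))"
 proof (rule nn_integral_cong, rule arg_cong2[where f = "(*)"], rule refl)
  fix u
  show "(nint lborel (%v. ennreal (normal_density 0 (sqrt tau) v) * f (x + u + v))) =
   (nint lborel (%w. ennreal (normal_density 0 (sqrt tau) (w - u)) * f (x + w)))"
   using nn_integral_real_affine[of "%w. ennreal (normal_density 0 (sqrt tau) (w - u)) * f (x + w)" 1 u]
   by (simp add: add.assoc)
 qed
 also have "... = (nint lborel (%u. (nint lborel (%w. ennreal (normal_density 0 (sqrt tau) (w - u) * normal_density 0 (sqrt sg) u) * f (x + w)))))"
  by (subst nn_integral_cmult[symmetric]) (auto intro!: nn_integral_cong simp: ennreal_mult mult_ac)
 also have "... = (nint lborel (%w. (nint lborel (%u. ennreal (normal_density 0 (sqrt tau) (w - u) * normal_density 0 (sqrt sg) u) * f (x + w)))))"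
  by (rule lborel_pair.Fubini') measurable
 also have "... = (nint lborel (%w. (nint lborel (%u. ennreal (normal_density 0 (sqrt tau) (w - u) * normal_density 0 (sqrt sg) u))) * f (x + w)))"
  by (intro nn_integral_cong nn_integral_multc) measurable
 also have "... = (nint lborel (%w. ennreal (normal_density 0 (sqrt (sg + tau)) w) * f (x + w)))"
  using fun_cong[OF conv_normal_density_zero_mean[of "sqrt tau" "sqrt sg"]] assms by (simp add: add.commute)
 also have "... = (nint stdn (%a. f (x + (0 + sqrt (sg + tau) * a))))"
  by (rule nn_integral_stdn_affine[symmetric]) (use assms in auto)
 finally show ?thesis by simp
qed

text \<open>The Chapman-Kolmogorov equation, in the role that independent increments of a path would
  have. Laws on the product space are determined by boxes, where everything factorises into the
  one-dimensional identity \<open>stdn_add\<close>; vanishing times have no density and are treated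
  directly.\<close>

lemma gauss_semigroup:
 fixes G :: "(nat => real) => ennreal"
 assumes [measurable]: "G \<in> borel_measurable borel" and "sg >= 0" "tau >= 0"
 shows "(nint (gauss d) (%z. nint (gauss d) (%z'. G (gshift d (gshift d x (sqrt sg) z) (sqrt tau) z'))))
   = (nint (gauss d) (%z. G (gshift d x (sqrt (sg + tau)) z)))"
proof -
 interpret prob_space "gauss d" by (rule prob_space_gauss)
 consider "sg = 0" | "tau = 0" | "sg > 0" "tau > 0" using assms by fastforce
 then show ?thesis
 proof cases
  case 1
  have "gshift d (gshift d x 0 z) c z' = gshift d x c z'" for z c z' by (auto simp: gshift_def)
  then show ?thesis using 1 by (simp add: emeasure_space_1)
 next
  case 2
  have "gshift d (gshift d x c z) 0 z' = gshift d x c z" for z c z' by (auto simp: gshift_def)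
  then show ?thesis using 2 by (simp add: emeasure_space_1)
 next
  case 3
  interpret S: prob_space stdn by (rule prob_space_stdn)
  interpret P: product_sigma_finite "%_::nat. stdn" ..
  interpret PP: pair_prob_space "gauss d" "gauss d" ..
  \<comment> \<open>Both laws are identified with the product of these one-dimensional laws.\<close>
  define N where "N = (%i. distr stdn borel (%a. x i + sqrt (sg + tau) * a))"
  interpret N: prob_space "N i" for i unfolding N_def by (rule S.prob_space_distr) simp
  interpret PN: product_sigma_finite N ..
  have sN[measurable_cong]: "sets (N i) = sets borel" for i by (simp add: N_def)
  have sPN: "sets (PiM {..<d} N) = sets (PiM {..<d} (%_. borel))" by (intro sets_PiM_cong) (auto simp: sN)
  let ?P = "PiM {..<d} (%_. borel :: real measure)"
  have shm: "(%z. gshift d y c z) \<in> measurable (gauss d) ?P" for y c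
   unfolding gshift_def gauss_def by measurable
  have shm2: "(%w. gshift d (gshift d x (sqrt sg) (fst w)) (sqrt tau) (snd w)) \<in> measurable (gauss d \<Otimes>\<^sub>M gauss d) ?P"
  proof -
   have f: "(%w. fst w i) \<in> borel_measurable (gauss d \<Otimes>\<^sub>M gauss d)"
    and g: "(%w. snd w i) \<in> borel_measurable (gauss d \<Otimes>\<^sub>M gauss d)" if "i < d" for i
    using measurable_compose[OF measurable_fst gauss_coord_measurable[OF that]]
     measurable_compose[OF measurable_snd gauss_coord_measurable[OF that]] by auto
   show ?thesis
    unfolding gshift_def by (rule measurable_restrict) (use f g in auto)
  qed
  have box: "indicator (Pi\<^sub>E {..<d} A) (gshift d y c z) = (\<Prod>i<d. indicator (A i) (y i + c * z i) :: ennreal)" for A y c z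
  proof (cases "\<forall>i<d. y i + c * z i \<in> A i")
   case True
   then show ?thesis by (auto simp: gshift_def indicator_def)
  next
   case False
   then obtain i where "i < d" "y i + c * z i \<notin> A i" by auto
   then have "(\<Prod>i<d. indicator (A i) (y i + c * z i) :: ennreal) = 0" using prod_zero[of "{..<d}"] by (auto simp: indicator_def)
   with False show ?thesis by (auto simp: gshift_def indicator_def)
  qed
  have 1: "distr (gauss d) ?P (gshift d x (sqrt (sg + tau))) = PiM {..<d} N"
  proof (rule PN.PiM_eqI)
   fix A assume A: "!!i. i \<in> {..<d} ==> A i \<in> sets (N i)"
   then have [measurable]: "i < d ==> A i \<in> sets borel" for i by (auto simp: sN)
   have "emeasure (distr (gauss d) ?P (gshift d x (sqrt (sg + tau)))) (Pi\<^sub>E {..<d} A)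
    = (nint (gauss d) (%z. indicator (Pi\<^sub>E {..<d} A) (gshift d x (sqrt (sg + tau)) z)))"
   proof -
    have [measurable]: "Pi\<^sub>E {..<d} A \<in> sets ?P" using A by (auto intro!: sets_PiM_I_finite simp: sN)
    have "emeasure (distr (gauss d) ?P (gshift d x (sqrt (sg + tau)))) (Pi\<^sub>E {..<d} A)
     = (nint (distr (gauss d) ?P (gshift d x (sqrt (sg + tau)))) (%y. indicator (Pi\<^sub>E {..<d} A) y))" by simp
    also have "... = (nint (gauss d) (%z. indicator (Pi\<^sub>E {..<d} A) (gshift d x (sqrt (sg + tau)) z)))"
     by (rule nn_integral_distr[OF shm]) simp
    finally show ?thesis .
   qed
   also have "... = (\<Prod>i<d. nint stdn (%a. indicator (A i) (x i + sqrt (sg + tau) * a)))"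
    unfolding box unfolding gauss_def
    by (rule P.product_nn_integral_prod) auto
   also have "... = (\<Prod>i<d. emeasure (N i) (A i))"
   proof (intro prod.cong refl)
    fix i assume "i \<in> {..<d}"
    then have [measurable]: "A i \<in> sets borel" by auto
    have "emeasure (N i) (A i) = (nint (N i) (%a. indicator (A i) a))" by (simp add: sN)
    also have "... = (nint stdn (%a. indicator (A i) (x i + sqrt (sg + tau) * a)))"
     unfolding N_def by (rule nn_integral_distr) auto
    finally show "(nint stdn (%a. indicator (A i) (x i + sqrt (sg + tau) * a))) = emeasure (N i) (A i)" ..
   qed
   finally show "emeasure (distr (gauss d) ?P (gshift d x (sqrt (sg + tau)))) (Pi\<^sub>E {..<d} A) = (\<Prod>i<d. emeasure (N i) (A i))" .
  qed (auto simp: sPN)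
  have 2: "distr (gauss d \<Otimes>\<^sub>M gauss d) ?P (%w. gshift d (gshift d x (sqrt sg) (fst w)) (sqrt tau) (snd w)) = PiM {..<d} N"
  proof (rule PN.PiM_eqI)
   fix A assume A: "!!i. i \<in> {..<d} ==> A i \<in> sets (N i)"
   then have Am[measurable]: "i < d ==> A i \<in> sets borel" for i by (auto simp: sN)
   have Bm[measurable]: "Pi\<^sub>E {..<d} A \<in> sets ?P" using Am by (auto intro!: sets_PiM_I_finite)
   have "emeasure (distr (gauss d \<Otimes>\<^sub>M gauss d) ?P (%w. gshift d (gshift d x (sqrt sg) (fst w)) (sqrt tau) (snd w))) (Pi\<^sub>E {..<d} A)
    = (nint (gauss d \<Otimes>\<^sub>M gauss d) (%w. indicator (Pi\<^sub>E {..<d} A) (gshift d (gshift d x (sqrt sg) (fst w)) (sqrt tau) (snd w))))"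
   proof -
    have "emeasure (distr (gauss d \<Otimes>\<^sub>M gauss d) ?P (%w. gshift d (gshift d x (sqrt sg) (fst w)) (sqrt tau) (snd w))) (Pi\<^sub>E {..<d} A)
     = (nint (distr (gauss d \<Otimes>\<^sub>M gauss d) ?P (%w. gshift d (gshift d x (sqrt sg) (fst w)) (sqrt tau) (snd w))) (%y. indicator (Pi\<^sub>E {..<d} A) y))" by simp
    also have "... = (nint (gauss d \<Otimes>\<^sub>M gauss d) (%w. indicator (Pi\<^sub>E {..<d} A) (gshift d (gshift d x (sqrt sg) (fst w)) (sqrt tau) (snd w))))"
     by (rule nn_integral_distr[OF shm2]) simp
    finally show ?thesis .
   qed
   also have "... = (nint (gauss d) (%z. nint (gauss d) (%z'. indicator (Pi\<^sub>E {..<d} A) (gshift d (gshift d x (sqrt sg) z) (sqrt tau) z'))))"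
   proof -
    have "(%w. indicator (Pi\<^sub>E {..<d} A) (gshift d (gshift d x (sqrt sg) (fst w)) (sqrt tau) (snd w)) :: ennreal) \<in> borel_measurable (gauss d \<Otimes>\<^sub>M gauss d)"
     by (rule measurable_compose[OF shm2]) (use Bm in auto)
    from nn_integral_fst[OF this] show ?thesis by simp
   qed
   also have "... = (nint (gauss d) (%z. (\<Prod>i<d. nint stdn (%b. indicator (A i) (gshift d x (sqrt sg) z i + sqrt tau * b)))))"
    unfolding box unfolding gauss_def
    by (intro nn_integral_cong P.product_nn_integral_prod) auto
   also have "... = (nint (gauss d) (%z. (\<Prod>i<d. nint stdn (%b. indicator (A i) (x i + sqrt sg * z i + sqrt tau * b)))))"
    by (intro nn_integral_cong prod.cong) (auto simp: gshift_def)
   also have "... = (\<Prod>i<d. nint stdn (%a. nint stdn (%b. indicator (A i) (x i + sqrt sg * a + sqrt tau * b))))"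
    unfolding gauss_def by (rule P.product_nn_integral_prod) auto
   also have "... = (\<Prod>i<d. emeasure (N i) (A i))"
   proof (intro prod.cong refl)
    fix i assume "i \<in> {..<d}"
    then have [measurable]: "A i \<in> sets borel" by auto
    have "emeasure (N i) (A i) = (nint (N i) (%a. indicator (A i) a))" by (simp add: sN)
    also have "... = (nint stdn (%a. indicator (A i) (x i + sqrt (sg + tau) * a)))"
     unfolding N_def by (rule nn_integral_distr) auto
    also have "... = (nint stdn (%a. nint stdn (%b. indicator (A i) (x i + sqrt sg * a + sqrt tau * b))))"
     by (rule stdn_add[symmetric]) (use 3 in auto)
    finally show "(nint stdn (%a. nint stdn (%b. indicator (A i) (x i + sqrt sg * a + sqrt tau * b)))) = emeasure (N i) (A i)" ..
   qed
   finally show "emeasure (distr (gauss d \<Otimes>\<^sub>M gauss d) ?P (%w. gshift d (gshift d x (sqrt sg) (fst w)) (sqrt tau) (snd w))) (Pi\<^sub>E {..<d} A) = (\<Prod>i<d. emeasure (N i) (A i))" .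
  qed (auto simp: sPN)
  have Gm: "G \<in> borel_measurable ?P"
   using measurable_compose[OF measurable_PiM_borel_id assms(1)] .
  have "(nint (gauss d) (%z. nint (gauss d) (%z'. G (gshift d (gshift d x (sqrt sg) z) (sqrt tau) z'))))
    = (nint (gauss d \<Otimes>\<^sub>M gauss d) (%w. G (gshift d (gshift d x (sqrt sg) (fst w)) (sqrt tau) (snd w))))"
   using nn_integral_fst[OF measurable_compose[OF shm2 Gm]] by simp
  also have "... = (nint (PiM {..<d} N) (%y. G y))"
   unfolding 2[symmetric] by (rule nn_integral_distr[OF shm2, symmetric]) (use Gm in simp)
  also have "... = (nint (gauss d) (%z. G (gshift d x (sqrt (sg + tau)) z)))"
   unfolding 1[symmetric] by (rule nn_integral_distr[OF shm]) (use Gm in simp)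
  finally show ?thesis .
 qed
qed

declare continuous_on_coordinatewise_then_product [continuous_intros del]

section \<open>Mild solutions\<close>

lemma borel_measurable_continuous_on_closed:
 fixes F :: "'a::topological_space => 'b::topological_space"
 assumes "continuous_on C F" "C \<in> sets borel" "g \<in> borel_measurable M" "!!x. x \<in> space M ==> g x \<in> C"
 shows "(%x. F (g x)) \<in> borel_measurable M"
proof -
 have "F \<in> borel_measurable (restrict_space borel C)"
  by (rule borel_measurable_continuous_on_restrict[OF assms(1)])
 moreover have "g \<in> measurable M (restrict_space borel C)"
  by (rule measurable_restrict_space2) (use assms in auto)
 ultimately show ?thesis by (rule measurable_compose[rotated])
qed

text \<open>The factor \<open>w\<close> prepares for derivatives, where differentiating the kernel
  leaves a polynomial in \<open>z\<close>. The dominating function separates into a continuous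
  function of the parameters and \<open>(1 + enorm d z) powr (s + m)\<close>.\<close>

lemma continuous_on_gauss_expectation:
 fixes G :: "real => (nat => real) => real" and S :: "'p::metric_space set"
 assumes d: "d >= 1" and s: "s >= 0" and m: "m >= 0"
  and G: "continuous_on (C \<times> UNIV) (%(t, x). G t x)" "closed C"
  and Gb: "!!t x. t \<in> C ==> abs (G t x) <= K * wgt d x powr s"
  and w: "w \<in> borel_measurable (gauss d)" "!!z. abs (w z) <= K' * (1 + enorm d z) powr m"
  and a: "continuous_on S a" "!!p. p \<in> S ==> a p \<in> C"
  and y: "continuous_on S y" and c: "continuous_on S c"
 shows "continuous_on S (%p. lint (gauss d) (%z. G (a p) (gshift d (y p) (c p) z) * w z))"
  and "!!t x c. t \<in> C ==> integrable (gauss d) (%z. G t (gshift d x c z) * w z)"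
proof -
 have W: "integrable (gauss d) (%z. (1 + enorm d z) powr (s + m))"
  by (rule integrable_gauss_enorm) (use d s m in auto)
 have meas: "(%z. G t (gshift d x c z) * w z) \<in> borel_measurable (gauss d)" if "t \<in> C" for t x c
 proof (intro borel_measurable_times w)
  have "(%z. (%(t, x). G t x) (t, gshift d x c z)) \<in> borel_measurable (gauss d)"
   by (rule borel_measurable_continuous_on_closed[OF G(1)])
    (use that G in \<open>auto intro!: borel_measurable_Pair measurable_shift measurable_gauss_id borel_closed closed_Times\<close>)
  then show "(%z. G t (gshift d x c z)) \<in> borel_measurable (gauss d)" by simp
 qed
 have bnd: "abs (G t (gshift d x c z) * w z) <= (abs K * (wgt d x * (1 + abs c)) powr s * abs K') * (1 + enorm d z) powr (s + m)"
  if "t \<in> C" for t x c z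
 proof -
  have "abs (G t (gshift d x c z)) <= abs K * wgt d (gshift d x c z) powr s"
   using Gb[OF that, of "gshift d x c z"] by (meson abs_ge_self mult_right_mono order_trans powr_ge_zero)
  also have "... <= abs K * (wgt d x * ((1 + abs c) * (1 + enorm d z))) powr s"
   using wgt_ge_1[OF d] s
   by (intro mult_left_mono powr_mono2 wgt_shift_le' d) (auto intro: order_trans[OF zero_le_one])
  also have "... = abs K * (wgt d x * (1 + abs c)) powr s * (1 + enorm d z) powr s"
   by (simp add: powr_mult)
  finally have 1: "abs (G t (gshift d x c z)) <= abs K * (wgt d x * (1 + abs c)) powr s * (1 + enorm d z) powr s" .
  have 2: "abs (w z) <= abs K' * (1 + enorm d z) powr m"
   using w(2)[of z] by (meson abs_ge_self mult_right_mono order_trans powr_ge_zero)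
  have "abs (G t (gshift d x c z) * w z) \<le>
    (abs K * (wgt d x * (1 + abs c)) powr s * (1 + enorm d z) powr s) * (abs K' * (1 + enorm d z) powr m)"
   unfolding abs_mult by (rule mult_mono[OF 1 2]) auto
  also have "... = (abs K * (wgt d x * (1 + abs c)) powr s * abs K') * (1 + enorm d z) powr (s + m)"
   by (simp add: powr_add)
  finally show ?thesis .
 qed
 show "continuous_on S (%p. lint (gauss d) (%z. G (a p) (gshift d (y p) (c p) z) * w z))"
 proof (rule continuous_on_parametric_integral[OF _ _ _ _ W])
  show "continuous_on S (%p. abs K * (wgt d (y p) * (1 + abs (c p))) powr s * abs K')"
  proof (intro continuous_on_mult continuous_on_const continuous_on_powr' continuous_on_wgt y continuous_on_add continuous_on_rabs c)
   show "\<forall>x\<in>S. 0 <= wgt d (y x) * (1 + abs (c x)) \<and> (wgt d (y x) * (1 + abs (c x)) = 0 --> 0 < s)"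
   proof
    fix x
    have "0 < wgt d (y x) * (1 + abs (c x))"
     using wgt_ge_1[OF d, of "y x"] by (intro mult_pos_pos) auto
    then show "0 <= wgt d (y x) * (1 + abs (c x)) \<and> (wgt d (y x) * (1 + abs (c x)) = 0 --> 0 < s)" by linarith
   qed
  qed
  fix z
  have "continuous_on S (%p. (%(t, x). G t x) (a p, gshift d (y p) (c p) z))"
   by (rule continuous_on_compose2[OF G(1)]) (use a y c in \<open>auto intro!: continuous_intros\<close>)
  then show "continuous_on S (%p. G (a p) (gshift d (y p) (c p) z) * w z)"
   by (auto intro!: continuous_on_mult)
 qed (use meas bnd a in auto)
 show "integrable (gauss d) (%z. G t (gshift d x c z) * w z)" if "t \<in> C" for t x c
 proof (rule Bochner_Integration.integrable_bound)
  show "integrable (gauss d) (%z. (abs K * (wgt d x * (1 + abs c)) powr s * abs K') * (1 + enorm d z) powr (s + m))"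
   using W by simp
  show "AE z in gauss d. norm (G t (gshift d x c z) * w z) \<le>
    norm ((abs K * (wgt d x * (1 + abs c)) powr s * abs K') * (1 + enorm d z) powr (s + m))"
   using bnd[OF that] by (auto intro!: AE_I2 intro: order_trans[OF _ abs_ge_self])
 qed (rule meas[OF that])
qed

lemma integrable_gauss_time_fst:
 assumes "integrable (gauss d) (g :: _ => real)"
 shows "integrable (gauss_time d) (%th. g (fst th))"
proof -
 interpret B: prob_space unit_time by (rule prob_space_unit_time)
 have "distr (gauss d \<Otimes>\<^sub>M unit_time) (gauss d) fst = gauss d"
  by (rule B.distr_pair_fst)
 then have "integrable (distr (gauss d \<Otimes>\<^sub>M unit_time) (gauss d) fst) g" using assms by simp
 then show ?thesis unfolding gauss_time_def by (subst (asm) integrable_distr_eq) (use assms in auto)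
qed

definition heat :: "nat => real => ((nat => real) => real) => (nat => real) => real" where
 "heat d tau h x = (lint (gauss d) (%z. h (gshift d x (sqrt tau) z)))"

text \<open>\<open>source d T F t x\<close> is the Duhamel integral of \<open>heat d (s - t) (F s) x\<close> over \<open>s\<close> from \<open>t\<close> to \<open>T\<close>,
 written as an average over \<open>s = t + (T - t) r\<close> with \<open>r\<close> uniform in the unit interval.\<close>

definition source_arg :: "nat => real => (real => (nat => real) => real) => real => (nat => real) => (nat => real) \<times> real => real" where
 "source_arg d T F t x th = F (t + (T - t) * snd th) (gshift d x (sqrt ((T - t) * snd th)) (fst th))"

definition source :: "nat => real => (real => (nat => real) => real) => real => (nat => real) => real" where
 "source d T F t x = (T - t) * (lint (gauss_time d) (%th. source_arg d T F t x th))"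

lemma nn_integral_exp_unit_time:
 fixes b :: real
 assumes "b >= 0"
 shows "(nint unit_time (%r. ennreal (b * exp (b * (1 - r))))) = ennreal (exp b - 1)"
proof -
 have "(nint unit_time (%r. ennreal (b * exp (b * (1 - r))))) = (nint lborel (%r. ennreal (b * exp (b * (1 - r))) * indicator {0..1} r))"
  unfolding unit_time_def by (subst nn_integral_restrict_space) auto
 also have "... = ennreal (- exp (b * (1 - 1)) - (- exp (b * (1 - 0))))"
  by (rule nn_integral_FTC_Icc) (use assms in \<open>auto intro!: derivative_eq_intros\<close>)
 finally show ?thesis by simp
qed

locale heat_setting =
 fixes d :: nat and T s :: real
 assumes d: "d >= 1" and T: "T > 0" and s: "s >= 0"
begin

text \<open>The functions are defined on all of \<open>nat => real\<close>, where shifts are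
  continuous; functions given only on \<open>Rd d\<close> enter through
  \<open>restrict\<close>.\<close>

definition adm :: "(real => (nat => real) => real) => bool" where
 "adm F \<longleftrightarrow> continuous_on ({0..T} \<times> UNIV) (%(t, x). F t x) \<and>
   (\<exists>K. \<forall>t\<in>{0..T}. \<forall>x. abs (F t x) <= K * wgt d x powr s)"

definition adm0 :: "((nat => real) => real) => bool" where
 "adm0 h \<longleftrightarrow> continuous_on UNIV h \<and> (\<exists>K. \<forall>x. abs (h x) <= K * wgt d x powr s)"

definition Cw :: real where "Cw = wgt_const s (sqrt T)"

lemma Cw: "Cw >= 1" by (simp add: Cw_def wgt_const_ge_1)

lemma wgt_pos[simp]: "0 < wgt d x" using wgt_ge_1[OF d, of x] by linarith

lemma wgt_nz[simp]: "wgt d x ~= 0" using wgt_pos[of x] by linarith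

lemma one_plus_enorm_nz[simp]: "1 + enorm d x ~= 0"
 using enorm_nonneg[of d x] by linarith

lemma wgt_powr_ge_1: "1 <= wgt d x powr s"
 using wgt_ge_1[OF d, of x] s by (simp add: ge_one_powr_ge_zero)

lemma admD:
 assumes "adm F"
 obtains K where "K >= 0" "!!t x. t \<in> {0..T} ==> abs (F t x) <= K * wgt d x powr s"
proof -
 obtain K where K: "!!t x. t \<in> {0..T} ==> abs (F t x) <= K * wgt d x powr s"
  using assms unfolding adm_def by blast
 have "0 <= K * wgt d undefined powr s" using K[of 0 undefined] T by (auto intro: order_trans[OF abs_ge_zero])
 then have "K >= 0" using wgt_powr_ge_1[of undefined] by (meson less_le_trans not_less zero_less_one mult_neg_pos)
 with K that show thesis by blast
qed

lemma adm_cont: "adm F ==> continuous_on ({0..T} \<times> UNIV) (%(t, x). F t x)"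
 by (simp add: adm_def)

lemma adm_cont_split: "adm F ==> continuous_on ({0..T} \<times> UNIV) (%p. F (fst p) (snd p))"
 by (simp add: adm_def case_prod_beta')

lemma admI:
 assumes "continuous_on ({0..T} \<times> UNIV) (%p. F (fst p) (snd p))"
  "!!t x. t \<in> {0..T} ==> abs (F t x) <= K * wgt d x powr s"
 shows "adm F"
 using assms unfolding adm_def case_prod_beta' by blast

lemma adm_add: assumes "adm F" "adm G" shows "adm (%t x. F t x + G t x)"
proof -
 obtain K where K: "!!t x. t \<in> {0..T} ==> abs (F t x) <= K * wgt d x powr s" by (rule admD[OF assms(1)]) blast
 obtain K' where K': "!!t x. t \<in> {0..T} ==> abs (G t x) <= K' * wgt d x powr s" by (rule admD[OF assms(2)]) blast
 show ?thesis
 proof (rule admI[where K = "K + K'"])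
  show "abs (F t x + G t x) <= (K + K') * wgt d x powr s" if "t \<in> {0..T}" for t x
   using K[OF that, of x] K'[OF that, of x] by (simp add: distrib_right)
 qed (intro continuous_on_add adm_cont_split assms)
qed

lemma adm_cmult: assumes "adm F" shows "adm (%t x. c * F t x)"
proof -
 obtain K where K: "!!t x. t \<in> {0..T} ==> abs (F t x) <= K * wgt d x powr s" by (rule admD[OF assms(1)]) blast
 show ?thesis
 proof (rule admI[where K = "abs c * K"])
  show "abs (c * F t x) <= (abs c * K) * wgt d x powr s" if "t \<in> {0..T}" for t x
   using mult_left_mono[OF K[OF that, of x], of "abs c"] by (simp add: abs_mult mult.assoc)
 qed (intro continuous_on_mult continuous_on_const adm_cont_split assms)
qed

lemma adm_diff: "adm F ==> adm G ==> adm (%t x. F t x - G t x)"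
 using adm_add[of F "%t x. (-1) * G t x"] adm_cmult[of G "-1"] by simp

lemma adm_abs: assumes "adm F" shows "adm (%t x. abs (F t x))"
proof -
 obtain K where K: "!!t x. t \<in> {0..T} ==> abs (F t x) <= K * wgt d x powr s" by (rule admD[OF assms(1)]) blast
 show ?thesis
 proof (rule admI[where K = K])
  show "continuous_on ({0..T} \<times> UNIV) (%p. abs (F (fst p) (snd p)))"
   by (intro continuous_on_rabs adm_cont_split assms)
 qed (use K in auto)
qed

lemma adm_const: "adm (%t x. c)"
proof (rule admI[where K = "abs c"])
 show "abs c <= abs c * wgt d x powr s" for x
  using mult_left_mono[OF wgt_powr_ge_1[of x], of "abs c"] by simp
qed (intro continuous_intros)

lemma continuous_on_wgt_powr: "continuous_on S f ==> continuous_on S (%p. wgt d (f p) powr s)"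
 by (intro continuous_on_powr continuous_on_wgt continuous_on_const) auto

lemma adm_Lipschitz:
 fixes f :: "real => real"
 assumes F: "adm F" and L: "!!v w. abs (f v - f w) <= L * abs (v - w)"
 shows "adm (%t x. f (F t x))"
proof -
 obtain K where K: "K >= 0" "!!t x. t \<in> {0..T} ==> abs (F t x) <= K * wgt d x powr s" by (rule admD[OF F]) blast
 have L0: "L >= 0" using L[of 1 0] by (auto intro: order_trans[OF abs_ge_zero])
 have cf: "continuous_on UNIV f"
  using L L0 by (intro lipschitz_on_continuous_on[of L] lipschitz_onI) (auto simp: dist_real_def)
 show ?thesis
 proof (rule admI[where K = "abs (f 0) + L * K"])
  show "continuous_on ({0..T} \<times> UNIV) (%p. f (F (fst p) (snd p)))"
   by (rule continuous_on_compose2[OF cf adm_cont_split[OF F]]) simp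
  fix t x assume t: "t \<in> {0..T}"
  have "abs (f (F t x)) <= abs (f 0) + L * abs (F t x)" using L[of "F t x" 0] by simp
  also have "... <= abs (f 0) * wgt d x powr s + L * (K * wgt d x powr s)"
   using mult_left_mono[OF wgt_powr_ge_1[of x], of "abs (f 0)"] mult_left_mono[OF K(2)[OF t, of x] L0] by simp
  finally show "abs (f (F t x)) <= (abs (f 0) + L * K) * wgt d x powr s" by (simp add: algebra_simps)
 qed
qed

section \<open>The Duhamel operator on functions of controlled growth\<close>

lemma source_time_in:
 assumes "t \<in> {0..T}" "r \<in> {0..1}"
 shows "t + (T - t) * r \<in> {0..T}"
proof -
 have "0 <= (T - t) * r" "(T - t) * r <= (T - t) * 1"
  using assms by (auto simp del: mult_1_right intro!: mult_left_mono mult_nonneg_nonneg)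
 then show ?thesis using assms by auto
qed

lemma sqrt_source_le:
 assumes "t \<in> {0..T}" "r \<in> {0..1}"
 shows "abs (sqrt ((T - t) * r)) <= sqrt T"
proof -
 have "0 <= (T - t) * r" using assms by auto
 moreover have "(T - t) * r <= T" using source_time_in[OF assms] assms by auto
 ultimately show ?thesis by simp
qed

lemma source_arg_measurable:
 assumes F: "adm F" and t: "t \<in> {0..T}"
 shows "source_arg d T F t x \<in> borel_measurable (gauss_time d)"
proof -
 have "(%th. (%(t, x). F t x) (t + (T - t) * snd th, gshift d x (sqrt ((T - t) * snd th)) (fst th))) \<in> borel_measurable (gauss_time d)"
 proof (rule borel_measurable_continuous_on_closed[OF adm_cont[OF F]])
  show "(%th. (t + (T - t) * snd th, gshift d x (sqrt ((T - t) * snd th)) (fst th))) \<in> borel_measurable (gauss_time d)"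
   by (intro borel_measurable_Pair measurable_shift) measurable
 qed (use source_time_in[OF t] in \<open>auto simp: space_gauss_time intro!: borel_closed closed_Times\<close>)
 then show ?thesis by (simp add: source_arg_def[abs_def])
qed

lemma source_arg_bound:
 assumes F: "!!t x. t \<in> {0..T} ==> abs (F t x) <= K * wgt d x powr s" "K >= 0"
  and t: "t \<in> {0..T}" and th: "th \<in> space (gauss_time d)"
 shows "abs (source_arg d T F t x th) <= (K * (wgt d x * (1 + sqrt T)) powr s) * (1 + enorm d (fst th)) powr s"
proof -
 have r: "snd th \<in> {0..1}" using th by (auto simp: space_gauss_time)
 let ?c = "sqrt ((T - t) * snd th)"
 have "abs (source_arg d T F t x th) <= K * wgt d (gshift d x ?c (fst th)) powr s"
  unfolding source_arg_def by (rule F(1)[OF source_time_in[OF t r]])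
 also have "... <= K * (wgt d x * ((1 + sqrt T) * (1 + enorm d (fst th)))) powr s"
 proof (intro mult_left_mono powr_mono2 F s)
  have "wgt d (gshift d x ?c (fst th)) <= wgt d x * ((1 + abs ?c) * (1 + enorm d (fst th)))"
   by (rule wgt_shift_le'[OF d])
  also have "... <= wgt d x * ((1 + sqrt T) * (1 + enorm d (fst th)))"
   using sqrt_source_le[OF t r] by (intro mult_left_mono mult_right_mono add_left_mono) (auto simp: less_imp_le)
  finally show "wgt d (gshift d x ?c (fst th)) <= wgt d x * ((1 + sqrt T) * (1 + enorm d (fst th)))" .
 qed (simp add: less_imp_le)
 also have "... = (K * (wgt d x * (1 + sqrt T)) powr s) * (1 + enorm d (fst th)) powr s"
  by (simp add: powr_mult)
 finally show ?thesis .
qed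

lemma source_arg_integrable:
 assumes F: "adm F" and t: "t \<in> {0..T}"
 shows "integrable (gauss_time d) (source_arg d T F t x)"
proof -
 obtain K where K: "K >= 0" "!!t x. t \<in> {0..T} ==> abs (F t x) <= K * wgt d x powr s" by (rule admD[OF F]) blast
 show ?thesis
 proof (rule Bochner_Integration.integrable_bound)
  show "integrable (gauss_time d) (%th. (K * (wgt d x * (1 + sqrt T)) powr s) * (1 + enorm d (fst th)) powr s)"
   by (intro Bochner_Integration.integrable_mult_right integrable_gauss_time_fst integrable_gauss_enorm d s)
  show "AE th in gauss_time d. norm (source_arg d T F t x th) <= norm ((K * (wgt d x * (1 + sqrt T)) powr s) * (1 + enorm d (fst th)) powr s)"
   using source_arg_bound[OF K(2,1) t] by (auto intro!: AE_I2 intro: order_trans[OF _ abs_ge_self])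
 qed (rule source_arg_measurable[OF F t])
qed

lemma source_cont:
 assumes F: "adm F"
 shows "continuous_on ({0..T} \<times> UNIV) (%p. source d T F (fst p) (snd p))"
proof -
 obtain K where K: "K >= 0" "!!t x. t \<in> {0..T} ==> abs (F t x) <= K * wgt d x powr s" by (rule admD[OF F]) blast
 show ?thesis
  unfolding source_def
 proof (intro continuous_on_mult continuous_on_diff continuous_on_const continuous_on_fst continuous_on_id)
  show "continuous_on ({0..T} \<times> UNIV) (%p. lint (gauss_time d) (%th. source_arg d T F (fst p) (snd p) th))"
  proof (rule continuous_on_parametric_integral)
   show "integrable (gauss_time d) (%th. (1 + enorm d (fst th)) powr s)"
    by (intro integrable_gauss_time_fst integrable_gauss_enorm d s)
   show "continuous_on ({0..T} \<times> UNIV) (%p::real \<times> (nat => real). K * (wgt d (snd p) * (1 + sqrt T)) powr s)"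
    unfolding powr_mult by (intro continuous_on_mult continuous_on_const continuous_on_wgt_powr continuous_on_snd continuous_on_id)
   fix th assume th: "th \<in> space (gauss_time d)"
   then have r: "snd th \<in> {0..1}" by (auto simp: space_gauss_time)
   have "continuous_on ({0..T} \<times> UNIV) (%p. (%(t, x). F t x) (fst p + (T - fst p) * snd th, gshift d (snd p) (sqrt ((T - fst p) * snd th)) (fst th)))"
    by (rule continuous_on_compose2[OF adm_cont[OF F]]) (use source_time_in[OF _ r] in \<open>auto intro!: continuous_intros\<close>)
   then show "continuous_on ({0..T} \<times> UNIV) (%p. source_arg d T F (fst p) (snd p) th)"
    by (simp add: source_arg_def)
  qed (use source_arg_measurable[OF F] source_arg_bound[OF K(2,1)] in auto)
 qed
qed

text \<open>Bielecki's device. Under the weight \<open>exp (lam * (T - t))\<close> the integral over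
  the remaining time is explicit and gains \<open>1 / lam\<close>, while the Gaussian average costs
  only \<open>Cw\<close>. For large \<open>lam\<close> the Duhamel map with a Lipschitz nonlinearity
  is therefore a contraction.\<close>

lemma nn_source_arg_le:
 assumes F: "adm F" "!!t x. t \<in> {0..T} ==> abs (F t x) <= A * exp (lam * (T - t)) * wgt d x powr s"
  and A: "A >= 0" and t: "t \<in> {0..T}" and lam: "lam > 0"
 shows "abs (source d T F t x) <= A * Cw / lam * exp (lam * (T - t)) * wgt d x powr s"
proof -
 interpret A: prob_space "gauss d" by (rule prob_space_gauss)
 interpret B: prob_space unit_time by (rule prob_space_unit_time)
 interpret P: pair_sigma_finite "gauss d" unit_time ..
 let ?b = "lam * (T - t)"
 let ?A = "A * Cw * wgt d x powr s"
 have b: "?b >= 0" using t lam by auto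
 have A0: "?A >= 0" using A Cw by auto
 have "ennreal (abs (lint (gauss_time d) (%th. source_arg d T F t x th))) <= ennreal (lint (gauss_time d) (%th. abs (source_arg d T F t x th)))"
  by (intro ennreal_leI integral_abs_bound)
 also have "... = (nint (gauss_time d) (%th. ennreal (abs (source_arg d T F t x th))))"
  by (rule nn_integral_eq_integral[symmetric]) (use source_arg_integrable[OF F(1) t] in auto)
 also have "... <= (nint (gauss_time d) (%th. ennreal (A * exp (?b * (1 - snd th)) * wgt d (gshift d x (sqrt ((T - t) * snd th)) (fst th)) powr s)))"
 proof (intro nn_integral_mono ennreal_leI)
  fix th assume "th \<in> space (gauss_time d)"
  then have r: "snd th \<in> {0..1}" by (auto simp: space_gauss_time)
  have e: "lam * (T - (t + (T - t) * snd th)) = ?b * (1 - snd th)" by (simp add: algebra_simps)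
  show "abs (source_arg d T F t x th) <= A * exp (?b * (1 - snd th)) * wgt d (gshift d x (sqrt ((T - t) * snd th)) (fst th)) powr s"
   unfolding source_arg_def by (rule F(2)[OF source_time_in[OF t r], unfolded e])
 qed
 also have "... = (nint unit_time (%r. nint (gauss d) (%z. ennreal (A * exp (?b * (1 - r)) * wgt d (gshift d x (sqrt ((T - t) * r)) z) powr s))))"
 proof -
  have "(%th. ennreal (A * exp (?b * (1 - snd th)) * wgt d (gshift d x (sqrt ((T - t) * snd th)) (fst th)) powr s)) \<in> borel_measurable (gauss_time d)"
   by measurable
  from P.nn_integral_snd[OF this[unfolded gauss_time_def]] show ?thesis unfolding gauss_time_def by simp
 qed
 also have "... <= (nint unit_time (%r. ennreal (?A * exp (?b * (1 - r)))))"
 proof (rule nn_integral_mono)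
  fix r assume "r \<in> space unit_time"
  then have r: "r \<in> {0..1}" by (simp add: space_unit_time)
  have m: "(%z. wgt d (gshift d x (sqrt ((T - t) * r)) z) powr s) \<in> borel_measurable (gauss d)"
   by (intro powr_real_measurable borel_measurable_wgt measurable_shift measurable_gauss_id borel_measurable_const)
  have "(nint (gauss d) (%z. ennreal (A * exp (?b * (1 - r)) * wgt d (gshift d x (sqrt ((T - t) * r)) z) powr s)))
   = ennreal (A * exp (?b * (1 - r))) * (nint (gauss d) (%z. ennreal (wgt d (gshift d x (sqrt ((T - t) * r)) z) powr s)))"
   using A m by (subst nn_integral_cmult[symmetric]) (auto simp: ennreal_mult)
  also have "... <= ennreal (A * exp (?b * (1 - r))) * ennreal (Cw * wgt d x powr s)"
   unfolding Cw_def by (intro mult_left_mono nn_wgt_gauss d s sqrt_source_le t r) auto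
  also have "... = ennreal (?A * exp (?b * (1 - r)))"
   using A Cw by (subst ennreal_mult[symmetric]) (auto simp: mult_ac)
  finally show "(nint (gauss d) (%z. ennreal (A * exp (?b * (1 - r)) * wgt d (gshift d x (sqrt ((T - t) * r)) z) powr s))) <= ennreal (?A * exp (?b * (1 - r)))" .
 qed
 finally have *: "ennreal (abs (lint (gauss_time d) (%th. source_arg d T F t x th))) <= (nint unit_time (%r. ennreal (?A * exp (?b * (1 - r)))))" .
 have mr: "(%r. ennreal (c * exp (?b * (1 - r)))) \<in> borel_measurable unit_time" for c
  using measurable_unit_time_id by measurable
 \<comment> \<open>Multiplying by \<open>lam\<close> instead of dividing by \<open>?b\<close>
   includes \<open>t = T\<close>, where \<open>?b\<close> is zero.\<close>
 have "ennreal (lam * abs (source d T F t x)) = ennreal ?b * ennreal (abs (lint (gauss_time d) (%th. source_arg d T F t x th)))"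
  using t lam b by (simp add: source_def abs_mult ennreal_mult[symmetric] mult.assoc)
 also have "... <= ennreal ?b * (nint unit_time (%r. ennreal (?A * exp (?b * (1 - r)))))"
  by (rule mult_left_mono[OF *]) simp
 also have "... = ennreal ?A * (nint unit_time (%r. ennreal (?b * exp (?b * (1 - r)))))"
 proof -
  have "ennreal ?b * (nint unit_time (%r. ennreal (?A * exp (?b * (1 - r))))) = (nint unit_time (%r. ennreal ?b * ennreal (?A * exp (?b * (1 - r)))))"
   by (rule nn_integral_cmult[symmetric, OF mr])
  also have "... = (nint unit_time (%r. ennreal ?A * ennreal (?b * exp (?b * (1 - r)))))"
  proof (rule nn_integral_cong)
   fix r
   have "?b * (?A * exp (?b * (1 - r))) = ?A * (?b * exp (?b * (1 - r)))" by (simp only: mult_ac)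
   then show "ennreal ?b * ennreal (?A * exp (?b * (1 - r))) = ennreal ?A * ennreal (?b * exp (?b * (1 - r)))"
    by (metis A0 b ennreal_mult')
  qed
  also have "... = ennreal ?A * (nint unit_time (%r. ennreal (?b * exp (?b * (1 - r)))))"
   by (rule nn_integral_cmult[OF mr])
  finally show ?thesis .
 qed
 also have "... <= ennreal (?A * exp ?b)"
  unfolding nn_integral_exp_unit_time[OF b] using A0 b by (subst ennreal_mult[symmetric]) (auto intro!: ennreal_leI mult_left_mono)
 finally have "lam * abs (source d T F t x) <= ?A * exp ?b"
  using A0 by (subst (asm) ennreal_le_iff) auto
 then show ?thesis using lam by (simp add: field_simps)
qed

lemma source_le:
 assumes F: "adm F" "!!t x. t \<in> {0..T} ==> abs (F t x) <= A * wgt d x powr s"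
  and A: "A >= 0" and t: "t \<in> {0..T}"
 shows "abs (source d T F t x) <= A * Cw * exp T * wgt d x powr s"
proof -
 have "abs (source d T F t x) <= A * Cw / 1 * exp (1 * (T - t)) * wgt d x powr s"
 proof (rule nn_source_arg_le[OF F(1) _ A t])
  fix t x assume t: "t \<in> {0..T}"
  have "1 * (A * wgt d x powr s) <= exp (1 * (T - t)) * (A * wgt d x powr s)"
   using t A by (intro mult_right_mono) auto
  with F(2)[OF t, of x] show "abs (F t x) <= A * exp (1 * (T - t)) * wgt d x powr s" by (simp add: mult_ac)
 qed simp
 also have "... <= A * Cw * exp T * wgt d x powr s"
  using t A Cw by (auto intro!: mult_right_mono mult_left_mono)
 finally show ?thesis .
qed

lemma adm_source: assumes "adm F" shows "adm (source d T F)"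
proof -
 obtain K where K: "K >= 0" "!!t x. t \<in> {0..T} ==> abs (F t x) <= K * wgt d x powr s" by (rule admD[OF assms]) blast
 show ?thesis
  by (rule admI[OF source_cont[OF assms] source_le[OF assms K(2,1)]])
qed

lemma source_add:
 assumes "adm F" "adm G" "t \<in> {0..T}"
 shows "source d T (%t x. F t x + G t x) t x = source d T F t x + source d T G t x"
proof -
 have "source_arg d T (%t x. F t x + G t x) t x = (%th. source_arg d T F t x th + source_arg d T G t x th)"
  by (simp add: source_arg_def fun_eq_iff)
 then show ?thesis
  using Bochner_Integration.integral_add[OF source_arg_integrable[OF assms(1,3)] source_arg_integrable[OF assms(2,3)], of x x]
  by (simp add: source_def distrib_left)
qed

lemma source_cmult: "source d T (%t x. c * F t x) t x = c * source d T F t x"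
 by (simp add: source_def source_arg_def)

lemma source_diff:
 assumes "adm F" "adm G" "t \<in> {0..T}"
 shows "source d T (%t x. F t x - G t x) t x = source d T F t x - source d T G t x"
 using source_add[OF assms(1) adm_cmult[OF assms(2), of "-1"] assms(3)] source_cmult[of "-1" G] by simp

lemma source_mono_abs:
 assumes "adm F" "adm G" "t \<in> {0..T}" "!!t x. t \<in> {0..T} ==> abs (F t x) <= G t x"
 shows "abs (source d T F t x) <= source d T G t x"
proof -
 have "abs (source d T F t x) <= (T - t) * (lint (gauss_time d) (%th. abs (source_arg d T F t x th)))"
  using assms(3) by (auto simp: source_def abs_mult intro!: mult_left_mono integral_abs_bound)
 also have "... <= source d T G t x"
  unfolding source_def
 proof (intro mult_left_mono integral_mono integrable_abs source_arg_integrable assms)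
  show "abs (source_arg d T F t x th) <= source_arg d T G t x th" if "th \<in> space (gauss_time d)" for th
   unfolding source_arg_def
   by (rule assms(4)[OF source_time_in]) (use that assms(3) in \<open>auto simp: space_gauss_time\<close>)
 qed (use assms(3) in auto)
 finally show ?thesis .
qed

section \<open>The heat semigroup on terminal data\<close>

lemma heat_integrable:
 assumes h: "adm0 h"
 shows "integrable (gauss d) (%z. h (gshift d x c z))"
proof -
 obtain K where K: "!!x. abs (h x) <= K * wgt d x powr s" using h unfolding adm0_def by blast
 have "integrable (gauss d) (%z. h (gshift d x c z) * 1)"
 proof (rule continuous_on_gauss_expectation(2)[where C = UNIV and G = "%_. h" and K' = 1 and m = 0, OF d s])
  show "continuous_on (UNIV \<times> UNIV) (%(t::real, x). h x)"
   using h unfolding adm0_def case_prod_beta' by (auto intro!: continuous_on_compose2[of UNIV h] continuous_intros)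
  show "continuous_on {} (%_. 0)" "continuous_on {} (%_. x)" "continuous_on {} (%_::real. 0)" by auto
 qed (use K in auto)
 then show ?thesis by simp
qed

lemma heat_cont:
 assumes h: "adm0 h" and "continuous_on S tau" "continuous_on S y"
 shows "continuous_on (S :: 'p::metric_space set) (%p. heat d (tau p) h (y p))"
proof -
 obtain K where K: "!!x. abs (h x) <= K * wgt d x powr s" using h unfolding adm0_def by blast
 have "continuous_on S (%p. lint (gauss d) (%z. h (gshift d (y p) (sqrt (tau p)) z) * 1))"
 proof (rule continuous_on_gauss_expectation(1)[where C = UNIV and G = "%_. h" and K' = 1 and m = 0 and a = "%_. 0", OF d s])
  show "continuous_on (UNIV \<times> UNIV) (%(t::real, x). h x)"
   using h unfolding adm0_def case_prod_beta' by (auto intro!: continuous_on_compose2[of UNIV h] continuous_intros)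
 qed (use K assms in \<open>auto intro!: continuous_intros\<close>)
 then show ?thesis by (simp add: heat_def)
qed

lemma heat_le:
 assumes h: "adm0 h" "!!x. abs (h x) <= A * wgt d x powr s" and A: "A >= 0" and tau: "tau \<in> {0..T}"
 shows "abs (heat d tau h x) <= A * Cw * wgt d x powr s"
proof -
 have c: "abs (sqrt tau) <= sqrt T" using tau by auto
 have "abs (heat d tau h x) <= (lint (gauss d) (%z. abs (h (gshift d x (sqrt tau) z))))"
  unfolding heat_def by (rule integral_abs_bound)
 also have "... <= (lint (gauss d) (%z. A * wgt d (gshift d x (sqrt tau) z) powr s))"
  using heat_integrable[OF h(1), of x "sqrt tau"] wgt_gauss(1)[OF d s c] h(2) by (intro integral_mono) auto
 also have "... <= A * (Cw * wgt d x powr s)"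
  unfolding Cw_def using wgt_gauss(2)[OF d s c] A by (auto intro!: mult_left_mono)
 finally show ?thesis by (simp add: mult.assoc)
qed

lemma heat_diff:
 assumes "adm0 h" "adm0 h'"
 shows "heat d tau (%x. h x - h' x) x = heat d tau h x - heat d tau h' x"
 unfolding heat_def by (rule Bochner_Integration.integral_diff) (intro heat_integrable assms)+

lemma adm0_diff: assumes "adm0 h" "adm0 h'" shows "adm0 (%x. h x - h' x)"
proof -
 obtain K where K: "!!x. abs (h x) <= K * wgt d x powr s" using assms(1) unfolding adm0_def by blast
 obtain K' where K': "!!x. abs (h' x) <= K' * wgt d x powr s" using assms(2) unfolding adm0_def by blast
 have "abs (h x - h' x) <= (K + K') * wgt d x powr s" for x
  using K[of x] K'[of x] by (simp add: distrib_right)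
 then show ?thesis using assms unfolding adm0_def by (auto intro!: continuous_on_diff)
qed

lemma adm_heat: assumes "adm0 h" shows "adm (%t x. heat d (T - t) h x)"
proof -
 obtain K where K: "!!x. abs (h x) <= K * wgt d x powr s" using assms unfolding adm0_def by blast
 then have K1: "abs (h x) <= abs K * wgt d x powr s" for x
  by (meson abs_ge_self mult_right_mono order_trans powr_ge_zero)
 show ?thesis
  by (rule admI[where K = "abs K * Cw"]) (auto intro!: heat_cont heat_le assms K1 continuous_intros)
qed

section \<open>Stability, uniqueness and existence of mild solutions\<close>

definition mild :: "(real => real) => ((nat => real) => real) => (real => (nat => real) => real) => bool" where
 "mild f h u \<longleftrightarrow> (\<forall>t\<in>{0..T}. \<forall>x. u t x = heat d (T - t) h x + source d T (%t x. f (u t x)) t x)"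

text \<open>The hypothesis is inserted into itself. With \<open>lam = 2 * L * Cw + 1\<close> each
  insertion halves the part of the bound that stems from the a priori constant \<open>K\<close>,
  which disappears in the limit.\<close>

lemma gronwall:
 assumes D: "adm D" "!!t x. t \<in> {0..T} ==> 0 <= D t x"
  and le: "!!t x. t \<in> {0..T} ==> D t x <= A * wgt d x powr s + L * source d T D t x"
  and A: "A >= 0" and L: "L >= 0" and t: "t \<in> {0..T}"
 shows "D t x <= 2 * A * exp ((2 * L * Cw + 1) * (T - t)) * wgt d x powr s"
proof -
 define lam where "lam = 2 * L * Cw + 1"
 have LC: "L * Cw >= 0" using L Cw by auto
 then have lam1: "lam > 0" by (simp add: lam_def add_nonneg_pos mult.assoc)
 have "L * Cw <= 1 / 2 * lam" by (simp add: lam_def)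
 then have lam: "lam > 0" "L * Cw / lam <= 1 / 2" using lam1 by (simp_all add: pos_divide_le_eq)
 obtain K where K: "K >= 0" "!!t x. t \<in> {0..T} ==> abs (D t x) <= K * wgt d x powr s" by (rule admD[OF D(1)]) blast
 have step: "D t x <= (2 * A + K / 2 ^ n) * exp (lam * (T - t)) * wgt d x powr s" if "t \<in> {0..T}" for t x n
  using that
 proof (induction n arbitrary: t x)
  case 0
  have "D t x <= 1 * (K * wgt d x powr s)" using K(2)[OF 0, of x] by simp
  also have "... <= exp (lam * (T - t)) * ((2 * A + K) * wgt d x powr s)"
   using 0 lam K A by (intro mult_mono mult_right_mono) auto
  finally show ?case by (simp add: mult_ac)
 next
  case (Suc n)
  let ?k = "2 * A + K / 2 ^ n" and ?e = "exp (lam * (T - t))"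
  have k: "?k >= 0" using A K by auto
  have "abs (source d T D t x) <= ?k * Cw / lam * ?e * wgt d x powr s"
   by (rule nn_source_arg_le[OF D(1) _ k Suc.prems lam(1)]) (use Suc.IH D(2) in auto)
  then have "L * source d T D t x <= L * (?k * Cw / lam * ?e * wgt d x powr s)"
   using L by (intro mult_left_mono) auto
  also have "... = (L * Cw / lam) * (?k * ?e * wgt d x powr s)" by simp
  also have "... <= (1 / 2) * (?k * ?e * wgt d x powr s)"
   using lam k by (intro mult_right_mono) auto
  finally have 1: "L * source d T D t x <= ?k / 2 * ?e * wgt d x powr s" by simp
  have "1 * (A * wgt d x powr s) <= ?e * (A * wgt d x powr s)"
   using A Suc.prems lam by (intro mult_right_mono) auto
  then have 2: "A * wgt d x powr s <= A * ?e * wgt d x powr s" by (simp add: mult_ac)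
  have "D t x <= A * ?e * wgt d x powr s + ?k / 2 * ?e * wgt d x powr s"
   using le[OF Suc.prems, of x] 1 2 by linarith
  also have "... = (2 * A + K / 2 ^ Suc n) * ?e * wgt d x powr s" by (simp add: field_simps)
  finally show ?case .
 qed
 have lim: "(%n. (2 * A + K * (1/2) ^ n) * exp (lam * (T - t)) * wgt d x powr s) \<longlonglongrightarrow> (2 * A + K * 0) * exp (lam * (T - t)) * wgt d x powr s"
  by (intro tendsto_intros LIMSEQ_realpow_zero) auto
 have "D t x <= (2 * A + K * 0) * exp (lam * (T - t)) * wgt d x powr s"
  by (rule LIMSEQ_le_const[OF lim]) (use step[OF t] in \<open>simp add: power_one_over\<close>)
 then show ?thesis by (simp add: lam_def)
qed

definition stab_const :: "real => real" where
 "stab_const L = 2 * Cw * exp T * exp ((2 * L * Cw + 1) * T)"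

lemma stab_const_pos: "stab_const L > 0" using Cw by (simp add: stab_const_def)

text \<open>The difference of the two equations has three parts: the terminal data, the change of
  nonlinearity evaluated along \<open>u\<close>, and the Lipschitz increment of \<open>f'\<close>
  from \<open>u\<close> to \<open>v\<close>. The last one is left to
  \<open>gronwall\<close>.\<close>

lemma mild_stability:
 assumes u: "adm u" "mild f h u" and v: "adm v" "mild f' h' v" and h: "adm0 h" "adm0 h'"
  and fu: "adm (%t x. f (u t x))"
  and L: "!!v w. abs (f' v - f' w) <= L * abs (v - w)"
  and dl: "!!x. abs (h x - h' x) <= dl1 * wgt d x powr s"
   "!!t x. t \<in> {0..T} ==> abs (f (u t x) - f' (u t x)) <= dl2 * wgt d x powr s"
   "dl1 >= 0" "dl2 >= 0"
  and t: "t \<in> {0..T}"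
 shows "abs (u t x - v t x) <= stab_const L * (dl1 + dl2) * wgt d x powr s"
proof -
 have L0: "L >= 0" using L[of 1 0] by (auto intro: order_trans[OF abs_ge_zero])
 define D where "D = (%t x. abs (u t x - v t x))"
 have aD: "adm D" unfolding D_def by (intro adm_abs adm_diff u v)
 have f'u: "adm (%t x. f' (u t x))" and f'v: "adm (%t x. f' (v t x))" by (rule adm_Lipschitz[OF _ L] u v)+
 let ?A = "(dl1 + dl2 * exp T) * Cw"
 have A: "?A >= 0" using dl Cw by auto
 have le: "D t x <= ?A * wgt d x powr s + L * source d T D t x" if t: "t \<in> {0..T}" for t x
 proof -
  have "u t x - v t x = heat d (T - t) (%x. h x - h' x) x + (source d T (%t x. f (u t x) - f' (u t x)) t x + source d T (%t x. f' (u t x) - f' (v t x)) t x)"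
   using u v t by (simp add: mild_def heat_diff[OF h] source_diff[OF fu f'u t] source_diff[OF f'u f'v t])
  then have "D t x <= abs (heat d (T - t) (%x. h x - h' x) x) + abs (source d T (%t x. f (u t x) - f' (u t x)) t x) + abs (source d T (%t x. f' (u t x) - f' (v t x)) t x)"
   unfolding D_def by linarith
  also have "abs (heat d (T - t) (%x. h x - h' x) x) <= dl1 * Cw * wgt d x powr s"
   by (rule heat_le[OF adm0_diff[OF h] dl(1,3)]) (use t in auto)
  also have "abs (source d T (%t x. f (u t x) - f' (u t x)) t x) <= dl2 * Cw * exp T * wgt d x powr s"
   by (rule source_le[OF adm_diff[OF fu f'u] dl(2,4) t])
  also have "abs (source d T (%t x. f' (u t x) - f' (v t x)) t x) <= source d T (%t x. L * D t x) t x"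
   by (rule source_mono_abs[OF adm_diff[OF f'u f'v] adm_cmult[OF aD] t]) (simp add: D_def L)
  finally show ?thesis by (simp add: source_cmult algebra_simps)
 qed
 have "D t x <= 2 * ?A * exp ((2 * L * Cw + 1) * (T - t)) * wgt d x powr s"
  by (rule gronwall[OF aD _ le A L0 t]) (simp_all add: D_def)
 also have "... <= stab_const L * (dl1 + dl2) * wgt d x powr s"
 proof (rule mult_right_mono)
  have "?A <= ((dl1 + dl2) * exp T) * Cw"
  proof (rule mult_right_mono)
   have "dl1 * 1 <= dl1 * exp T" using dl T by (intro mult_left_mono) auto
   then show "dl1 + dl2 * exp T <= (dl1 + dl2) * exp T" by (simp add: distrib_right)
  qed (use Cw in auto)
  then have "2 * ?A * exp ((2 * L * Cw + 1) * (T - t)) <= 2 * (((dl1 + dl2) * exp T) * Cw) * exp ((2 * L * Cw + 1) * T)"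
  proof (intro mult_mono)
   have "(2 * L * Cw + 1) * (T - t) <= (2 * L * Cw + 1) * T"
    using t L0 Cw by (intro mult_left_mono) auto
   then show "exp ((2 * L * Cw + 1) * (T - t)) <= exp ((2 * L * Cw + 1) * T)" by simp
  qed (use A Cw dl in auto)
  then show "2 * ?A * exp ((2 * L * Cw + 1) * (T - t)) <= stab_const L * (dl1 + dl2)"
   unfolding stab_const_def by (simp add: mult_ac distrib_left distrib_right)
 qed simp
 finally show ?thesis by (simp add: D_def)
qed

lemma mild_unique:
 assumes "adm u" "mild f h u" "adm v" "mild f h v" "adm0 h"
  and L: "!!v w. abs (f v - f w) <= L * abs (v - w)" and t: "t \<in> {0..T}"
 shows "u t x = v t x"
proof -
 have "abs (u t x - v t x) <= stab_const L * (0 + 0) * wgt d x powr s"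
  by (rule mild_stability[OF assms(1-5,5) adm_Lipschitz[OF assms(1) L] L _ _ _ _ t]) auto
 then show ?thesis by simp
qed

text \<open>Stability against the zero function, the mild solution for zero data; \<open>f 0\<close>
  then appears as the change of nonlinearity.\<close>

lemma mild_bound:
 assumes u: "adm u" "mild f h u" and h: "adm0 h" "!!x. abs (h x) <= dl1 * wgt d x powr s" "dl1 >= 0"
  and L: "!!v w. abs (f v - f w) <= L * abs (v - w)" and t: "t \<in> {0..T}"
 shows "abs (u t x) <= stab_const L * (dl1 + abs (f 0)) * wgt d x powr s"
proof -
 have "abs (0 - u t x) <= stab_const L * (dl1 + abs (f 0)) * wgt d x powr s"
 proof (rule mild_stability[of "%_ _. 0" "%_. 0" "%_. 0", OF _ _ u _ h(1) _ L _ _ h(3) _ t])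
  show "adm0 (%_. 0)" unfolding adm0_def by (auto intro: exI[of _ 0])
  show "abs (0 - f 0) <= abs (f 0) * wgt d x powr s" for x
   using mult_left_mono[OF wgt_powr_ge_1[of x], of "abs (f 0)"] by simp
 qed (use h in \<open>auto simp: adm_const mild_def heat_def source_def source_arg_def\<close>)
 then show ?thesis by simp
qed

text \<open>Picard iteration written as a series of differences, which decay like
  \<open>(1/2) ^ n\<close> under the exponential time weight.\<close>

theorem mild_exists:
 assumes h: "adm0 h" and L: "!!v w. abs (f v - f w) <= L * abs (v - w)"
 shows "\<exists>u. adm u \<and> mild f h u"
proof -
 have L0: "L >= 0" using L[of 1 0] by (auto intro: order_trans[OF abs_ge_zero])
 define Ph where "Ph u t x = heat d (T - t) h x + source d T (%t x. f (u t x)) t x" for u t x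
 have aPh: "adm (Ph u)" if "adm u" for u
  unfolding Ph_def by (intro adm_add adm_heat h adm_source adm_Lipschitz[OF that L])
 define U where "U n = (Ph ^^ n) (%_ _. 0)" for n
 have U0: "U 0 = (%_ _. 0)" and US: "U (Suc n) = Ph (U n)" for n by (simp_all add: U_def)
 have aU: "adm (U n)" for n by (induction n) (auto simp: U0 US adm_const aPh)
 define lam where "lam = 2 * L * Cw + 1"
 have LC: "L * Cw >= 0" using L0 Cw by auto
 then have lam1: "lam > 0" by (simp add: lam_def add_nonneg_pos mult.assoc)
 have "L * Cw <= 1 / 2 * lam" by (simp add: lam_def)
 then have lam: "lam > 0" "L * Cw / lam <= 1 / 2" using lam1 by (simp_all add: pos_divide_le_eq)
 have Ph_diff: "abs (Ph u t x - Ph v t x) <= k / 2 * exp (lam * (T - t)) * wgt d x powr s"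
  if uv: "adm u" "adm v" and t: "t \<in> {0..T}" and k: "k >= 0"
   and le: "!!t x. t \<in> {0..T} ==> abs (u t x - v t x) <= k * exp (lam * (T - t)) * wgt d x powr s" for u v t x k
 proof -
  have fu: "adm (%t x. f (u t x))" "adm (%t x. f (v t x))" by (rule adm_Lipschitz[OF _ L] uv)+
  have "Ph u t x - Ph v t x = source d T (%t x. f (u t x) - f (v t x)) t x"
   by (simp add: Ph_def source_diff[OF fu t])
  also have "abs ... <= (L * k) * Cw / lam * exp (lam * (T - t)) * wgt d x powr s"
  proof (rule nn_source_arg_le[OF adm_diff[OF fu] _ _ t lam(1)])
   fix t x assume "t \<in> {0..T}"
   from mult_left_mono[OF le[OF this] L0] L[of "u t x" "v t x"]
   show "abs (f (u t x) - f (v t x)) <= L * k * exp (lam * (T - t)) * wgt d x powr s" by (simp add: mult.assoc) (meson order_trans)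
  qed (use L0 k in auto)
  also have "... = (L * Cw / lam) * (k * exp (lam * (T - t)) * wgt d x powr s)" by simp
  also have "... <= (1 / 2) * (k * exp (lam * (T - t)) * wgt d x powr s)"
   using lam k by (intro mult_right_mono) auto
  finally show ?thesis by simp
 qed
 obtain A where A: "A >= 0" "!!t x. t \<in> {0..T} ==> abs (U 1 t x) <= A * wgt d x powr s" by (rule admD[OF aU]) blast
 have step: "abs (U (Suc n) t x - U n t x) <= A * (1/2) ^ n * exp (lam * (T - t)) * wgt d x powr s" if "t \<in> {0..T}" for n t x
  using that
 proof (induction n arbitrary: t x)
  case 0
  have "1 * (A * wgt d x powr s) <= exp (lam * (T - t)) * (A * wgt d x powr s)"
   using A 0 lam by (intro mult_right_mono) auto
  then show ?case using A(2)[OF 0, of x] by (simp add: U0 mult_ac)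
 next
  case (Suc n)
  have "abs (U (Suc (Suc n)) t x - U (Suc n) t x) <= (A * (1/2) ^ n) / 2 * exp (lam * (T - t)) * wgt d x powr s"
   unfolding US[of "Suc n"] US[of n]
   by (rule Ph_diff) (use aU[of "Suc n"] aU[of n] Suc A in \<open>auto simp flip: US\<close>)
  then show ?case by simp
 qed
 let ?W = "%p. wgt d (snd p) powr s"
 \<comment> \<open>Dividing by the growth weight makes the series uniformly summable on the
   unbounded domain; the limit is therefore continuous, and the weight is multiplied back in
   \<open>u\<close>.\<close>
 define v where "v n p = (U (Suc n) (fst p) (snd p) - U n (fst p) (snd p)) / ?W p" for n p
 define M where "M n = A * exp (lam * T) * (1/2) ^ n" for n
 have vM: "norm (v n p) <= M n" if "p \<in> {0..T} \<times> UNIV" for n p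
 proof -
  have W: "?W p > 0" by simp
  have t: "fst p \<in> {0..T}" using that by auto
  have "abs (U (Suc n) (fst p) (snd p) - U n (fst p) (snd p)) <= A * (1/2) ^ n * exp (lam * (T - fst p)) * ?W p"
   by (rule step[OF t])
  also have "... <= A * (1/2) ^ n * exp (lam * T) * ?W p"
   using t A lam by (intro mult_right_mono mult_left_mono) auto
  finally show ?thesis using W by (simp add: v_def M_def divide_le_eq mult_ac)
 qed
 have "summable M" unfolding M_def by (intro summable_mult summable_geometric) auto
 have ul: "uniform_limit ({0..T} \<times> UNIV) (%n p. \<Sum>i<n. v i p) (%p. suminf (%i. v i p)) sequentially"
  by (rule Weierstrass_m_test[OF vM \<open>summable M\<close>])
 define u where "u t x = suminf (%i. v i (t, x)) * wgt d x powr s" for t x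
 have sumv: "(\<Sum>i<n. v i p) = U n (fst p) (snd p) / ?W p" for n p
  by (induction n) (auto simp: U0 v_def diff_divide_distrib)
 have vcont: "continuous_on ({0..T} \<times> UNIV) (v n)" for n
  unfolding v_def
  by (intro continuous_on_divide continuous_on_diff adm_cont_split aU continuous_on_wgt_powr continuous_on_snd continuous_on_id) auto
 have ucont: "continuous_on ({0..T} \<times> UNIV) (%p. suminf (%i. v i p))"
  by (rule uniform_limit_theorem[OF _ ul]) (auto intro!: continuous_on_sum vcont eventuallyI)
 have usum: "summable (%i. v i p)" if "p \<in> {0..T} \<times> UNIV" for p
  by (rule summable_comparison_test'[OF \<open>summable M\<close>]) (use vM[OF that] in auto)
 have uU: "abs (u t x - U n t x) <= (2 * A * exp (lam * T) * (1/2) ^ n) * wgt d x powr s" if t: "t \<in> {0..T}" for t x n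
 proof -
  have p: "(t, x) \<in> {0..T} \<times> UNIV" using t by auto
  have W: "wgt d x powr s > 0" by simp
  have "suminf (%i. v i (t, x)) - (\<Sum>i<n. v i (t, x)) = (\<Sum>i. v (i + n) (t, x))"
   using suminf_split_initial_segment[OF usum[OF p], of n] by simp
  also have "abs ... <= (\<Sum>i. M (i + n))"
  proof -
   have sM: "summable (%i. M (i + n))" using \<open>summable M\<close> by (simp add: summable_iff_shift)
   have "summable (%i. norm (v (i + n) (t, x)))"
    by (rule summable_comparison_test'[OF sM]) (use vM[OF p] in auto)
   then have "norm (\<Sum>i. v (i + n) (t, x)) <= (\<Sum>i. norm (v (i + n) (t, x)))" by (rule summable_norm)
   also have "... <= (\<Sum>i. M (i + n))" by (rule suminf_le[OF _ \<open>summable (%i. norm (v (i + n) (t, x)))\<close> sM]) (use vM[OF p] in auto)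
   finally show ?thesis by simp
  qed
  also have "(\<Sum>i. M (i + n)) = 2 * A * exp (lam * T) * (1/2) ^ n"
  proof -
   have "(\<Sum>i. M (i + n)) = (\<Sum>i. (A * exp (lam * T) * (1/2) ^ n) * (1/2) ^ i)"
    by (simp add: M_def power_add mult_ac)
   also have "... = (A * exp (lam * T) * (1/2) ^ n) * (\<Sum>i. (1/2) ^ i)"
    by (rule suminf_mult) (simp add: summable_geometric)
   also have "(\<Sum>i. (1/2::real) ^ i) = 2" by (subst suminf_geometric) auto
   finally show ?thesis by simp
  qed
  finally have "abs (suminf (%i. v i (t, x)) - (\<Sum>i<n. v i (t, x))) * wgt d x powr s <= 2 * A * exp (lam * T) * (1/2) ^ n * wgt d x powr s"
   by (rule mult_right_mono) simp
  moreover have "abs (suminf (%i. v i (t, x)) - (\<Sum>i<n. v i (t, x))) * wgt d x powr s = abs (u t x - U n t x)"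
  proof -
   have "u t x - U n t x = (suminf (%i. v i (t, x)) - (\<Sum>i<n. v i (t, x))) * wgt d x powr s"
    using W by (simp add: u_def sumv left_diff_distrib)
   then show ?thesis by (simp add: abs_mult)
  qed
  ultimately show ?thesis by simp
 qed
 have au: "adm u"
 proof (rule admI)
  show "continuous_on ({0..T} \<times> UNIV) (%p. u (fst p) (snd p))"
   unfolding u_def by (intro continuous_on_mult continuous_on_wgt_powr continuous_on_snd continuous_on_id) (use ucont in simp)
  show "abs (u t x) <= (2 * A * exp (lam * T)) * wgt d x powr s" if "t \<in> {0..T}" for t x
   using uU[OF that, of x 0] by (simp add: U0)
 qed
 have "u t x = Ph u t x" if t: "t \<in> {0..T}" for t x
 proof -
  let ?B = "2 * A * exp (lam * T)"
  have le: "abs (u t x - Ph u t x) <= (2 * ?B * exp (lam * T) * wgt d x powr s) * (1/2) ^ n" for n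
  proof -
   have B: "?B * (1/2) ^ n >= 0" using A by auto
   have "abs (Ph u t x - Ph (U n) t x) <= (?B * (1/2) ^ n) / 2 * exp (lam * (T - t)) * wgt d x powr s"
   proof (rule Ph_diff[OF au aU t B])
    fix t x assume t: "t \<in> {0..T}"
    have "1 * (?B * (1/2) ^ n * wgt d x powr s) <= exp (lam * (T - t)) * (?B * (1/2) ^ n * wgt d x powr s)"
     using A t lam by (intro mult_right_mono) auto
    then show "abs (u t x - U n t x) <= ?B * (1/2) ^ n * exp (lam * (T - t)) * wgt d x powr s"
     using uU[OF t, of x n] by (simp add: mult_ac)
   qed
   also have "... <= (?B * (1/2) ^ n) * exp (lam * T) * wgt d x powr s"
    using t A lam by (intro mult_right_mono mult_mono) auto
   finally have 1: "abs (Ph u t x - Ph (U n) t x) <= ?B * (1/2) ^ n * exp (lam * T) * wgt d x powr s" .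
   have "abs (u t x - U (Suc n) t x) <= (?B * (1/2) ^ Suc n) * wgt d x powr s" using uU[OF t, of x "Suc n"] by simp
   also have "... <= (?B * (1/2) ^ n * exp (lam * T)) * wgt d x powr s"
   proof (rule mult_right_mono)
    have "?B * (1/2) ^ Suc n <= ?B * (1/2) ^ n * 1" using A by simp
    also have "... <= ?B * (1/2) ^ n * exp (lam * T)" using A lam T by (intro mult_left_mono) auto
    finally show "?B * (1/2) ^ Suc n <= ?B * (1/2) ^ n * exp (lam * T)" .
   qed simp
   finally have "abs (u t x - Ph (U n) t x) <= ?B * (1/2) ^ n * exp (lam * T) * wgt d x powr s" by (simp add: US)
   with 1 have "abs (u t x - Ph u t x) <= 2 * (?B * (1/2) ^ n * exp (lam * T) * wgt d x powr s)" by linarith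
   then show ?thesis by (simp add: mult_ac)
  qed
  have "(%n. (2 * ?B * exp (lam * T) * wgt d x powr s) * (1/2) ^ n) \<longlonglongrightarrow> (2 * ?B * exp (lam * T) * wgt d x powr s) * 0"
   by (intro tendsto_intros LIMSEQ_realpow_zero) auto
  then have "abs (u t x - Ph u t x) <= (2 * ?B * exp (lam * T) * wgt d x powr s) * 0"
   by (rule LIMSEQ_le_const) (use le in auto)
  then show ?thesis by simp
 qed
 then have "mild f h u" unfolding mild_def Ph_def by blast
 with au show ?thesis by blast
qed

end

section \<open>Derivatives of heat potentials\<close>

text \<open>Fubini and the fundamental theorem of calculus write the integral of \<open>N\<close> as
  a primitive of the integral of \<open>D\<close>. Continuity of the integral of
  \<open>abs D\<close> gives joint integrability on compact intervals, so no uniform majorant has to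
  be produced.\<close>

lemma (in sigma_finite_measure) has_derivative_under_integral:
 fixes N D :: "real => 'a => real"
 assumes der: "!!r y. r \<in> {a<..<b} ==> y \<in> space M ==> ((%r. N r y) has_real_derivative D r y) (at r)"
  and meas: "(%(r, y). D r y) \<in> borel_measurable (borel \<Otimes>\<^sub>M M)"
  and N: "!!r. r \<in> {a<..<b} ==> integrable M (N r)"
  and D: "!!r. r \<in> {a<..<b} ==> integrable M (D r)"
  and c1: "continuous_on {a<..<b} (%r. lint M (%y. D r y))"
  and c2: "continuous_on {a<..<b} (%r. lint M (%y. abs (D r y)))"
  and c3: "!!y. y \<in> space M ==> continuous_on {a<..<b} (%r. D r y)"
  and r: "r0 \<in> {a<..<b}"
 shows "((%r. lint M (%y. N r y)) has_real_derivative (lint M (%y. D r0 y))) (at r0)"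
proof -
 interpret P: pair_sigma_finite lborel M ..
 define al where "al = (a + r0) / 2"
 define bt where "bt = (r0 + b) / 2"
 have ab: "a < al" "al < r0" "r0 < bt" "bt < b" using r by (auto simp: al_def bt_def)
 have sub: "{al..bt} \<subseteq> {a<..<b}" using ab by auto
 let ?G = "%r. lint M (%y. D r y)"
 have eq: "(lint M (%y. N r y)) = (lint M (%y. N al y)) + integral {al..r} ?G" if r: "r \<in> {al..bt}" for r
 proof -
  have rs: "{al..r} \<subseteq> {a<..<b}" using r ab by auto
  have ar: "al <= r" using r by simp
  let ?f = "%rho y. D rho y * indicator {al..r} rho"
  have m: "(%w. ?f (fst w) (snd w)) \<in> borel_measurable (lborel \<Otimes>\<^sub>M M)"
  proof -
   have "(%w. D (fst w) (snd w)) \<in> borel_measurable (lborel \<Otimes>\<^sub>M M)"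
    using meas by (simp add: case_prod_beta' cong: measurable_cong_sets sets_pair_measure_cong)
   then show ?thesis by measurable
  qed
  have int: "integrable (lborel \<Otimes>\<^sub>M M) (%w. ?f (fst w) (snd w))"
  proof (rule P.Fubini_integrable[OF m])
   have "integrable lborel (%rho. (lint M (%y. abs (D rho y))) * indicator {al..r} rho)"
    using borel_integrable_atLeastAtMost'[OF continuous_on_subset[OF c2 rs]]
    by (simp add: set_integrable_def mult.commute)
   then show "integrable lborel (%rho. lint M (%y. norm (?f (fst (rho, y)) (snd (rho, y)))))"
    by (simp add: abs_mult)
   show "AE rho in lborel. integrable M (%y. ?f (fst (rho, y)) (snd (rho, y)))"
    using D rs by (intro AE_I2) (auto simp: indicator_def)
  qed
  have ftc: "(lint lborel (%rho. ?f rho y)) = N r y - N al y" if y: "y \<in> space M" for y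
  proof (rule integral_FTC_Icc_real[OF ar])
   fix x assume "al <= x" "x <= r"
   then have x: "x \<in> {a<..<b}" using rs by auto
   show "DERIV (%r. N r y) x :> D x y" by (rule der[OF x y])
   show "isCont (%r. D r y) x"
    using c3[OF y] x by (simp add: continuous_on_eq_continuous_at)
  qed
  have "(lint M (%y. N r y)) - (lint M (%y. N al y)) = (lint M (%y. N r y - N al y))"
   using N r ar rs ab by (intro Bochner_Integration.integral_diff[symmetric] N) auto
  also have "... = (lint M (%y. (lint lborel (%rho. ?f rho y))))"
   by (intro Bochner_Integration.integral_cong refl ftc[symmetric])
  also have "... = (lint lborel (%rho. (lint M (%y. ?f rho y))))"
   by (rule P.Fubini_integral) (use int in \<open>simp add: case_prod_beta'\<close>)
  also have "... = (LINT rho:{al..r}|lborel. ?G rho)"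
   by (simp add: set_lebesgue_integral_def mult.commute)
  also have "... = integral {al..r} ?G"
   by (rule set_borel_integral_eq_integral, rule borel_integrable_atLeastAtMost', rule continuous_on_subset[OF c1 rs])
  finally show ?thesis by simp
 qed
 have "((%r. integral {al..r} ?G) has_real_derivative ?G r0) (at r0 within {al..bt})"
  by (rule integral_has_real_derivative[OF continuous_on_subset[OF c1 sub]]) (use ab in auto)
 then have "((%r. integral {al..r} ?G) has_real_derivative ?G r0) (at r0)"
  using at_within_Icc_at[of al r0 bt] ab by simp
 then have "((%r. (lint M (%y. N al y)) + integral {al..r} ?G) has_real_derivative ?G r0) (at r0)"
  by (auto intro!: derivative_eq_intros)
 then show ?thesis
 proof (rule has_field_derivative_transform_within_open[where S = "{al<..<bt}"])
  show "(lint M (%y. N al y)) + integral {al..r} ?G = (lint M (%y. N r y))" if "r \<in> {al<..<bt}" for r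
   by (rule eq[symmetric]) (use that in auto)
 qed (use ab in auto)
qed

lemma integral_unit_substitution:
 fixes f :: "real => real"
 assumes f: "continuous_on {t..T} f" and t: "t <= T"
 shows "integral {t..T} f = (T - t) * integral {0..1} (%r. f (t + (T - t) * r))"
proof -
 have im: "(%r. t + (T - t) * r) ` {0..1} \<subseteq> {t..T}"
 proof
  fix y assume "y \<in> (%r. t + (T - t) * r) ` {0..1}"
  then obtain r where r: "0 <= r" "r <= 1" "y = t + (T - t) * r" by auto
  have "0 <= (T - t) * r" "(T - t) * r <= (T - t) * 1" using r t by (auto simp del: mult_1_right intro!: mult_left_mono)
  with r show "y \<in> {t..T}" by auto
 qed
 have "((%r. (T - t) *\<^sub>R f (t + (T - t) * r)) has_integral (integral {t + (T - t) * 0..t + (T - t) * 1} f)) {0..1}"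
  by (rule has_integral_substitution[where g = "%r. t + (T - t) * r" and c = t and d = T])
   (use t f im in \<open>auto intro!: derivative_eq_intros\<close>)
 then have "integral {0..1} (%r. (T - t) * f (t + (T - t) * r)) = integral {t..T} f"
  by (simp only: integral_unique real_scaleR_def mult_0_right mult_1_right add_0_right) simp
 then show ?thesis by (simp add: Henstock_Kurzweil_Integration.integral_mult_right)
qed

text \<open>The variable \<open>t\<close> occurs in the limit and in the integrand. With the limit
  frozen at \<open>t0\<close> (\<open>f2\<close>) Leibniz' rule applies; since \<open>eps\<close> is
  positive, the second argument of \<open>Q\<close> stays positive near \<open>t0\<close>.\<close>

lemma has_derivative_moving_integral:
 fixes Q Q' :: "real => real => real"
 assumes eps: "eps > 0"
  and Q: "continuous_on ({0..T} \<times> {0<..}) (%(s, sg). Q s sg)"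
  and Q': "continuous_on ({0..T} \<times> {0<..}) (%(s, sg). Q' s sg)"
  and der: "!!s sg. s \<in> {0..T} ==> sg > 0 ==> (Q s has_real_derivative Q' s sg) (at sg)"
  and t: "t0 \<in> {0<..<T}"
 shows "((%t. integral {t..T} (%s. Q s (s - t + eps))) has_real_derivative
   (- Q t0 eps - integral {t0..T} (%s. Q' s (s - t0 + eps)))) (at t0)"
proof -
 define U where "U = {max 0 (t0 - eps / 2)<..<min T (t0 + eps / 2)}"
 have U: "open U" "convex U" "t0 \<in> U" using t eps by (auto simp: U_def)
 have Ut: "0 < t" "t < T" "t0 - eps / 2 < t" "t < t0 + eps / 2" if "t \<in> U" for t using that by (auto simp: U_def)
 have contQ: "continuous_on {l..T} (%s. Q s (s - t + eps))" if "0 <= l" "l - t + eps > 0" for l t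
 proof -
  have "continuous_on {l..T} (%s. (%(s, sg). Q s sg) (s, s - t + eps))"
   by (rule continuous_on_compose2[OF Q]) (use that in \<open>auto intro!: continuous_intros\<close>)
  then show ?thesis by simp
 qed
 define f2 where "f2 = (%t. integral {t0..T} (%s. Q s (s - t + eps)))"
 have "((%t. integral (cbox t0 T) (%s. Q s (s - t + eps))) has_real_derivative integral (cbox t0 T) (%s. - Q' s (s - t0 + eps))) (at t0 within U)"
 proof (rule leibniz_rule_field_derivative[OF _ _ _ U(3,2)])
  fix t s assume t': "t \<in> U" and s: "s \<in> cbox t0 T"
  have pos: "s - t + eps > 0" and s': "s \<in> {0..T}" using Ut[OF t'] s t eps by auto
  have "((%x. s - x + eps) has_real_derivative (-1)) (at t)" by (auto intro!: derivative_eq_intros)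
  from DERIV_chain2[OF der[OF s' pos] this]
  show "((%x. Q s (s - x + eps)) has_real_derivative - Q' s (s - t + eps)) (at t within U)"
   by (auto intro: has_field_derivative_at_within)
 next
  fix t' assume t': "t' \<in> U"
  show "(%s. Q s (s - t' + eps)) integrable_on cbox t0 T"
   using integrable_continuous_real[OF contQ[of t0 t']] Ut[OF t'] t eps by auto
 next
  have "continuous_on (U \<times> cbox t0 T) (%p. (%(s, sg). Q' s sg) (snd p, snd p - fst p + eps))"
  proof (rule continuous_on_compose2[OF Q'])
   show "(%p. (snd p, snd p - fst p + eps)) ` (U \<times> cbox t0 T) \<subseteq> {0..T} \<times> {0<..}"
    using Ut t eps by fastforce
  qed (intro continuous_intros)
  then show "continuous_on (U \<times> cbox t0 T) (%(t, s). - Q' s (s - t + eps))"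
   by (auto simp: case_prod_beta' intro!: continuous_on_minus)
 qed
 then have f2: "(f2 has_real_derivative (- integral {t0..T} (%s. Q' s (s - t0 + eps)))) (at t0)"
  using at_within_open[OF U(3,1)] by (simp add: f2_def)
 \<comment> \<open>What is left is the integral between \<open>t\<close> and \<open>t0\<close>. Its
   integrand is close to \<open>Q t0 eps\<close>, which gives the boundary term.\<close>
 define f1 where "f1 = (%t. integral {t..T} (%s. Q s (s - t + eps)) - f2 t)"
 have f1: "(f1 has_real_derivative (- Q t0 eps)) (at t0)"
  unfolding has_field_derivative_def has_derivative_at_alt
 proof (intro conjI allI impI)
  show "bounded_linear ((*) (- Q t0 eps))" by (rule bounded_linear_mult_right)
  fix e :: real assume e: "e > 0"
  have "(t0, eps) \<in> {0..T} \<times> {0<..}" using t eps by auto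
  with Q e obtain eta where eta: "eta > 0"
   "!!p. p \<in> {0..T} \<times> {0<..} ==> dist p (t0, eps) < eta ==> dist (case p of (s, sg) => Q s sg) (Q t0 eps) < e"
   unfolding continuous_on_iff by fastforce
  obtain rho where rho: "rho > 0" "!!t. abs (t - t0) < rho ==> t \<in> U"
   using U(1,3) unfolding open_dist dist_real_def by blast
  show "\<exists>dl>0. \<forall>t. norm (t - t0) < dl --> norm (f1 t - f1 t0 - (- Q t0 eps) * (t - t0)) <= e * norm (t - t0)"
  proof (intro exI[of _ "min rho (eta / 2)"] conjI allI impI)
   fix t' assume "norm (t' - t0) < min rho (eta / 2)"
   then have t': "t' \<in> U" "abs (t' - t0) < eta / 2" using rho by auto
   note Ut' = Ut[OF t'(1)]
   have near: "norm (Q s (s - t' + eps) - Q t0 eps) <= e" if s: "s \<in> {min t' t0..max t' t0}" for s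
   proof -
    have pos: "s - t' + eps > 0" "s \<in> {0..T}" using s Ut' t eps by (auto simp: min_def max_def split: if_splits)
    have "dist (s, s - t' + eps) (t0, eps) <= abs (s - t0) + abs (s - t')"
     unfolding dist_Pair_Pair by (rule order_trans[OF sqrt_sum_squares_le_sum_abs]) (simp add: dist_real_def)
    also have "... < eta" using s t'(2) by (auto simp: min_def max_def split: if_splits)
    finally show ?thesis using eta(2)[of "(s, s - t' + eps)"] pos by (auto simp: dist_real_def)
   qed
   have f1t0: "f1 t0 = 0" by (simp add: f1_def f2_def)
   show "norm (f1 t' - f1 t0 - (- Q t0 eps) * (t' - t0)) <= e * norm (t' - t0)"
   proof (cases "t0 <= t'")
    case True
    have c: "continuous_on {t0..T} (%s. Q s (s - t' + eps))" using Ut' t eps by (intro contQ) auto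
    have "integral {t0..t'} (%s. Q s (s - t' + eps)) + integral {t'..T} (%s. Q s (s - t' + eps)) = f2 t'"
     unfolding f2_def using True Ut' by (intro Henstock_Kurzweil_Integration.integral_combine integrable_continuous_real c) auto
    then have "f1 t' = - integral {t0..t'} (%s. Q s (s - t' + eps))" by (simp add: f1_def)
    moreover have "integral {t0..t'} (%s. Q s (s - t' + eps) - Q t0 eps) = integral {t0..t'} (%s. Q s (s - t' + eps)) - Q t0 eps * (t' - t0)"
     using True Ut' by (subst Henstock_Kurzweil_Integration.integral_diff)
      (auto intro!: integrable_continuous_real continuous_on_subset[OF c])
    moreover have "norm (integral {t0..t'} (%s. Q s (s - t' + eps) - Q t0 eps)) <= e * (t' - t0)"
     using True Ut' near by (intro integral_bound continuous_on_diff continuous_on_const continuous_on_subset[OF c]) auto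
    ultimately show ?thesis using True f1t0 by (simp add: abs_minus_commute)
   next
    case False
    have c: "continuous_on {t'..T} (%s. Q s (s - t' + eps))" using Ut' t eps by (intro contQ) auto
    have "integral {t'..t0} (%s. Q s (s - t' + eps)) + f2 t' = integral {t'..T} (%s. Q s (s - t' + eps))"
     unfolding f2_def using False t by (intro Henstock_Kurzweil_Integration.integral_combine integrable_continuous_real c) auto
    then have "f1 t' = integral {t'..t0} (%s. Q s (s - t' + eps))" by (simp add: f1_def)
    moreover have "integral {t'..t0} (%s. Q s (s - t' + eps) - Q t0 eps) = integral {t'..t0} (%s. Q s (s - t' + eps)) - Q t0 eps * (t0 - t')"
     using False t by (subst Henstock_Kurzweil_Integration.integral_diff)
      (auto intro!: integrable_continuous_real continuous_on_subset[OF c])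
    moreover have "norm (integral {t'..t0} (%s. Q s (s - t' + eps) - Q t0 eps)) <= e * (t0 - t')"
     using False t near by (intro integral_bound continuous_on_diff continuous_on_const continuous_on_subset[OF c]) auto
    ultimately show ?thesis using False f1t0 by (simp add: algebra_simps)
   qed
  qed (use rho eta in auto)
 qed
 have "((%t. f1 t + f2 t) has_real_derivative (- Q t0 eps + (- integral {t0..T} (%s. Q' s (s - t0 + eps))))) (at t0)"
  by (rule DERIV_add[OF f1 f2])
 then show ?thesis by (simp add: f1_def)
qed

subsection \<open>The heat kernel\<close>

definition kern :: "nat => real => (nat => real) => (nat => real) => real" where
 "kern d sg x y = (1 / sqrt (2 * pi * sg)) ^ d * exp (- (\<Sum>i<d. (y i - x i)\<^sup>2) / (2 * sg))"

definition leb :: "nat => (nat => real) measure" where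
 "leb d = PiM {..<d} (%_. lborel)"

text \<open>\<open>unshift d sg x\<close> inverts \<open>z \<mapsto> gshift d x (sqrt sg) z\<close>.\<close>

definition unshift :: "nat => real => (nat => real) => (nat => real) => (nat => real)" where
 "unshift d sg x y = gshift d (%i. - x i / sqrt sg) (1 / sqrt sg) y"

lemma unshift_apply: "i < d ==> unshift d sg x y i = (y i - x i) / sqrt sg"
 by (simp add: unshift_def gshift_def field_simps diff_divide_distrib)

lemma unshift_gshift:
 assumes "z \<in> Rd d" "sg > 0"
 shows "unshift d sg x (gshift d x (sqrt sg) z) = z"
proof
 fix i
 show "unshift d sg x (gshift d x (sqrt sg) z) i = z i"
 proof (cases "i < d")
  case True
  then show ?thesis using assms by (simp add: unshift_apply) (simp add: gshift_def)
 next
  case False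
  then show ?thesis using assms by (auto simp: unshift_def gshift_def Rd_def PiE_def extensional_def)
 qed
qed

lemma kern_prod:
 assumes "sg > 0"
 shows "kern d sg x y = (\<Prod>i<d. normal_density (x i) (sqrt sg) (y i))"
proof -
 have "(\<Prod>i<d. normal_density (x i) (sqrt sg) (y i)) = (\<Prod>i<d. (1 / sqrt (2 * pi * sg)) * exp (- (y i - x i)\<^sup>2 / (2 * sg)))"
  using assms by (simp add: normal_density_def)
 also have "... = (1 / sqrt (2 * pi * sg)) ^ d * exp (\<Sum>i<d. - (y i - x i)\<^sup>2 / (2 * sg))"
  by (simp only: prod.distrib exp_sum[OF finite_lessThan] prod_constant card_lessThan)
 also have "(\<Sum>i<d. - (y i - x i)\<^sup>2 / (2 * sg)) = - (\<Sum>i<d. (y i - x i)\<^sup>2) / (2 * sg)"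
  by (simp add: sum_negf flip: sum_divide_distrib)
 finally show ?thesis by (simp add: kern_def)
qed

lemma kern_nonneg: "sg > 0 ==> kern d sg x y >= 0"
 by (simp add: kern_def)

lemma sets_leb[measurable_cong]: "sets (leb d) = sets (PiM {..<d} (%_. borel))"
 unfolding leb_def by (intro sets_PiM_cong) auto

lemma space_leb: "space (leb d) = Rd d"
 by (simp add: leb_def space_PiM Rd_def)

lemma measurable_leb_id: "(%x. x) \<in> borel_measurable (leb d)"
 using measurable_PiM_borel_id[of "{..<d}"] by (simp add: measurable_cong_sets[OF sets_leb refl])

lemma sigma_finite_leb: "sigma_finite_measure (leb d)"
proof -
 interpret product_sigma_finite "%_::nat. lborel :: real measure" ..
 show ?thesis unfolding leb_def by (rule sigma_finite) simp
qed

lemma borel_measurable_kern: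
 assumes "sg \<in> borel_measurable M" "x \<in> borel_measurable M" "y \<in> borel_measurable M"
 shows "(%p. kern d (sg p) (x p) (y p)) \<in> borel_measurable M"
proof -
 have [measurable]: "sg \<in> borel_measurable M" "(%p. x p i) \<in> borel_measurable M" "(%p. y p i) \<in> borel_measurable M" for i
  using assms(1) measurable_compose[OF assms(2) measurable_product_coordinates]
   measurable_compose[OF assms(3) measurable_product_coordinates] by auto
 show ?thesis unfolding kern_def by measurable
qed

text \<open>Both sides are recognised as the product of the normal laws \<open>N i\<close>, again by
  comparison on boxes.\<close>

lemma distr_gauss_kern:
 assumes sg: "sg > 0"
 shows "distr (gauss d) (leb d) (gshift d x (sqrt sg)) = density (leb d) (%y. ennreal (kern d sg x y))"
proof -
 interpret S: prob_space stdn by (rule prob_space_stdn)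
 interpret P: product_sigma_finite "%_::nat. stdn" ..
 interpret L: product_sigma_finite "%_::nat. lborel :: real measure" ..
 define N where "N i = density lborel (%y. ennreal (normal_density (x i) (sqrt sg) y))" for i
 interpret N: prob_space "N i" for i unfolding N_def by (rule prob_space_normal_density) (use sg in simp)
 interpret PN: product_sigma_finite N ..
 have sN[measurable_cong]: "sets (N i) = sets borel" for i by (simp add: N_def)
 have sPN: "sets (PiM {..<d} N) = sets (leb d)" unfolding leb_def by (intro sets_PiM_cong) (auto simp: sN)
 have shm: "(%z. gshift d y c z) \<in> measurable (gauss d) (leb d)" for y c
  unfolding gshift_def gauss_def leb_def by measurable
 have box: "indicator (Pi\<^sub>E {..<d} A) (gshift d y c z) = (\<Prod>i<d. indicator (A i) (y i + c * z i) :: ennreal)" for A y c z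
 proof (cases "\<forall>i<d. y i + c * z i \<in> A i")
  case True
  then show ?thesis by (auto simp: gshift_def indicator_def)
 next
  case False
  then obtain i where "i < d" "y i + c * z i \<notin> A i" by auto
  then have "(\<Prod>i<d. indicator (A i) (y i + c * z i) :: ennreal) = 0"
   using prod_zero[of "{..<d}"] by (auto simp: indicator_def)
  with False show ?thesis by (auto simp: gshift_def indicator_def)
 qed
 have "distr (gauss d) (leb d) (gshift d x (sqrt sg)) = PiM {..<d} N"
 proof (rule PN.PiM_eqI)
  fix A assume A: "!!i. i \<in> {..<d} ==> A i \<in> sets (N i)"
  have [measurable]: "Pi\<^sub>E {..<d} A \<in> sets (leb d)" unfolding leb_def using A by (auto intro!: sets_PiM_I_finite simp: sN)
  have "emeasure (distr (gauss d) (leb d) (gshift d x (sqrt sg))) (Pi\<^sub>E {..<d} A)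
   = (nint (distr (gauss d) (leb d) (gshift d x (sqrt sg))) (%y. indicator (Pi\<^sub>E {..<d} A) y))" by simp
  also have "... = (nint (gauss d) (%z. indicator (Pi\<^sub>E {..<d} A) (gshift d x (sqrt sg) z)))"
   by (rule nn_integral_distr[OF shm]) simp
  also have "... = (\<Prod>i<d. nint stdn (%a. indicator (A i) (x i + sqrt sg * a)))"
   unfolding box unfolding gauss_def
   by (rule P.product_nn_integral_prod) (use A in \<open>auto simp: sN\<close>)
  also have "... = (\<Prod>i<d. emeasure (N i) (A i))"
  proof (intro prod.cong refl)
   fix i assume "i \<in> {..<d}"
   then have [measurable]: "A i \<in> sets borel" using A by (auto simp: sN)
   have "(nint stdn (%a. indicator (A i) (x i + sqrt sg * a))) = (nint lborel (%y. ennreal (normal_density (x i) (sqrt sg) y) * indicator (A i) y))"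
    by (rule nn_integral_stdn_affine) (use sg in auto)
   also have "... = emeasure (N i) (A i)" unfolding N_def by (rule emeasure_density[symmetric]) auto
   finally show "(nint stdn (%a. indicator (A i) (x i + sqrt sg * a))) = emeasure (N i) (A i)" .
  qed
  finally show "emeasure (distr (gauss d) (leb d) (gshift d x (sqrt sg))) (Pi\<^sub>E {..<d} A) = (\<Prod>i<d. emeasure (N i) (A i))" .
 qed (auto simp: sPN)
 also have "PiM {..<d} N = density (leb d) (%y. ennreal (kern d sg x y))"
 proof (rule PN.PiM_eqI[symmetric])
  have km: "(%y. ennreal (kern d sg x y)) \<in> borel_measurable (leb d)"
   using borel_measurable_kern[OF _ _ measurable_leb_id] by measurable
  fix A assume A: "!!i. i \<in> {..<d} ==> A i \<in> sets (N i)"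
  have S: "Pi\<^sub>E {..<d} A \<in> sets (leb d)" unfolding leb_def using A by (auto intro!: sets_PiM_I_finite simp: sN)
  have "emeasure (density (leb d) (%y. ennreal (kern d sg x y))) (Pi\<^sub>E {..<d} A) = (nint (leb d) (%y. ennreal (kern d sg x y) * indicator (Pi\<^sub>E {..<d} A) y))"
   by (rule emeasure_density[OF km S])
  also have "... = (nint (leb d) (%y. (\<Prod>i<d. ennreal (normal_density (x i) (sqrt sg) (y i)) * indicator (A i) (y i))))"
  proof (rule nn_integral_cong)
   fix y assume "y \<in> space (leb d)"
   then have "y \<in> extensional {..<d}" by (auto simp: space_leb Rd_def PiE_def)
   then have "gshift d (%_. 0) 1 y = y" by (auto simp: gshift_def extensional_def fun_eq_iff)
   with box[of A "%_. 0" 1 y] have "indicator (Pi\<^sub>E {..<d} A) y = (\<Prod>i<d. indicator (A i) (y i) :: ennreal)" by simp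
   then show "ennreal (kern d sg x y) * indicator (Pi\<^sub>E {..<d} A) y = (\<Prod>i<d. ennreal (normal_density (x i) (sqrt sg) (y i)) * indicator (A i) (y i))"
    using sg by (simp add: kern_prod prod_ennreal prod.distrib)
  qed
  also have "... = (\<Prod>i<d. nint lborel (%y. ennreal (normal_density (x i) (sqrt sg) y) * indicator (A i) y))"
   unfolding leb_def by (rule L.product_nn_integral_prod) (use A in \<open>auto simp: sN\<close>)
  also have "... = (\<Prod>i<d. emeasure (N i) (A i))"
   unfolding N_def by (intro prod.cong refl emeasure_density[symmetric]) (use A in \<open>auto simp: sN\<close>)
  finally show "emeasure (density (leb d) (%y. ennreal (kern d sg x y))) (Pi\<^sub>E {..<d} A) = (\<Prod>i<d. emeasure (N i) (A i))" .
 qed (auto simp: sPN)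
 finally show ?thesis .
qed

text \<open>Moves the dependence on \<open>x\<close> and \<open>sg\<close> from the merely
  continuous \<open>f\<close> to the smooth kernel, where it can be differentiated.\<close>

lemma gauss_kern:
 assumes sg: "sg > 0" and f: "f \<in> borel_measurable borel" and w: "w \<in> borel_measurable borel"
  and i: "integrable (gauss d) (%z. f (gshift d x (sqrt sg) z) * w z)"
 shows "integrable (leb d) (%y. kern d sg x y * (f y * w (unshift d sg x y)))" (is ?A)
  "(lint (gauss d) (%z. f (gshift d x (sqrt sg) z) * w z)) = (lint (leb d) (%y. kern d sg x y * (f y * w (unshift d sg x y))))" (is ?B)
proof -
 let ?F = "%y. f y * w (unshift d sg x y)"
 have Fm: "?F \<in> borel_measurable (leb d)"
  unfolding unshift_def
  by (intro borel_measurable_times measurable_compose[OF measurable_leb_id f] measurable_compose[OF _ w] measurable_shift measurable_leb_id borel_measurable_const)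
 have km: "(%y. kern d sg x y) \<in> borel_measurable (leb d)"
  by (intro borel_measurable_kern measurable_leb_id borel_measurable_const)
 have shm: "gshift d x (sqrt sg) \<in> measurable (gauss d) (leb d)"
  unfolding gshift_def gauss_def leb_def by measurable
 have eq: "?F (gshift d x (sqrt sg) z) = f (gshift d x (sqrt sg) z) * w z" if "z \<in> space (gauss d)" for z
  using that sg by (simp add: unshift_gshift space_gauss)
 have "integrable (gauss d) (%z. ?F (gshift d x (sqrt sg) z))"
  using i by (subst Bochner_Integration.integrable_cong[OF refl eq]) auto
 then have "integrable (distr (gauss d) (leb d) (gshift d x (sqrt sg))) ?F"
  by (subst integrable_distr_eq[OF shm Fm])
 then show ?A
  unfolding distr_gauss_kern[OF sg] using Fm km kern_nonneg[OF sg] by (subst (asm) integrable_density) auto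
 have "(lint (gauss d) (%z. f (gshift d x (sqrt sg) z) * w z)) = (lint (gauss d) (%z. ?F (gshift d x (sqrt sg) z)))"
  by (rule Bochner_Integration.integral_cong[OF refl eq[symmetric]])
 also have "... = (lint (distr (gauss d) (leb d) (gshift d x (sqrt sg))) (%y. ?F y))"
  by (rule integral_distr[OF shm Fm, symmetric])
 also have "... = (lint (leb d) (%y. kern d sg x y * ?F y))"
  unfolding distr_gauss_kern[OF sg] using Fm km kern_nonneg[OF sg] by (subst integral_density) auto
 finally show ?B .
qed

lemma sum_sq_upd:
 fixes d :: nat
 assumes "i < d"
 shows "(\<Sum>j<d. (y j - (x(i := r)) j)\<^sup>2) = (y i - r)\<^sup>2 + (\<Sum>j\<in>{..<d} - {i}. (y j - x j :: real)\<^sup>2)"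
 using assms by (subst sum.remove[of "{..<d}" i]) auto

lemma kern_dx:
 assumes i: "i < d" and sg: "sg > 0"
 shows "((%r. kern d sg (x(i := r)) y) has_real_derivative kern d sg (x(i := r)) y * ((y i - r) / sg)) (at r)"
 unfolding kern_def sum_sq_upd[OF i]
 by (rule derivative_eq_intros refl | use sg in \<open>simp add: field_simps\<close>)+

lemma kern_dsg:
 assumes sg: "sg > 0"
 shows "((%sg. kern d sg x y) has_real_derivative
   kern d sg x y * (1 / (2 * sg) * ((\<Sum>i<d. (unshift d sg x y i)\<^sup>2) - real d))) (at sg)"
proof -
 let ?S = "\<Sum>i<d. (y i - x i)\<^sup>2"
 \<comment> \<open>As a real power of \<open>r\<close>, the normalising factor can be differentiated
   by the power rule.\<close>
 have e: "(1 / sqrt (2 * pi * r)) ^ d = (2 * pi) powr (- real d / 2) * r powr (- real d / 2)" if "r > 0" for r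
 proof -
  have a: "1 / sqrt (2 * pi * r) = (2 * pi * r) powr (- (1/2))"
   using that by (simp add: powr_minus_divide powr_half_sqrt)
  have "(1 / sqrt (2 * pi * r)) ^ d = (1 / sqrt (2 * pi * r)) powr real d"
   using that by (subst powr_realpow) auto
  also have "... = ((2 * pi * r) powr (- (1/2))) powr real d" by (simp only: a)
  also have "... = (2 * pi * r) powr (- real d / 2)"
   by (simp add: powr_powr)
  also have "... = (2 * pi) powr (- real d / 2) * r powr (- real d / 2)"
   using that by (simp add: powr_mult)
  finally show ?thesis .
 qed
 have S: "(\<Sum>i<d. (unshift d sg x y i)\<^sup>2) = ?S / sg"
  using sg by (simp add: unshift_apply power_divide flip: sum_divide_distrib)
 have p: "sg powr (- real d / 2 - 1) = sg powr (- real d / 2) / sg"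
  using sg by (simp add: powr_diff)
 have "((%r. (2 * pi) powr (- real d / 2) * r powr (- real d / 2) * exp (- ?S / (2 * r))) has_real_derivative
   (2 * pi) powr (- real d / 2) * (- real d / 2 * sg powr (- real d / 2 - 1)) * exp (- ?S / (2 * sg))
   + (2 * pi) powr (- real d / 2) * sg powr (- real d / 2) * (exp (- ?S / (2 * sg)) * (?S / (2 * sg\<^sup>2)))) (at sg)"
  using sg by (auto intro!: derivative_eq_intros simp: field_simps power2_eq_square)
 also have "(2 * pi) powr (- real d / 2) * (- real d / 2 * sg powr (- real d / 2 - 1)) * exp (- ?S / (2 * sg))
   + (2 * pi) powr (- real d / 2) * sg powr (- real d / 2) * (exp (- ?S / (2 * sg)) * (?S / (2 * sg\<^sup>2)))
   = kern d sg x y * (1 / (2 * sg) * ((\<Sum>i<d. (unshift d sg x y i)\<^sup>2) - real d))"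
  unfolding S p kern_def e[OF sg] using sg by (simp add: field_simps power2_eq_square)
 finally show ?thesis
  by (rule has_field_derivative_transform_within_open[where S = "{0<..}"]) (use sg e in \<open>auto simp: kern_def\<close>)
qed

context heat_setting
begin

text \<open>Contains the polynomials in \<open>z\<close> that differentiating the kernel produces;
  the order \<open>m\<close> is left open so that products stay in the class.\<close>

definition wp :: "((nat => real) => real) => bool" where
 "wp w \<longleftrightarrow> continuous_on UNIV w \<and> (\<exists>K m. m >= 0 \<and> (\<forall>z. abs (w z) <= K * (1 + enorm d z) powr m))"

lemma wp_const: "wp (%_. c)"
proof -
 have "abs c <= abs c * (1 + enorm d z) powr 0" for z by simp
 then show ?thesis unfolding wp_def by (intro conjI continuous_on_const exI[of _ "abs c"] exI[of _ 0]) auto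
qed

lemma wp_coord: assumes "i < d" shows "wp (%z. z i)"
proof -
 have "abs (z i) <= 1 * (1 + enorm d z) powr 1" for z :: "nat => real"
 proof -
  have "(z i)\<^sup>2 <= (\<Sum>i<d. (z i)\<^sup>2)" using assms by (intro member_le_sum) auto
  then have "abs (z i) <= enorm d z" unfolding enorm_def by (metis real_sqrt_abs real_sqrt_le_mono)
  then show ?thesis using enorm_nonneg[of d z] by simp
 qed
 then show ?thesis unfolding wp_def
  by (intro conjI continuous_on_product_coordinates exI[of _ 1]) auto
qed

lemma wp_mult: assumes "wp v" "wp w" shows "wp (%z. v z * w z)"
proof -
 obtain K m where K: "m >= 0" "!!z. abs (v z) <= K * (1 + enorm d z) powr m" using assms(1) unfolding wp_def by blast
 obtain K' m' where K': "m' >= 0" "!!z. abs (w z) <= K' * (1 + enorm d z) powr m'" using assms(2) unfolding wp_def by blast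
 have "abs (v z * w z) <= (K * K') * (1 + enorm d z) powr (m + m')" for z
 proof -
  have "abs (v z * w z) <= (K * (1 + enorm d z) powr m) * (K' * (1 + enorm d z) powr m')"
   unfolding abs_mult by (rule mult_mono[OF K(2) K'(2)]) (use K(2)[of z] in \<open>auto intro: order_trans[OF abs_ge_zero]\<close>)
  then show ?thesis by (simp add: powr_add mult_ac)
 qed
 with K K' assms show ?thesis unfolding wp_def
  by (intro conjI continuous_on_mult exI[of _ "K * K'"] exI[of _ "m + m'"]) auto
qed

lemma wp_add: assumes "wp v" "wp w" shows "wp (%z. v z + w z)"
proof -
 obtain K m where K: "m >= 0" "!!z. abs (v z) <= K * (1 + enorm d z) powr m" using assms(1) unfolding wp_def by blast
 obtain K' m' where K': "m' >= 0" "!!z. abs (w z) <= K' * (1 + enorm d z) powr m'" using assms(2) unfolding wp_def by blast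
 have "abs (v z + w z) <= (abs K + abs K') * (1 + enorm d z) powr (m + m')" for z
 proof -
  let ?p = "%m. (1 + enorm d z) powr m"
  have "K * ?p m <= abs K * ?p (m + m')"
   using K K' by (intro mult_mono powr_mono) auto
  moreover have "K' * ?p m' <= abs K' * ?p (m + m')"
   using K K' by (intro mult_mono powr_mono) auto
  ultimately show ?thesis using K(2)[of z] K'(2)[of z] by (simp add: distrib_right)
 qed
 with K K' assms show ?thesis unfolding wp_def
  by (intro conjI continuous_on_add exI[of _ "abs K + abs K'"] exI[of _ "m + m'"]) auto
qed

lemma wp_diff: "wp v ==> wp w ==> wp (%z. v z - w z)"
 using wp_add[of v "%z. (-1) * w z"] wp_mult[OF wp_const[of "-1"], of w] by simp

lemma wp_sum: "finite I ==> (!!i. i \<in> I ==> wp (w i)) ==> wp (%z. \<Sum>i\<in>I. w i z)"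
 by (induction I rule: finite_induct) (auto intro!: wp_const wp_add)

lemma wp_abs: "wp w ==> wp (%z. abs (w z))"
 unfolding wp_def by (auto intro: continuous_on_rabs)

definition Ew :: "(real => (nat => real) => real) => ((nat => real) => real) => real => real => (nat => real) => real" where
 "Ew g w t sg x = (lint (gauss d) (%z. g t (gshift d x (sqrt sg) z) * w z))"

lemma wp_measurable: "wp w ==> w \<in> borel_measurable borel"
 unfolding wp_def by (auto intro: borel_measurable_continuous_onI)

lemma wp_measurable_gauss: "wp w ==> w \<in> borel_measurable (gauss d)"
 using measurable_compose[OF measurable_gauss_id wp_measurable] .

lemma Ew_cont:
 assumes g: "adm g" and w: "wp w" and a: "continuous_on S a" "!!p. p \<in> S ==> a p \<in> {0..T}"
  and "continuous_on S tau" "continuous_on S y"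
 shows "continuous_on (S :: 'p::metric_space set) (%p. Ew g w (a p) (tau p) (y p))"
proof -
 obtain K where K: "!!t x. t \<in> {0..T} ==> abs (g t x) <= K * wgt d x powr s" by (rule admD[OF g]) blast
 obtain K' m where K': "m >= 0" "!!z. abs (w z) <= K' * (1 + enorm d z) powr m" using w unfolding wp_def by blast
 show ?thesis unfolding Ew_def
  by (rule continuous_on_gauss_expectation(1)[OF d s K'(1) adm_cont[OF g] _ K wp_measurable_gauss[OF w] K'(2) a])
   (use assms in \<open>auto intro!: continuous_intros\<close>)
qed

lemma Ew_int:
 assumes g: "adm g" and w: "wp w" and t: "t \<in> {0..T}"
 shows "integrable (gauss d) (%z. g t (gshift d x c z) * w z)"
proof -
 obtain K where K: "!!t x. t \<in> {0..T} ==> abs (g t x) <= K * wgt d x powr s" by (rule admD[OF g]) blast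
 obtain K' m where K': "m >= 0" "!!z. abs (w z) <= K' * (1 + enorm d z) powr m" using w unfolding wp_def by blast
 show ?thesis
  by (rule continuous_on_gauss_expectation(2)[OF d s K'(1) adm_cont[OF g] _ K wp_measurable_gauss[OF w] K'(2), where S = "{} :: real set" and a = "%_. 0"])
   (use t in \<open>auto intro: continuous_on_empty\<close>)
qed

lemma adm_slice_cont: assumes "adm g" "t \<in> {0..T}" shows "continuous_on UNIV (g t)"
proof -
 have "continuous_on UNIV (%x. (%(t, x). g t x) (t, x))"
  by (rule continuous_on_compose2[OF adm_cont[OF assms(1)]]) (use assms(2) in \<open>auto intro!: continuous_intros\<close>)
 then show ?thesis by simp
qed

text \<open>Differentiation along an arbitrary curve of kernel parameters. All space and time
  derivatives are instances: each needs only the pointwise identity \<open>der\<close> for the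
  kernel, and the prefactors \<open>c0\<close> and \<open>c\<close> hold the powers of
  \<open>sg\<close>.\<close>

lemma gauss_deriv:
 fixes sg c c0 :: "real => real" and xi :: "real => nat => real"
 assumes g: "adm g" and t: "t \<in> {0..T}" and w0: "wp w0" and w: "wp w"
  and r: "r0 \<in> {lo<..<hi}" and pos: "!!r. r \<in> {lo<..<hi} ==> sg r > 0"
  and cont: "continuous_on {lo<..<hi} sg" "continuous_on {lo<..<hi} xi" "continuous_on {lo<..<hi} c"
  and meas: "sg \<in> borel_measurable borel" "xi \<in> borel_measurable borel" "c \<in> borel_measurable borel"
  and der: "!!r y. r \<in> {lo<..<hi} ==> ((%r. kern d (sg r) (xi r) y * (c0 r * w0 (unshift d (sg r) (xi r) y)))
   has_real_derivative kern d (sg r) (xi r) y * (c r * w (unshift d (sg r) (xi r) y))) (at r)"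
 shows "((%r. c0 r * Ew g w0 t (sg r) (xi r)) has_real_derivative c r0 * Ew g w t (sg r0) (xi r0)) (at r0)"
proof -
 interpret L: sigma_finite_measure "leb d" by (rule sigma_finite_leb)
 have gm: "g t \<in> borel_measurable borel"
  by (rule borel_measurable_continuous_onI[OF adm_slice_cont[OF g t]])
 let ?I = "{lo<..<hi}"
 define N where "N r y = g t y * (kern d (sg r) (xi r) y * (c0 r * w0 (unshift d (sg r) (xi r) y)))" for r y
 define D where "D r y = g t y * (kern d (sg r) (xi r) y * (c r * w (unshift d (sg r) (xi r) y)))" for r y
 have NE: "integrable (leb d) (N r)" "(lint (leb d) (%y. N r y)) = c0 r * Ew g w0 t (sg r) (xi r)" if r: "r \<in> ?I" for r
 proof -
  note * = gauss_kern[OF pos[OF r] gm wp_measurable[OF w0] Ew_int[OF g w0 t], of "xi r"]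
  have e: "N r y = c0 r * (kern d (sg r) (xi r) y * (g t y * w0 (unshift d (sg r) (xi r) y)))" for y
   by (simp add: N_def)
  show "integrable (leb d) (N r)" unfolding e[abs_def] by (intro Bochner_Integration.integrable_mult_right *(1))
  show "(lint (leb d) (%y. N r y)) = c0 r * Ew g w0 t (sg r) (xi r)" unfolding e Ew_def *(2) by simp
 qed
 have DE: "integrable (leb d) (D r)" "(lint (leb d) (%y. D r y)) = c r * Ew g w t (sg r) (xi r)"
  "(lint (leb d) (%y. abs (D r y))) = abs (c r) * Ew (%t x. abs (g t x)) (%z. abs (w z)) t (sg r) (xi r)" if r: "r \<in> ?I" for r
 proof -
  note * = gauss_kern[OF pos[OF r] gm wp_measurable[OF w] Ew_int[OF g w t], of "xi r"]
  have e: "D r y = c r * (kern d (sg r) (xi r) y * (g t y * w (unshift d (sg r) (xi r) y)))" for y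
   by (simp add: D_def)
  show "integrable (leb d) (D r)" unfolding e[abs_def] by (intro Bochner_Integration.integrable_mult_right *(1))
  show "(lint (leb d) (%y. D r y)) = c r * Ew g w t (sg r) (xi r)" unfolding e Ew_def *(2) by simp
  have gm': "(%x. abs (g t x)) \<in> borel_measurable borel" using gm by simp
  note ** = gauss_kern(2)[OF pos[OF r] gm' wp_measurable[OF wp_abs[OF w]] Ew_int[OF adm_abs[OF g] wp_abs[OF w] t], of "xi r"]
  have e': "abs (D r y) = abs (c r) * (kern d (sg r) (xi r) y * (abs (g t y) * abs (w (unshift d (sg r) (xi r) y))))" for y
   using kern_nonneg[OF pos[OF r], of d "xi r" y] by (simp add: e abs_mult)
  show "(lint (leb d) (%y. abs (D r y))) = abs (c r) * Ew (%t x. abs (g t x)) (%z. abs (w z)) t (sg r) (xi r)"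
   unfolding e' Ew_def ** by simp
 qed
 have "((%r. lint (leb d) (%y. N r y)) has_real_derivative (lint (leb d) (%y. D r0 y))) (at r0)"
 proof (rule L.has_derivative_under_integral[OF _ _ NE(1) DE(1) _ _ _ r])
  show "((%r. N r y) has_real_derivative D r y) (at r)" if "r \<in> ?I" for r y
   unfolding N_def D_def by (rule DERIV_cmult[OF der[OF that]])
  have "continuous_on ?I (%r. c r * Ew g w t (sg r) (xi r))"
   by (intro continuous_on_mult cont Ew_cont g w continuous_on_const) (use t in auto)
  then show "continuous_on ?I (%r. lint (leb d) (%y. D r y))"
   by (rule continuous_on_eq) (use DE in auto)
  have "continuous_on ?I (%r. abs (c r) * Ew (%t x. abs (g t x)) (%z. abs (w z)) t (sg r) (xi r))"
   by (intro continuous_on_mult continuous_on_rabs cont Ew_cont adm_abs[OF g] wp_abs[OF w] continuous_on_const) (use t in auto)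
  then show "continuous_on ?I (%r. lint (leb d) (%y. abs (D r y)))"
   by (rule continuous_on_eq) (use DE in auto)
  have ww: "continuous_on UNIV w" using w by (simp add: wp_def)
  have xi: "continuous_on ?I (%r. xi r i)" for i by (rule continuous_on_coord[OF cont(2)])
  have sne: "sqrt (sg r) ~= 0" "sg r ~= 0" "sqrt (2 * pi * sg r) ~= 0" "2 * sg r ~= 0" if "r \<in> ?I" for r using pos[OF that] by auto
  have cu: "continuous_on ?I (%r. unshift d (sg r) (xi r) y)" for y
   unfolding unshift_def
   by (intro continuous_on_shift continuous_on_const continuous_on_coordinatewise_then_product continuous_on_divide continuous_on_minus continuous_on_real_sqrt cont xi)
    (use sne in auto)
  have ck: "continuous_on ?I (%r. kern d (sg r) (xi r) y)" for y
   unfolding kern_def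
   by (intro continuous_on_mult continuous_on_power continuous_on_divide continuous_on_const continuous_on_exp continuous_on_minus
     continuous_on_sum continuous_on_diff continuous_on_real_sqrt cont xi) (use sne in auto)
  show "continuous_on ?I (%r. D r y)" for y
   unfolding D_def
   by (intro continuous_on_mult continuous_on_const ck cont continuous_on_compose2[OF ww cu]) auto
  show "(%(r, y). D r y) \<in> borel_measurable (borel \<Otimes>\<^sub>M leb d)"
  proof -
   have m1: "(%p. sg (fst p)) \<in> borel_measurable (borel \<Otimes>\<^sub>M leb d)" "(%p. xi (fst p)) \<in> borel_measurable (borel \<Otimes>\<^sub>M leb d)"
    "(%p. c (fst p)) \<in> borel_measurable (borel \<Otimes>\<^sub>M leb d)"
    by (rule measurable_compose[OF measurable_fst] meas)+
   have m2: "(%p. snd p) \<in> borel_measurable (borel \<Otimes>\<^sub>M leb d)"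
    by (rule measurable_compose[OF measurable_snd measurable_leb_id])
   have m3: "(%p. unshift d (sg (fst p)) (xi (fst p)) (snd p)) \<in> borel_measurable (borel \<Otimes>\<^sub>M leb d)"
    unfolding unshift_def
   proof (intro measurable_shift m2 measurable_coordinatewise_then_product)
    show "(%p. - xi (fst p) i / sqrt (sg (fst p))) \<in> borel_measurable (borel \<Otimes>\<^sub>M leb d)" for i
     using m1(1) measurable_compose[OF m1(2) measurable_product_coordinates[of i]] by measurable
   qed (use m1(1) in measurable)
   show ?thesis unfolding D_def case_prod_beta'
    by (intro borel_measurable_times borel_measurable_kern m1 m2 measurable_compose[OF m2 gm] measurable_compose[OF m3 wp_measurable[OF w]])
  qed
 qed
 then have "((%r. lint (leb d) (%y. N r y)) has_real_derivative c r0 * Ew g w t (sg r0) (xi r0)) (at r0)"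
  using DE(2)[OF r] by simp
 then show ?thesis
  by (rule has_field_derivative_transform_within_open[where S = ?I]) (use r NE(2) in auto)
qed

text \<open>\<open>Q0\<close> is the heat semigroup; the other three are its derivatives in
  \<open>x\<close> and in \<open>sg\<close>. Hermite polynomials in the Gaussian variable carry the
  differentiation, so \<open>g\<close> may be merely continuous.\<close>

definition Q0 where "Q0 g t sg x = Ew g (%_. 1) t sg x"
definition Q1 where "Q1 g i t sg x = 1 / sqrt sg * Ew g (%z. z i) t sg x"
definition Q2 where "Q2 g i j t sg x = 1 / sg * Ew g (%z. z i * z j - (if i = j then 1 else 0)) t sg x"
definition Qt where "Qt g t sg x = 1 / (2 * sg) * Ew g (%z. (\<Sum>i<d. (z i)\<^sup>2) - real d) t sg x"

lemma wp_Q2: "i < d ==> j < d ==> wp (%z. z i * z j - (if i = j then 1 else 0))"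
 by (intro wp_diff wp_mult wp_coord wp_const)

lemma wp_Qt: "wp (%z. (\<Sum>i<d. (z i)\<^sup>2) - real d)"
 unfolding power2_eq_square by (intro wp_diff wp_sum wp_mult wp_coord wp_const) auto

lemma Q0_Q1:
 assumes g: "adm g" and t: "t \<in> {0..T}" and sg: "sg > 0" and i: "i < d"
 shows "((%r. Q0 g t sg (x(i := r))) has_real_derivative Q1 g i t sg x) (at (x i))"
proof -
 have "((%r. 1 * Ew g (%_. 1) t sg (x(i := r))) has_real_derivative 1 / sqrt sg * Ew g (%z. z i) t sg (x(i := x i))) (at (x i))"
 proof (rule gauss_deriv[OF g t wp_const wp_coord[OF i], where lo = "x i - 1" and hi = "x i + 1"])
  show "((%r. kern d sg (x(i := r)) y * (1 * 1)) has_real_derivative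
    kern d sg (x(i := r)) y * (1 / sqrt sg * unshift d sg (x(i := r)) y i)) (at r)" for r y
   using kern_dx[OF i sg, of x y r] sg i by (simp add: unshift_apply)
  have c: "continuous_on S (%r. x(i := r))" for S
  proof (rule continuous_on_coordinatewise_then_product)
   show "continuous_on S (%r. (x(i := r)) j)" for j by (cases "j = i") auto
  qed
  show "continuous_on {x i - 1<..<x i + 1} (%r. x(i := r))" by (rule c)
  show "(%r. x(i := r)) \<in> borel_measurable borel" by (rule borel_measurable_continuous_onI[OF c])
 qed (use sg in auto)
 then show ?thesis by (simp add: Q0_def Q1_def)
qed

lemma Q1_Q2:
 assumes g: "adm g" and t: "t \<in> {0..T}" and sg: "sg > 0" and i: "i < d" and j: "j < d"
 shows "((%r. Q1 g i t sg (x(j := r))) has_real_derivative Q2 g i j t sg x) (at (x j))"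
proof -
 have "((%r. 1 / sqrt sg * Ew g (%z. z i) t sg (x(j := r))) has_real_derivative
   1 / sg * Ew g (%z. z i * z j - (if i = j then 1 else 0)) t sg (x(j := x j))) (at (x j))"
 proof (rule gauss_deriv[OF g t wp_coord[OF i] wp_Q2[OF i j], where lo = "x j - 1" and hi = "x j + 1"])
  fix r y
  have eq: "(1 / sqrt sg) * unshift d sg (x(j := r)) y i = (y i - (x(j := r)) i) / sg" for r
   using i sg by (simp add: unshift_apply)
  have lin: "((%r. (y i - (x(j := r)) i) / sg) has_real_derivative (- (if i = j then 1 else 0) / sg)) (at r)"
   using sg by (cases "i = j") (auto intro!: derivative_eq_intros)
  have "((%r. kern d sg (x(j := r)) y * ((y i - (x(j := r)) i) / sg)) has_real_derivative
    kern d sg (x(j := r)) y * ((y j - r) / sg) * ((y i - (x(j := r)) i) / sg) + (- (if i = j then 1 else 0) / sg) * kern d sg (x(j := r)) y) (at r)"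
   by (rule DERIV_mult[OF kern_dx[OF j sg] lin])
  also have "kern d sg (x(j := r)) y * ((y j - r) / sg) * ((y i - (x(j := r)) i) / sg) + (- (if i = j then 1 else 0) / sg) * kern d sg (x(j := r)) y
    = kern d sg (x(j := r)) y * (1 / sg * (unshift d sg (x(j := r)) y i * unshift d sg (x(j := r)) y j - (if i = j then 1 else 0)))"
   using i j sg by (simp add: unshift_apply field_simps)
  finally show "((%r. kern d sg (x(j := r)) y * (1 / sqrt sg * unshift d sg (x(j := r)) y i)) has_real_derivative
    kern d sg (x(j := r)) y * (1 / sg * (unshift d sg (x(j := r)) y i * unshift d sg (x(j := r)) y j - (if i = j then 1 else 0)))) (at r)"
   unfolding eq .
 next
  have c: "continuous_on S (%r. x(j := r))" for S
  proof (rule continuous_on_coordinatewise_then_product)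
   show "continuous_on S (%r. (x(j := r)) k)" for k by (cases "k = j") auto
  qed
  show "continuous_on {x j - 1<..<x j + 1} (%r. x(j := r))" by (rule c)
  show "(%r. x(j := r)) \<in> borel_measurable borel" by (rule borel_measurable_continuous_onI[OF c])
 qed (use sg in auto)
 then show ?thesis by (simp add: Q1_def Q2_def)
qed

lemma Q0_Qt:
 assumes g: "adm g" and t: "t \<in> {0..T}" and sg: "sg > 0"
 shows "((%sg. Q0 g t sg x) has_real_derivative Qt g t sg x) (at sg)"
proof -
 have "((%r. 1 * Ew g (%_. 1) t r x) has_real_derivative 1 / (2 * sg) * Ew g (%z. (\<Sum>i<d. (z i)\<^sup>2) - real d) t sg x) (at sg)"
 proof (rule gauss_deriv[OF g t wp_const wp_Qt, where lo = 0 and hi = "sg + 1"])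
  show "((%r. kern d r x y * (1 * 1)) has_real_derivative
    kern d r x y * (1 / (2 * r) * ((\<Sum>i<d. (unshift d r x y i)\<^sup>2) - real d))) (at r)" if "r \<in> {0<..<sg + 1}" for r y
   using kern_dsg[of r d x y] that by simp
 qed (use sg in \<open>auto intro!: continuous_intros\<close>)
 then show ?thesis by (simp add: Q0_def Qt_def)
qed

text \<open>The heat equation for \<open>Q0\<close>, in the form that the diagonal second Hermite
  polynomials add up to the weight of \<open>Qt\<close>.\<close>

lemma Qt_Q2:
 assumes g: "adm g" and t: "t \<in> {0..T}" and sg: "sg > 0"
 shows "Qt g t sg x = 1 / 2 * (\<Sum>i<d. Q2 g i i t sg x)"
proof -
 have "(\<Sum>i<d. Ew g (%z. z i * z i - 1) t sg x) = (lint (gauss d) (%z. (\<Sum>i<d. g t (gshift d x (sqrt sg) z) * (z i * z i - 1))))"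
  unfolding Ew_def
  by (rule Bochner_Integration.integral_sum[symmetric]) (use Ew_int[OF g wp_Q2 t] in fastforce)
 also have "... = Ew g (%z. (\<Sum>i<d. (z i)\<^sup>2) - real d) t sg x"
  unfolding Ew_def by (simp add: sum_subtractf power2_eq_square flip: sum_distrib_left)
 finally have "(\<Sum>i<d. Ew g (%z. z i * z i - 1) t sg x) = Ew g (%z. (\<Sum>i<d. (z i)\<^sup>2) - real d) t sg x" .
 moreover have "(\<Sum>i<d. Q2 g i i t sg x) = 1 / sg * (\<Sum>i<d. Ew g (%z. z i * z i - 1) t sg x)"
  unfolding Q2_def sum_distrib_left by simp
 ultimately show ?thesis by (simp add: Qt_def)
qed

lemma Q_cont:
 assumes g: "adm g"
 shows "continuous_on ({0..T} \<times> {0<..} \<times> UNIV) (%(t, sg, x). Q0 g t sg x)"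
  "i < d ==> continuous_on ({0..T} \<times> {0<..} \<times> UNIV) (%(t, sg, x). Q1 g i t sg x)"
  "i < d ==> j < d ==> continuous_on ({0..T} \<times> {0<..} \<times> UNIV) (%(t, sg, x). Q2 g i j t sg x)"
  "continuous_on ({0..T} \<times> {0<..} \<times> UNIV) (%(t, sg, x). Qt g t sg x)"
proof -
 let ?S = "{0..T} \<times> {0::real<..} \<times> (UNIV :: (nat => real) set)"
 have E: "continuous_on ?S (%p. Ew g w (fst p) (fst (snd p)) (snd (snd p)))" if "wp w" for w
  by (rule Ew_cont[OF g that]) (auto intro!: continuous_intros)
 show "continuous_on ?S (%(t, sg, x). Q0 g t sg x)"
  unfolding case_prod_beta' Q0_def by (rule E[OF wp_const])
 show "continuous_on ?S (%(t, sg, x). Q1 g i t sg x)" if "i < d"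
  unfolding case_prod_beta' Q1_def by (intro continuous_on_mult E wp_coord that continuous_intros) auto
 show "continuous_on ?S (%(t, sg, x). Q2 g i j t sg x)" if "i < d" "j < d"
  unfolding case_prod_beta' Q2_def by (intro continuous_on_mult E wp_Q2 that continuous_intros) auto
 show "continuous_on ?S (%(t, sg, x). Qt g t sg x)"
  unfolding case_prod_beta' Qt_def by (intro continuous_on_mult E wp_Qt continuous_intros) auto
qed

text \<open>The Duhamel integral over \<open>s\<close> from \<open>t\<close> to \<open>T\<close>
  with all kernel times increased by \<open>eps\<close>, transported to the unit interval so that
  its domain is fixed.\<close>

definition jj where
 "jj Q eps t x = (T - t) * integral {0..1} (%r. Q (t + (T - t) * r) ((T - t) * r + eps) x)"

lemma jj_arg:
 assumes Q: "continuous_on ({0..T} \<times> {0<..} \<times> UNIV) (%(t, sg, x). Q t sg x)" and eps: "eps > (0::real)"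
  and "continuous_on S a" "continuous_on S b" "continuous_on S y" "!!p. p \<in> S ==> a p \<in> {0..T} \<and> b p \<in> {0..1}"
 shows "continuous_on S (%p. Q (a p + (T - a p) * b p) ((T - a p) * b p + eps) (y p) :: real)"
proof -
 have "continuous_on S (%p. (%(t, sg, x). Q t sg x) (a p + (T - a p) * b p, (T - a p) * b p + eps, y p))"
 proof (rule continuous_on_compose2[OF Q])
  show "(%p. (a p + (T - a p) * b p, (T - a p) * b p + eps, y p)) ` S \<subseteq> {0..T} \<times> {0<..} \<times> UNIV"
  proof
   fix w assume "w \<in> (%p. (a p + (T - a p) * b p, (T - a p) * b p + eps, y p)) ` S"
   then obtain p where p: "p \<in> S" "w = (a p + (T - a p) * b p, (T - a p) * b p + eps, y p)" by auto
   have "a p + (T - a p) * b p \<in> {0..T}" using assms(6)[OF p(1)] by (intro source_time_in) auto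
   moreover have "0 <= (T - a p) * b p" using assms(6)[OF p(1)] by auto
   ultimately show "w \<in> {0..T} \<times> {0<..} \<times> UNIV" using eps p by auto
  qed
 qed (intro continuous_intros assms)
 then show ?thesis by simp
qed

lemma jj_cont:
 fixes Q :: "real => real => (nat => real) => real"
 assumes Q: "continuous_on ({0..T} \<times> {0<..} \<times> UNIV) (%(t, sg, x). Q t sg x)" and eps: "eps > 0"
 shows "continuous_on ({0..T} \<times> UNIV) (%p. jj Q eps (fst p) (snd p))"
 unfolding jj_def
proof (intro continuous_on_mult continuous_on_diff continuous_on_const continuous_on_fst continuous_on_id)
 have "continuous_on ({0..T} \<times> UNIV) (%p::real \<times> (nat => real). integral (cbox 0 1) (%r::real. Q (fst p + (T - fst p) * r) ((T - fst p) * r + eps) (snd p)))"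
  by (rule integral_continuous_on_param, unfold case_prod_beta', rule jj_arg[OF Q eps]) (auto intro!: continuous_intros)
 then show "continuous_on ({0..T} \<times> UNIV) (%p. integral {0..1} (%r. Q (fst p + (T - fst p) * r) ((T - fst p) * r + eps) (snd p)))"
  by simp
qed

lemma continuous_on_fun_upd_real:
 "continuous_on S f ==> continuous_on S (%p. (x :: nat => real)(i := f p))"
proof (rule continuous_on_coordinatewise_then_product)
 show "continuous_on S f ==> continuous_on S (%r. (x(i := f r)) j)" for j by (cases "j = i") auto
qed

lemma jj_dx:
 fixes Q Q' :: "real => real => (nat => real) => real"
 assumes Q: "continuous_on ({0..T} \<times> {0<..} \<times> UNIV) (%(t, sg, x). Q t sg x)"
  and Q': "continuous_on ({0..T} \<times> {0<..} \<times> UNIV) (%(t, sg, x). Q' t sg x)" and eps: "eps > 0"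
  and der: "!!t sg x. t \<in> {0..T} ==> sg > 0 ==> ((%r. Q t sg (x(i := r))) has_real_derivative Q' t sg x) (at (x i))"
  and t: "t \<in> {0..T}"
 shows "((%r. jj Q eps t (x(i := r))) has_real_derivative jj Q' eps t x) (at (x i))"
proof -
 have "((%r'. integral (cbox 0 1) (%r. Q (t + (T - t) * r) ((T - t) * r + eps) (x(i := r')))) has_real_derivative
   integral (cbox 0 1) (%r. Q' (t + (T - t) * r) ((T - t) * r + eps) (x(i := x i)))) (at (x i) within UNIV)"
 proof (rule leibniz_rule_field_derivative)
  fix r' r :: real assume r: "r \<in> cbox 0 1"
  have "t + (T - t) * r \<in> {0..T}" "(T - t) * r + eps > 0"
   using r t eps by (auto simp del: atLeastAtMost_iff intro!: source_time_in add_nonneg_pos mult_nonneg_nonneg) auto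
  from der[OF this, of "x(i := r')"]
  show "((%r'. Q (t + (T - t) * r) ((T - t) * r + eps) (x(i := r'))) has_real_derivative Q' (t + (T - t) * r) ((T - t) * r + eps) (x(i := r'))) (at r' within UNIV)"
   by simp
 next
  show "(%r. Q (t + (T - t) * r) ((T - t) * r + eps) (x(i := r'))) integrable_on cbox 0 1" for r'
   by (rule integrable_continuous, rule jj_arg[OF Q eps]) (use t in \<open>auto intro!: continuous_intros\<close>)
  show "continuous_on (UNIV \<times> cbox 0 1) (%(r', r). Q' (t + (T - t) * r) ((T - t) * r + eps) (x(i := r')))"
   unfolding case_prod_beta'
   by (rule jj_arg[OF Q' eps]) (use t in \<open>auto intro!: continuous_intros continuous_on_fun_upd_real\<close>)
 qed auto
 then show ?thesis unfolding jj_def by (intro DERIV_cmult) simp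
qed

text \<open>For the time derivative the substitution to the unit interval is undone. Otherwise
  \<open>t\<close> would enter the first argument of \<open>Q\<close>, in which nothing is
  differentiable.\<close>

lemma jj_dt:
 fixes Q Q' :: "real => real => (nat => real) => real"
 assumes Q: "continuous_on ({0..T} \<times> {0<..} \<times> UNIV) (%(t, sg, x). Q t sg x)"
  and Q': "continuous_on ({0..T} \<times> {0<..} \<times> UNIV) (%(t, sg, x). Q' t sg x)" and eps: "eps > 0"
  and der: "!!t sg x. t \<in> {0..T} ==> sg > 0 ==> ((%sg. Q t sg x) has_real_derivative Q' t sg x) (at sg)"
  and t: "t \<in> {0<..<T}"
 shows "((%t. jj Q eps t x) has_real_derivative (- Q t eps x - jj Q' eps t x)) (at t)"
proof -
 have sl: "continuous_on ({0..T} \<times> {0<..}) (%(s, sg). P s sg x)"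
  if P: "continuous_on ({0..T} \<times> {0<..} \<times> UNIV) (%(t, sg, x). P t sg x)" for P :: "real => real => (nat => real) => real"
 proof -
  have "continuous_on ({0..T} \<times> {0<..}) (%p. (%(t, sg, x). P t sg x) (fst p, snd p, x))"
   by (rule continuous_on_compose2[OF P]) (auto intro!: continuous_intros)
  then show ?thesis by (simp add: case_prod_beta')
 qed
 have eq: "jj P eps t x = integral {t..T} (%s. P s (s - t + eps) x)" if "t \<in> {0..T}"
  and P: "continuous_on ({0..T} \<times> {0<..} \<times> UNIV) (%(t, sg, x). P t sg x)" for t and P :: "real => real => (nat => real) => real"
 proof -
  have "continuous_on {t..T} (%s. (%(t, sg, x). P t sg x) (s, s - t + eps, x))"
   by (rule continuous_on_compose2[OF P]) (use that eps in \<open>auto intro!: continuous_intros\<close>)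
  then have "continuous_on {t..T} (%s. P s (s - t + eps) x)" by simp
  from integral_unit_substitution[OF this] show ?thesis using that by (simp add: jj_def)
 qed
 have "((%t. integral {t..T} (%s. Q s (s - t + eps) x)) has_real_derivative (- Q t eps x - integral {t..T} (%s. Q' s (s - t + eps) x))) (at t)"
  by (rule has_derivative_moving_integral[OF eps sl[OF Q] sl[OF Q'] der t])
 then have "((%t. integral {t..T} (%s. Q s (s - t + eps) x)) has_real_derivative (- Q t eps x - jj Q' eps t x)) (at t)"
  using eq[OF _ Q', of t] t by simp
 then show ?thesis
  by (rule has_field_derivative_transform_within_open[where S = "{0<..<T}"]) (use t eq[OF _ Q] in auto)
qed

end

section \<open>Classical approximations of mild solutions\<close>

lemma second_derivative_max:
 fixes f f' :: "real => real"
 assumes f: "!!s. s \<in> {a<..<b} ==> (f has_real_derivative f' s) (at s)"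
  and f': "(f' has_real_derivative D) (at m)" and m: "m \<in> {a<..<b}"
  and max: "!!s. s \<in> {a<..<b} ==> f s <= f m"
 shows "f' m = 0" "D <= 0"
proof -
 show 0: "f' m = 0"
 proof (rule DERIV_local_max[OF f[OF m]])
  show "0 < min (m - a) (b - m)" using m by auto
  show "\<forall>y. abs (m - y) < min (m - a) (b - m) --> f y <= f m"
   by (intro allI impI max) (auto simp: abs_less_iff)
 qed
 show "D <= 0"
 proof (rule ccontr)
  assume "\<not> D <= 0"
  then have "D > 0" by simp
  from DERIV_pos_inc_right[OF f' this] obtain e where e: "e > 0" "!!h. h > 0 ==> h < e ==> f' m < f' (m + h)" by auto
  define h where "h = min (e / 2) ((b - m) / 2)"
  have h1: "h <= e / 2" and h2: "h <= (b - m) / 2" by (simp_all only: h_def min.cobounded1 min.cobounded2)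
  have mb: "m < b" using m by simp
  then have "h > 0" using e by (simp add: h_def)
  moreover have "h < e" using h1 e by linarith
  moreover have "m + h < b" using h2 mb by argo
  ultimately have h: "h > 0" "h < e" "m + h < b" by blast+
  have "\<exists>z. m < z \<and> z < m + h \<and> f (m + h) - f m = (m + h - m) * f' z"
   by (rule MVT2) (use h m f in auto)
  then obtain z where z: "m < z" "z < m + h" "f (m + h) - f m = h * f' z" by auto
  have "f' z > 0" using e(2)[of "z - m"] z h 0 by auto
  then have "f (m + h) > f m" using z h by (metis diff_gt_0_iff_gt mult_pos_pos)
  moreover have "f (m + h) <= f m" using max[of "m + h"] h m by auto
  ultimately show False by simp
 qed
qed

text \<open>A basic open set constrains the coordinates one by one, and beyond the first
  \<open>d\<close> all points of \<open>Rd d\<close> agree; finitely many radii are left and their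
  minimum is positive.\<close>

lemma Rd_box_subset_open:
 assumes U: "open U" and x: "x \<in> U" "x \<in> Rd d"
 shows "\<exists>rho>0. \<forall>y\<in>Rd d. (\<forall>i<d. abs (y i - x i) <= rho) --> y \<in> U"
proof -
 have "openin (product_topology (%i. euclidean) UNIV) U"
  using U by (simp add: euclidean_product_topology)
 from product_topology_open_contains_basis[OF this x(1)]
 obtain X where X: "x \<in> (\<Pi>\<^sub>E i\<in>UNIV. X i)" "!!i. open (X i)" "(\<Pi>\<^sub>E i\<in>UNIV. X i) \<subseteq> U" by auto
 have "\<exists>rho. \<forall>i. rho i > 0 \<and> ball (x i) (rho i) \<subseteq> X i"
 proof (rule choice, rule allI)
  fix i show "\<exists>r>0. ball (x i) r \<subseteq> X i"
   using X(1) X(2)[of i] by (auto simp: open_contains_ball)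
 qed
 then obtain rho where rho: "!!i. rho i > 0" "!!i. ball (x i) (rho i) \<subseteq> X i" by blast
 define r where "r = Min (insert 1 (rho ` {..<d})) / 2"
 have r0: "Min (insert 1 (rho ` {..<d})) > 0" using rho by (subst Min_gr_iff) auto
 have r: "r > 0" "!!i. i < d ==> r < rho i"
 proof -
  show "r > 0" using r0 by (simp add: r_def)
  fix i assume "i < d"
  then have "Min (insert 1 (rho ` {..<d})) <= rho i" by (intro Min_le) auto
  then show "r < rho i" using r0 unfolding r_def by linarith
 qed
 show ?thesis
 proof (intro exI[of _ r] conjI ballI impI)
  fix y assume y: "y \<in> Rd d" "\<forall>i<d. abs (y i - x i) <= r"
  have "y i \<in> X i" for i
  proof (cases "i < d")
   case True
   then have "dist (x i) (y i) < rho i" using y r by (force simp: dist_real_def abs_minus_commute)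
   then show ?thesis using rho(2)[of i] by auto
  next
   case False
   then have "y i = x i" using y x by (auto simp: Rd_def PiE_def extensional_def)
   then show ?thesis using X(1) by auto
  qed
  then show "y \<in> U" using X(3) by auto
 qed (rule r)
qed

definition box :: "nat => (nat => real) => real => (nat => real) set" where
 "box d x R = {y \<in> Rd d. \<forall>i<d. abs (y i - x i) <= R}"

text \<open>Tychonoff: compact intervals in the first \<open>d\<close> coordinates, singletons
  \<open>{undefined}\<close> in all others.\<close>

lemma compact_box: "compact (box d x R)"
proof -
 have "box d x R = (\<Pi>\<^sub>E i\<in>UNIV. if i < d then {x i - R..x i + R} else {undefined})"
 proof (intro set_eqI iffI)
  fix y assume y: "y \<in> box d x R"
  have "y i \<in> (if i < d then {x i - R..x i + R} else {undefined})" for i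
  proof (cases "i < d")
   case True
   then have "abs (y i - x i) <= R" using y by (simp add: box_def)
   then have "x i - R <= y i" "y i <= x i + R" by linarith+
   then show ?thesis using True by simp
  next
   case False
   then show ?thesis using y by (auto simp: box_def Rd_def PiE_def extensional_def)
  qed
  then show "y \<in> (\<Pi>\<^sub>E i\<in>UNIV. if i < d then {x i - R..x i + R} else {undefined})" by auto
 next
  fix y assume "y \<in> (\<Pi>\<^sub>E i\<in>UNIV. if i < d then {x i - R..x i + R} else {undefined})"
  then have y: "y i \<in> (if i < d then {x i - R..x i + R} else {undefined})" for i by (rule PiE_mem) simp
  have "abs (y i - x i) <= R" if "i < d" for i
  proof -
   have "x i - R <= y i" "y i <= x i + R" using y[of i] that by auto
   then show ?thesis by linarith
  qed
  moreover have "y i = undefined" if "\<not> i < d" for i using y[of i] that by simp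
  ultimately show "y \<in> box d x R" by (auto simp: box_def Rd_def PiE_def extensional_def)
 qed
 moreover have "compactin (product_topology (%i::nat. euclidean) UNIV) (\<Pi>\<^sub>E i\<in>UNIV. if i < d then {x i - R..x i + R} else {undefined})"
  unfolding compactin_PiE by auto
 ultimately show ?thesis by (simp add: euclidean_product_topology)
qed

lemma restrict_Rd: "x \<in> Rd d ==> restrict x {..<d} = x"
 by (simp add: Rd_def PiE_restrict)

lemma restrict_in_Rd[simp]: "restrict x {..<d} \<in> Rd d" by (simp add: Rd_def)

lemma upd_Rd[simp]: "x \<in> Rd d ==> i < d ==> x(i := r) \<in> Rd d"
 by (auto simp: Rd_def PiE_def extensional_def)

lemma gshift_restrict[simp]: "gshift d (restrict x {..<d}) c z = gshift d x c z"
 by (auto simp: gshift_def)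

lemma gshift_0[simp]: "gshift d x 0 z = restrict x {..<d}"
 by (auto simp: gshift_def)

lemma is_C12_add:
 assumes "is_C12 d T ph pht phx phxx" "is_C12 d T psi psit psix psixx"
 shows "is_C12 d T (%t x. ph t x + psi t x) (%t x. pht t x + psit t x) (%i t x. phx i t x + psix i t x) (%i j t x. phxx i j t x + psixx i j t x)"
 using assms unfolding is_C12_def case_prod_beta'
 by (auto intro!: DERIV_add continuous_on_add)

lemma is_C12_uminus:
 assumes "is_C12 d T ph pht phx phxx"
 shows "is_C12 d T (%t x. - ph t x) (%t x. - pht t x) (%i t x. - phx i t x) (%i j t x. - phxx i j t x)"
 using assms unfolding is_C12_def case_prod_beta'
 by (auto intro!: DERIV_minus continuous_on_minus)

lemma source_restrict: "source d T F t (restrict x {..<d}) = source d T F t x"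
 by (simp add: source_def source_arg_def)

lemma heat_restrict: "heat d tau h (restrict x {..<d}) = heat d tau h x"
 by (simp add: heat_def)

lemma heat_0: "heat d 0 h x = h (restrict x {..<d})"
proof -
 interpret prob_space "gauss d" by (rule prob_space_gauss)
 show ?thesis by (simp add: heat_def prob_space)
qed

context heat_setting
begin

lemma adm_of_adm0: "adm0 h ==> adm (%_. h)"
 unfolding adm_def adm0_def case_prod_beta'
 by (auto intro!: continuous_on_compose2[of UNIV h] continuous_intros)

text \<open>\<open>Wc\<close> solves the linear heat equation with source \<open>g\<close> up to an error that vanishes with \<open>eps\<close>:
 all kernel times are shifted by \<open>eps\<close>, hence its derivatives \<open>Wct\<close>, \<open>Wcx\<close>, \<open>Wcxx\<close> exist.  \<open>Wl\<close> is the same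
 function as one Gaussian average, which has a limit as \<open>eps\<close> tends to 0.\<close>

definition Wc where "Wc h g eps t x = Q0 (%_. h) 0 (T - t + eps) x + jj (Q0 g) eps t x"
definition Wct where "Wct h g eps t x = - Qt (%_. h) 0 (T - t + eps) x + (- Q0 g t eps x - jj (Qt g) eps t x)"
definition Wcx where "Wcx h g eps i t x = Q1 (%_. h) i 0 (T - t + eps) x + jj (Q1 g i) eps t x"
definition Wcxx where "Wcxx h g eps i j t x = Q2 (%_. h) i j 0 (T - t + eps) x + jj (Q2 g i j) eps t x"

lemma Wc_C12:
 assumes g: "adm g" and h: "adm0 h" and eps: "eps > 0"
 shows "is_C12 d T (Wc h g eps) (Wct h g eps) (Wcx h g eps) (Wcxx h g eps)"
proof -
 note h' = adm_of_adm0[OF h]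
 let ?S = "{0<..<T} \<times> Rd d"
 have T0: "(0::real) \<in> {0..T}" using T by simp
 have jc: "continuous_on ?S (%p. jj Q eps (fst p) (snd p))" if "continuous_on ({0..T} \<times> {0<..} \<times> UNIV) (%(t, sg, x). Q t sg x)" for Q
  by (rule continuous_on_subset[OF jj_cont[OF that eps]]) auto
 have hc: "continuous_on ?S (%p. Q 0 (T - fst p + eps) (snd p))" if "continuous_on ({0..T} \<times> {0<..} \<times> UNIV) (%(t, sg, x). Q t sg x)"
  for Q :: "real => real => (nat => real) => real"
 proof -
  have "continuous_on ?S (%p. (%(t, sg, x). Q t sg x) (0, T - fst p + eps, snd p))"
   by (rule continuous_on_compose2[OF that]) (use T eps in \<open>auto intro!: continuous_intros add_nonneg_pos\<close>)
  then show ?thesis by simp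
 qed
 have gc: "continuous_on ?S (%p. Q0 g (fst p) eps (snd p))"
 proof -
  have "continuous_on ?S (%p. (%(t, sg, x). Q0 g t sg x) (fst p, eps, snd p))"
   by (rule continuous_on_compose2[OF Q_cont(1)[OF g]]) (use T eps in \<open>auto intro!: continuous_intros\<close>)
  then show ?thesis by simp
 qed
 have pos: "T - t + eps > 0" if "t \<in> {0<..<T}" for t using that eps by auto
 show ?thesis
  unfolding is_C12_def case_prod_beta'
 proof (intro conjI allI impI)
  fix t x assume t: "t \<in> {0<..<T}" and x: "x \<in> Rd d"
  then have t': "t \<in> {0..T}" by auto
  show "((%s. Wc h g eps s x) has_real_derivative Wct h g eps t x) (at t)"
   unfolding Wc_def Wct_def
  proof (rule DERIV_add)
   have "((%s. T - s + eps) has_real_derivative (-1)) (at t)" by (auto intro!: derivative_eq_intros)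
   from DERIV_chain2[OF Q0_Qt[OF h' T0 pos[OF t]] this]
   show "((%s. Q0 (%_. h) 0 (T - s + eps) x) has_real_derivative - Qt (%_. h) 0 (T - t + eps) x) (at t)" by simp
   show "((%s. jj (Q0 g) eps s x) has_real_derivative - Q0 g t eps x - jj (Qt g) eps t x) (at t)"
    by (rule jj_dt[OF Q_cont(1)[OF g] Q_cont(4)[OF g] eps Q0_Qt[OF g] t])
  qed
  fix i assume i: "i < d"
  show "((%s. Wc h g eps t (x(i := s))) has_real_derivative Wcx h g eps i t x) (at (x i))"
   unfolding Wc_def Wcx_def
   by (intro DERIV_add Q0_Q1 h' T0 pos t i jj_dx[OF Q_cont(1)[OF g] Q_cont(2)[OF g i] eps _ t'] g)
  fix j assume j: "j < d"
  show "((%s. Wcx h g eps i t (x(j := s))) has_real_derivative Wcxx h g eps i j t x) (at (x j))"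
   unfolding Wcx_def Wcxx_def
   by (intro DERIV_add Q1_Q2 h' T0 pos t i j jj_dx[OF Q_cont(2)[OF g i] Q_cont(3)[OF g i j] eps _ t'] g)
 next
  show "continuous_on ?S (%p. Wc h g eps (fst p) (snd p))"
   unfolding Wc_def by (intro continuous_on_add jc[OF Q_cont(1)[OF g]] hc[OF Q_cont(1)[OF h']])
  show "continuous_on ?S (%p. Wct h g eps (fst p) (snd p))"
   unfolding Wct_def by (intro continuous_on_add continuous_on_minus continuous_on_diff gc jc[OF Q_cont(4)[OF g]] hc[OF Q_cont(4)[OF h']])
  show "continuous_on ?S (%p. Wcx h g eps i (fst p) (snd p))" if "i < d" for i
   unfolding Wcx_def by (intro continuous_on_add jc[OF Q_cont(2)[OF g that]] hc[OF Q_cont(2)[OF h' that]])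
  show "continuous_on ?S (%p. Wcxx h g eps i j (fst p) (snd p))" if "i < d" "j < d" for i j
   unfolding Wcxx_def by (intro continuous_on_add jc[OF Q_cont(3)[OF g that]] hc[OF Q_cont(3)[OF h' that]])
 qed
qed

text \<open>The heat equation cancels everything under the integral. Only the boundary term of the
  moving integral survives, which is the source smoothed over the time \<open>eps\<close>.\<close>

lemma Wc_equation:
 assumes g: "adm g" and h: "adm0 h" and eps: "eps > 0" and t: "t \<in> {0<..<T}"
 shows "Wct h g eps t x + (1/2) * (\<Sum>i<d. Wcxx h g eps i i t x) = - Q0 g t eps x"
proof -
 have t': "t \<in> {0..T}" using t by auto
 have "jj (Qt g) eps t x = (1/2) * (\<Sum>i<d. jj (Q2 g i i) eps t x)"
 proof -
  have "integral {0..1} (%r. Qt g (t + (T - t) * r) ((T - t) * r + eps) x)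
   = integral {0..1} (%r. (1/2) * (\<Sum>i<d. Q2 g i i (t + (T - t) * r) ((T - t) * r + eps) x))"
  proof (rule Henstock_Kurzweil_Integration.integral_cong)
   fix r :: real assume r: "r \<in> {0..1}"
   have "0 <= (T - t) * r" using r t by auto
   then have "(T - t) * r + eps > 0" using eps by linarith
   from Qt_Q2[OF g source_time_in[OF t' r] this]
   show "Qt g (t + (T - t) * r) ((T - t) * r + eps) x = (1/2) * (\<Sum>i<d. Q2 g i i (t + (T - t) * r) ((T - t) * r + eps) x)" .
  qed
  also have "... = (1/2) * (\<Sum>i<d. integral {0..1} (%r. Q2 g i i (t + (T - t) * r) ((T - t) * r + eps) x))"
  proof -
   have "(%r. Q2 g i i (t + (T - t) * r) ((T - t) * r + eps) x) integrable_on {0..1}" if "i < d" for i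
    by (rule integrable_continuous_real, rule jj_arg[OF Q_cont(3)[OF g that that] eps])
     (use t' in \<open>auto intro!: continuous_intros\<close>)
   then have "integral {0..1} (%r. \<Sum>i<d. Q2 g i i (t + (T - t) * r) ((T - t) * r + eps) x)
    = (\<Sum>i<d. integral {0..1} (%r. Q2 g i i (t + (T - t) * r) ((T - t) * r + eps) x))"
    by (intro Henstock_Kurzweil_Integration.integral_sum) auto
   then show ?thesis by simp
  qed
  finally show ?thesis by (simp add: jj_def sum_distrib_left mult_ac)
 qed
 moreover have "Qt (%_. h) 0 (T - t + eps) x = (1/2) * (\<Sum>i<d. Q2 (%_. h) i i 0 (T - t + eps) x)"
  by (rule Qt_Q2[OF adm_of_adm0[OF h]]) (use T t eps in auto)
 ultimately show ?thesis by (simp add: Wct_def Wcxx_def sum.distrib distrib_left)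
qed

definition Wl_arg where
 "Wl_arg g eps t x th = g (t + (T - t) * snd th) (gshift d x (sqrt ((T - t) * snd th + eps)) (fst th))"

definition Wl where
 "Wl h g eps t x = Ew (%_. h) (%_. 1) 0 (T - t + eps) x + (T - t) * (lint (gauss_time d) (%th. Wl_arg g eps t x th))"

lemma adm_shift_bound:
 assumes g: "adm g"
 obtains K where "K >= 0" "!!t x sg z. t \<in> {0..T} ==> sg \<in> {0..T + 1} ==> abs (g t (gshift d x (sqrt sg) z)) <= K * wgt d x powr s * (1 + enorm d z) powr s"
proof -
 obtain K where K: "K >= 0" "!!t x. t \<in> {0..T} ==> abs (g t x) <= K * wgt d x powr s" by (rule admD[OF g]) blast
 show thesis
 proof (rule that)
  show "0 <= K * (1 + sqrt (T + 1)) powr s" using K by simp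
  fix t x sg z assume t: "t \<in> {0..T}" and sg: "sg \<in> {0..T + 1}"
  have "abs (g t (gshift d x (sqrt sg) z)) <= K * wgt d (gshift d x (sqrt sg) z) powr s" by (rule K(2)[OF t])
  also have "... <= K * (wgt d x * ((1 + sqrt (T + 1)) * (1 + enorm d z))) powr s"
  proof (intro mult_left_mono powr_mono2 K s)
   have "wgt d (gshift d x (sqrt sg) z) <= wgt d x * ((1 + abs (sqrt sg)) * (1 + enorm d z))" by (rule wgt_shift_le'[OF d])
   also have "... <= wgt d x * ((1 + sqrt (T + 1)) * (1 + enorm d z))"
    using sg by (intro mult_left_mono mult_right_mono add_left_mono) (auto simp: less_imp_le)
   finally show "wgt d (gshift d x (sqrt sg) z) <= wgt d x * ((1 + sqrt (T + 1)) * (1 + enorm d z))" .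
  qed (simp add: less_imp_le)
  also have "... = (K * (1 + sqrt (T + 1)) powr s) * wgt d x powr s * (1 + enorm d z) powr s"
   by (simp add: powr_mult)
  finally show "abs (g t (gshift d x (sqrt sg) z)) <= (K * (1 + sqrt (T + 1)) powr s) * wgt d x powr s * (1 + enorm d z) powr s" .
 qed
qed

lemma Wl_arg_measurable:
 assumes g: "adm g" and t: "t \<in> {0..T}"
 shows "Wl_arg g eps t x \<in> borel_measurable (gauss_time d)"
proof -
 have "(%th. (%(t, x). g t x) (t + (T - t) * snd th, gshift d x (sqrt ((T - t) * snd th + eps)) (fst th))) \<in> borel_measurable (gauss_time d)"
 proof (rule borel_measurable_continuous_on_closed[OF adm_cont[OF g]])
  show "(%th. (t + (T - t) * snd th, gshift d x (sqrt ((T - t) * snd th + eps)) (fst th))) \<in> borel_measurable (gauss_time d)"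
   by (intro borel_measurable_Pair measurable_shift) measurable
 qed (use source_time_in[OF t] in \<open>auto simp: space_gauss_time intro!: borel_closed closed_Times\<close>)
 then show ?thesis by (simp add: Wl_arg_def[abs_def])
qed

lemma Wl_sigma:
 assumes "t \<in> {0..T}" "r \<in> {0..1}" "eps \<in> {0..1}"
 shows "(T - t) * r + eps \<in> {0..T + 1}"
proof -
 have "0 <= (T - t) * r" using assms by auto
 moreover have "t + (T - t) * r <= T" using source_time_in[OF assms(1,2)] by auto
 ultimately show ?thesis using assms by auto
qed

lemma Wl_cont:
 assumes g: "adm g" and h: "adm0 h"
 shows "continuous_on ({0..1} \<times> {0..T} \<times> UNIV) (%p. Wl h g (fst p) (fst (snd p)) (snd (snd p)))"
 unfolding Wl_def
proof (intro continuous_on_add continuous_on_mult)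
 show "continuous_on ({0..1} \<times> {0..T} \<times> UNIV) (%p. Ew (%_. h) (%_. 1) 0 (T - fst (snd p) + fst p) (snd (snd p)))"
  by (intro Ew_cont adm_of_adm0 h wp_const continuous_intros) (use T in auto)
 show "continuous_on ({0..1} \<times> {0..T} \<times> UNIV) (%p. T - fst (snd p))" by (intro continuous_intros)
 obtain K where K: "K >= 0" "!!t x sg z. t \<in> {0..T} ==> sg \<in> {0..T + 1} ==> abs (g t (gshift d x (sqrt sg) z)) <= K * wgt d x powr s * (1 + enorm d z) powr s"
  by (rule adm_shift_bound[OF g]) blast
 show "continuous_on ({0..1} \<times> {0..T} \<times> UNIV) (%p. lint (gauss_time d) (%th. Wl_arg g (fst p) (fst (snd p)) (snd (snd p)) th))"
 proof (rule continuous_on_parametric_integral)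
  show "integrable (gauss_time d) (%th. (1 + enorm d (fst th)) powr s)"
   by (intro integrable_gauss_time_fst integrable_gauss_enorm d s)
  show "continuous_on ({0..1} \<times> {0..T} \<times> UNIV) (%p::real \<times> real \<times> (nat => real). K * wgt d (snd (snd p)) powr s)"
   by (intro continuous_on_mult continuous_on_const continuous_on_wgt_powr continuous_intros)
  show "Wl_arg g (fst p) (fst (snd p)) (snd (snd p)) \<in> borel_measurable (gauss_time d)" if "p \<in> {0..1} \<times> {0..T} \<times> UNIV" for p
   using that by (intro Wl_arg_measurable g) auto
  fix th assume "th \<in> space (gauss_time d)"
  then have r: "snd th \<in> {0..1}" by (auto simp: space_gauss_time)
  show "abs (Wl_arg g (fst p) (fst (snd p)) (snd (snd p)) th) <= K * wgt d (snd (snd p)) powr s * (1 + enorm d (fst th)) powr s"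
   if "p \<in> {0..1} \<times> {0..T} \<times> UNIV" for p
   unfolding Wl_arg_def by (rule K(2)[OF source_time_in Wl_sigma]) (use that r in auto)
  have "continuous_on ({0..1} \<times> {0..T} \<times> UNIV) (%p. (%(t, x). g t x) (fst (snd p) + (T - fst (snd p)) * snd th, gshift d (snd (snd p)) (sqrt ((T - fst (snd p)) * snd th + fst p)) (fst th)))"
   by (rule continuous_on_compose2[OF adm_cont[OF g]]) (use source_time_in[OF _ r] in \<open>auto intro!: continuous_intros\<close>)
  then show "continuous_on ({0..1} \<times> {0..T} \<times> UNIV) (%p. Wl_arg g (fst p) (fst (snd p)) (snd (snd p)) th)"
   by (simp add: Wl_arg_def)
 qed
qed

lemma Wl_arg_integrable:
 assumes g: "adm g" and t: "t \<in> {0..T}" and eps: "eps \<in> {0..1}"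
 shows "integrable (gauss_time d) (Wl_arg g eps t x)"
proof -
 obtain K where K: "K >= 0" "!!t x sg z. t \<in> {0..T} ==> sg \<in> {0..T + 1} ==> abs (g t (gshift d x (sqrt sg) z)) <= K * wgt d x powr s * (1 + enorm d z) powr s"
  by (rule adm_shift_bound[OF g]) blast
 show ?thesis
 proof (rule Bochner_Integration.integrable_bound)
  show "integrable (gauss_time d) (%th. K * wgt d x powr s * (1 + enorm d (fst th)) powr s)"
   by (intro Bochner_Integration.integrable_mult_right integrable_gauss_time_fst integrable_gauss_enorm d s)
  show "AE th in gauss_time d. norm (Wl_arg g eps t x th) <= norm (K * wgt d x powr s * (1 + enorm d (fst th)) powr s)"
  proof (rule AE_I2)
   fix th assume "th \<in> space (gauss_time d)"
   then have r: "snd th \<in> {0..1}" by (auto simp: space_gauss_time)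
   show "norm (Wl_arg g eps t x th) <= norm (K * wgt d x powr s * (1 + enorm d (fst th)) powr s)"
    unfolding Wl_arg_def using K(2)[OF source_time_in[OF t r] Wl_sigma[OF t r eps]] K(1) by (simp add: abs_mult)
  qed
 qed (rule Wl_arg_measurable[OF g t])
qed

lemma Wl_bound:
 assumes g: "adm g" and h: "adm0 h"
 obtains K where "K >= 0" "!!eps t x. eps \<in> {0..1} ==> t \<in> {0..T} ==> abs (Wl h g eps t x) <= K * wgt d x powr s"
proof -
 obtain K where K: "K >= 0" "!!t x sg z. t \<in> {0..T} ==> sg \<in> {0..T + 1} ==> abs (g t (gshift d x (sqrt sg) z)) <= K * wgt d x powr s * (1 + enorm d z) powr s"
  by (rule adm_shift_bound[OF g]) blast
 obtain K' where K': "K' >= 0" "!!t x sg z. t \<in> {0..T} ==> sg \<in> {0..T + 1} ==> abs (h (gshift d x (sqrt sg) z)) <= K' * wgt d x powr s * (1 + enorm d z) powr s"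
  by (rule adm_shift_bound[OF adm_of_adm0[OF h]]) blast
 define M where "M = (lint (gauss d) (%z. (1 + enorm d z) powr s))"
 define M' where "M' = (lint (gauss_time d) (%th. (1 + enorm d (fst th)) powr s))"
 have M: "M >= 0" "M' >= 0" by (simp_all add: M_def M'_def)
 show thesis
 proof (rule that)
  show "0 <= K' * M + T * K * M'" using K K' M T by auto
  fix eps t x assume eps: "eps \<in> {0..1::real}" and t: "t \<in> {0..T}"
  have 1: "abs (Ew (%_. h) (%_. 1) 0 (T - t + eps) x) <= K' * wgt d x powr s * M"
  proof -
   have "abs (Ew (%_. h) (%_. 1) 0 (T - t + eps) x) <= (lint (gauss d) (%z. abs (h (gshift d x (sqrt (T - t + eps)) z))))"
    unfolding Ew_def by (rule order_trans[OF integral_abs_bound]) simp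
   also have "... <= (lint (gauss d) (%z. K' * wgt d x powr s * (1 + enorm d z) powr s))"
    using K'(2)[of 0] t eps T
    by (intro integral_mono integrable_abs heat_integrable h Bochner_Integration.integrable_mult_right integrable_gauss_enorm d s) auto
   finally show ?thesis by (simp add: M_def)
  qed
  have 2: "abs (lint (gauss_time d) (%th. Wl_arg g eps t x th)) <= K * wgt d x powr s * M'"
  proof -
   have "abs (lint (gauss_time d) (%th. Wl_arg g eps t x th)) <= (lint (gauss_time d) (%th. abs (Wl_arg g eps t x th)))" by (rule integral_abs_bound)
   also have "... <= (lint (gauss_time d) (%th. K * wgt d x powr s * (1 + enorm d (fst th)) powr s))"
   proof (intro integral_mono integrable_abs Wl_arg_integrable g t eps Bochner_Integration.integrable_mult_right integrable_gauss_time_fst integrable_gauss_enorm d s)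
    fix th assume "th \<in> space (gauss_time d)"
    then have r: "snd th \<in> {0..1}" by (auto simp: space_gauss_time)
    show "abs (Wl_arg g eps t x th) <= K * wgt d x powr s * (1 + enorm d (fst th)) powr s"
     unfolding Wl_arg_def by (rule K(2)[OF source_time_in[OF t r] Wl_sigma[OF t r eps]])
   qed
   finally show ?thesis by (simp add: M'_def)
  qed
  have "abs ((T - t) * (lint (gauss_time d) (%th. Wl_arg g eps t x th))) <= T * (K * wgt d x powr s * M')"
   unfolding abs_mult using t 2 by (intro mult_mono) auto
  with 1 show "abs (Wl h g eps t x) <= (K' * M + T * K * M') * wgt d x powr s"
   unfolding Wl_def by (simp add: algebra_simps)
 qed
qed

lemma Wl_0: "Wl h g 0 t x = heat d (T - t) h x + source d T g t x"
 by (simp add: Wl_def Wl_arg_def Ew_def heat_def source_def source_arg_def)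

lemma Wl_T:
 "Wl h g 0 T x = h (restrict x {..<d})"
 using heat_0[of d h x] by (simp add: Wl_0 source_def)

lemma Wc_eq_Wl:
 assumes g: "adm g" and t: "t \<in> {0..T}" and eps: "eps \<in> {0<..1}"
 shows "Wc h g eps t x = Wl h g eps t x"
proof -
 interpret A: prob_space "gauss d" by (rule prob_space_gauss)
 interpret B: prob_space unit_time by (rule prob_space_unit_time)
 interpret P: pair_sigma_finite "gauss d" unit_time ..
 let ?q = "%r. Q0 g (t + (T - t) * r) ((T - t) * r + eps) x"
 have "integrable (gauss d \<Otimes>\<^sub>M unit_time) (case_prod (%z r. Wl_arg g eps t x (z, r)))"
  using Wl_arg_integrable[OF g t, of eps x] eps by (simp add: gauss_time_def)
 from P.integral_snd[OF this]
 have "(lint (gauss_time d) (%th. Wl_arg g eps t x th)) = (lint unit_time (%r. ?q r))"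
  by (simp add: gauss_time_def Wl_arg_def Q0_def Ew_def case_prod_beta')
 also have "... = (LINT r:{0..1}|lborel. ?q r)"
  unfolding unit_time_def set_lebesgue_integral_def by (subst integral_restrict_space) auto
 also have "... = integral {0..1} ?q"
 proof (rule set_borel_integral_eq_integral, rule borel_integrable_atLeastAtMost')
  show "continuous_on {0..1} ?q"
   by (rule jj_arg[OF Q_cont(1)[OF g]]) (use t eps in \<open>auto intro!: continuous_intros\<close>)
 qed
 finally show ?thesis by (simp add: Wc_def Wl_def jj_def Q0_def)
qed

subsection \<open>Weighted convergence of the smooth approximations\<close>

text \<open>\<open>psi\<close> is the barrier that localises the comparison: it grows faster than \<open>wgt d x powr s\<close>, and its
 Laplacian is at most a multiple of \<open>psi\<close>.\<close>

definition mexp :: nat where "mexp = nat \<lceil>s\<rceil> + 1"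

definition psi :: "(nat => real) => real" where
 "psi x = 1 + (\<Sum>i<d. x i ^ (2 * mexp))"

lemma psi_ge_1: "psi x >= 1"
 unfolding psi_def by (auto intro!: sum_nonneg simp: zero_le_even_power)

lemma wgt_le_box:
 assumes "!!i. i < d ==> abs (x i) <= b" "b >= 0"
 shows "wgt d x <= sqrt (real d) * (1 + b)"
proof -
 have "(\<Sum>i<d. (x i)\<^sup>2) <= (\<Sum>i<d. b\<^sup>2)"
  using assms by (intro sum_mono) (metis abs_le_square_iff abs_of_nonneg lessThan_iff)
 then have "enorm d x <= sqrt (real d * b\<^sup>2)" unfolding enorm_def by (intro real_sqrt_le_mono) simp
 then show ?thesis using assms by (simp add: wgt_def real_sqrt_mult algebra_simps)
qed

text \<open>If \<open>b >= 1\<close> is the largest coordinate in absolute value, the weight is at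
  most \<open>2 * sqrt d * b\<close> while \<open>psi\<close> is at least
  \<open>b powr (s + 1)\<close>; the spare power of \<open>b > R\<close> beats every
  constant.\<close>

lemma psi_dominates:
 assumes dl: "dl > 0"
 obtains R where "R >= 1" "!!x. \<exists>i<d. R < abs (x i) ==> C * wgt d x powr s <= dl * psi x"
proof -
 define R where "R = max 1 (abs C * (2 * sqrt (real d)) powr s / dl)"
 have R1: "R >= 1" by (simp add: R_def)
 have RC: "abs C * (2 * sqrt (real d)) powr s <= dl * R"
  using dl by (simp add: R_def max_def field_simps)
 show thesis
 proof (rule that[OF R1])
  fix x :: "nat => real" assume "\<exists>i<d. R < abs (x i)"
  then obtain i0 where i0: "i0 < d" "R < abs (x i0)" by auto
  define b where "b = Max ((%i. abs (x i)) ` {..<d})"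
  have bi: "abs (x i) <= b" if "i < d" for i unfolding b_def using that by (intro Max_ge) auto
  have "b \<in> (%i. abs (x i)) ` {..<d}" unfolding b_def using i0 by (intro Max_in) auto
  then obtain i where i: "i < d" "b = abs (x i)" by auto
  have bR: "b > R" using bi[OF i0(1)] i0 by linarith
  then have b1: "b >= 1" using R1 by linarith
  have "wgt d x <= sqrt (real d) * (1 + b)" by (rule wgt_le_box) (use bi b1 in auto)
  also have "... <= (2 * sqrt (real d)) * b" using mult_left_mono[OF b1, of "sqrt (real d)"] by (simp add: algebra_simps)
  finally have "wgt d x powr s <= ((2 * sqrt (real d)) * b) powr s" using s by (intro powr_mono2) (auto simp: less_imp_le)
  also have "... = (2 * sqrt (real d)) powr s * b powr s" using b1 by (simp add: powr_mult)
  finally have "abs C * wgt d x powr s <= abs C * ((2 * sqrt (real d)) powr s * b powr s)" by (intro mult_left_mono) auto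
  also have "... = (abs C * (2 * sqrt (real d)) powr s) * b powr s" by simp
  also have "... <= (dl * R) * b powr s" by (intro mult_right_mono RC) auto
  also have "... <= (dl * b) * b powr s" using bR dl by (intro mult_right_mono mult_left_mono) auto
  also have "... = dl * b powr (s + 1)" using b1 by (simp add: powr_add)
  also have "... <= dl * b powr real (2 * mexp)"
  proof (intro mult_left_mono powr_mono b1)
   have "real (2 * mexp) = 2 * real (nat \<lceil>s\<rceil>) + 2" by (simp only: mexp_def) simp
   then show "s + 1 <= real (2 * mexp)" using real_nat_ceiling_ge[of s] s by linarith
  qed (use dl in simp)
  also have "b powr real (2 * mexp) = x i ^ (2 * mexp)"
   using b1 i by (subst powr_realpow) (auto simp: power_mult)
  also have "... <= psi x"
  proof -
   have "x i ^ (2 * mexp) <= (\<Sum>i<d. x i ^ (2 * mexp))"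
    using i by (intro member_le_sum) (auto simp: zero_le_even_power)
   then show ?thesis by (simp add: psi_def)
  qed
  finally have "abs C * wgt d x powr s <= dl * psi x" using dl by simp
  moreover have "C * wgt d x powr s <= abs C * wgt d x powr s" by (intro mult_right_mono) auto
  ultimately show "C * wgt d x powr s <= dl * psi x" by linarith
 qed
qed

lemma box_uniform:
 fixes F :: "real => real => (nat => real) => real"
 assumes F: "continuous_on ({0..1} \<times> {0..T} \<times> UNIV) (%p. F (fst p) (fst (snd p)) (snd (snd p)))" and e: "e > 0"
 shows "\<exists>eps0>0. \<forall>eps\<in>{0..1}. eps <= eps0 --> (\<forall>t\<in>{0..T}. \<forall>x\<in>box d y R. abs (F eps t x - F 0 t x) < e)"
proof -
 let ?K = "{0..1} \<times> {0..T} \<times> box d y R"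
 have "uniformly_continuous_on ?K (%p. F (fst p) (fst (snd p)) (snd (snd p)))"
  by (rule compact_uniformly_continuous, rule continuous_on_subset[OF F]) (auto intro!: compact_Times compact_box)
 then obtain r where r: "r > 0" "!!p q. p \<in> ?K ==> q \<in> ?K ==> dist q p < r ==>
   dist (F (fst q) (fst (snd q)) (snd (snd q))) (F (fst p) (fst (snd p)) (snd (snd p))) < e"
  by (rule uniformly_continuous_onE[OF _ e]) blast
 show ?thesis
 proof (intro exI[of _ "r / 2"] conjI ballI impI)
  fix eps t x assume *: "eps \<in> {0..1}" "eps <= r / 2" "t \<in> {0..T}" "x \<in> box d y R"
  have "dist (eps, t, x) (0, t, x) = eps" using * by (simp add: dist_Pair_Pair)
  then show "abs (F eps t x - F 0 t x) < e"
   using r(2)[of "(0, t, x)" "(eps, t, x)"] * r(1) by (auto simp: dist_real_def)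
 qed (use r in auto)
qed

text \<open>On a large box this is uniform continuity together with \<open>psi >= 1\<close>; outside
  it both functions are already below the barrier.\<close>

lemma weighted_uniform:
 fixes F :: "real => real => (nat => real) => real"
 assumes F: "continuous_on ({0..1} \<times> {0..T} \<times> UNIV) (%p. F (fst p) (fst (snd p)) (snd (snd p)))"
  and K: "!!eps t x. eps \<in> {0..1} ==> t \<in> {0..T} ==> abs (F eps t x) <= K * wgt d x powr s" and dl: "dl > 0"
 shows "\<exists>eps0>0. \<forall>eps\<in>{0..1}. eps <= eps0 --> (\<forall>t\<in>{0..T}. \<forall>x\<in>Rd d. abs (F eps t x - F 0 t x) <= dl * psi x)"
proof -
 obtain R where R: "R >= 1" "!!x. \<exists>i<d. R < abs (x i) ==> (2 * K) * wgt d x powr s <= dl * psi x"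
  by (rule psi_dominates[OF dl]) blast
 obtain eps0 where eps: "eps0 > 0" "!!eps t x. eps \<in> {0..1} ==> eps <= eps0 ==> t \<in> {0..T} ==> x \<in> box d (%_. 0) R ==> abs (F eps t x - F 0 t x) < dl"
  using box_uniform[OF F dl, of "%_. 0" R] by blast
 show ?thesis
 proof (intro exI[of _ eps0] conjI ballI impI)
  fix eps t x assume *: "eps \<in> {0..1}" "eps <= eps0" "t \<in> {0..T}" "x \<in> Rd d"
  show "abs (F eps t x - F 0 t x) <= dl * psi x"
  proof (cases "\<exists>i<d. R < abs (x i)")
   case True
   have "abs (F eps t x - F 0 t x) <= (2 * K) * wgt d x powr s"
    using K[OF *(1,3), of x] K[OF _ *(3), of 0 x] by simp
   then show ?thesis using R(2)[OF True] by linarith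
  next
   case False
   then have "\<forall>i<d. abs (x i) <= R" by (meson not_le)
   then have "x \<in> box d (%_. 0) R" using * by (simp add: box_def)
   from eps(2)[OF *(1-3) this] have "abs (F eps t x - F 0 t x) <= dl * 1" by simp
   also have "... <= dl * psi x" using dl psi_ge_1 by (intro mult_left_mono) auto
   finally show ?thesis .
  qed
 qed (rule eps)
qed

lemma G_cont:
 assumes "adm g"
 shows "continuous_on ({0..1} \<times> {0..T} \<times> UNIV) (%p. Q0 g (fst (snd p)) (fst p) (snd (snd p)))"
 unfolding Q0_def by (rule Ew_cont[OF assms wp_const]) (auto intro!: continuous_intros)

lemma G_0: "Q0 g t 0 x = g t (restrict x {..<d})"
 using heat_0[of d "g t" x] by (simp add: Q0_def Ew_def heat_def)

lemma G_bound:
 assumes g: "adm g"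
 obtains K where "K >= 0" "!!eps t x. eps \<in> {0..1} ==> t \<in> {0..T} ==> abs (Q0 g t eps x) <= K * wgt d x powr s"
proof -
 obtain K where K: "K >= 0" "!!t x sg z. t \<in> {0..T} ==> sg \<in> {0..T + 1} ==> abs (g t (gshift d x (sqrt sg) z)) <= K * wgt d x powr s * (1 + enorm d z) powr s"
  by (rule adm_shift_bound[OF g]) blast
 define M where "M = (lint (gauss d) (%z. (1 + enorm d z) powr s))"
 have M: "M >= 0" by (simp add: M_def)
 show thesis
 proof (rule that)
  show "0 <= K * M" using K M by auto
  fix eps t x assume eps: "eps \<in> {0..1::real}" and t: "t \<in> {0..T}"
  have "abs (Q0 g t eps x) <= (lint (gauss d) (%z. abs (g t (gshift d x (sqrt eps) z) * 1)))"
   unfolding Q0_def Ew_def by (rule integral_abs_bound)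
  also have "... <= (lint (gauss d) (%z. K * wgt d x powr s * (1 + enorm d z) powr s))"
   using K(2)[OF t] eps T
   by (intro integral_mono integrable_abs Ew_int g t wp_const Bochner_Integration.integrable_mult_right integrable_gauss_enorm d s) auto
  finally show "abs (Q0 g t eps x) <= (K * M) * wgt d x powr s" by (simp add: M_def mult_ac)
 qed
qed

end

section \<open>Viscosity solutions\<close>

lemma is_C12D:
 assumes "is_C12 d T ph pht phx phxx"
 shows "t \<in> {0<..<T} ==> x \<in> Rd d ==> ((%s. ph s x) has_real_derivative pht t x) (at t)"
  "t \<in> {0<..<T} ==> x \<in> Rd d ==> i < d ==> ((%s. ph t (x(i := s))) has_real_derivative phx i t x) (at (x i))"
  "t \<in> {0<..<T} ==> x \<in> Rd d ==> i < d ==> j < d ==> ((%s. phx i t (x(j := s))) has_real_derivative phxx i j t x) (at (x j))"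
  "continuous_on ({0<..<T} \<times> Rd d) (%p. ph (fst p) (snd p))"
  "continuous_on ({0<..<T} \<times> Rd d) (%p. pht (fst p) (snd p))"
  "i < d ==> j < d ==> continuous_on ({0<..<T} \<times> Rd d) (%p. phxx i j (fst p) (snd p))"
 using assms unfolding is_C12_def case_prod_beta' by blast+

lemma is_C12_at_upd:
 assumes C: "is_C12 d T ph pht phx phxx" and t: "t \<in> {0<..<T}" and x: "x \<in> Rd d" and i: "i < d"
 shows "((%s. ph t (x(i := s))) has_real_derivative phx i t (x(i := r))) (at r)"
 using is_C12D(2)[OF C t upd_Rd[OF x i] i, of r] by simp

lemma is_C12_quadratic:
 assumes y: "y \<in> Rd d"
 shows "is_C12 d T (%t x. c * ((t - a)\<^sup>2 + (\<Sum>i<d. (x i - y i)\<^sup>2))) (%t x. c * (2 * (t - a)))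
  (%i t x. c * (2 * (x i - y i))) (%i j t x. if i = j then 2 * c else 0)"
 unfolding is_C12_def case_prod_beta'
proof (intro conjI allI impI)
 fix t x i assume i: "i < d"
 have e: "(\<Sum>j<d. ((x(i := r)) j - y j)\<^sup>2) = (r - y i)\<^sup>2 + (\<Sum>j\<in>{..<d} - {i}. (x j - y j)\<^sup>2)" for r
  using i by (subst sum.remove[of "{..<d}" i]) auto
 show "((%s. c * ((t - a)\<^sup>2 + (\<Sum>j<d. ((x(i := s)) j - y j)\<^sup>2))) has_real_derivative c * (2 * (x i - y i))) (at (x i))"
  unfolding e by (auto intro!: derivative_eq_intros)
 fix j
 show "((%s. c * (2 * ((x(j := s)) i - y i))) has_real_derivative (if i = j then 2 * c else 0)) (at (x j))"
  by (cases "i = j") (auto intro!: derivative_eq_intros)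
next
 fix t x
 show "((%t. c * ((t - a)\<^sup>2 + (\<Sum>i<d. (x i - y i)\<^sup>2))) has_real_derivative c * (2 * (t - a))) (at t)"
  by (auto intro!: derivative_eq_intros)
next
 have cc: "continuous_on S (%p. snd p i)" for S :: "(real \<times> (nat => real)) set" and i
  by (rule continuous_on_coord) (intro continuous_intros)
 show "continuous_on ({0<..<T} \<times> Rd d) (%p. c * ((fst p - a)\<^sup>2 + (\<Sum>i<d. (snd p i - y i)\<^sup>2)))"
  "continuous_on ({0<..<T} \<times> Rd d) (%p. c * (2 * (fst p - a)))"
  "continuous_on ({0<..<T} \<times> Rd d) (%p. c * (2 * (snd p i - y i)))"
  "continuous_on ({0<..<T} \<times> Rd d) (%p. if i = j then 2 * c else 0)" for i j
  by (intro continuous_intros cc)+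
qed

context heat_setting
begin

lemma adm0_minus: "adm0 h ==> adm0 (%x. - h x)"
 unfolding adm0_def by (auto intro: continuous_on_minus)

text \<open>Stability of viscosity solutions under locally uniform convergence. If the inequality
  failed at the touching point, it would fail nearby with a margin; the smooth approximation minus
  the penalised test function has an interior maximum there, contradicting
  \<open>Wc_equation\<close>. With the source frozen as \<open>g\<close>, only a linear equation is
  involved.\<close>

lemma mild_subtest:
 assumes g: "adm g" and h: "adm0 h"
  and u: "!!t x. t \<in> {0..T} ==> x \<in> Rd d ==> u t x = heat d (T - t) h x + source d T g t x"
  and C: "is_C12 d T ph pht phx phxx"
  and above: "!!s y. s \<in> {0<..<T} ==> y \<in> Rd d ==> u s y <= ph s y"
  and t0: "t0 \<in> {0<..<T}" and x0: "x0 \<in> Rd d" and eq: "ph t0 x0 = u t0 x0"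
 shows "pht t0 x0 + (1/2) * (\<Sum>i<d. phxx i i t0 x0) + g t0 x0 >= 0"
proof (rule ccontr)
 assume neg: "\<not> ?thesis"
 define A where "A p = pht (fst p) (snd p) + (1/2) * (\<Sum>i<d. phxx i i (fst p) (snd p)) + g (fst p) (snd p)" for p
 define eta where "eta = - A (t0, x0) / 3"
 have eta: "eta > 0" "A (t0, x0) = - 3 * eta" using neg by (auto simp: eta_def A_def)
 let ?D = "{0<..<T} \<times> Rd d"
 have Ac: "continuous_on ?D A"
  unfolding A_def
  by (intro continuous_on_add continuous_on_mult continuous_on_const continuous_on_sum is_C12D(5,6)[OF C] continuous_on_subset[OF adm_cont_split[OF g]]) auto
 have p0: "(t0, x0) \<in> ?D" using t0 x0 by auto
 obtain U where U: "open U" "(t0, x0) \<in> U" "!!p. p \<in> U \<inter> ?D ==> A p < - 2 * eta"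
 proof -
  have "A (t0, x0) \<in> {..< - 2 * eta}" using eta by simp
  with Ac p0 obtain U where "open U" "(t0, x0) \<in> U" "\<forall>p\<in>?D. p \<in> U --> A p \<in> {..< - 2 * eta}"
   unfolding continuous_on_topological by (metis open_lessThan)
  then show thesis by (intro that[of U]) auto
 qed
 obtain U1 U2 where U12: "open U1" "open U2" "(t0, x0) \<in> U1 \<times> U2" "U1 \<times> U2 \<subseteq> U"
  using open_prod_elim[OF U(1,2)] by blast
 obtain rho1 where rho1: "rho1 > 0" "!!y. y \<in> Rd d ==> (!!i. i < d ==> abs (y i - x0 i) <= rho1) ==> y \<in> U2"
  using Rd_box_subset_open[OF U12(2) _ x0] U12(3) by blast
 have "open (U1 \<inter> {0<..<T})" "t0 \<in> U1 \<inter> {0<..<T}" using U12 t0 by auto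
 then obtain rho2 where rho2: "rho2 > 0" "cball t0 rho2 \<subseteq> U1 \<inter> {0<..<T}"
  using open_contains_cball by blast
 define rho where "rho = min rho1 rho2"
 have rho: "rho > 0" "rho <= rho1" "rho <= rho2" using rho1 rho2 by (auto simp: rho_def)
 define N where "N = {t0 - rho..t0 + rho} \<times> box d x0 rho"
 have Nt: "t \<in> {0<..<T} \<and> t \<in> U1" if "t \<in> {t0 - rho..t0 + rho}" for t
 proof -
  have "t \<in> cball t0 rho2" using that rho by (auto simp: dist_real_def abs_le_iff)
  then show ?thesis using rho2 by auto
 qed
 have ND: "N \<subseteq> ?D" using Nt by (auto simp: N_def box_def)
 have NA: "A p < - 2 * eta" if "p \<in> N" for p
 proof (rule U(3))
  have "fst p \<in> U1" using that Nt by (auto simp: N_def)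
  moreover have "snd p \<in> U2" using that rho by (intro rho1(2)) (force simp: N_def box_def)+
  ultimately show "p \<in> U \<inter> ?D" using U12(4) that ND by (cases p) auto
 qed
 \<comment> \<open>So small that the derivatives of the penalty \<open>c * q\<close> change the
   operator by at most \<open>eta / 2\<close> on \<open>N\<close>.\<close>
 define c where "c = eta / (2 * (2 * rho + real d + 1))"
 have den: "2 * (2 * rho + real d + 1) > 0" using rho by (intro mult_pos_pos add_nonneg_pos) auto
 have c: "c > 0" using eta den by (simp add: c_def)
 have c2: "2 * c * rho + c * real d <= eta / 2"
 proof -
  have "c * (2 * (2 * rho + real d + 1)) = eta" using den by (simp add: c_def)
  then show ?thesis using c by (simp add: algebra_simps)
 qed
 \<comment> \<open>One third of the penalty at distance \<open>rho\<close>. The approximation error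
   is paid once at the centre and once at the maximum, so the penalty wins and the maximum stays
   inside.\<close>
 have e3: "c * rho\<^sup>2 / 3 > 0" using c rho by auto
 have cW: "continuous_on ({0..1} \<times> {0..T} \<times> UNIV) (%p. Wl h g (fst p) (fst (snd p)) (snd (snd p)))" by (rule Wl_cont[OF g h])
 obtain eps1 where eps1: "eps1 > 0" "!!eps t x. eps \<in> {0..1} ==> eps <= eps1 ==> t \<in> {0..T} ==> x \<in> box d x0 rho ==> abs (Wl h g eps t x - Wl h g 0 t x) < c * rho\<^sup>2 / 3"
  using box_uniform[OF cW e3] by metis
 have "eta / 2 > 0" using eta by simp
 then obtain eps2 where eps2: "eps2 > 0" "!!eps t x. eps \<in> {0..1} ==> eps <= eps2 ==> t \<in> {0..T} ==> x \<in> box d x0 rho ==> abs (Q0 g t eps x - Q0 g t 0 x) < eta / 2"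
  using box_uniform[OF G_cont[OF g], of "eta / 2" x0 rho] by metis
 define eps where "eps = min 1 (min eps1 eps2)"
 have eps: "eps > 0" "eps \<in> {0<..1}" "eps \<in> {0..1}" "eps <= eps1" "eps <= eps2" using eps1 eps2 by (auto simp: eps_def)
 have near: "abs (Wc h g eps t x - u t x) < c * rho\<^sup>2 / 3" if "(t, x) \<in> N" for t x
 proof -
  have tx: "t \<in> {0..T}" "x \<in> box d x0 rho" "x \<in> Rd d" using that Nt[of t] by (auto simp: N_def box_def)
  then show ?thesis using eps1(2)[OF eps(3,4) tx(1,2)] by (simp add: Wc_eq_Wl[OF g tx(1) eps(2)] u Wl_0)
 qed
 have nearG: "abs (Q0 g t eps x - g t x) < eta / 2" if "(t, x) \<in> N" for t x
 proof -
  have tx: "t \<in> {0..T}" "x \<in> box d x0 rho" "x \<in> Rd d" using that Nt[of t] by (auto simp: N_def box_def)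
  then show ?thesis using eps2(2)[OF eps(3,5) tx(1,2)] by (simp add: G_0 restrict_Rd)
 qed
 define q where "q t x = (t - t0)\<^sup>2 + (\<Sum>i<d. (x i - x0 i)\<^sup>2)" for t and x :: "nat => real"
 define Z where "Z t x = Wc h g eps t x + (- (ph t x + c * q t x))" for t x
 note CZ = is_C12_add[OF Wc_C12[OF g h eps(1)] is_C12_uminus[OF is_C12_add[OF C is_C12_quadratic[OF x0, of T c t0]]]]
 have CZ': "is_C12 d T Z (%t x. Wct h g eps t x + - (pht t x + c * (2 * (t - t0))))
   (%i t x. Wcx h g eps i t x + - (phx i t x + c * (2 * (x i - x0 i))))
   (%i j t x. Wcxx h g eps i j t x + - (phxx i j t x + (if i = j then 2 * c else 0)))"
  unfolding Z_def[abs_def] q_def by (rule CZ)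
 have Ncomp: "compact N" unfolding N_def by (intro compact_Times compact_box) simp
 have N0: "(t0, x0) \<in> N" using rho x0 by (auto simp: N_def box_def)
 obtain p where p: "p \<in> N" "!!p'. p' \<in> N ==> Z (fst p') (snd p') <= Z (fst p) (snd p)"
  using continuous_attains_sup[OF Ncomp _ continuous_on_subset[OF is_C12D(4)[OF CZ'] ND]] N0 by blast
 obtain t1 x1 where p1: "p = (t1, x1)" by (cases p)
 have N1: "(t1, x1) \<in> N" using p p1 by simp
 have max: "Z t x <= Z t1 x1" if "(t, x) \<in> N" for t x using p(2)[OF that] p1 by simp
 have "Z t0 x0 = Wc h g eps t0 x0 - u t0 x0" using eq by (simp add: Z_def q_def)
 then have "Z t0 x0 > - (c * rho\<^sup>2 / 3)" using near[OF N0] by linarith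
 then have Z1: "Z t1 x1 > - (c * rho\<^sup>2 / 3)" using max[OF N0] by linarith
 have t1: "t1 \<in> {0<..<T}" and x1: "x1 \<in> Rd d" using N1 ND by auto
 have q1: "q t1 x1 < rho\<^sup>2"
 proof (rule ccontr)
  assume "\<not> q t1 x1 < rho\<^sup>2"
  then have "c * rho\<^sup>2 <= c * q t1 x1" using c by (intro mult_left_mono) auto
  moreover have "Wc h g eps t1 x1 < ph t1 x1 + c * rho\<^sup>2 / 3" using near[OF N1] above[OF t1 x1] by linarith
  moreover have "c * rho\<^sup>2 > 0" using c rho by simp
  ultimately show False using Z1 by (simp add: Z_def)
 qed
 have bt: "abs (t1 - t0) < rho"
 proof -
  have "(t1 - t0)\<^sup>2 <= q t1 x1" by (auto simp: q_def sum_nonneg)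
  then have "(t1 - t0)\<^sup>2 < rho\<^sup>2" using q1 by linarith
  then have "(abs (t1 - t0))\<^sup>2 < rho\<^sup>2" by simp
  then show ?thesis using rho by (intro power2_less_imp_less[of _ rho]) auto
 qed
 have bx: "abs (x1 i - x0 i) < rho" if "i < d" for i
 proof -
  have "(x1 i - x0 i)\<^sup>2 <= (\<Sum>i<d. (x1 i - x0 i)\<^sup>2)" using that by (intro member_le_sum) auto
  also have "... <= q t1 x1" by (simp add: q_def)
  finally have "(abs (x1 i - x0 i))\<^sup>2 < rho\<^sup>2" using q1 by simp
  then show ?thesis using rho by (intro power2_less_imp_less[of _ rho]) auto
 qed
 have inbox: "x1 \<in> box d x0 rho" using N1 by (simp add: N_def)
 have T1: "Wct h g eps t1 x1 + - (pht t1 x1 + c * (2 * (t1 - t0))) = 0"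
 proof (rule DERIV_local_max[OF is_C12D(1)[OF CZ' t1 x1]])
  show "0 < rho - abs (t1 - t0)" using bt by simp
  show "\<forall>y. abs (t1 - y) < rho - abs (t1 - t0) --> Z y x1 <= Z t1 x1"
  proof (intro allI impI max)
   fix y assume "abs (t1 - y) < rho - abs (t1 - t0)"
   then have "y \<in> {t0 - rho..t0 + rho}" by auto
   then show "(y, x1) \<in> N" using inbox by (simp add: N_def)
  qed
 qed
 have X1: "Wcxx h g eps i i t1 x1 + - (phxx i i t1 x1 + 2 * c) <= 0" if i: "i < d" for i
 proof -
  let ?r = "rho - abs (x1 i - x0 i)"
  have dd: "((%s. Wcx h g eps i t1 (x1(i := s)) + - (phx i t1 (x1(i := s)) + c * (2 * ((x1(i := s)) i - x0 i)))) has_real_derivative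
    Wcxx h g eps i i t1 x1 + - (phxx i i t1 x1 + 2 * c)) (at (x1 i))"
   using is_C12D(3)[OF CZ' t1 x1 i i] by simp
  show ?thesis
  proof (rule second_derivative_max(2)[OF is_C12_at_upd[OF CZ' t1 x1 i] dd])
   show "x1 i \<in> {x1 i - ?r<..<x1 i + ?r}" using bx[OF i] by auto
   fix r assume r: "r \<in> {x1 i - ?r<..<x1 i + ?r}"
   have "abs (r - x0 i) <= rho" using r by auto
   then have "x1(i := r) \<in> box d x0 rho" using inbox i by (simp add: box_def)
   then have "(t1, x1(i := r)) \<in> N" using N1 by (simp add: N_def)
   from max[OF this] show "Z t1 (x1(i := r)) <= Z t1 (x1(i := x1 i))" by simp
  qed
 qed
 have "(\<Sum>i<d. Wcxx h g eps i i t1 x1) <= (\<Sum>i<d. phxx i i t1 x1 + 2 * c)"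
  by (intro sum_mono) (use X1 in force)
 also have "... = (\<Sum>i<d. phxx i i t1 x1) + 2 * c * real d" by (simp add: sum.distrib)
 finally have "Wct h g eps t1 x1 + (1/2) * (\<Sum>i<d. Wcxx h g eps i i t1 x1) \<le>
   pht t1 x1 + c * (2 * (t1 - t0)) + (1/2) * (\<Sum>i<d. phxx i i t1 x1) + c * real d" using T1 by simp
 moreover have "c * (2 * (t1 - t0)) <= 2 * c * rho"
 proof -
  have "c * (t1 - t0) <= c * rho" using bt c by (intro mult_left_mono) auto
  then show ?thesis by (simp add: algebra_simps)
 qed
 ultimately have "- Q0 g t1 eps x1 <= A (t1, x1) - g t1 x1 + eta / 2"
  using Wc_equation[OF g h eps(1) t1, of x1] c2 by (simp add: A_def)
 then have "A (t1, x1) >= - eta / 2 - eta / 2" using nearG[OF N1] by linarith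
 with NA[OF N1] eta show False by simp
qed

text \<open>\<open>psi\<close> controls infinity, the exponential absorbs its Laplacian, and
  \<open>dl / t\<close> keeps maxima away from \<open>t = 0\<close>, where no boundary value is
  prescribed. The constant \<open>c\<close> will lift the function until it touches.\<close>

lemma is_C12_barrier:
 "is_C12 d T (%t x. dl * (exp (mu * (T - t)) * psi x) + dl / t + c)
  (%t x. - (mu * dl * (exp (mu * (T - t)) * psi x)) - dl / t\<^sup>2)
  (%i t x. dl * (exp (mu * (T - t)) * (real (2 * mexp) * x i ^ (2 * mexp - 1))))
  (%i j t x. if i = j then dl * (exp (mu * (T - t)) * (real (2 * mexp) * (real (2 * mexp - 1) * x i ^ (2 * mexp - 2)))) else 0)"
 unfolding is_C12_def case_prod_beta'
proof (intro conjI allI impI)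
 fix t x assume t: "t \<in> {0<..<T}"
 show "((%t. dl * (exp (mu * (T - t)) * psi x) + dl / t + c) has_real_derivative - (mu * dl * (exp (mu * (T - t)) * psi x)) - dl / t\<^sup>2) (at t)"
  using t by (auto intro!: derivative_eq_intros simp: power2_eq_square)
 fix i assume i: "i < d"
 have e: "psi (x(i := r)) = 1 + (r ^ (2 * mexp) + (\<Sum>j\<in>{..<d} - {i}. x j ^ (2 * mexp)))" for r
  unfolding psi_def using i by (subst sum.remove[of "{..<d}" i]) auto
 show "((%s. dl * (exp (mu * (T - t)) * psi (x(i := s))) + dl / t + c) has_real_derivative
   dl * (exp (mu * (T - t)) * (real (2 * mexp) * x i ^ (2 * mexp - 1)))) (at (x i))"
  unfolding e by (auto intro!: derivative_eq_intros)
 fix j assume j: "j < d"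
 show "((%s. dl * (exp (mu * (T - t)) * (real (2 * mexp) * (x(j := s)) i ^ (2 * mexp - 1)))) has_real_derivative
   (if i = j then dl * (exp (mu * (T - t)) * (real (2 * mexp) * (real (2 * mexp - 1) * x i ^ (2 * mexp - 2)))) else 0)) (at (x j))"
  by (cases "i = j") (auto intro!: derivative_eq_intros simp: numeral_2_eq_2)
next
 have c: "continuous_on S (%p. psi (snd p))" for S :: "(real \<times> (nat => real)) set"
  unfolding psi_def
  by (intro continuous_on_add continuous_on_const continuous_on_sum continuous_on_power) (rule continuous_on_coord, intro continuous_intros)
 have cc: "continuous_on S (%p. snd p i)" for S :: "(real \<times> (nat => real)) set" and i
  by (rule continuous_on_coord) (intro continuous_intros)
 show "continuous_on ({0<..<T} \<times> Rd d) (%p. dl * (exp (mu * (T - fst p)) * psi (snd p)) + dl / fst p + c)"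
  by (intro continuous_intros c) auto
 show "continuous_on ({0<..<T} \<times> Rd d) (%p. - (mu * dl * (exp (mu * (T - fst p)) * psi (snd p))) - dl / (fst p)\<^sup>2)"
  by (intro continuous_intros c) auto
 show "continuous_on ({0<..<T} \<times> Rd d) (%p. dl * (exp (mu * (T - fst p)) * (real (2 * mexp) * snd p i ^ (2 * mexp - 1))))" for i
  by (intro continuous_intros cc)
 show "continuous_on ({0<..<T} \<times> Rd d) (%p. if i = j then dl * (exp (mu * (T - fst p)) * (real (2 * mexp) * (real (2 * mexp - 1) * snd p i ^ (2 * mexp - 2)))) else 0)" for i j
  by (cases "i = j"; simp) (intro continuous_intros cc)
qed

lemma psi_laplace: "(\<Sum>i<d. real (2 * mexp) * (real (2 * mexp - 1) * x i ^ (2 * mexp - 2))) <= real (2 * mexp) * real (2 * mexp - 1) * real d * psi x"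
proof -
 have m: "2 * mexp - 2 = 2 * (mexp - 1)" "2 * mexp = 2 * (mexp - 1) + 2" by (auto simp: mexp_def)
 have 1: "y ^ (2 * mexp - 2) <= 1 + y ^ (2 * mexp)" for y :: real
 proof (cases "abs y <= 1")
  case True
  have "y ^ (2 * mexp - 2) = abs y ^ (2 * mexp - 2)" unfolding m(1) by (simp add: power_mult)
  also have "... <= 1" using True by (intro power_le_one) auto
  finally have "y ^ (2 * mexp - 2) <= 1" .
  moreover have "0 <= y ^ (2 * mexp)" by (rule zero_le_even_power) simp
  ultimately show ?thesis by linarith
 next
  case False
  have "abs y ^ (2 * mexp - 2) <= abs y ^ (2 * mexp)" using False by (intro power_increasing) auto
  moreover have "y ^ (2 * mexp - 2) = abs y ^ (2 * mexp - 2)" unfolding m(1) by (simp add: power_mult)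
  moreover have "y ^ (2 * mexp) = abs y ^ (2 * mexp)" by (simp add: power_mult)
  ultimately show ?thesis by simp
 qed
 have "(\<Sum>i<d. real (2 * mexp) * (real (2 * mexp - 1) * x i ^ (2 * mexp - 2))) <= (\<Sum>i<d. real (2 * mexp) * (real (2 * mexp - 1) * (1 + x i ^ (2 * mexp))))"
  using 1 by (intro sum_mono mult_left_mono) auto
 also have "... = real (2 * mexp) * real (2 * mexp - 1) * (real d + (\<Sum>i<d. x i ^ (2 * mexp)))"
  by (simp add: sum.distrib distrib_left mult.assoc flip: sum_distrib_left)
 also have "... <= real (2 * mexp) * real (2 * mexp - 1) * (real d * psi x)"
 proof (rule mult_left_mono)
  have "(\<Sum>i<d. x i ^ (2 * mexp)) >= 0" by (auto intro!: sum_nonneg simp: zero_le_even_power)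
  then have "1 * (\<Sum>i<d. x i ^ (2 * mexp)) <= real d * (\<Sum>i<d. x i ^ (2 * mexp))" using d by (intro mult_right_mono) auto
  then show "real d + (\<Sum>i<d. x i ^ (2 * mexp)) <= real d * psi x" by (simp add: psi_def distrib_left)
 qed auto
 finally show ?thesis by (simp add: mult.assoc)
qed

text \<open>The smooth approximation plus the barrier lies above \<open>v\<close>. A positive
  maximum of the difference would be attained in a compact set at some time before \<open>T\<close>,
  and there the lifted sum is an admissible test function that violates \<open>test\<close>.\<close>

lemma comparison_interior:
 assumes g: "adm g" and h: "adm0 h"
  and v: "continuous_on ({0..T} \<times> Rd d) (%p. v (fst p) (snd p))"
  and vK: "!!t x. t \<in> {0..T} ==> x \<in> Rd d ==> abs (v t x) <= K * wgt d x powr s"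
  and vT: "!!x. x \<in> Rd d ==> v T x <= h x"
  and test: "!!t x ph pht phx phxx. t \<in> {0<..<T} ==> x \<in> Rd d ==> is_C12 d T ph pht phx phxx ==>
    (!!s y. s \<in> {0<..<T} ==> y \<in> Rd d ==> v s y <= ph s y) ==> ph t x = v t x ==>
    pht t x + (1/2) * (\<Sum>i<d. phxx i i t x) + g t x >= 0"
  and dl: "dl > 0" and t1: "t1 \<in> {0<..<T}" and x1: "x1 \<in> Rd d"
 shows "v t1 x1 <= Wl h g 0 t1 x1 + dl * psi x1
  + dl * (exp ((real mexp * real (2 * mexp - 1) * real d + 2) * (T - t1)) * psi x1) + dl / t1"
proof -
 define l0 where "l0 = real mexp * real (2 * mexp - 1) * real d"
 \<comment> \<open>\<open>l0\<close> pays for the Laplacian of \<open>psi\<close>, one further unit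
   for the smoothing error of the source, and the last one makes the inequality strict.\<close>
 define mu where "mu = l0 + 2"
 have l0: "l0 >= 0" by (simp add: l0_def)
 obtain K2 where K2: "K2 >= 0" "!!eps t x. eps \<in> {0..1} ==> t \<in> {0..T} ==> abs (Wl h g eps t x) <= K2 * wgt d x powr s" by (rule Wl_bound[OF g h]) blast
 obtain K3 where K3: "K3 >= 0" "!!eps t x. eps \<in> {0..1} ==> t \<in> {0..T} ==> abs (Q0 g t eps x) <= K3 * wgt d x powr s" by (rule G_bound[OF g]) blast
 obtain eps1 where eps1: "eps1 > 0" "!!eps t x. eps \<in> {0..1} ==> eps <= eps1 ==> t \<in> {0..T} ==> x \<in> Rd d ==> abs (Wl h g eps t x - Wl h g 0 t x) <= dl * psi x"
  using weighted_uniform[OF Wl_cont[OF g h] K2(2) dl] by metis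
 obtain eps2 where eps2: "eps2 > 0" "!!eps t x. eps \<in> {0..1} ==> eps <= eps2 ==> t \<in> {0..T} ==> x \<in> Rd d ==> abs (Q0 g t eps x - Q0 g t 0 x) <= dl * psi x"
  using weighted_uniform[OF G_cont[OF g] K3(2) dl] by metis
 define eps where "eps = min 1 (min eps1 eps2)"
 have eps: "eps > 0" "eps \<in> {0<..1}" "eps \<in> {0..1}" "eps <= eps1" "eps <= eps2" using eps1 eps2 by (auto simp: eps_def)
 define W where "W = Wl h g eps"
 have Wc: "Wc h g eps t x = W t x" if "t \<in> {0..T}" for t x unfolding W_def by (rule Wc_eq_Wl[OF g that eps(2)])
 define Bt where "Bt t x = dl * (exp (mu * (T - t)) * psi x) + dl / t" for t x
 define Z where "Z t x = v t x - W t x - Bt t x" for t x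
 have ep: "psi x <= exp (mu * (T - t)) * psi x" if "t \<in> {0..T}" for t x
 proof -
  have "1 * psi x <= exp (mu * (T - t)) * psi x"
   using that l0 psi_ge_1[of x] by (intro mult_right_mono) (auto simp: mu_def)
  then show ?thesis by simp
 qed
 have claim: "Z t1 x1 <= 0"
 proof (rule ccontr)
  assume "\<not> Z t1 x1 <= 0"
  then have Z1: "Z t1 x1 > 0" by simp
  obtain R where R: "R >= 1" "!!x. \<exists>i<d. R < abs (x i) ==> (K + K2) * wgt d x powr s <= dl * psi x"
   by (rule psi_dominates[OF dl]) blast
  have vW: "v t x - W t x <= (K + K2) * wgt d x powr s" if "t \<in> {0..T}" "x \<in> Rd d" for t x
   using vK[OF that] K2(2)[OF eps(3) that(1), of x] by (simp add: W_def algebra_simps abs_le_iff)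
  have out: "Z t x < 0" if t: "t \<in> {0<..T}" and x: "x \<in> Rd d" "\<exists>i<d. R < abs (x i)" for t x
  proof -
   have t': "t \<in> {0..T}" using t by auto
   have "dl * psi x <= dl * (exp (mu * (T - t)) * psi x)" using ep[OF t'] dl by (intro mult_left_mono) auto
   moreover have "dl / t > 0" using dl t by simp
   ultimately show ?thesis using vW[OF t' x(1)] R(2)[OF x(2)] by (simp add: Z_def Bt_def)
  qed
  define w where "w = sqrt (real d) * (1 + R)"
  define C3 where "C3 = abs (K + K2) * w powr s"
  have C3: "C3 >= 0" by (simp add: C3_def)
  have inb: "(K + K2) * wgt d x powr s <= C3" if "\<not> (\<exists>i<d. R < abs (x i))" for x
  proof -
   have "\<forall>i<d. abs (x i) <= R" using that by (meson not_le)
   then have "wgt d x <= w" unfolding w_def by (intro wgt_le_box) (use R in auto)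
   then have "abs (K + K2) * wgt d x powr s <= C3" unfolding C3_def using s by (intro mult_left_mono powr_mono2) (auto simp: less_imp_le)
   moreover have "(K + K2) * wgt d x powr s <= abs (K + K2) * wgt d x powr s" by (intro mult_right_mono) auto
   ultimately show ?thesis by linarith
  qed
  \<comment> \<open>Before this time \<open>dl / t\<close> exceeds \<open>C3\<close>, the bound for
    \<open>v - W\<close> inside the box.\<close>
  define tl where "tl = min t1 (dl / (C3 + 1))"
  have tl: "tl > 0" "tl <= t1" using t1 dl C3 by (auto simp: tl_def)
  have early: "Z t x < 0" if t: "0 < t" "t < tl" and x: "x \<in> Rd d" for t x
  proof (cases "\<exists>i<d. R < abs (x i)")
   case True
   then show ?thesis using out[of t x] t tl t1 x by auto
  next
   case False
   have t': "t \<in> {0..T}" using t tl t1 by auto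
   have "t < dl / (C3 + 1)" using t by (simp add: tl_def)
   then have "C3 + 1 < dl / t" using t C3 by (simp add: field_simps)
   moreover have "dl * (exp (mu * (T - t)) * psi x) >= 0" using dl psi_ge_1[of x] by simp
   ultimately show ?thesis using vW[OF t' x] inb[OF False] by (simp add: Z_def Bt_def)
  qed
  define S where "S = {tl..T} \<times> box d (%_. 0) R"
  have SD: "S \<subseteq> {0..T} \<times> Rd d" using tl by (auto simp: S_def box_def)
  have Zc: "continuous_on S (%p. Z (fst p) (snd p))"
   unfolding Z_def Bt_def
  proof (intro continuous_on_diff continuous_on_add continuous_on_subset[OF v SD])
   have "continuous_on S (%p. (%p. Wl h g (fst p) (fst (snd p)) (snd (snd p))) (eps, fst p, snd p))"
    by (rule continuous_on_compose2[OF Wl_cont[OF g h]]) (use SD eps in \<open>auto intro!: continuous_intros\<close>)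
   then show "continuous_on S (%p. W (fst p) (snd p))" by (simp add: W_def)
   show "continuous_on S (%p. dl * (exp (mu * (T - fst p)) * psi (snd p)))"
   proof -
    have "continuous_on S (%p. snd p i)" for i by (rule continuous_on_coord) (intro continuous_intros)
    then show ?thesis unfolding psi_def by (intro continuous_intros)
   qed
   show "continuous_on S (%p. dl / fst p)"
    using tl by (intro continuous_on_divide continuous_on_const continuous_on_fst continuous_on_id) (auto simp: S_def)
  qed
  have x1b: "x1 \<in> box d (%_. 0) R"
  proof -
   have "\<not> (\<exists>i<d. R < abs (x1 i))" using out[of t1 x1] t1 x1 Z1 by auto
   then have "\<forall>i<d. abs (x1 i) <= R" by (meson not_le)
   then show ?thesis using x1 by (simp add: box_def)
  qed
  have S1: "(t1, x1) \<in> S" using x1b tl t1 by (auto simp: S_def)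
  have Sc: "compact S" unfolding S_def by (intro compact_Times compact_box) simp
  obtain p where p: "p \<in> S" "!!q. q \<in> S ==> Z (fst q) (snd q) <= Z (fst p) (snd p)"
   using continuous_attains_sup[OF Sc _ Zc] S1 by blast
  obtain t0 x0 where p0: "p = (t0, x0)" by (cases p)
  have S0: "(t0, x0) \<in> S" and max: "!!t x. (t, x) \<in> S ==> Z t x <= Z t0 x0" using p p0 by auto
  have Z0: "Z t0 x0 > 0" using max[OF S1] Z1 by linarith
  have x0: "x0 \<in> Rd d" using S0 SD by auto
  have "t0 ~= T"
  proof
   assume [simp]: "t0 = T"
   have TT: "T \<in> {0..T}" using T by simp
   have "abs (W T x0 - h x0) <= dl * psi x0"
    using eps1(2)[OF eps(3,4) TT x0] by (simp add: W_def Wl_T restrict_Rd[OF x0])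
   moreover have "dl / T > 0" using dl T by simp
   ultimately show False using Z0 vT[OF x0] by (simp add: Z_def Bt_def)
  qed
  then have t0: "t0 \<in> {0<..<T}" using S0 tl by (auto simp: S_def)
  have t0': "t0 \<in> {0..T}" using t0 by auto
  have glob: "Z t x <= Z t0 x0" if t: "t \<in> {0<..<T}" and x: "x \<in> Rd d" for t x
  proof (cases "(t, x) \<in> S")
   case False
   then have "t < tl \<or> (\<exists>i<d. R < abs (x i))" using t x by (auto simp: S_def box_def not_le)
   then have "Z t x < 0" using early[of t x] out[of t x] t x by auto
   with Z0 show ?thesis by simp
  qed (rule max)
  \<comment> \<open>Lifting by the value \<open>Z t0 x0\<close> at the maximum makes the test
    function touch \<open>v\<close> at \<open>(t0, x0)\<close>.\<close>
  note C = is_C12_add[OF Wc_C12[OF g h eps(1)] is_C12_barrier[of dl mu "Z t0 x0"]]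
  let ?e = "exp (mu * (T - t0))"
  have "(Wct h g eps t0 x0 + (- (mu * dl * (?e * psi x0)) - dl / t0\<^sup>2))
   + (1/2) * (\<Sum>i<d. Wcxx h g eps i i t0 x0 + (if i = i then dl * (?e * (real (2 * mexp) * (real (2 * mexp - 1) * x0 i ^ (2 * mexp - 2)))) else 0)) + g t0 x0 >= 0"
  proof (rule test[OF t0 x0 C])
   show "v t y <= Wc h g eps t y + (dl * (exp (mu * (T - t)) * psi y) + dl / t + Z t0 x0)" if "t \<in> {0<..<T}" "y \<in> Rd d" for t y
    using glob[OF that] Wc[of t y] that by (simp add: Z_def[of t y] Bt_def)
   show "Wc h g eps t0 x0 + (dl * (exp (mu * (T - t0)) * psi x0) + dl / t0 + Z t0 x0) = v t0 x0"
    using Wc[OF t0'] by (simp add: Z_def Bt_def)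
  qed
  then have main: "(Wct h g eps t0 x0 + (1/2) * (\<Sum>i<d. Wcxx h g eps i i t0 x0)) - mu * dl * (?e * psi x0) - dl / t0\<^sup>2
   + (1/2) * (dl * ?e * (\<Sum>i<d. real (2 * mexp) * (real (2 * mexp - 1) * x0 i ^ (2 * mexp - 2)))) + g t0 x0 >= 0"
   by (simp add: sum.distrib distrib_left sum_distrib_left mult.assoc)
  have "dl * ?e * (\<Sum>i<d. real (2 * mexp) * (real (2 * mexp - 1) * x0 i ^ (2 * mexp - 2))) <= dl * ?e * (real (2 * mexp) * real (2 * mexp - 1) * real d * psi x0)"
   using dl by (intro mult_left_mono psi_laplace) auto
  also have "... = 2 * (l0 * dl * (?e * psi x0))" by (simp add: l0_def)
  finally have lap: "(1/2) * (dl * ?e * (\<Sum>i<d. real (2 * mexp) * (real (2 * mexp - 1) * x0 i ^ (2 * mexp - 2)))) <= l0 * dl * (?e * psi x0)" by simp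
  have Gg: "abs (Q0 g t0 eps x0 - g t0 x0) <= dl * psi x0"
   using eps2(2)[OF eps(3,5) t0' x0] by (simp add: G_0 restrict_Rd[OF x0])
  have "dl * psi x0 <= dl * (?e * psi x0)" using ep[OF t0'] dl by (intro mult_left_mono) auto
  moreover have "mu * dl * (?e * psi x0) = l0 * dl * (?e * psi x0) + 2 * (dl * (?e * psi x0))" by (simp add: mu_def algebra_simps)
  moreover have "dl * (?e * psi x0) > 0" using dl psi_ge_1[of x0] by (intro mult_pos_pos) auto
  moreover have "dl / t0\<^sup>2 > 0" using dl t0 by simp
  ultimately show False
   using main lap Gg Wc_equation[OF g h eps(1) t0, of x0] by (simp add: abs_le_iff)
 qed
 have "t1 \<in> {0..T}" using t1 by auto
 from eps1(2)[OF eps(3,4) this x1] have "W t1 x1 <= Wl h g 0 t1 x1 + dl * psi x1" by (simp add: W_def abs_le_iff)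
 with claim show ?thesis by (simp add: Z_def Bt_def mu_def l0_def)
qed

text \<open>The barrier is removed by letting \<open>dl\<close> tend to zero at a fixed interior
  point. At \<open>t = 0\<close>, where \<open>dl / t\<close> is singular, the inequality follows by
  continuity.\<close>

lemma comparison:
 assumes g: "adm g" and h: "adm0 h"
  and v: "continuous_on ({0..T} \<times> Rd d) (%p. v (fst p) (snd p))"
  and vK: "!!t x. t \<in> {0..T} ==> x \<in> Rd d ==> abs (v t x) <= K * wgt d x powr s"
  and vT: "!!x. x \<in> Rd d ==> v T x <= h x"
  and test: "!!t x ph pht phx phxx. t \<in> {0<..<T} ==> x \<in> Rd d ==> is_C12 d T ph pht phx phxx ==>
    (!!s y. s \<in> {0<..<T} ==> y \<in> Rd d ==> v s y <= ph s y) ==> ph t x = v t x ==>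
    pht t x + (1/2) * (\<Sum>i<d. phxx i i t x) + g t x >= 0"
  and t: "t \<in> {0..T}" and x: "x \<in> Rd d"
 shows "v t x <= heat d (T - t) h x + source d T g t x"
proof -
 define B where "B t = psi x + exp ((real mexp * real (2 * mexp - 1) * real d + 2) * (T - t)) * psi x + 1 / t" for t
 have int: "v t x <= Wl h g 0 t x" if t: "t \<in> {0<..<T}" for t
 proof (rule field_le_epsilon)
  fix e :: real assume e: "e > 0"
  have B: "B t > 0" using t psi_ge_1[of x] by (auto simp: B_def intro!: add_pos_pos)
  have "v t x <= Wl h g 0 t x + (e / B t) * psi x + (e / B t) * (exp ((real mexp * real (2 * mexp - 1) * real d + 2) * (T - t)) * psi x) + (e / B t) / t"
  proof (rule comparison_interior[where v = v and K = K and g = g and h = h])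
   fix t x ph pht phx phxx
   assume "t \<in> {0<..<T}" "x \<in> Rd d" "is_C12 d T ph pht phx phxx"
    "!!s y. s \<in> {0<..<T} ==> y \<in> Rd d ==> v s y <= ph s y" "ph t x = v t x"
   then show "pht t x + (1/2) * (\<Sum>i<d. phxx i i t x) + g t x >= 0" by (rule test)
  qed (use g h v vK vT t x e B in auto)
  also have "... = Wl h g 0 t x + (e / B t) * B t"
   unfolding B_def[of t] by (simp add: distrib_left add.assoc)
  finally show "v t x <= Wl h g 0 t x + e" using B by simp
 qed
 consider "t = T" | "t \<in> {0<..<T}" | "t = 0" using t by fastforce
 then have "v t x <= Wl h g 0 t x"
 proof cases
  case 1
  then show ?thesis using vT[OF x] by (simp add: Wl_T restrict_Rd[OF x])
 next
  case 3
  \<comment> \<open>Interior times decreasing to 0; the offset 2 keeps also the first one strictly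
    below \<open>T\<close>.\<close>
  let ?s = "%n. T / (real n + 2)"
  have s: "?s n \<in> {0<..<T}" for n
  proof -
   have "T * 1 < T * (real n + 2)" using T by (intro mult_strict_left_mono) auto
   then show ?thesis using T by (simp add: divide_less_eq)
  qed
  have lim: "?s \<longlonglongrightarrow> 0" by real_asymp
  have s': "?s n \<in> {0..T}" for n using s[of n] by auto
  have "continuous_on {0..T} (%t. (%p. v (fst p) (snd p)) (t, x))"
   by (rule continuous_on_compose2[OF v]) (use x in \<open>auto intro!: continuous_intros\<close>)
  then have cv: "continuous_on {0..T} (%t. v t x)" by simp
  have "continuous_on {0..T} (%t. (%p. Wl h g (fst p) (fst (snd p)) (snd (snd p))) (0, t, x))"
   by (rule continuous_on_compose2[OF Wl_cont[OF g h]]) (auto intro!: continuous_intros)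
  then have cW: "continuous_on {0..T} (%t. Wl h g 0 t x)" by simp
  have T0: "0 \<in> {0..T}" using T by simp
  have "(%n. v (?s n) x) \<longlonglongrightarrow> v 0 x" "(%n. Wl h g 0 (?s n) x) \<longlonglongrightarrow> Wl h g 0 0 x"
   using cv[unfolded continuous_on_sequentially comp_def, rule_format, OF T0, of ?s]
    cW[unfolded continuous_on_sequentially comp_def, rule_format, OF T0, of ?s] s' lim by simp_all
  from LIMSEQ_le[OF this] have "v 0 x <= Wl h g 0 0 x" using int[OF s] by auto
  then show ?thesis using 3 by simp
 qed (rule int)
 then show ?thesis by (simp add: Wl_0)
qed

end

text \<open>Polynomial growth is formulated with a single number as factor and exponent, hence the
  maximum of the two.\<close>

lemma wgt_pg_bound:
 assumes d: "d >= 1" and s: "s >= 0" and K: "K >= 0" "abs y <= K * wgt d x powr s"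
 shows "abs y <= max (K * sqrt (real d) powr s) s * (1 + enorm d x) powr max (K * sqrt (real d) powr s) s"
proof -
 let ?c = "max (K * sqrt (real d) powr s) s"
 have d1: "1 <= sqrt (real d)" using d by simp
 have "wgt d x <= sqrt (real d) * (1 + enorm d x)"
  using mult_right_mono[OF d1 enorm_nonneg[of d x]] by (simp add: wgt_def distrib_left)
 then have "wgt d x powr s <= (sqrt (real d) * (1 + enorm d x)) powr s"
  using s wgt_ge_1[OF d, of x] by (intro powr_mono2) auto
 also have "... = sqrt (real d) powr s * (1 + enorm d x) powr s" by (simp add: powr_mult)
 finally have "K * wgt d x powr s <= K * (sqrt (real d) powr s * (1 + enorm d x) powr s)" using K by (intro mult_left_mono) auto
 also have "... <= ?c * (1 + enorm d x) powr ?c"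
  unfolding mult.assoc[symmetric] using s by (intro mult_mono powr_mono) auto
 finally show ?thesis using K by linarith
qed

text \<open>A competing solution may satisfy its growth bound with a larger exponent than
  \<open>u\<close>, so the uniqueness argument runs in a wider weighted class than the existence
  argument.\<close>

theorem visc_exists_unique:
 fixes f :: "real => real" and hd :: "(nat => real) => real"
 assumes d: "d >= 1" and T: "T > 0" and s: "s >= 0"
  and L: "!!v w. abs (f v - f w) <= L * abs (v - w)"
  and h: "continuous_on (Rd d) hd" "!!x. x \<in> Rd d ==> abs (hd x) <= K * wgt d x powr s"
  and u: "heat_setting.adm d T s u" "heat_setting.mild d T f (%x. hd (restrict x {..<d})) u"
 shows "is_pg_visc_solution d T f hd u"
  and "is_pg_visc_solution d T f hd v ==> t \<in> {0..T} ==> x \<in> Rd d ==> v t x = u t x"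
proof -
 interpret A: heat_setting d T s by unfold_locales fact+
 let ?h = "%x. hd (restrict x {..<d})"
 have hc: "continuous_on UNIV ?h"
  by (rule continuous_on_compose2[OF h(1)]) (auto intro!: continuous_intros)
 have h0: "A.adm0 ?h" unfolding A.adm0_def
  using hc h(2)[of "restrict _ {..<d}"] by (auto intro!: exI[of _ K])
 note mild_def = A.mild_def
 have fu: "A.adm (%t x. f (u t x))" by (rule A.adm_Lipschitz[OF u(1) L])
 have ueq: "u t x = heat d (T - t) ?h x + source d T (%t x. f (u t x)) t x" if "t \<in> {0..T}" for t x
  using u(2) that by (simp add: mild_def)
 have sub: "visc_sub d T f u"
  unfolding visc_sub_def
 proof (intro allI impI)
  fix t x ph pht phx phxx
  assume *: "t \<in> {0<..<T}" "x \<in> Rd d" "is_C12 d T ph pht phx phxx" "\<forall>s y. s \<in> {0<..<T} --> y \<in> Rd d --> u s y <= ph s y" "ph t x = u t x"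
  show "pht t x + (1/2) * (\<Sum>i<d. phxx i i t x) + f (u t x) >= 0"
   by (rule A.mild_subtest[OF fu h0 ueq *(3) _ *(1,2,5)]) (use *(4) in auto)
 qed
 have h0m: "A.adm0 (%x. - ?h x)" by (rule A.adm0_minus[OF h0])
 have fum: "A.adm (%t x. - f (u t x))" using A.adm_cmult[OF fu, of "-1"] by simp
 have neg_heat: "heat d tau (%x. - k x) x = - heat d tau k x" for tau k x by (simp add: heat_def)
 have neg_source: "source d T (%t x. - F t x) t x = - source d T F t x" for F t x by (simp add: source_def source_arg_def)
 have super: "visc_super d T f u"
  unfolding visc_super_def
 proof (intro allI impI)
  fix t x ph pht phx phxx
  assume *: "t \<in> {0<..<T}" "x \<in> Rd d" "is_C12 d T ph pht phx phxx" "\<forall>s y. s \<in> {0<..<T} --> y \<in> Rd d --> u s y >= ph s y" "ph t x = u t x"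
  have "- pht t x + (1/2) * (\<Sum>i<d. - phxx i i t x) + - f (u t x) >= 0"
  proof (rule A.mild_subtest[OF fum h0m _ is_C12_uminus[OF *(3)] _ *(1,2), where u = "%t x. - u t x"])
   show "- u t x = heat d (T - t) (%x. - ?h x) x + source d T (%t x. - f (u t x)) t x" if "t \<in> {0..T}" for t x
    using ueq[OF that, of x] by (simp add: neg_heat neg_source)
   show "- u s y <= - ph s y" if "s \<in> {0<..<T}" "y \<in> Rd d" for s y using *(4) that by auto
  qed (use *(5) in simp)
  then show "pht t x + (1/2) * (\<Sum>i<d. phxx i i t x) + f (u t x) <= 0" by (simp add: sum_negf)
 qed
 obtain Ku where Ku: "Ku >= 0" "!!t x. t \<in> {0..T} ==> abs (u t x) <= Ku * wgt d x powr s" by (rule A.admD[OF u(1)]) blast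
 show "is_pg_visc_solution d T f hd u"
  unfolding is_pg_visc_solution_def
 proof (intro conjI sub super ballI)
  show "continuous_on ({0..T} \<times> Rd d) (%(t, x). u t x)" by (rule continuous_on_subset[OF A.adm_cont[OF u(1)]]) auto
  show "\<exists>c. \<forall>t x. t \<in> {0..T} --> x \<in> Rd d --> abs (u t x) <= c * (1 + enorm d x) powr c"
   by (intro exI[of _ "max (Ku * sqrt (real d) powr s) s"] allI impI wgt_pg_bound[OF d s Ku(1)] Ku(2))
  show "u T x = hd x" if "x \<in> Rd d" for x
   using ueq[of T x] T that by (simp add: heat_0 restrict_Rd source_def)
 qed
 assume v: "is_pg_visc_solution d T f hd v" and t: "t \<in> {0..T}" and x: "x \<in> Rd d"
 obtain c where c: "!!t x. t \<in> {0..T} ==> x \<in> Rd d ==> abs (v t x) <= c * (1 + enorm d x) powr c"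
  using v unfolding is_pg_visc_solution_def by blast
 have c0: "c >= 0"
 proof -
  have "0 <= c * (1 + enorm d x) powr c" using c[OF t x] by linarith
  moreover have "(1 + enorm d x) powr c > 0" using enorm_nonneg[of d x] by (intro powr_gt_zero[THEN iffD2]) linarith
  ultimately show ?thesis by (simp add: zero_le_mult_iff)
 qed
 \<comment> \<open>An exponent that admits \<open>u\<close> as well as the given solution
   \<open>v\<close>.\<close>
 define s' where "s' = max s c"
 interpret B: heat_setting d T s' by unfold_locales (use d T s s'_def in auto)
 have up: "wgt d x powr s <= wgt d x powr s'" "wgt d x powr c <= wgt d x powr s'" for x
  using wgt_ge_1[OF d, of x] by (auto intro!: powr_mono simp: s'_def)
 have vb: "abs (v t x) <= c * wgt d x powr s'" if "t \<in> {0..T}" "x \<in> Rd d" for t x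
 proof -
  have "(1 + enorm d x) powr c <= wgt d x powr c" using c0 wgt_ge_one_plus[OF d, of x] by (intro powr_mono2) (auto intro: add_nonneg_nonneg)
  also have "... <= wgt d x powr s'" by (rule up)
  finally have "c * (1 + enorm d x) powr c <= c * wgt d x powr s'" using c0 by (intro mult_left_mono)
  then show ?thesis using c[OF that] by linarith
 qed
 \<comment> \<open>Extends \<open>v\<close> from \<open>Rd d\<close> to all functions, so that it
   can be a member of \<open>B.adm\<close>.\<close>
 define w where "w t x = v t (restrict x {..<d})" for t x
 have vc: "continuous_on ({0..T} \<times> Rd d) (%p. v (fst p) (snd p))"
  using v by (simp add: is_pg_visc_solution_def case_prod_beta')
 have aw: "B.adm w"
 proof (rule B.admI)
  have "continuous_on ({0..T} \<times> UNIV) (%p. (%p. v (fst p) (snd p)) (fst p, restrict (snd p) {..<d}))"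
   by (rule continuous_on_compose2[OF vc]) (auto intro!: continuous_intros)
  then show "continuous_on ({0..T} \<times> UNIV) (%p. w (fst p) (snd p))" by (simp add: w_def)
  show "abs (w t x) <= c * wgt d x powr s'" if "t \<in> {0..T}" for t x
   unfolding w_def using vb[OF that restrict_in_Rd, of x] by simp
 qed
 have K0: "abs (hd x) <= abs K * wgt d x powr s'" if "x \<in> Rd d" for x
 proof -
  have "abs (hd x) <= K * wgt d x powr s" by (rule h(2)[OF that])
  also have "... <= abs K * wgt d x powr s'" by (intro mult_mono up) auto
  finally show ?thesis .
 qed
 have Bh0: "B.adm0 ?h" unfolding B.adm0_def
  using hc K0[of "restrict _ {..<d}"] by (auto intro!: exI[of _ "abs K"])
 have Bh0m: "B.adm0 (%x. - ?h x)" by (rule B.adm0_minus[OF Bh0])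
 have fw: "B.adm (%t x. f (w t x))" by (rule B.adm_Lipschitz[OF aw L])
 have fwm: "B.adm (%t x. - f (w t x))" using B.adm_cmult[OF fw, of "-1"] by simp
 have vT: "v T x = ?h x" if "x \<in> Rd d" for x using v that by (simp add: is_pg_visc_solution_def restrict_Rd)
 have vsub: "visc_sub d T f v" and vsup: "visc_super d T f v" using v by (auto simp: is_pg_visc_solution_def)
 have le: "v t x <= heat d (T - t) ?h x + source d T (%t x. f (w t x)) t x" if tx: "t \<in> {0..T}" "x \<in> Rd d" for t x
 proof (rule B.comparison[where v = v, OF fw Bh0 vc vb _ _ tx])
  show "v T x <= ?h x" if "x \<in> Rd d" for x using vT[OF that] by simp
  fix t x ph pht phx phxx
  assume *: "t \<in> {0<..<T}" "x \<in> Rd d" "is_C12 d T ph pht phx phxx" "!!s y. s \<in> {0<..<T} ==> y \<in> Rd d ==> v s y <= ph s y" "ph t x = v t x"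
  then show "pht t x + (1/2) * (\<Sum>i<d. phxx i i t x) + f (w t x) >= 0"
   using vsub unfolding visc_sub_def w_def restrict_Rd[OF *(2)] by blast
 qed
 have ge: "- v t x <= heat d (T - t) (%x. - ?h x) x + source d T (%t x. - f (w t x)) t x" if tx: "t \<in> {0..T}" "x \<in> Rd d" for t x
 proof (rule B.comparison[where v = "%t x. - v t x", OF fwm Bh0m _ _ _ _ tx])
  show "continuous_on ({0..T} \<times> Rd d) (%p. - v (fst p) (snd p))" by (rule continuous_on_minus[OF vc])
  show "abs (- v t x) <= c * wgt d x powr s'" if "t \<in> {0..T}" "x \<in> Rd d" for t x using vb[OF that] by simp
  show "- v T x <= - ?h x" if "x \<in> Rd d" for x using vT[OF that] by simp
  fix t x ph pht phx phxx
  assume *: "t \<in> {0<..<T}" "x \<in> Rd d" "is_C12 d T ph pht phx phxx" "!!s y. s \<in> {0<..<T} ==> y \<in> Rd d ==> - v s y <= ph s y" "ph t x = - v t x"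
  have "- pht t x + (1/2) * (\<Sum>i<d. - phxx i i t x) + f (v t x) <= 0"
  proof (rule vsup[unfolded visc_super_def, rule_format, OF *(1,2) is_C12_uminus[OF *(3)]])
   show "- ph s y <= v s y" if "s \<in> {0<..<T}" "y \<in> Rd d" for s y using *(4)[OF that] by simp
   show "- ph t x = v t x" using *(5) by simp
  qed
  then show "pht t x + (1/2) * (\<Sum>i<d. phxx i i t x) + - f (w t x) >= 0"
   unfolding w_def restrict_Rd[OF *(2)] by (simp add: sum_negf)
 qed
 have veq: "v t x = heat d (T - t) ?h x + source d T (%t x. f (w t x)) t x" if tx: "t \<in> {0..T}" "x \<in> Rd d" for t x
  using le[OF tx] ge[OF tx] by (simp add: neg_heat neg_source)
 have mw: "B.mild f ?h w"
  unfolding B.mild_def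
 proof (intro ballI allI)
  fix t x assume "t \<in> {0..T}"
  from veq[OF this restrict_in_Rd, of x]
  show "w t x = heat d (T - t) ?h x + source d T (%t x. f (w t x)) t x"
   by (simp add: w_def[of t x] heat_restrict source_restrict)
 qed
 have Bu: "B.adm u"
 proof (rule B.admI[OF A.adm_cont_split[OF u(1)]])
  show "abs (u t x) <= Ku * wgt d x powr s'" if "t \<in> {0..T}" for t x
   using Ku(2)[OF that, of x] mult_left_mono[OF up(1)[of x] Ku(1)] by linarith
 qed
 have "w t x = u t x"
  by (rule B.mild_unique[OF aw mw Bu u(2) Bh0 L t])
 then show "v t x = u t x" by (simp add: w_def restrict_Rd[OF x])
qed

section \<open>Calculus of networks\<close>

text \<open>\<open>net a ds G\<close>: the map \<open>G\<close> is realised by a network with layer dimensions \<open>ds\<close>; weights are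
 functions on indices, so that the calculus of networks needs no list manipulations.\<close>

inductive net :: "(real => real) => nat list => ((nat => real) => nat => real) => bool" for a where
 net_lin: "m > 0 ==> n > 0 ==> net a [m, n] (%x i. (\<Sum>j<m. W i j * x j) + B i)"
| net_cons: "m > 0 ==> net a (n # k # ds) G ==> net a (m # n # k # ds) (%x. G (%i. a ((\<Sum>j<m. W i j * x j) + B i)))"

text \<open>Coordinates beyond the input width may be changed freely; this disposes of padding and
  of the \<open>undefined\<close> values of extensional points.\<close>

lemma net_dep: "net a ds G ==> (!!j. j < hd ds ==> x j = y j) ==> G x = G y"
proof (induction arbitrary: x y rule: net.induct)
 case (net_lin m n W B)
 then have "(\<Sum>j<m. W i j * x j) = (\<Sum>j<m. W i j * y j)" for i by (intro sum.cong) auto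
 then show ?case by simp
next
 case (net_cons m n k ds G W B)
 then have "(\<Sum>j<m. W i j * x j) = (\<Sum>j<m. W i j * y j)" for i by (intro sum.cong) auto
 then show ?case by simp
qed

lemma net_pos: "net a ds G ==> \<forall>l\<in>set ds. l > 0"
 by (induction rule: net.induct) auto

lemma net_length: "net a ds G ==> 2 <= length ds"
 by (induction rule: net.induct) auto

text \<open>The first matrix absorbs the affine map, so shifting or duplicating inputs costs no
  layer.\<close>

lemma net_pre_affine:
 assumes "net a (m # ds) G" "m' > 0"
 shows "net a (m' # ds) (%x. G (%j. (\<Sum>i<m'. V j i * x i) + c j))"
proof -
 have lin: "(\<Sum>j<m. W i j * ((\<Sum>k<m'. V j k * x k) + c j)) + B i = (\<Sum>k<m'. (\<Sum>j<m. W i j * V j k) * x k) + ((\<Sum>j<m. W i j * c j) + B i)"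
  for W :: "nat => nat => real" and B i and x :: "nat => real"
 proof -
  have "(\<Sum>j<m. W i j * (\<Sum>k<m'. V j k * x k)) = (\<Sum>k<m'. (\<Sum>j<m. W i j * V j k) * x k)"
   unfolding sum_distrib_left sum_distrib_right by (subst sum.swap) (simp add: mult.assoc)
  then show ?thesis by (simp add: distrib_left sum.distrib)
 qed
 from assms(1) show ?thesis
 proof cases
  case (net_lin n W B)
  show ?thesis unfolding net_lin lin
   by (rule net.net_lin) (use assms(2) net_lin in auto)
 next
  case (net_cons n k ds' G' W B)
  show ?thesis unfolding net_cons lin
   by (rule net.net_cons) (use assms(2) net_cons in auto)
 qed
qed

text \<open>The last affine map of \<open>G\<close> merges with the first one of \<open>G'\<close>;
  the intermediate dimension \<open>last ds\<close> therefore disappears from the list.\<close>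

lemma net_comp:
 assumes "net a ds G" "net a (last ds # ds') G'"
 shows "net a (butlast ds @ ds') (%x. G' (G x))"
 using assms
proof (induction rule: net.induct)
 case (net_lin m n W B)
 then show ?case using net_pre_affine[of a n ds' G' m W B] by simp
next
 case (net_cons m n k ds G W B)
 then have IH: "net a (n # (butlast (k # ds) @ ds')) (%x. G' (G x))" by simp
 have "ds' ~= []" using net_length[OF net_cons.prems] by auto
 then obtain k' ds'' where e: "butlast (k # ds) @ ds' = k' # ds''" by (cases "butlast (k # ds) @ ds'") auto
 have "net a (m # n # k' # ds'') (%x. G' (G (%i. a ((\<Sum>j<m. W i j * x j) + B i))))"
  by (rule net.net_cons[where G = "%x. G' (G x)"]) (use IH e net_cons in simp_all)
 moreover have "butlast (m # n # k # ds) @ ds' = m # n # (butlast (k # ds) @ ds')" by simp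
 ultimately show ?case using e by simp
qed

lemma sum_lessThan_add: "(\<Sum>j<m + n. f j) = (\<Sum>j<m. f j) + (\<Sum>j<n. f (j + m) :: real)" for m n :: nat
 by (induction n) (auto simp: add.commute add.left_commute)

text \<open>Used on the dimensions after the input layer: hidden widths add up, while the two scalar
  outputs are combined into one.\<close>

fun par :: "nat list => nat list => nat list" where
 "par [x] ys = [1]"
| "par xs [y] = [1]"
| "par (x # xs) (y # ys) = (x + y) # par xs ys"
| "par [] ys = []"
| "par xs [] = []"

lemma net_par:
 assumes "net a (m1 # ds1) G1" "net a (m2 # ds2) G2" "length ds1 = length ds2" "last ds1 = 1" "last ds2 = 1"
 shows "net a ((m1 + m2) # par ds1 ds2) (%x i. c1 * G1 x 0 + c2 * G2 (%j. x (j + m1)) 0)"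
 using assms
proof (induction "m1 # ds1" G1 arbitrary: m1 ds1 m2 ds2 G2 rule: net.induct)
 case (net_lin m n W B m2 ds2 G2)
 have [simp]: "n = 1" "m > 0" using net_lin by auto
 have "length ds2 = 1" using net_lin by simp
 then have [simp]: "ds2 = [1]" using net_lin by (cases ds2) auto
 from \<open>net a (m2 # ds2) G2\<close> obtain W2 B2 where G2: "G2 = (%x i. (\<Sum>j<m2. W2 i j * x j) + B2 i)" "m2 > 0"
  by cases auto
 let ?W = "%(i::nat) j. if j < m then c1 * W 0 j else c2 * W2 0 (j - m)"
 have "net a [m + m2, 1] (%x i. (\<Sum>j<m + m2. ?W i j * x j) + (c1 * B 0 + c2 * B2 0))"
  by (rule net.net_lin) auto
 also have "(%x i. (\<Sum>j<m + m2. ?W i j * x j) + (c1 * B 0 + c2 * B2 0)) =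
   (%x (i::nat). c1 * ((\<Sum>j<m. W 0 j * x j) + B 0) + c2 * G2 (%j. x (j + m)) 0)"
  by (intro ext) (simp add: G2 sum_lessThan_add distrib_left sum_distrib_left mult.assoc)
 finally show ?case using net_lin by simp
next
 case (net_cons m n k ds G W B m2 ds2 G2)
 have l2: "length ds2 = Suc (Suc (length ds))" using net_cons by simp
 from \<open>net a (m2 # ds2) G2\<close> obtain n2 k2 ds2' G2' W2 B2 where G2: "ds2 = n2 # k2 # ds2'" "m2 > 0"
  "G2 = (%x. G2' (%i. a ((\<Sum>j<m2. W2 i j * x j) + B2 i)))" "net a (n2 # k2 # ds2') G2'"
  by cases (use l2 in auto)
 have IH: "net a ((n + n2) # par (k # ds) (k2 # ds2')) (%x i. c1 * G x 0 + c2 * G2' (%j. x (j + n)) 0)"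
  using net_cons.hyps(3)[OF G2(4)] net_cons.prems G2 by simp
 \<comment> \<open>Block-diagonal weights: the first \<open>n\<close> neurons run the first network,
   the remaining ones the second.\<close>
 let ?W = "%i j. if i < n then (if j < m then W i j else 0) else (if j < m then 0 else W2 (i - n) (j - m))"
 let ?B = "%i. if i < n then B i else B2 (i - n)"
 obtain q qs where q: "par (k # ds) (k2 # ds2') = q # qs"
  by (cases "ds"; cases ds2') auto
 have "net a ((m + m2) # (n + n2) # q # qs) (%x. (%x i. c1 * G x 0 + c2 * G2' (%j. x (j + n)) 0) (%i. a ((\<Sum>j<m + m2. ?W i j * x j) + ?B i)))"
  by (rule net.net_cons) (use IH q net_cons G2 in simp_all)
 also have "(%x. (%x i. c1 * G x 0 + c2 * G2' (%j. x (j + n)) 0) (%i. a ((\<Sum>j<m + m2. ?W i j * x j) + ?B i))) =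
   (%x (i::nat). c1 * G (%i. a ((\<Sum>j<m. W i j * x j) + B i)) 0 + c2 * G2 (%j. x (j + m)) 0)"
 proof (intro ext)
  fix x :: "nat => real" and i :: nat
  have "G (%i. a ((\<Sum>j<m + m2. ?W i j * x j) + ?B i)) = G (%i. a ((\<Sum>j<m. W i j * x j) + B i))"
   by (rule net_dep[OF net_cons.hyps(2)]) (simp add: sum_lessThan_add)
  moreover have "G2' (%j. a ((\<Sum>j'<m + m2. ?W (j + n) j' * x j') + ?B (j + n))) = G2 (%j. x (j + m))"
   unfolding G2(3) by (rule net_dep[OF G2(4)]) (simp add: sum_lessThan_add)
  ultimately show "(%x i. c1 * G x 0 + c2 * G2' (%j. x (j + n)) 0) (%i. a ((\<Sum>j<m + m2. ?W i j * x j) + ?B i)) i =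
   c1 * G (%i. a ((\<Sum>j<m. W i j * x j) + B i)) 0 + c2 * G2 (%j. x (j + m)) 0" by simp
 qed
 finally show ?case using q G2 by simp
qed

subsection \<open>Networks as lists of matrices\<close>

lemma ann_dims_Cons: "ann_dims ((W, B) # Ph) = length (hd W) # length W # map (%(W, B). length W) Ph"
 by (simp add: ann_dims_def)

lemma is_ann_single:
 "is_ann [(W, B)] \<longleftrightarrow> W ~= [] \<and> hd W ~= [] \<and> length B = length W \<and> (\<forall>row\<in>set W. length row = length (hd W))"
 by (auto simp: is_ann_def ann_dims_def)

lemma is_ann_Cons:
 assumes "Ph ~= []"
 shows "is_ann ((W, B) # Ph) \<longleftrightarrow> W ~= [] \<and> hd W ~= [] \<and> length B = length W \<and> (\<forall>row\<in>set W. length row = length (hd W)) \<and>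
   is_ann Ph \<and> length (hd (fst (hd Ph))) = length W" (is "?L \<longleftrightarrow> ?R")
proof -
 have all: "(\<forall>k<length ((W, B) # Ph). P k) \<longleftrightarrow> P 0 \<and> (\<forall>k<length Ph. P (Suc k))" for P
  by (auto simp: less_Suc_eq_0_disj)
 define m where "m = length (hd W)"
 have dims: "ann_dims ((W, B) # Ph) = m # length W # map (%(W, B). length W) Ph" by (simp add: ann_dims_Cons m_def)
 have dims': "ann_dims Ph = length (hd (fst (hd Ph))) # map (%(W, B). length W) Ph" by (simp add: ann_dims_def)
 have L: "?L \<longleftrightarrow> hd W ~= [] \<and> (W ~= [] \<and> length B = length W \<and> (\<forall>row\<in>set W. length row = m)) \<and>
  (\<forall>k<length Ph. fst (Ph ! k) ~= [] \<and> length (snd (Ph ! k)) = length (fst (Ph ! k)) \<and>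
    (\<forall>row\<in>set (fst (Ph ! k)). length row = (length W # map (%(W, B). length W) Ph) ! k))"
  unfolding is_ann_def all dims by simp
 show ?thesis
 proof
  assume l: ?L
  then have A: "\<forall>k<length Ph. fst (Ph ! k) ~= [] \<and> length (snd (Ph ! k)) = length (fst (Ph ! k)) \<and>
    (\<forall>row\<in>set (fst (Ph ! k)). length row = (length W # map (%(W, B). length W) Ph) ! k)" and W: "W ~= []"
   unfolding L by blast+
  from A assms have "fst (hd Ph) ~= [] \<and> (\<forall>row\<in>set (fst (hd Ph)). length row = length W)"
   by (auto simp: hd_conv_nth dest!: spec[of _ 0])
  then have h2: "length (hd (fst (hd Ph))) = length W" by (meson hd_in_set)
  have "is_ann Ph" unfolding is_ann_def dims' h2 using A assms h2 W by fastforce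
  with l h2 show ?R unfolding L m_def by blast
 next
  assume r: ?R
  then have h2: "length (hd (fst (hd Ph))) = length W" by blast
  have "\<forall>k<length Ph. fst (Ph ! k) ~= [] \<and> length (snd (Ph ! k)) = length (fst (Ph ! k)) \<and>
    (\<forall>row\<in>set (fst (Ph ! k)). length row = (length W # map (%(W, B). length W) Ph) ! k)"
   using r unfolding is_ann_def dims' h2 by blast
  with r show ?L unfolding L m_def by blast
 qed
qed

text \<open>Agreement holds only on the output indices, since \<open>affine\<close> returns 0 beyond
  them while \<open>G\<close> may be anything there.\<close>

lemma net_ann:
 assumes "net a ds G"
 shows "\<exists>Ph. is_ann Ph \<and> ann_dims Ph = ds \<and> (\<forall>x. \<forall>i<last ds. realize a Ph x i = G x i)"
 using assms
proof (induction rule: net.induct)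
 case (net_lin m n W B)
 let ?W = "map (%i. map (W i) [0..<m]) [0..<n]" and ?B = "map B [0..<n]"
 have h: "hd ?W = map (W 0) [0..<m]" using net_lin by (simp add: hd_map)
 have "is_ann [(?W, ?B)]" using net_lin by (auto simp: is_ann_single h)
 moreover have "ann_dims [(?W, ?B)] = [m, n]" by (simp add: ann_dims_Cons h)
 moreover have "realize a [(?W, ?B)] x i = (\<Sum>j<m. W i j * x j) + B i" if "i < n" for x i
  using that by (simp add: affine_def)
 ultimately show ?case by (intro exI[of _ "[(?W, ?B)]"]) auto
next
 case (net_cons m n k ds G W B)
 then obtain Ph where Ph: "is_ann Ph" "ann_dims Ph = n # k # ds" "!!x i. i < last (n # k # ds) ==> realize a Ph x i = G x i"
  by blast
 have n: "n > 0" using net_pos[OF net_cons.hyps(2)] by simp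
 let ?W = "map (%i. map (W i) [0..<m]) [0..<n]" and ?B = "map B [0..<n]"
 have h: "hd ?W = map (W 0) [0..<m]" using n by (simp add: hd_map)
 have ne: "Ph ~= []" using Ph(1) by (simp add: is_ann_def)
 have h2: "length (hd (fst (hd Ph))) = n" using Ph(2) by (simp add: ann_dims_def)
 have "is_ann ((?W, ?B) # Ph)" using n net_cons Ph h2 by (auto simp: is_ann_Cons[OF ne] h)
 moreover have "ann_dims ((?W, ?B) # Ph) = m # n # k # ds"
  using Ph(2) by (simp add: ann_dims_Cons h) (simp add: ann_dims_def)
 moreover have "realize a ((?W, ?B) # Ph) x i = G (%i. a ((\<Sum>j<m. W i j * x j) + B i)) i" if "i < last (n # k # ds)" for x i
 proof -
  have "realize a ((?W, ?B) # Ph) x = realize a Ph (%i. a (affine ?W ?B x i))" using ne by (cases Ph) auto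
  then have "realize a ((?W, ?B) # Ph) x i = G (%i. a (affine ?W ?B x i)) i" using Ph(3)[OF that] by simp
  also have "G (%i. a (affine ?W ?B x i)) = G (%i. a ((\<Sum>j<m. W i j * x j) + B i))"
   by (rule net_dep[OF net_cons.hyps(2)]) (simp add: affine_def)
  finally show ?thesis .
 qed
 ultimately show ?case by (intro exI[of _ "(?W, ?B) # Ph"]) auto
qed

lemma ann_net:
 assumes "is_ann Ph"
 shows "\<exists>G. net a (ann_dims Ph) G \<and> (\<forall>x. \<forall>i<last (ann_dims Ph). realize a Ph x i = G x i)"
 using assms
proof (induction Ph)
 case Nil
 then show ?case by (simp add: is_ann_def)
next
 case (Cons WB Ph)
 obtain W B where [simp]: "WB = (W, B)" by (cases WB)
 show ?case
 proof (cases "Ph = []")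
  case True
  have "is_ann [(W, B)]" using Cons.prems True by simp
  then have A: "W ~= []" "hd W ~= []" "length B = length W" "\<forall>row\<in>set W. length row = length (hd W)"
   unfolding is_ann_single by blast+
  define m where "m = length (hd W)"
  have Am: "length (W ! i) = m" if "i < length W" for i using A(4) that by (auto simp: m_def)
  have "net a [m, length W] (%x i. (\<Sum>j<m. W ! i ! j * x j) + B ! i)"
   by (rule net_lin) (use A(1,2) m_def in auto)
  moreover have "realize a [(W, B)] x i = (\<Sum>j<m. W ! i ! j * x j) + B ! i" if "i < length W" for x i
   using that Am[OF that] by (simp add: affine_def)
  ultimately show ?thesis using True by (auto simp: ann_dims_Cons m_def[symmetric])
 next
  case False
  have "is_ann ((W, B) # Ph)" using Cons.prems by simp
  then have A: "W ~= []" "hd W ~= []" "length B = length W" "\<forall>row\<in>set W. length row = length (hd W)"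
   "is_ann Ph" "length (hd (fst (hd Ph))) = length W"
   unfolding is_ann_Cons[OF False] by blast+
  define m where "m = length (hd W)"
  have Am: "length (W ! i) = m" if "i < length W" for i using A(4) that by (auto simp: m_def)
  then obtain G where G: "net a (ann_dims Ph) G" "!!x i. i < last (ann_dims Ph) ==> realize a Ph x i = G x i"
   using Cons.IH[OF A(5)] by blast
  have d: "ann_dims (WB # Ph) = m # ann_dims Ph" "ann_dims Ph = length W # map (%(W, B). length W) Ph"
   using A(6) by (auto simp: ann_dims_def m_def)
  obtain k ks where k: "map (%(W, B). length W) Ph = k # ks" using False by (cases Ph) auto
  have "net a (m # length W # k # ks) (%x. G (%i. a ((\<Sum>j<m. W ! i ! j * x j) + B ! i)))"
   by (rule net_cons) (use G d k A(2) m_def in auto)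
  moreover have "realize a (WB # Ph) x i = G (%i. a ((\<Sum>j<m. W ! i ! j * x j) + B ! i)) i"
   if "i < last (ann_dims Ph)" for x i
  proof -
   have "realize a (WB # Ph) x = realize a Ph (%i. a (affine W B x i))" using False by (cases Ph) auto
   then have "realize a (WB # Ph) x i = G (%i. a (affine W B x i)) i" using G(2)[OF that] by simp
   also have "G (%i. a (affine W B x i)) = G (%i. a ((\<Sum>j<m. W ! i ! j * x j) + B ! i))"
    by (rule net_dep[OF G(1)]) (use d Am in \<open>simp add: affine_def\<close>)
   finally show ?thesis .
  qed
  ultimately show ?thesis using d k by (intro exI) auto
 qed
qed

subsection \<open>Scalar networks of given depth and width\<close>

text \<open>\<open>N\<close> counts the affine maps, and \<open>w\<close> bounds the hidden layers
  only: the input dimension is shared by all summands of a sum and must not be multiplied by their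
  number.\<close>

definition snet :: "(real => real) => nat => nat => nat => ((nat => real) => real) => bool" where
 "snet a d N w g \<longleftrightarrow> (\<exists>ds G. net a (d # ds @ [1]) G \<and> N = Suc (length ds) \<and> (\<forall>l\<in>set ds. l <= w) \<and> (\<forall>x. g x = G x 0))"

lemma snet_dep:
 assumes "snet a d N w g" "!!j. j < d ==> x j = y j"
 shows "g x = g y"
proof -
 obtain ds G where G: "net a (d # ds @ [1]) G" "!!x. g x = G x 0"
  using assms(1) unfolding snet_def by blast
 have "G x = G y" by (rule net_dep[OF G(1)]) (simp add: assms(2))
 then show ?thesis by (simp add: G(2))
qed

lemma snet_mono: "snet a d N w g ==> w <= w' ==> snet a d N w' g"
 unfolding snet_def by (elim exE conjE, intro exI conjI) (auto intro: order_trans)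

lemma snet_shift: assumes "snet a d N w g" shows "snet a d N w (%x. g (gshift d x c z))"
proof -
 obtain ds G where G: "net a (d # ds @ [1]) G" "N = Suc (length ds)" "\<forall>l\<in>set ds. l <= w" "!!x. g x = G x 0"
  using assms unfolding snet_def by blast
 have d: "d > 0" using net_pos[OF G(1)] by simp
 have "net a (d # ds @ [1]) (%x. G (%j. (\<Sum>i<d. (if i = j then 1 else 0) * x i) + c * z j))"
  by (rule net_pre_affine[OF G(1) d])
 moreover have "G (%j. (\<Sum>i<d. (if i = j then 1 else 0) * x i) + c * z j) = G (gshift d x c z)" for x
  by (rule net_dep[OF G(1)]) (simp add: gshift_def if_distrib[of "%u. u * _"] sum.delta cong: if_cong)
 ultimately show ?thesis unfolding snet_def using G by (intro exI[of _ ds] exI conjI) auto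
qed

text \<open>The two affine maps that meet become one, which accounts for the \<open>- 1\<close>; the
  scalar between them leaves no layer.\<close>

lemma snet_comp:
 assumes "snet a d N1 w1 g1" "snet a 1 N2 w2 g2"
 shows "snet a d (N1 + N2 - 1) (max w1 w2) (%x. g2 (%_. g1 x))"
proof -
 obtain ds1 G1 where G1: "net a (d # ds1 @ [1]) G1" "N1 = Suc (length ds1)" "\<forall>l\<in>set ds1. l <= w1" "!!x. g1 x = G1 x 0"
  using assms(1) unfolding snet_def by blast
 obtain ds2 G2 where G2: "net a (1 # ds2 @ [1]) G2" "N2 = Suc (length ds2)" "\<forall>l\<in>set ds2. l <= w2" "!!x. g2 x = G2 x 0"
  using assms(2) unfolding snet_def by blast
 have "net a (butlast (d # ds1 @ [1]) @ ds2 @ [1]) (%x. G2 (G1 x))"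
  by (rule net_comp[OF G1(1)]) (use G2 in simp)
 also have "butlast (d # ds1 @ [1]) @ ds2 @ [1] = d # (ds1 @ ds2) @ [1]" by (simp add: butlast_append)
 finally have "net a (d # (ds1 @ ds2) @ [1]) (%x. G2 (G1 x))" .
 moreover have "G2 (G1 x) 0 = g2 (%_. g1 x)" for x
  unfolding G1 G2 by (rule fun_cong[OF net_dep[OF G2(1)]]) auto
 ultimately show ?thesis unfolding snet_def using G1 G2
  by (intro exI[of _ "ds1 @ ds2"] exI conjI) (auto simp: le_max_iff_disj)
qed

lemma snet_affine: assumes "snet a d N w g" shows "snet a d N w (%x. c * g x + b)"
proof -
 have "net a [1, 1] (%x i. (\<Sum>j<1. c * x j) + b)" by (rule net_lin) auto
 then have "snet a 1 1 w (%x. c * x 0 + b)" unfolding snet_def by (intro exI[of _ "[]"] exI conjI) auto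
 from snet_comp[OF assms this] show ?thesis by simp
qed

lemma par_app: "length xs = length ys ==> par (xs @ [1]) (ys @ [1]) = map2 (+) xs ys @ [1]"
proof (induction xs ys rule: list_induct2)
 case (Cons x xs y ys)
 then obtain p ps q qs where "xs @ [1] = p # ps" "ys @ [1] = q # qs" by (cases "xs @ [1]"; cases "ys @ [1]") auto
 with Cons show ?case by simp
qed simp

lemma snet_add:
 assumes "snet a d N w1 g1" "snet a d N w2 g2"
 shows "snet a d N (w1 + w2) (%x. c1 * g1 x + c2 * g2 x)"
proof -
 obtain ds1 G1 where G1: "net a (d # ds1 @ [1]) G1" "N = Suc (length ds1)" "\<forall>l\<in>set ds1. l <= w1" "!!x. g1 x = G1 x 0"
  using assms(1) unfolding snet_def by blast
 obtain ds2 G2 where G2: "net a (d # ds2 @ [1]) G2" "N = Suc (length ds2)" "\<forall>l\<in>set ds2. l <= w2" "!!x. g2 x = G2 x 0"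
  using assms(2) unfolding snet_def by blast
 have d: "d > 0" using net_pos[OF G1(1)] by simp
 have l: "length ds1 = length ds2" using G1 G2 by simp
 have "net a ((d + d) # par (ds1 @ [1]) (ds2 @ [1])) (%x i. c1 * G1 x 0 + c2 * G2 (%j. x (j + d)) 0)"
  by (rule net_par[OF G1(1) G2(1)]) (use l in auto)
 \<comment> \<open>The parallel network reads \<open>d + d\<close> inputs. Feeding it two copies of
   \<open>x\<close> is affine and disappears into the first layer.\<close>
 from net_pre_affine[OF this[unfolded par_app[OF l]] d, where V = "%j i. if j < d then (if i = j then 1 else 0) else (if i + d = j then 1 else 0)" and c = "%_. 0"]
 have "net a (d # map2 (+) ds1 ds2 @ [1]) (%x i.
   c1 * G1 (%j. (\<Sum>i<d. (if j < d then (if i = j then 1 else 0) else (if i + d = j then 1 else 0)) * x i) + 0) 0 +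
   c2 * G2 (%j. (\<Sum>i<d. (if j + d < d then (if i = j + d then 1 else 0) else (if i + d = j + d then 1 else 0)) * x i) + 0) 0)"
  by simp
 moreover have "G1 (%j. (\<Sum>i<d. (if j < d then (if i = j then 1 else 0) else (if i + d = j then 1 else 0)) * x i) + 0) = G1 x" for x
  by (rule net_dep[OF G1(1)]) (simp add: if_distrib[of "%u. u * _"] sum.delta cong: if_cong)
 moreover have "G2 (%j. (\<Sum>i<d. (if j + d < d then (if i = j + d then 1 else 0) else (if i + d = j + d then 1 else 0)) * x i) + 0) = G2 x" for x
  by (rule net_dep[OF G2(1)]) (simp add: if_distrib[of "%u. u * _"] sum.delta cong: if_cong)
 ultimately have "net a (d # map2 (+) ds1 ds2 @ [1]) (%x i. c1 * G1 x 0 + c2 * G2 x 0)" by simp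
 moreover have "\<forall>l\<in>set (map2 (+) ds1 ds2). l <= w1 + w2"
 proof
  fix l assume "l \<in> set (map2 (+) ds1 ds2)"
  then obtain x y where xy: "(x, y) \<in> set (zip ds1 ds2)" "l = x + y" by auto
  from set_zip_leftD[OF xy(1)] set_zip_rightD[OF xy(1)] G1(3) G2(3) have "x <= w1" "y <= w2" by auto
  then show "l <= w1 + w2" using xy(2) by simp
 qed
 ultimately show ?thesis unfolding snet_def using G1 G2 l
  by (intro exI[of _ "map2 (+) ds1 ds2"] exI conjI) auto
qed

lemma snet_sum:
 assumes "K >= 1" "!!i. i < K ==> snet a d N w (g i)"
 shows "snet a d N (K * w) (%x. \<Sum>i<K. c i * g i x)"
 using assms
proof (induction K rule: dec_induct)
 case base
 show ?case using snet_affine[OF base(1)[of 0], of "c 0" 0] by simp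
next
 case (step K)
 have "snet a d N (K * w + w) (%x. 1 * (\<Sum>i<K. c i * g i x) + c K * g K x)"
  by (rule snet_add[OF step.IH]) (use step.prems in auto)
 then show ?case by (simp add: add.commute)
qed

text \<open>Composition with the two-layer network for the identity lengthens a network by exactly
  one layer. Summands of different depth can thus be aligned before they are added.\<close>

lemma snet_extend:
 assumes J: "snet a 1 2 jw (%x. x 0)" and g: "snet a d N w g" and "N <= N'" "jw <= w"
 shows "snet a d N' w g"
 using assms(3)
proof (induction N' rule: dec_induct)
 case (step n)
 then show ?case using snet_comp[OF step.IH J] assms(4) by (simp add: max_def)
qed (rule g)

lemma snet_of_ann:
 assumes "is_ann Ph" "ann_I Ph = d" "ann_O Ph = 1"
 shows "snet a d (ann_L Ph) (ann_Dmax Ph) (realize1 a Ph)"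
proof -
 obtain G where G: "net a (ann_dims Ph) G" "!!x i. i < last (ann_dims Ph) ==> realize a Ph x i = G x i"
  using ann_net[OF assms(1)] by blast
 have ne: "Ph ~= []" using assms(1) by (simp add: is_ann_def)
 define es where "es = map (%(W, B). length W) Ph"
 have es: "es ~= []" using ne by (simp add: es_def)
 have dd: "ann_dims Ph = d # es" using assms(2) by (simp add: ann_I_def ann_dims_def es_def)
 have "last es = 1" using assms(3) es by (simp add: ann_O_def dd)
 then have e: "es = butlast es @ [1]" using es by (metis append_butlast_last_id)
 show ?thesis unfolding snet_def
 proof (intro exI conjI)
  show "net a (d # butlast es @ [1]) G" using G(1) dd e by simp
  show "ann_L Ph = Suc (length (butlast es))" using es by (simp add: ann_L_def es_def)
  show "\<forall>l\<in>set (butlast es). l <= ann_Dmax Ph" by (auto simp: ann_Dmax_def dd dest: in_set_butlastD)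
  show "\<forall>x. realize1 a Ph x = G x 0" using G(2)[of 0] e by (simp add: realize1_def dd \<open>last es = 1\<close> es)
 qed
qed

text \<open>A crude count: each of the \<open>N\<close> layers has at most
  \<open>W * (W + 1)\<close> parameters, once \<open>W\<close> bounds the input dimension as
  well.\<close>

lemma ann_of_snet:
 assumes "snet a d N w g" "d <= W" "w <= W" "1 <= W"
 shows "\<exists>Ph. is_ann Ph \<and> ann_I Ph = d \<and> ann_O Ph = 1 \<and> realize1 a Ph = g \<and> ann_P Ph <= N * (W * (W + 1))"
proof -
 obtain ds G where G: "net a (d # ds @ [1]) G" "N = Suc (length ds)" "\<forall>l\<in>set ds. l <= w" "!!x. g x = G x 0"
  using assms unfolding snet_def by blast
 obtain Ph where Ph: "is_ann Ph" "ann_dims Ph = d # ds @ [1]" "!!x i. i < 1 ==> realize a Ph x i = G x i"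
  using net_ann[OF G(1)] by auto
 have L: "ann_L Ph = N"
  using arg_cong[OF Ph(2), of length] G(2) by (simp add: ann_L_def ann_dims_def)
 have le: "ann_dims Ph ! k <= W" if "k <= N" for k
 proof -
  have "ann_dims Ph ! k \<in> set (ann_dims Ph)" using that G(2) by (intro nth_mem) (simp add: Ph(2))
  then show ?thesis using G(3) assms by (auto simp: Ph(2) intro: order_trans)
 qed
 have "ann_P Ph <= (\<Sum>k\<in>{1..N}. W * (W + 1))"
  unfolding ann_P_def L by (intro sum_mono mult_mono add_mono le) auto
 then have "ann_P Ph <= N * (W * (W + 1))" by simp
 then show ?thesis using Ph G by (intro exI[of _ Ph]) (auto simp: ann_I_def ann_O_def realize1_def)
qed

lemma snet_identity:
 assumes "is_ann J" "ann_H J = 1" "ann_I J = 1" "ann_O J = 1" "!!v. realize1 a J (vec1 v) = v"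
 shows "snet a 1 2 (ann_Dmax J) (%x. x 0)"
proof -
 have "ann_L J = 2" using assms(2) by (simp add: ann_H_def ann_L_def)
 with snet_of_ann[OF assms(1,3,4), of a] have s: "snet a 1 2 (ann_Dmax J) (realize1 a J)" by simp
 have "realize1 a J x = x 0" for x
  using snet_dep[OF s, of x "vec1 (x 0)"] assms(5)[of "x 0"] by (simp add: vec1_def)
 then have "realize1 a J = (%x. x 0)" by (intro ext)
 with s show ?thesis by simp
qed

section \<open>Multilevel Picard iteration\<close>

locale sampling_setting = heat_setting +
 fixes q :: real and nu :: "(nat => real) measure"
 assumes q: "q >= 2" and nu_prob: "prob_space nu" and nu_sets: "sets nu = sets (PiM {..<d} (%_. lborel))"
begin

text \<open>Continuity on the whole time axis gives joint measurability at once; growth is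
  controlled only where times occur.\<close>

definition cadm :: "(real => (nat => real) => real) => bool" where
 "cadm D \<longleftrightarrow> continuous_on UNIV (%p. D (fst p) (snd p)) \<and> (\<exists>K. \<forall>t\<in>{0..T}. \<forall>x. abs (D t x) <= K * wgt d x powr s)"

lemma cadm_adm: "cadm D ==> adm D"
 unfolding cadm_def adm_def case_prod_beta' by (auto intro: continuous_on_subset)

lemma cadm_meas:
 assumes "cadm D" "t \<in> borel_measurable M" "x \<in> borel_measurable M"
 shows "(%w. D (t w) (x w)) \<in> borel_measurable M"
 using borel_measurable_continuous_on[of "%p. D (fst p) (snd p)" "%w. (t w, x w)" M] assms
 by (auto simp: cadm_def intro!: borel_measurable_Pair)

lemma cadm_add: "cadm D ==> cadm E ==> cadm (%t x. D t x + E t x)"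
 using adm_add[OF cadm_adm cadm_adm, of D E] unfolding cadm_def adm_def by (auto intro: continuous_on_add)

lemma cadm_cmult: "cadm D ==> cadm (%t x. c * D t x)"
 using adm_cmult[OF cadm_adm, of D c] unfolding cadm_def adm_def by (auto intro!: continuous_on_mult)

lemma cadm_diff: "cadm D ==> cadm E ==> cadm (%t x. D t x - E t x)"
 using cadm_add[of D "%t x. (-1) * E t x"] cadm_cmult[of E "-1"] by simp

lemma cadm_const: "cadm (%t x. c)"
 using adm_const[of c] unfolding cadm_def adm_def by auto

lemma cadm_Lipschitz:
 assumes "cadm D" and L: "!!v w. abs (f v - f w) <= L * abs (v - w)"
 shows "cadm (%t x. f (D t x))"
proof -
 have L0: "L >= 0" using L[of 1 0] by (auto intro: order_trans[OF abs_ge_zero])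
 have cf: "continuous_on UNIV f"
  using L L0 by (intro lipschitz_on_continuous_on[of L] lipschitz_onI) (auto simp: dist_real_def)
 show ?thesis
  using adm_Lipschitz[OF cadm_adm[OF assms(1)] L] assms(1) unfolding cadm_def adm_def
  by (auto intro!: continuous_on_compose2[OF cf])
qed

lemma cadm_sum: "finite I ==> (!!i. i \<in> I ==> cadm (D i)) ==> cadm (%t x. \<Sum>i\<in>I. D i t x)"
 by (induction I rule: finite_induct) (auto intro!: cadm_const cadm_add)

lemma nu_id: "(%x. x) \<in> borel_measurable nu"
 using measurable_PiM_borel_id[of "{..<d}"] nu_sets
 by (simp add: measurable_cong_sets[of nu "PiM {..<d} (%_. borel)"] sets_PiM_cong[of "{..<d}" "{..<d}" "%_. lborel" "%_. borel"])

lemma space_nu: "space nu = Rd d"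
 using sets_eq_imp_space_eq[OF nu_sets] by (simp add: space_PiM Rd_def)

definition tm :: "real measure => bool" where
 "tm tau \<longleftrightarrow> finite_measure tau \<and> sets tau = sets (restrict_space borel {0..T})"

text \<open>A point \<open>(t, z, x)\<close> of \<open>Ym tau\<close> stands for the space-time point \<open>(t, x + sqrt t * z)\<close>: the time
 is distributed as \<open>tau\<close> and the position as a Brownian motion started with law \<open>nu\<close>.\<close>

definition Ym :: "real measure => (real \<times> (nat => real) \<times> (nat => real)) measure" where
 "Ym tau = tau \<Otimes>\<^sub>M (gauss d \<Otimes>\<^sub>M nu)"

definition lift :: "(real => (nat => real) => real) => real \<times> (nat => real) \<times> (nat => real) => real" where
 "lift D y = D (fst y) (gshift d (snd (snd y)) (sqrt (fst y)) (fst (snd y)))"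

lemma tm_space: "tm tau ==> space tau = {0..T}"
 unfolding tm_def using sets_eq_imp_space_eq[of tau "restrict_space borel {0..T}"] by (auto simp: space_restrict_space)

lemma tm_id: "tm tau ==> (%t. t) \<in> borel_measurable tau"
 unfolding tm_def by (simp add: measurable_cong_sets[of tau "restrict_space borel {0..T}"] measurable_restrict_space1)

lemma Ym_meas:
 assumes "tm tau"
 shows "(%y. fst y) \<in> borel_measurable (Ym tau)" "(%y. fst (snd y)) \<in> borel_measurable (Ym tau)" "(%y. snd (snd y)) \<in> borel_measurable (Ym tau)"
proof -
 have [measurable]: "fst \<in> measurable (Ym tau) tau" "snd \<in> measurable (Ym tau) (gauss d \<Otimes>\<^sub>M nu)" unfolding Ym_def by simp_all
 show "(%y. fst y) \<in> borel_measurable (Ym tau)" by (rule measurable_compose[OF _ tm_id[OF assms]]) simp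
 show "(%y. fst (snd y)) \<in> borel_measurable (Ym tau)"
  using measurable_compose[OF measurable_compose[OF \<open>snd \<in> measurable (Ym tau) (gauss d \<Otimes>\<^sub>M nu)\<close> measurable_fst] measurable_gauss_id] by simp
 show "(%y. snd (snd y)) \<in> borel_measurable (Ym tau)"
  using measurable_compose[OF measurable_compose[OF \<open>snd \<in> measurable (Ym tau) (gauss d \<Otimes>\<^sub>M nu)\<close> measurable_snd] nu_id] by simp
qed

lemma lift_meas: "cadm D ==> tm tau ==> lift D \<in> borel_measurable (Ym tau)"
 unfolding lift_def[abs_def]
 by (rule cadm_meas[OF _ Ym_meas(1) measurable_shift[OF Ym_meas(3) measurable_compose[OF Ym_meas(1) borel_measurable_sqrt] Ym_meas(2)]])

lemma Ym_space: "tm tau ==> y \<in> space (Ym tau) ==> fst y \<in> {0..T}"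
 using tm_space by (auto simp: Ym_def space_pair_measure)

text \<open>The \<open>q\<close>-th absolute moment of \<open>D t\<close> at the
  time-\<open>t\<close> position of a Brownian motion with initial law \<open>nu\<close>.\<close>

definition QQ :: "(real => (nat => real) => real) => real => ennreal" where
 "QQ D t = (nint nu (%x. nint (gauss d) (%z. ennreal (abs (D t (gshift d x (sqrt t) z)) powr q))))"

lemma sf: "sigma_finite_measure nu" "sigma_finite_measure (gauss d)" "sigma_finite_measure (gauss d \<Otimes>\<^sub>M nu)"
 "sigma_finite_measure unit_time" "sigma_finite_measure (gauss_time d)"
 "tm tau ==> sigma_finite_measure tau" "tm tau ==> sigma_finite_measure (Ym tau)"
proof -
 interpret N: prob_space nu by (rule nu_prob)
 interpret G: prob_space "gauss d" by (rule prob_space_gauss)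
 interpret U: prob_space unit_time by (rule prob_space_unit_time)
 interpret GT: prob_space "gauss_time d" by (rule prob_space_gauss_time)
 interpret P: pair_sigma_finite "gauss d" nu ..
 show "sigma_finite_measure nu" "sigma_finite_measure (gauss d)" "sigma_finite_measure (gauss d \<Otimes>\<^sub>M nu)"
  "sigma_finite_measure unit_time" "sigma_finite_measure (gauss_time d)" by unfold_locales
 show *: "sigma_finite_measure tau" if "tm tau" for tau
  using that unfolding tm_def by (auto intro: finite_measure.sigma_finite_measure)
 show "sigma_finite_measure (Ym tau)" if "tm tau"
 proof -
  interpret A: sigma_finite_measure tau by (rule *[OF that])
  interpret PP: pair_sigma_finite tau "gauss d \<Otimes>\<^sub>M nu" ..
  show ?thesis unfolding Ym_def by unfold_locales
 qed
qed

lemma nn_lift: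
 assumes D: "cadm D" and tau: "tm tau"
 shows "(nint (Ym tau) (%y. ennreal (abs (lift D y) powr q))) = (nint tau (%t. QQ D t))"
proof -
 interpret A: sigma_finite_measure "gauss d \<Otimes>\<^sub>M nu" by (rule sf)
 interpret N: sigma_finite_measure nu by (rule sf)
 interpret G: sigma_finite_measure "gauss d" by (rule sf)
 interpret P: pair_sigma_finite "gauss d" nu ..
 have m: "(%y. ennreal (abs (lift D y) powr q)) \<in> borel_measurable (Ym tau)"
  using lift_meas[OF D tau] by measurable
 have "(nint (Ym tau) (%y. ennreal (abs (lift D y) powr q))) = (nint tau (%t. nint (gauss d \<Otimes>\<^sub>M nu) (%w. ennreal (abs (lift D (t, w)) powr q))))"
  using A.nn_integral_fst[OF m[unfolded Ym_def]] by (simp add: Ym_def)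
 also have "... = (nint tau (%t. QQ D t))"
 proof (rule nn_integral_cong)
  fix t assume t: "t \<in> space tau"
  have "(%w. ennreal (abs (lift D (t, w)) powr q)) \<in> borel_measurable (gauss d \<Otimes>\<^sub>M nu)"
   using measurable_compose[OF measurable_Pair1'[OF t] m[unfolded Ym_def]] by simp
  from P.nn_integral_snd[OF this]
  show "(nint (gauss d \<Otimes>\<^sub>M nu) (%w. ennreal (abs (lift D (t, w)) powr q))) = QQ D t"
   by (simp add: QQ_def lift_def)
 qed
 finally show ?thesis .
qed

text \<open>One sample of the Duhamel integral at the space-time point encoded by \<open>y\<close>;
  averaging over \<open>th\<close> gives \<open>source d T D\<close> there. \<open>XH\<close> does
  the same for the terminal value.\<close>

definition XS :: "(real => (nat => real) => real) => (nat => real) \<times> real => real \<times> (nat => real) \<times> (nat => real) => real" where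
 "XS D th y = (T - fst y) * source_arg d T D (fst y) (gshift d (snd (snd y)) (sqrt (fst y)) (fst (snd y))) th"

definition XH :: "((nat => real) => real) => (nat => real) \<times> real => real \<times> (nat => real) \<times> (nat => real) => real" where
 "XH h th y = h (gshift d (gshift d (snd (snd y)) (sqrt (fst y)) (fst (snd y))) (sqrt (T - fst y)) (fst th))"

lemma pair_meas:
 assumes "tm tau"
 shows "(%w. fst (fst w)) \<in> borel_measurable (gauss_time d \<Otimes>\<^sub>M Ym tau)" "(%w. snd (fst w)) \<in> borel_measurable (gauss_time d \<Otimes>\<^sub>M Ym tau)"
  "(%w. fst (snd w)) \<in> borel_measurable (gauss_time d \<Otimes>\<^sub>M Ym tau)" "(%w. fst (snd (snd w))) \<in> borel_measurable (gauss_time d \<Otimes>\<^sub>M Ym tau)"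
  "(%w. snd (snd (snd w))) \<in> borel_measurable (gauss_time d \<Otimes>\<^sub>M Ym tau)"
 by (rule measurable_compose[OF measurable_fst measurable_gauss_time_fst] measurable_compose[OF measurable_fst measurable_gauss_time_snd]
   measurable_compose[OF measurable_snd Ym_meas(1)[OF assms]] measurable_compose[OF measurable_snd Ym_meas(2)[OF assms]]
   measurable_compose[OF measurable_snd Ym_meas(3)[OF assms]])+

lemma XS_meas:
 assumes D: "cadm D" and tau: "tm tau"
 shows "(%(th, y). XS D th y) \<in> borel_measurable (gauss_time d \<Otimes>\<^sub>M Ym tau)"
proof -
 note [measurable] = pair_meas[OF tau]
 show ?thesis unfolding XS_def source_arg_def case_prod_beta'
  by (intro borel_measurable_times cadm_meas[OF D] measurable_shift) measurable
qed

lemma XH_meas: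
 assumes h: "continuous_on UNIV h" and tau: "tm tau"
 shows "(%(th, y). XH h th y) \<in> borel_measurable (gauss_time d \<Otimes>\<^sub>M Ym tau)"
proof -
 note [measurable] = pair_meas[OF tau]
 show ?thesis unfolding XH_def case_prod_beta'
  by (intro borel_measurable_continuous_on[OF h] measurable_shift) measurable
qed

lemma integrable_powr_bound:
 assumes "integrable (gauss_time d) (%th. (1 + enorm d (fst th)) powr (s * q))" and "g \<in> borel_measurable (gauss_time d)"
  "!!th. th \<in> space (gauss_time d) ==> abs (g th) <= K * (1 + enorm d (fst th)) powr s"
 shows "integrable (gauss_time d) (%th. abs (g th) powr q)"
proof (rule Bochner_Integration.integrable_bound)
 show "integrable (gauss_time d) (%th. abs K powr q * (1 + enorm d (fst th)) powr (s * q))" using assms(1) by simp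
 show "(%th. abs (g th) powr q) \<in> borel_measurable (gauss_time d)" using assms(2) by measurable
 show "AE th in gauss_time d. norm (abs (g th) powr q) <= norm (abs K powr q * (1 + enorm d (fst th)) powr (s * q))"
 proof (rule AE_I2)
  fix th assume "th \<in> space (gauss_time d)"
  from assms(3)[OF this] have "abs (g th) <= abs K * (1 + enorm d (fst th)) powr s"
   by (meson abs_ge_self mult_right_mono order_trans powr_ge_zero)
  then have "abs (g th) powr q <= (abs K * (1 + enorm d (fst th)) powr s) powr q" using q by (intro powr_mono2) auto
  then show "norm (abs (g th) powr q) <= norm (abs K powr q * (1 + enorm d (fst th)) powr (s * q))"
   by (simp add: powr_mult powr_powr)
 qed
qed

lemma enorm_integrable: "integrable (gauss_time d) (%th. (1 + enorm d (fst th)) powr (s * q))"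
 using s q by (intro integrable_gauss_time_fst integrable_gauss_enorm d) auto

lemma XS_integrable:
 assumes D: "cadm D" and tau: "tm tau" and y: "y \<in> space (Ym tau)"
 shows "integrable (gauss_time d) (%th. abs (XS D th y) powr q)"
proof -
 note t = Ym_space[OF tau y]
 obtain K where K: "K >= 0" "!!t x. t \<in> {0..T} ==> abs (D t x) <= K * wgt d x powr s" by (rule admD[OF cadm_adm[OF D]]) blast
 let ?x = "gshift d (snd (snd y)) (sqrt (fst y)) (fst (snd y))"
 show ?thesis
 proof (rule integrable_powr_bound[OF enorm_integrable])
  show "(%th. XS D th y) \<in> borel_measurable (gauss_time d)"
   unfolding XS_def using source_arg_measurable[OF cadm_adm[OF D] t] by measurable
  show "abs (XS D th y) <= (abs (T - fst y) * (K * (wgt d ?x * (1 + sqrt T)) powr s)) * (1 + enorm d (fst th)) powr s"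
   if "th \<in> space (gauss_time d)" for th
   unfolding XS_def abs_mult mult.assoc
   using source_arg_bound[OF K(2,1) t that, where x = ?x] by (intro mult_left_mono) (auto simp: mult.assoc)
 qed
qed

lemma XH_integrable:
 assumes h: "adm0 h" and tau: "tm tau" and y: "y \<in> space (Ym tau)"
 shows "integrable (gauss_time d) (%th. abs (XH h th y) powr q)"
proof -
 note t = Ym_space[OF tau y]
 obtain K where K: "K >= 0" "!!t x sg z. t \<in> {0..T} ==> sg \<in> {0..T + 1} ==> abs (h (gshift d x (sqrt sg) z)) <= K * wgt d x powr s * (1 + enorm d z) powr s"
  by (rule adm_shift_bound[OF adm_of_adm0[OF h]]) blast
 let ?x = "gshift d (snd (snd y)) (sqrt (fst y)) (fst (snd y))"
 show ?thesis
 proof (rule integrable_powr_bound[OF enorm_integrable])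
  have "continuous_on UNIV h" using h by (simp add: adm0_def)
  then show "(%th. XH h th y) \<in> borel_measurable (gauss_time d)"
   unfolding XH_def by (rule borel_measurable_continuous_on) (intro measurable_shift measurable_gauss_time_fst borel_measurable_const)
  show "abs (XH h th y) <= (K * wgt d ?x powr s) * (1 + enorm d (fst th)) powr s" for th
   unfolding XH_def using K(2)[of 0 "T - fst y" ?x "fst th"] t T by auto
 qed
qed

text \<open>Why the recursion closes: the Gaussian step up to time \<open>t\<close> and the step of
  length \<open>(T - t) * r\<close> taken by the sample merge into one step up to
  \<open>t + (T - t) * r\<close>. The moment of a sample is thus a moment of \<open>D\<close> at a
  later time under the same family of laws.\<close>

lemma nn_XS:
 assumes D: "cadm D" and tau: "tm tau"
 shows "(nint (Ym tau) (%y. nint (gauss_time d) (%th. ennreal (abs (XS D th y) powr q)))) =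
  (nint tau (%t. nint unit_time (%r. ennreal ((T - t) powr q) * QQ D (t + (T - t) * r))))"
proof -
 interpret A: sigma_finite_measure "gauss d \<Otimes>\<^sub>M nu" by (rule sf)
 interpret N: sigma_finite_measure nu by (rule sf)
 interpret G: sigma_finite_measure "gauss d" by (rule sf)
 interpret GT: sigma_finite_measure "gauss_time d" by (rule sf)
 interpret U: sigma_finite_measure unit_time by (rule sf)
 interpret P: pair_sigma_finite "gauss d" nu ..
 interpret PU: pair_sigma_finite "gauss d" unit_time ..
 interpret PA: pair_sigma_finite unit_time "gauss d \<Otimes>\<^sub>M nu" ..
 let ?F = "%t r w z. ennreal (abs (XS D (z, r) (t, w)) powr q)"
 have Fm: "(%p. ?F (t p) (r p) (z' p, x p) (z p)) \<in> borel_measurable M"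
  if "t \<in> borel_measurable M" "r \<in> borel_measurable M" "z' \<in> borel_measurable M" "x \<in> borel_measurable M" "z \<in> borel_measurable M"
  for M :: "'z measure" and t r z' x z
 proof -
  note [measurable] = that
  have "(%p. XS D (z p, r p) (t p, z' p, x p)) \<in> borel_measurable M"
   unfolding XS_def source_arg_def fst_conv snd_conv
   by (intro borel_measurable_times cadm_meas[OF D] measurable_shift) measurable
  then show ?thesis by measurable
 qed
 have m: "(%y. nint (gauss_time d) (%th. ennreal (abs (XS D th y) powr q))) \<in> borel_measurable (Ym tau)"
 proof -
  have "(%w. ennreal (abs (XS D (snd w) (fst w)) powr q)) \<in> borel_measurable (Ym tau \<Otimes>\<^sub>M gauss_time d)"
   using measurable_compose[OF measurable_pair_swap' XS_meas[OF D tau]] by (simp add: case_prod_beta')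
  from GT.borel_measurable_nn_integral_fst[OF this] show ?thesis by simp
 qed
 have "(nint (Ym tau) (%y. nint (gauss_time d) (%th. ennreal (abs (XS D th y) powr q)))) =
   (nint tau (%t. nint (gauss d \<Otimes>\<^sub>M nu) (%w. nint (gauss_time d) (%th. ennreal (abs (XS D th (t, w)) powr q)))))"
  using A.nn_integral_fst[OF m[unfolded Ym_def]] by (simp add: Ym_def)
 also have "... = (nint tau (%t. nint unit_time (%r. ennreal ((T - t) powr q) * QQ D (t + (T - t) * r))))"
 proof (rule nn_integral_cong)
  fix t assume "t \<in> space tau"
  then have t: "t \<in> {0..T}" using tm_space[OF tau] by simp
  have mg: "(%p. fst p) \<in> borel_measurable (gauss d \<Otimes>\<^sub>M N')" for N' :: "'y measure"
   by (rule measurable_compose[OF measurable_fst measurable_gauss_id])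
  have 1: "(nint (gauss_time d) (%th. ennreal (abs (XS D th (t, w)) powr q))) = (nint unit_time (%r. nint (gauss d) (%z. ?F t r w z)))" for w
  proof -
   have "(%th. ?F t (snd th) (fst w, snd w) (fst th)) \<in> borel_measurable (gauss d \<Otimes>\<^sub>M unit_time)"
    by (rule Fm) (auto intro!: mg measurable_compose[OF measurable_snd measurable_unit_time_id])
   from PU.nn_integral_snd[OF this] show ?thesis by (simp add: gauss_time_def)
  qed
  have "(nint (gauss d \<Otimes>\<^sub>M nu) (%w. nint (gauss_time d) (%th. ennreal (abs (XS D th (t, w)) powr q))))
   = (nint (gauss d \<Otimes>\<^sub>M nu) (%w. nint unit_time (%r. nint (gauss d) (%z. ?F t r w z))))" by (simp add: 1)
  also have "... = (nint unit_time (%r. nint (gauss d \<Otimes>\<^sub>M nu) (%w. nint (gauss d) (%z. ?F t r w z))))"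
  proof (rule PA.Fubini')
   let ?M = "(unit_time \<Otimes>\<^sub>M (gauss d \<Otimes>\<^sub>M nu)) \<Otimes>\<^sub>M gauss d"
   have "(%p. ?F t (fst (fst p)) (fst (snd (fst p)), snd (snd (fst p))) (snd p)) \<in> borel_measurable ?M"
   proof (rule Fm)
    have a: "fst \<in> measurable ?M (unit_time \<Otimes>\<^sub>M (gauss d \<Otimes>\<^sub>M nu))" "snd \<in> measurable ?M (gauss d)" by simp_all
    show "(%p. fst (fst p)) \<in> borel_measurable ?M"
     by (rule measurable_compose[OF measurable_compose[OF a(1) measurable_fst] measurable_unit_time_id])
    show "(%p. fst (snd (fst p))) \<in> borel_measurable ?M"
     by (rule measurable_compose[OF measurable_compose[OF measurable_compose[OF a(1) measurable_snd] measurable_fst] measurable_gauss_id])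
    show "(%p. snd (snd (fst p))) \<in> borel_measurable ?M"
     by (rule measurable_compose[OF measurable_compose[OF measurable_compose[OF a(1) measurable_snd] measurable_snd] nu_id])
    show "(%p. snd p) \<in> borel_measurable ?M" by (rule measurable_compose[OF a(2) measurable_gauss_id])
   qed simp
   from G.borel_measurable_nn_integral_fst[OF this]
   show "(%(r, w). nint (gauss d) (%z. ?F t r w z)) \<in> borel_measurable (unit_time \<Otimes>\<^sub>M (gauss d \<Otimes>\<^sub>M nu))"
    by (simp add: case_prod_beta')
  qed
  also have "... = (nint unit_time (%r. ennreal ((T - t) powr q) * QQ D (t + (T - t) * r)))"
  proof (rule nn_integral_cong)
   fix r assume "r \<in> space unit_time"
   then have r: "r \<in> {0..1}" by (simp add: space_unit_time)
   let ?s = "t + (T - t) * r"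
   have sm: "(%x. D ?s x) \<in> borel_measurable borel" by (rule cadm_meas[OF D]) auto
   let ?M = "(gauss d \<Otimes>\<^sub>M nu) \<Otimes>\<^sub>M gauss d"
   have "(%p. ?F t r (fst (fst p), snd (fst p)) (snd p)) \<in> borel_measurable ?M"
   proof (rule Fm)
    have a: "fst \<in> measurable ?M (gauss d \<Otimes>\<^sub>M nu)" "snd \<in> measurable ?M (gauss d)" by simp_all
    show "(%p. fst (fst p)) \<in> borel_measurable ?M"
     by (rule measurable_compose[OF measurable_compose[OF a(1) measurable_fst] measurable_gauss_id])
    show "(%p. snd (fst p)) \<in> borel_measurable ?M"
     by (rule measurable_compose[OF measurable_compose[OF a(1) measurable_snd] nu_id])
    show "(%p. snd p) \<in> borel_measurable ?M" by (rule measurable_compose[OF a(2) measurable_gauss_id])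
   qed simp_all
   from G.borel_measurable_nn_integral_fst[OF this]
   have "(%w. nint (gauss d) (%z. ?F t r w z)) \<in> borel_measurable (gauss d \<Otimes>\<^sub>M nu)" by simp
   from P.nn_integral_snd[OF this]
   have "(nint (gauss d \<Otimes>\<^sub>M nu) (%w. nint (gauss d) (%z. ?F t r w z))) = (nint nu (%x. nint (gauss d) (%z'. nint (gauss d) (%z. ?F t r (z', x) z))))" by simp
   also have "... = (nint nu (%x. nint (gauss d) (%z. ennreal ((T - t) powr q) * ennreal (abs (D ?s (gshift d x (sqrt ?s) z)) powr q))))"
   proof (rule nn_integral_cong)
    fix x
    let ?G = "%v. ennreal ((T - t) powr q) * ennreal (abs (D ?s v) powr q)"
    have Gm: "?G \<in> borel_measurable borel" using sm by measurable
    have "?F t r (z', x) z = ?G (gshift d (gshift d x (sqrt t) z') (sqrt ((T - t) * r)) z)" for z' z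
     using t by (simp add: XS_def source_arg_def abs_mult powr_mult ennreal_mult)
    then have "(nint (gauss d) (%z'. nint (gauss d) (%z. ?F t r (z', x) z))) = (nint (gauss d) (%z'. nint (gauss d) (%z. ?G (gshift d (gshift d x (sqrt t) z') (sqrt ((T - t) * r)) z))))" by simp
    also have "... = (nint (gauss d) (%z. ?G (gshift d x (sqrt ?s) z)))"
     by (rule gauss_semigroup[OF Gm]) (use t r in auto)
    finally show "(nint (gauss d) (%z'. nint (gauss d) (%z. ?F t r (z', x) z))) = (nint (gauss d) (%z. ?G (gshift d x (sqrt ?s) z)))" .
   qed
   also have "... = ennreal ((T - t) powr q) * QQ D ?s"
   proof -
    let ?g = "%x z. ennreal (abs (D ?s (gshift d x (sqrt ?s) z)) powr q)"
    have g1: "(%z. ?g x z) \<in> borel_measurable (gauss d)" for x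
     using measurable_compose[OF measurable_shift[OF borel_measurable_const borel_measurable_const measurable_gauss_id] sm] by measurable
    have "(%p. D ?s (gshift d (fst p) (sqrt ?s) (snd p))) \<in> borel_measurable (nu \<Otimes>\<^sub>M gauss d)"
     by (rule measurable_compose[OF _ sm])
      (intro measurable_shift measurable_compose[OF measurable_fst nu_id] measurable_compose[OF measurable_snd measurable_gauss_id] borel_measurable_const)
    then have "(%p. ?g (fst p) (snd p)) \<in> borel_measurable (nu \<Otimes>\<^sub>M gauss d)" by measurable
    from G.borel_measurable_nn_integral_fst[OF this]
    have g2: "(%x. nint (gauss d) (%z. ?g x z)) \<in> borel_measurable nu" by simp
    show ?thesis unfolding QQ_def by (simp add: nn_integral_cmult[OF g1] nn_integral_cmult[OF g2])
   qed
   finally show "(nint (gauss d \<Otimes>\<^sub>M nu) (%w. nint (gauss d) (%z. ?F t r w z))) = ennreal ((T - t) powr q) * QQ D ?s" .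
  qed
  finally show "(nint (gauss d \<Otimes>\<^sub>M nu) (%w. nint (gauss_time d) (%th. ennreal (abs (XS D th (t, w)) powr q)))) = (nint unit_time (%r. ennreal ((T - t) powr q) * QQ D (t + (T - t) * r)))" .
 qed
 finally show ?thesis .
qed

section \<open>Integration of the moments over time\<close>

lemma QQ_meas:
 assumes "cadm D" shows "QQ D \<in> borel_measurable borel"
proof -
 interpret N: sigma_finite_measure nu by (rule sf)
 interpret G: sigma_finite_measure "gauss d" by (rule sf)
 let ?M = "(borel \<Otimes>\<^sub>M nu) \<Otimes>\<^sub>M gauss d"
 have a: "fst \<in> measurable ?M (borel \<Otimes>\<^sub>M nu)" "snd \<in> measurable ?M (gauss d)" by simp_all
 have [measurable]: "(%p. fst (fst p)) \<in> borel_measurable ?M" "(%p. snd (fst p)) \<in> borel_measurable ?M" "(%p. snd p) \<in> borel_measurable ?M"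
  by (rule measurable_compose[OF a(1) measurable_fst] measurable_compose[OF measurable_compose[OF a(1) measurable_snd] nu_id] measurable_compose[OF a(2) measurable_gauss_id])+
 have "(%p. D (fst (fst p)) (gshift d (snd (fst p)) (sqrt (fst (fst p))) (snd p))) \<in> borel_measurable ?M"
  by (intro cadm_meas[OF assms] measurable_shift) measurable
 then have "(%p. ennreal (abs (D (fst (fst p)) (gshift d (snd (fst p)) (sqrt (fst (fst p))) (snd p))) powr q)) \<in> borel_measurable ?M" by measurable
 from G.borel_measurable_nn_integral_fst[OF this]
 have "(%p. nint (gauss d) (%z. ennreal (abs (D (fst p) (gshift d (snd p) (sqrt (fst p)) z)) powr q))) \<in> borel_measurable (borel \<Otimes>\<^sub>M nu)" by simp
 from N.borel_measurable_nn_integral_fst[OF this] show ?thesis by (simp add: QQ_def[abs_def])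
qed

definition tail :: "(real => (nat => real) => real) => real => ennreal" where
 "tail D t = (nint lborel (%s. QQ D s * indicator {t..T} s))"

lemma tail_meas:
 assumes "cadm D" shows "tail D \<in> borel_measurable borel"
proof -
 have m: "QQ D \<in> borel_measurable borel" by (rule QQ_meas[OF assms])
 have q1[measurable]: "(%p. QQ D (snd p)) \<in> borel_measurable (borel \<Otimes>\<^sub>M lborel)"
  by (rule measurable_compose[OF measurable_snd]) (use m in simp)
 have "(%p. QQ D (snd p) * indicator {w. fst w <= snd w \<and> snd w <= T} p) \<in> borel_measurable (borel \<Otimes>\<^sub>M lborel)"
  using q1 by measurable
 then have "(%p. QQ D (snd p) * indicator {fst p..T} (snd p)) \<in> borel_measurable (borel \<Otimes>\<^sub>M lborel)"
  by (simp add: indicator_def)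
 from lborel.borel_measurable_nn_integral_fst[OF this] show ?thesis by (simp add: tail_def[abs_def])
qed

text \<open>Returning from \<open>r\<close> to \<open>s = t + (T - t) * r\<close> uses up one factor
  \<open>T - t\<close>; the remaining power \<open>q - 1\<close> is bounded by that of
  \<open>T\<close>. At \<open>t = T\<close> the substitution degenerates, but the left side is
  zero.\<close>

lemma nn_XS_le:
 assumes D: "cadm D" and tau: "tm tau"
 shows "(nint (Ym tau) (%y. nint (gauss_time d) (%th. ennreal (abs (XS D th y) powr q)))) <= ennreal (T powr (q - 1)) * (nint tau (%t. tail D t))"
proof -
 have m: "QQ D \<in> borel_measurable borel" by (rule QQ_meas[OF D])
 have "(nint unit_time (%r. ennreal ((T - t) powr q) * QQ D (t + (T - t) * r))) <= ennreal (T powr (q - 1)) * tail D t"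
  if t: "t \<in> {0..T}" for t
 proof (cases "t = T")
  case False
  then have tT: "T - t > 0" using t by simp
  have mu: "(%r. QQ D (t + (T - t) * r)) \<in> borel_measurable unit_time"
   by (rule measurable_compose[OF _ m]) (use measurable_unit_time_id in measurable)
  have "tail D t = ennreal (abs (T - t)) * (nint lborel (%r. QQ D (t + (T - t) * r) * indicator {t..T} (t + (T - t) * r)))"
   unfolding tail_def by (rule nn_integral_real_affine) (use m tT in auto)
  also have "(nint lborel (%r. QQ D (t + (T - t) * r) * indicator {t..T} (t + (T - t) * r))) = (nint lborel (%r. QQ D (t + (T - t) * r) * indicator {0..1} r))"
  proof (rule nn_integral_cong)
   fix r
   have "t + (T - t) * r \<in> {t..T} \<longleftrightarrow> r \<in> {0..1}"
   proof -
    have "t + (T - t) * r <= T \<longleftrightarrow> (T - t) * r <= (T - t) * 1" by auto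
    also have "... \<longleftrightarrow> r <= 1" using mult_le_cancel_left_pos[OF tT, of r 1] by simp
    finally show ?thesis using tT by (auto simp: zero_le_mult_iff)
   qed
   then show "QQ D (t + (T - t) * r) * indicator {t..T} (t + (T - t) * r) = QQ D (t + (T - t) * r) * indicator {0..1} r"
    by (simp add: indicator_def)
  qed
  also have "... = (nint unit_time (%r. QQ D (t + (T - t) * r)))"
   unfolding unit_time_def by (subst nn_integral_restrict_space) auto
  finally have tl: "tail D t = ennreal (T - t) * (nint unit_time (%r. QQ D (t + (T - t) * r)))" using tT by simp
  have pw: "(T - t) powr q = (T - t) powr (q - 1) * (T - t)"
   using tT powr_add[of "T - t" "q - 1" 1] by simp
  have "(nint unit_time (%r. ennreal ((T - t) powr q) * QQ D (t + (T - t) * r))) = ennreal ((T - t) powr q) * (nint unit_time (%r. QQ D (t + (T - t) * r)))"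
   by (rule nn_integral_cmult[OF mu])
  also have "... = ennreal ((T - t) powr (q - 1)) * tail D t"
   using tT by (simp add: pw tl ennreal_mult mult.assoc)
  also have "... <= ennreal (T powr (q - 1)) * tail D t"
   using t tT q by (intro mult_right_mono ennreal_leI powr_mono2) auto
  finally show ?thesis .
 qed simp
 then have "(nint tau (%t. nint unit_time (%r. ennreal ((T - t) powr q) * QQ D (t + (T - t) * r)))) <= (nint tau (%t. ennreal (T powr (q - 1)) * tail D t))"
  using tm_space[OF tau] by (intro nn_integral_mono) auto
 also have "... = ennreal (T powr (q - 1)) * (nint tau (%t. tail D t))"
 proof (rule nn_integral_cmult)
  from measurable_compose[OF tm_id[OF tau] tail_meas[OF D]] show "tail D \<in> borel_measurable tau" by simp
 qed
 finally show ?thesis unfolding nn_XS[OF D tau] .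
qed

definition time_exp :: "real => real measure" where
 "time_exp lam = density (restrict_space lborel {0..T}) (%t. ennreal (exp (lam * t)))"

text \<open>The final error is measured at time 0 only. Regarding this as another time measure lets
  the same induction step produce it.\<close>

definition time_0 :: "real measure" where
 "time_0 = return (restrict_space borel {0..T}) 0"

lemma nn_time_exp:
 assumes "f \<in> borel_measurable borel"
 shows "(nint (time_exp lam) (%t. f t)) = (nint lborel (%t. ennreal (exp (lam * t)) * f t * indicator {0..T} t))"
proof -
 have "(nint (time_exp lam) (%t. f t)) = (nint (restrict_space lborel {0..T}) (%t. ennreal (exp (lam * t)) * f t))"
  unfolding time_exp_def using assms by (subst nn_integral_density) (auto intro!: measurable_restrict_space1)
 then show ?thesis by (simp add: nn_integral_restrict_space)
qed

lemma tm_time_exp: "tm (time_exp lam)"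
proof -
 have "emeasure (time_exp lam) (space (time_exp lam)) = (nint (time_exp lam) (%t. 1))" by simp
 also have "... = (nint lborel (%t. ennreal (exp (lam * t)) * 1 * indicator {0..T} t))" by (rule nn_time_exp) simp
 also have "... <= (nint lborel (%t. ennreal (exp (abs lam * T)) * indicator {0..T} t))"
  by (intro nn_integral_mono) (auto simp: indicator_def intro!: ennreal_leI mult_mono)
 also have "... < \<infinity>" using T by (simp add: nn_integral_cmult ennreal_mult_less_top)
 finally have "finite_measure (time_exp lam)" by (intro finite_measureI) auto
 moreover have "sets (time_exp lam) = sets (restrict_space borel {0..T})"
  by (simp add: time_exp_def sets_restrict_space)
 ultimately show ?thesis by (simp add: tm_def)
qed

lemma tm_time_0: "tm time_0"
proof -
 have "prob_space time_0" unfolding time_0_def by (rule prob_space_return) (use T in \<open>auto simp: space_restrict_space\<close>)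
 then interpret prob_space time_0 .
 show ?thesis unfolding tm_def by (auto intro: finite_measure_axioms) (simp_all add: time_0_def)
qed

lemma nn_time_0: "f \<in> borel_measurable borel ==> (nint time_0 (%t. f t)) = f 0"
 unfolding time_0_def using T by (intro nn_integral_return) (auto simp: space_restrict_space intro!: measurable_restrict_space1)

text \<open>The exponential weight in time turns the Volterra structure of \<open>source\<close> into a contraction
 with the factor \<open>1 / lam\<close>.\<close>

lemma tail_time_exp:
 assumes D: "cadm D" and lam: "lam > 0"
 shows "(nint (time_exp lam) (%t. tail D t)) <= ennreal (1 / lam) * (nint (time_exp lam) (%t. QQ D t))"
proof -
 have m[measurable]: "QQ D \<in> borel_measurable borel" by (rule QQ_meas[OF D])
 let ?k = "%t s. ennreal (exp (lam * t)) * (QQ D s * indicator {t..T} s) * indicator {0..T} t"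
 have km: "(%(t, s). ?k t s) \<in> borel_measurable (lborel \<Otimes>\<^sub>M lborel)"
 proof -
  have "(%(t, s). ennreal (exp (lam * t)) * (QQ D s * indicator {w. fst w <= snd w \<and> snd w <= T} (t, s)) * indicator {0..T} t) \<in> borel_measurable (lborel \<Otimes>\<^sub>M lborel)"
   by measurable
  then show ?thesis by (simp add: indicator_def)
 qed
 have "(nint (time_exp lam) (%t. tail D t)) = (nint lborel (%t. ennreal (exp (lam * t)) * tail D t * indicator {0..T} t))"
  by (rule nn_time_exp[OF tail_meas[OF D]])
 also have "... = (nint lborel (%t. nint lborel (%s. ?k t s)))"
  unfolding tail_def by (intro nn_integral_cong) (simp add: nn_integral_cmult nn_integral_multc)
 also have "... = (nint lborel (%s. nint lborel (%t. ?k t s)))"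
  by (rule lborel_pair.Fubini'[symmetric]) (rule km)
 also have "... <= (nint lborel (%s. ennreal (1 / lam) * (ennreal (exp (lam * s)) * QQ D s * indicator {0..T} s)))"
 proof (rule nn_integral_mono)
  fix s
  show "(nint lborel (%t. ?k t s)) <= ennreal (1 / lam) * (ennreal (exp (lam * s)) * QQ D s * indicator {0..T} s)"
  proof (cases "s \<in> {0..T}")
   case True
   have "(nint lborel (%t. ?k t s)) <= (nint lborel (%t. QQ D s * (ennreal (exp (lam * t)) * indicator {0..s} t)))"
    by (intro nn_integral_mono) (auto simp: indicator_def mult_ac)
   also have "... = QQ D s * (nint lborel (%t. ennreal (exp (lam * t)) * indicator {0..s} t))"
    by (rule nn_integral_cmult) measurable
   also have "(nint lborel (%t. ennreal (exp (lam * t)) * indicator {0..s} t)) = ennreal (exp (lam * s) / lam - exp (lam * 0) / lam)"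
    by (rule nn_integral_FTC_Icc) (use True lam in \<open>auto intro!: derivative_eq_intros\<close>)
   also have "... <= ennreal (1 / lam * exp (lam * s))" using lam by (intro ennreal_leI) (simp add: field_simps)
   finally have "(nint lborel (%t. ?k t s)) <= QQ D s * ennreal (1 / lam * exp (lam * s))" by (simp add: mult_left_mono)
   moreover have "QQ D s * ennreal (1 / lam * exp (lam * s)) = ennreal (1 / lam) * (ennreal (exp (lam * s)) * QQ D s * indicator {0..T} s)"
    using True lam ennreal_mult[of "1 / lam" "exp (lam * s)"] by (simp add: mult_ac)
   ultimately show ?thesis by metis
  next
   case False
   have "(nint lborel (%t. ?k t s)) = (nint (lborel :: real measure) (%t. 0))"
    by (rule nn_integral_cong) (use False in \<open>auto simp: indicator_def\<close>)
   also have "... = 0" by simp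
   finally show ?thesis by (metis zero_le)
  qed
 qed
 also have "... = ennreal (1 / lam) * (nint lborel (%s. ennreal (exp (lam * s)) * QQ D s * indicator {0..T} s))"
  by (rule nn_integral_cmult) measurable
 also have "(nint lborel (%s. ennreal (exp (lam * s)) * QQ D s * indicator {0..T} s)) = (nint (time_exp lam) (%t. QQ D t))"
  by (rule nn_time_exp[symmetric]) measurable
 finally show ?thesis .
qed

text \<open>No gain at time 0, only that the exponential weight is at least 1. This loss occurs
  once, in the last step.\<close>

lemma tail_time_0:
 assumes D: "cadm D" and lam: "lam > 0"
 shows "(nint time_0 (%t. tail D t)) <= (nint (time_exp lam) (%t. QQ D t))"
proof -
 have m[measurable]: "QQ D \<in> borel_measurable borel" by (rule QQ_meas[OF D])
 have "(nint time_0 (%t. tail D t)) = tail D 0" by (rule nn_time_0[OF tail_meas[OF D]])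
 also have "... <= (nint lborel (%s. ennreal (exp (lam * s)) * QQ D s * indicator {0..T} s))"
  unfolding tail_def
 proof (rule nn_integral_mono)
  fix s
  show "QQ D s * indicator {0..T} s <= ennreal (exp (lam * s)) * QQ D s * indicator {0..T} s"
  proof (cases "s \<in> {0..T}")
   case True
   have "ennreal 1 * QQ D s <= ennreal (exp (lam * s)) * QQ D s"
    using True lam by (intro mult_right_mono ennreal_leI) auto
   then show ?thesis using True by simp
  qed simp
 qed
 also have "... = (nint (time_exp lam) (%t. QQ D t))" by (rule nn_time_exp[symmetric]) measurable
 finally show ?thesis .
qed

end

text \<open>The constant is quantified outside the measures and the samples, so that one choice
  serves all dimensions, laws and networks.\<close>

definition mc_const :: "real => real => bool" where
 "mc_const q C \<longleftrightarrow> C > 0 \<and> (\<forall>(Th :: ((nat => real) \<times> real) measure) (mu :: (real \<times> (nat => real) \<times> (nat => real)) measure) X s (k::nat).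
   prob_space Th --> sigma_finite_measure mu -->
   (%(th, y). X th y) \<in> borel_measurable (Th \<Otimes>\<^sub>M mu) -->
   (\<forall>y\<in>space mu. integrable Th (%th. abs (X th y) powr q)) -->
   s >= 0 --> (nint mu (%y. nint Th (%th. ennreal (abs (X th y) powr q)))) <= ennreal (s powr q) --> k >= 1 -->
   (\<exists>ths. (\<forall>i<k. ths i \<in> space Th) \<and>
    Lq_le mu q (%y. (\<Sum>i<k. X (ths i) y) / real k - (lint Th (%th. X th y))) (C * s / sqrt (real k))))"

lemma mc_const_exists: "q >= 2 ==> \<exists>C. mc_const q C"
 unfolding mc_const_def by (rule derandomised_Monte_Carlo)

lemma Lq_le_diff: "Lq_le M q f a ==> Lq_le M q g b ==> q >= 1 ==> Lq_le M q (%x. f x - g x) (a + b)"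
 using Lq_le_add[of M q f a "%x. (-1) * g x" b] Lq_le_cmult[of M q g b "-1"] by simp

text \<open>A discrete Gronwall argument for the error recursion. Up to \<open>R ^ n\<close> every
  term is a constant times a power of \<open>B\<close>, and \<open>B\<close> is chosen so that
  \<open>B - 1\<close> collects these constants; the geometric sum then gives
  \<open>B ^ n - 1\<close>.\<close>

lemma mlp_arith:
 fixes R C L :: real
 assumes R: "R >= 1" and C: "C >= 0" and L: "L >= 0" and B: "B = 1 + 2 * C + 2 * C * L + L" and n: "n >= 1"
 shows "C / R ^ n + (\<Sum>l<n. C * (1 / R * (if l = 0 then 1 else L * ((B / R) ^ l + (B / R) ^ (l - 1)))) / R ^ (n - l))
   + 1 / R * (L * (B / R) ^ (n - 1)) <= (B / R) ^ n"
proof -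
 have B1: "B >= 1" using C L B by simp
 have Rn: "R ^ n > 0" using R by simp
 define S where "S = (\<Sum>l<n. B ^ l)"
 have tl: "C * (1 / R * (if l = 0 then 1 else L * ((B / R) ^ l + (B / R) ^ (l - 1)))) / R ^ (n - l) <= (2 * C * L * B ^ l + (if l = 0 then C else 0)) / R ^ n"
  if l: "l < n" for l
 proof (cases "l = 0")
  case True
  have "C / R <= C" using R C mult_left_mono[of 1 R C] by (simp add: divide_le_eq)
  also have "... <= 2 * C * L + C" using C L by simp
  finally have "C / R / R ^ n <= (2 * C * L + C) / R ^ n" using R by (intro divide_right_mono) auto
  then show ?thesis using True by simp
 next
  case False
  then obtain k where k: "l = Suc k" by (cases l) auto
  have e: "R ^ n = R ^ (n - l) * R ^ l" using l by (simp flip: power_add)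
  have "C * (1 / R * (L * ((B / R) ^ l + (B / R) ^ (l - 1)))) / R ^ (n - l) = C * L * (B ^ l + B ^ k * R) / (R * R ^ n)"
   using R unfolding e k by (simp add: field_simps power_divide)
  also have "... <= C * L * (B ^ l * R + B ^ l * R) / (R * R ^ n)"
  proof (intro divide_right_mono mult_left_mono add_mono)
   show "B ^ l <= B ^ l * R" using R B1 by simp
   show "B ^ k * R <= B ^ l * R" using R B1 by (simp add: k mult_right_mono)
  qed (use C L R in auto)
  also have "... = 2 * C * L * B ^ l / R ^ n" using R by (simp add: field_simps)
  finally show ?thesis using False by simp
 qed
 have "(\<Sum>l<n. C * (1 / R * (if l = 0 then 1 else L * ((B / R) ^ l + (B / R) ^ (l - 1)))) / R ^ (n - l))
   <= (\<Sum>l<n. (2 * C * L * B ^ l + (if l = 0 then C else 0)) / R ^ n)"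
  by (intro sum_mono tl) simp
 also have "... = (2 * C * L * S + C) / R ^ n"
  using n by (simp add: S_def sum_divide_distrib[symmetric] sum.distrib sum_distrib_left sum.delta)
 finally have 1: "(\<Sum>l<n. C * (1 / R * (if l = 0 then 1 else L * ((B / R) ^ l + (B / R) ^ (l - 1)))) / R ^ (n - l)) <= (2 * C * L * S + C) / R ^ n" .
 obtain k where k: "n = Suc k" using n by (cases n) auto
 have S0: "B ^ (n - 1) <= S" unfolding S_def using B1 k by (auto intro!: sum_nonneg)
 have S1: "1 <= S" using S0 B1 one_le_power[of B "n - 1"] by linarith
 have "1 / R * (L * (B / R) ^ (n - 1)) = L * B ^ (n - 1) / R ^ n" using R by (simp add: k power_divide)
 also have "... <= L * S / R ^ n" using S0 L R by (intro divide_right_mono mult_left_mono) auto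
 finally have 2: "1 / R * (L * (B / R) ^ (n - 1)) <= L * S / R ^ n" .
 have "C / R ^ n + (2 * C * L * S + C) / R ^ n + L * S / R ^ n = (2 * C * 1 + (2 * C * L + L) * S) / R ^ n"
  by (simp add: add_divide_distrib algebra_simps)
 also have "... <= (2 * C * S + (2 * C * L + L) * S) / R ^ n"
  using S1 C R by (intro divide_right_mono add_right_mono mult_left_mono) auto
 also have "2 * C * S + (2 * C * L + L) * S = (B - 1) * S" by (simp add: B algebra_simps)
 also have "... = B ^ n - 1" unfolding S_def by (rule power_diff_1_eq[symmetric])
 also have "... / R ^ n <= (B / R) ^ n" using R by (simp add: power_divide divide_right_mono)
 finally show ?thesis using 1 2 by linarith
qed

context sampling_setting
begin

text \<open>Continues a function constantly beyond both ends of \<open>[0, T]\<close>, as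
  \<open>cadm\<close> asks for continuity at all times.\<close>

definition clamp :: "(real => (nat => real) => real) => real => (nat => real) => real" where
 "clamp u t x = u (max 0 (min T t)) x"

lemma clamp_eq[simp]: "t \<in> {0..T} ==> clamp u t x = u t x" by (simp add: clamp_def)

lemma cadm_clamp: assumes "adm u" shows "cadm (clamp u)"
proof -
 obtain K where K: "!!t x. t \<in> {0..T} ==> abs (u t x) <= K * wgt d x powr s" by (rule admD[OF assms]) blast
 have "continuous_on UNIV (%p. (%p. u (fst p) (snd p)) (max 0 (min T (fst p)), snd p))"
  by (rule continuous_on_compose2[OF adm_cont_split[OF assms]]) (use T in \<open>auto intro!: continuous_intros\<close>)
 moreover have "\<forall>t\<in>{0..T}. \<forall>x. abs (clamp u t x) <= K * wgt d x powr s" using K by simp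
 ultimately show ?thesis unfolding cadm_def clamp_def fst_conv snd_conv by blast
qed

lemma source_cong:
 assumes "!!t x. t \<in> {0..T} ==> F t x = G t x" "t \<in> {0..T}"
 shows "source d T F t x = source d T G t x"
 unfolding source_def source_arg_def
 by (intro arg_cong2[where f = "(*)"] refl Bochner_Integration.integral_cong)
  (auto simp: space_gauss_time intro!: assms(1) simp del: atLeastAtMost_iff intro: source_time_in[OF assms(2)])

definition avgS :: "(nat => (nat => real) \<times> real) => nat => (real => (nat => real) => real) => real => (nat => real) => real" where
 "avgS zs K D t x = (\<Sum>i<K. (T - t) * source_arg d T D t x (zs i)) / real K"

definition avgH :: "(nat => (nat => real) \<times> real) => nat => ((nat => real) => real) => real => (nat => real) => real" where
 "avgH zs K h t x = (\<Sum>i<K. h (gshift d x (sqrt (T - t)) (fst (zs i)))) / real K"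

lemma cadm_time_mult: assumes "cadm D" shows "cadm (%t x. (T - t) * D t x)"
proof -
 obtain K where K: "K >= 0" "!!t x. t \<in> {0..T} ==> abs (D t x) <= K * wgt d x powr s" by (rule admD[OF cadm_adm[OF assms]]) blast
 have "abs ((T - t) * D t x) <= (T * K) * wgt d x powr s" if "t \<in> {0..T}" for t x
  unfolding abs_mult mult.assoc using that K(2)[OF that, of x] by (intro mult_mono) auto
 moreover have "continuous_on UNIV (%p. (T - fst p) * D (fst p) (snd p))"
  using assms unfolding cadm_def by (auto intro!: continuous_on_mult continuous_intros)
 ultimately show ?thesis unfolding cadm_def by blast
qed

lemma cadm_source_arg:
 assumes D: "cadm D" and th: "th \<in> space (gauss_time d)"
 shows "cadm (%t x. source_arg d T D t x th)"
proof -
 obtain K where K: "K >= 0" "!!t x. t \<in> {0..T} ==> abs (D t x) <= K * wgt d x powr s" by (rule admD[OF cadm_adm[OF D]]) blast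
 have "abs (source_arg d T D t x th) <= (K * ((1 + sqrt T) powr s * (1 + enorm d (fst th)) powr s)) * wgt d x powr s" if "t \<in> {0..T}" for t x
  using source_arg_bound[OF K(2,1) that th, where x = x] wgt_ge_1[OF d, of x] T by (simp add: powr_mult mult_ac)
 moreover have "continuous_on UNIV (%p. (%p. D (fst p) (snd p)) (fst p + (T - fst p) * snd th, gshift d (snd p) (sqrt ((T - fst p) * snd th)) (fst th)))"
  by (rule continuous_on_compose2[of UNIV "%p. D (fst p) (snd p)"])
   (use D in \<open>auto simp: cadm_def intro!: continuous_on_Pair continuous_on_shift continuous_on_real_sqrt continuous_on_mult continuous_on_add continuous_on_diff continuous_on_const continuous_on_fst continuous_on_snd continuous_on_id\<close>)
 ultimately show ?thesis unfolding cadm_def source_arg_def by (intro conjI exI ballI allI) auto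
qed

lemma cadm_avgS:
 assumes "cadm D" "!!i. i < K ==> zs i \<in> space (gauss_time d)"
 shows "cadm (avgS zs K D)"
proof -
 have "cadm (%t x. (1 / real K) * (\<Sum>i<K. (T - t) * source_arg d T D t x (zs i)))"
  by (intro cadm_cmult cadm_sum cadm_time_mult cadm_source_arg assms) (use assms(2) in auto)
 then show ?thesis by (simp add: avgS_def[abs_def])
qed

lemma cadm_avgH:
 assumes h: "adm0 h"
 shows "cadm (avgH zs K h)"
proof -
 obtain A where A: "A >= 0" "!!t x sg z. t \<in> {0..T} ==> sg \<in> {0..T + 1} ==> abs (h (gshift d x (sqrt sg) z)) <= A * wgt d x powr s * (1 + enorm d z) powr s"
  by (rule adm_shift_bound[OF adm_of_adm0[OF h]]) blast
 have "cadm (%t x. h (gshift d x (sqrt (T - t)) z))" for z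
 proof -
  have "abs (h (gshift d x (sqrt (T - t)) z)) <= (A * (1 + enorm d z) powr s) * wgt d x powr s" if "t \<in> {0..T}" for t x
   using A(2)[of 0 "T - t" x z] that T by (simp add: mult_ac)
  moreover have "continuous_on UNIV (%p. h (gshift d (snd p) (sqrt (T - fst p)) z))"
   by (rule continuous_on_compose2[of UNIV h])
    (use h in \<open>auto simp: adm0_def intro!: continuous_on_shift continuous_on_real_sqrt continuous_on_diff continuous_on_const continuous_on_fst continuous_on_snd continuous_on_id\<close>)
  ultimately show ?thesis unfolding cadm_def by blast
 qed
 then have "cadm (%t x. (1 / real K) * (\<Sum>i<K. h (gshift d x (sqrt (T - t)) (fst (zs i)))))"
  by (intro cadm_cmult cadm_sum) auto
 then show ?thesis by (simp add: avgH_def[abs_def])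
qed

section \<open>Errors of sample averages in the weighted norm\<close>

lemma avgS_error:
 assumes mc: "mc_const q C" and D: "cadm D" and tau: "tm tau" and b: "b >= 0"
  "(nint (Ym tau) (%y. nint (gauss_time d) (%th. ennreal (abs (XS D th y) powr q)))) <= ennreal (b powr q)" and K: "K >= 1"
 shows "\<exists>zs. (\<forall>i<K. zs i \<in> space (gauss_time d)) \<and> Lq_le (Ym tau) q (lift (%t x. avgS zs K D t x - source d T D t x)) (C * b / sqrt (real K))"
proof -
 have "\<exists>zs. (\<forall>i<K. zs i \<in> space (gauss_time d)) \<and> Lq_le (Ym tau) q (%y. (\<Sum>i<K. XS D (zs i) y) / real K - (lint (gauss_time d) (%th. XS D th y))) (C * b / sqrt (real K))"
  using mc[unfolded mc_const_def, THEN conjunct2, rule_format, OF prob_space_gauss_time sf(7)[OF tau] XS_meas[OF D tau] _ b K] XS_integrable[OF D tau] by blast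
 then show ?thesis by (simp add: XS_def lift_def[abs_def] avgS_def source_def)
qed

lemma avgH_error:
 assumes mc: "mc_const q C" and h: "adm0 h" and tau: "tm tau" and b: "b >= 0"
  "(nint (Ym tau) (%y. nint (gauss_time d) (%th. ennreal (abs (XH h th y) powr q)))) <= ennreal (b powr q)" and K: "K >= 1"
 shows "\<exists>zs. Lq_le (Ym tau) q (lift (%t x. avgH zs K h t x - heat d (T - t) h x)) (C * b / sqrt (real K))"
proof -
 have hc: "continuous_on UNIV h" using h by (simp add: adm0_def)
 have "\<exists>zs. (\<forall>i<K. zs i \<in> space (gauss_time d)) \<and> Lq_le (Ym tau) q (%y. (\<Sum>i<K. XH h (zs i) y) / real K - (lint (gauss_time d) (%th. XH h th y))) (C * b / sqrt (real K))"
  using mc[unfolded mc_const_def, THEN conjunct2, rule_format, OF prob_space_gauss_time sf(7)[OF tau] XH_meas[OF hc tau] _ b K] XH_integrable[OF h tau] by blast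
 moreover have gi: "(lint (gauss_time d) (%th. g (fst th))) = (lint (gauss d) (%z. g z))" if [measurable]: "g \<in> borel_measurable (gauss d)" for g :: "_ => real"
 proof -
  interpret B: prob_space unit_time by (rule prob_space_unit_time)
  have "(lint (gauss d) (%z. g z)) = (lint (distr (gauss d \<Otimes>\<^sub>M unit_time) (gauss d) fst) (%z. g z))" by (simp add: B.distr_pair_fst)
  also have "... = (lint (gauss_time d) (%th. g (fst th)))" unfolding gauss_time_def by (rule integral_distr) auto
  finally show ?thesis by simp
 qed
 moreover have gm: "(%z. h (gshift d x c z)) \<in> borel_measurable (gauss d)" for x c
  by (intro borel_measurable_continuous_on[OF hc] measurable_shift measurable_gauss_id borel_measurable_const)
 moreover have "(lint (gauss_time d) (%th. XH h th y)) = lift (%t x. heat d (T - t) h x) y" for y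
  unfolding XH_def lift_def heat_def by (rule gi[OF gm])
 ultimately show ?thesis by (auto simp: XH_def lift_def[abs_def] avgH_def)
qed

text \<open>\<open>rho\<close> bounds one random sample of \<open>source d T D\<close> in the \<open>L\<^sup>q\<close> norm of \<open>tau\<close> relative to \<open>D\<close> in the
 \<open>L\<^sup>q\<close> norm of the exponential time weight.\<close>

definition srcb :: "real => real measure => real => bool" where
 "srcb lam tau rho \<longleftrightarrow> tm tau \<and> rho >= 0 \<and> (\<forall>D b. cadm D --> Lq_le (Ym (time_exp lam)) q (lift D) b -->
   (nint (Ym tau) (%y. nint (gauss_time d) (%th. ennreal (abs (XS D th y) powr q)))) <= ennreal ((rho * b) powr q))"

lemma srcb_mono:
 assumes "srcb lam tau rho" "rho <= rho'" shows "srcb lam tau rho'"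
 unfolding srcb_def
proof (intro conjI allI impI)
 fix D b assume D: "cadm D" and b: "Lq_le (Ym (time_exp lam)) q (lift D) b"
 have "(nint (Ym tau) (%y. nint (gauss_time d) (%th. ennreal (abs (XS D th y) powr q)))) <= ennreal ((rho * b) powr q)"
  using assms(1) D b unfolding srcb_def by blast
 also have "... <= ennreal ((rho' * b) powr q)"
  using assms Lq_leD(2)[OF b] q by (intro ennreal_leI powr_mono2 mult_right_mono mult_nonneg_nonneg) (auto simp: srcb_def)
 finally show "(nint (Ym tau) (%y. nint (gauss_time d) (%th. ennreal (abs (XS D th y) powr q)))) <= ennreal ((rho' * b) powr q)" .
qed (use assms in \<open>auto simp: srcb_def\<close>)

lemma srcbI:
 assumes tau: "tm tau" and k: "k >= 0" "!!D. cadm D ==> (nint tau (%t. tail D t)) <= ennreal k * (nint (time_exp lam) (%t. QQ D t))"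
 shows "srcb lam tau ((T powr (q - 1) * k) powr (1 / q))"
 unfolding srcb_def
proof (intro conjI allI impI tau)
 fix D b assume D: "cadm D" and b: "Lq_le (Ym (time_exp lam)) q (lift D) b"
 have "(nint (Ym tau) (%y. nint (gauss_time d) (%th. ennreal (abs (XS D th y) powr q)))) <= ennreal (T powr (q - 1)) * (nint tau (%t. tail D t))"
  by (rule nn_XS_le[OF D tau])
 also have "... <= ennreal (T powr (q - 1)) * (ennreal k * (nint (time_exp lam) (%t. QQ D t)))"
  by (intro mult_left_mono k D) simp
 also have "(nint (time_exp lam) (%t. QQ D t)) = (nint (Ym (time_exp lam)) (%y. ennreal (abs (lift D y) powr q)))"
  by (rule nn_lift[OF D tm_time_exp, symmetric])
 also have "ennreal (T powr (q - 1)) * (ennreal k * ...) <= ennreal (T powr (q - 1)) * (ennreal k * ennreal (b powr q))"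
  by (intro mult_left_mono Lq_leD(3)[OF b]) auto
 also have "... = ennreal (((T powr (q - 1) * k) powr (1 / q) * b) powr q)"
  using k q Lq_leD(2)[OF b] by (simp add: powr_mult powr_powr ennreal_mult mult.assoc)
 finally show "(nint (Ym tau) (%y. nint (gauss_time d) (%th. ennreal (abs (XS D th y) powr q)))) <= ennreal (((T powr (q - 1) * k) powr (1 / q) * b) powr q)" .
qed simp

text \<open>Jensen over the sample: an average is no larger than one sample, so the deterministic
  bias obeys the same factor \<open>rho\<close>.\<close>

lemma Lq_source:
 assumes sb: "srcb lam tau rho" and D: "cadm D" and b: "Lq_le (Ym (time_exp lam)) q (lift D) b"
 shows "Lq_le (Ym tau) q (lift (source d T D)) (rho * b)"
proof -
 interpret P: prob_space "gauss_time d" by (rule prob_space_gauss_time)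
 have tau: "tm tau" using sb by (simp add: srcb_def)
 have e: "lift (source d T D) = (%y. lint (gauss_time d) (%th. XS D th y))" by (auto simp: lift_def XS_def source_def)
 have m1: "(%w. XS D (snd w) (fst w)) \<in> borel_measurable (Ym tau \<Otimes>\<^sub>M gauss_time d)"
  using measurable_compose[OF measurable_pair_swap' XS_meas[OF D tau]] by (simp add: case_prod_beta')
 have m: "(%y. lint (gauss_time d) (%th. XS D th y)) \<in> borel_measurable (Ym tau)"
  by (rule sigma_finite_measure.borel_measurable_lebesgue_integral[OF sf(5)]) (use m1 in \<open>simp add: case_prod_beta'\<close>)
 have "(nint (Ym tau) (%y. ennreal (abs (lift (source d T D) y) powr q))) <= (nint (Ym tau) (%y. nint (gauss_time d) (%th. ennreal (abs (XS D th y) powr q))))"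
  unfolding e
 proof (rule nn_integral_mono)
  fix y assume y: "y \<in> space (Ym tau)"
  have my: "(%th. XS D th y) \<in> borel_measurable (gauss_time d)"
   using measurable_compose[OF measurable_Pair1'[OF y] m1] by simp
  have "abs (lint (gauss_time d) (%th. XS D th y)) powr q <= (lint (gauss_time d) (%th. abs (XS D th y) powr q))"
   by (rule P.expectation_powr_le[OF my XS_integrable[OF D tau y]]) (use q in simp)
  then show "ennreal (abs (lint (gauss_time d) (%th. XS D th y)) powr q) <= (nint (gauss_time d) (%th. ennreal (abs (XS D th y) powr q)))"
   using XS_integrable[OF D tau y] by (subst nn_integral_eq_integral) (auto intro: ennreal_leI)
 qed
 also have "... <= ennreal ((rho * b) powr q)" using sb D b unfolding srcb_def by blast
 finally show ?thesis using m e sb Lq_leD(2)[OF b] by (simp add: Lq_le_def srcb_def)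
qed

lemma Lq_lift_wgt:
 assumes D: "cadm D" "!!t x. t \<in> {0..T} ==> abs (D t x) <= K * wgt d x powr s" "K >= 0"
  and tau: "tm tau" "emeasure tau (space tau) <= ennreal m" "m >= 0"
  and V: "(nint nu (%x. ennreal (wgt d x powr (s * q)))) <= ennreal V" "V >= 0"
 shows "Lq_le (Ym tau) q (lift D) (K * (m * wgt_const (s * q) (sqrt T) * V) powr (1 / q))"
proof -
 let ?c = "wgt_const (s * q) (sqrt T)"
 have c: "?c >= 1" by (rule wgt_const_ge_1)
 have [measurable]: "(%x. x) \<in> borel_measurable nu" by (rule nu_id)
 have QQ: "QQ D t <= ennreal (K powr q * ?c * V)" if t: "t \<in> {0..T}" for t
 proof -
  have "QQ D t <= (nint nu (%x. nint (gauss d) (%z. ennreal (K powr q) * ennreal (wgt d (gshift d x (sqrt t) z) powr (s * q)))))"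
   unfolding QQ_def
  proof (intro nn_integral_mono)
   fix x z
   have "abs (D t (gshift d x (sqrt t) z)) powr q <= (K * wgt d (gshift d x (sqrt t) z) powr s) powr q"
    using D(2)[OF t] q by (intro powr_mono2) auto
   then show "ennreal (abs (D t (gshift d x (sqrt t) z)) powr q) <= ennreal (K powr q) * ennreal (wgt d (gshift d x (sqrt t) z) powr (s * q))"
    using D(3) by (simp add: powr_mult powr_powr ennreal_leI flip: ennreal_mult)
  qed
  also have "... = (nint nu (%x. ennreal (K powr q) * (nint (gauss d) (%z. ennreal (wgt d (gshift d x (sqrt t) z) powr (s * q))))))"
   by (intro nn_integral_cong nn_integral_cmult) (use measurable_gauss_id in measurable)
  also have "... <= (nint nu (%x. ennreal (K powr q) * ennreal (?c * wgt d x powr (s * q))))"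
   using s q t by (intro nn_integral_mono mult_left_mono nn_wgt_gauss d) auto
  also have "... = (nint nu (%x. ennreal (K powr q * ?c) * ennreal (wgt d x powr (s * q))))"
   using c by (simp add: ennreal_mult mult.assoc)
  also have "... = ennreal (K powr q * ?c) * (nint nu (%x. ennreal (wgt d x powr (s * q))))"
   by (rule nn_integral_cmult) measurable
  also have "... <= ennreal (K powr q * ?c) * ennreal V" by (intro mult_left_mono V) simp
  also have "... = ennreal (K powr q * ?c * V)" using c V by (simp add: ennreal_mult)
  finally show ?thesis .
 qed
 have "(nint (Ym tau) (%y. ennreal (abs (lift D y) powr q))) = (nint tau (%t. QQ D t))" by (rule nn_lift[OF D(1) tau(1)])
 also have "... <= (nint tau (%t. ennreal (K powr q * ?c * V)))" by (intro nn_integral_mono QQ) (simp add: tm_space[OF tau(1)])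
 also have "... <= ennreal (K powr q * ?c * V) * ennreal m" by (simp add: tau(2) mult_left_mono)
 also have "... = ennreal ((K * (m * ?c * V) powr (1 / q)) powr q)"
  using D(3) c V(2) tau(3) q by (simp add: powr_mult powr_powr ennreal_mult[symmetric] mult_ac)
 finally show ?thesis using lift_meas[OF D(1) tau(1)] D(3) by (simp add: Lq_le_def)
qed

text \<open>The average over the increment from \<open>t\<close> to \<open>T\<close> is taken first
  and leaves the weight at the position at time \<open>t\<close>; then \<open>Lq_lift_wgt\<close>
  applies.\<close>

lemma nn_XH_le:
 assumes h: "adm0 h" "!!x. abs (h x) <= K * wgt d x powr s" "K >= 0"
  and tau: "tm tau" "emeasure tau (space tau) <= ennreal m" "m >= 0"
  and V: "(nint nu (%x. ennreal (wgt d x powr (s * q)))) <= ennreal V" "V >= 0"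
 shows "(nint (Ym tau) (%y. nint (gauss_time d) (%th. ennreal (abs (XH h th y) powr q))))
   <= ennreal ((K * wgt_const (s * q) (sqrt T) powr (1 / q) * (m * wgt_const (s * q) (sqrt T) * V) powr (1 / q)) powr q)"
proof -
 interpret U: prob_space unit_time by (rule prob_space_unit_time)
 let ?c = "wgt_const (s * q) (sqrt T)"
 have c: "?c >= 1" by (rule wgt_const_ge_1)
 \<comment> \<open>Its \<open>q\<close>-th power is the bound left by that inner average, which
   explains the root of the Gaussian constant.\<close>
 define D where "D = (%(t::real) x. K * ?c powr (1 / q) * wgt d x powr s)"
 have cD: "cadm D"
  unfolding cadm_def D_def
 proof (intro conjI exI ballI allI)
  show "continuous_on UNIV (%p::real \<times> (nat => real). K * ?c powr (1 / q) * wgt d (snd p) powr s)"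
   by (intro continuous_on_mult continuous_on_const continuous_on_wgt_powr continuous_on_snd continuous_on_id)
  show "abs (K * ?c powr (1 / q) * wgt d x powr s) <= (K * ?c powr (1 / q)) * wgt d x powr s" for x using h(3) by simp
 qed
 have L: "Lq_le (Ym tau) q (lift D) (K * ?c powr (1 / q) * (m * ?c * V) powr (1 / q))"
  by (rule Lq_lift_wgt[OF cD _ _ tau V]) (use h(3) in \<open>auto simp: D_def\<close>)
 have "(nint (Ym tau) (%y. nint (gauss_time d) (%th. ennreal (abs (XH h th y) powr q)))) <= (nint (Ym tau) (%y. ennreal (abs (lift D y) powr q)))"
 proof (rule nn_integral_mono)
  fix y assume y: "y \<in> space (Ym tau)"
  note t = Ym_space[OF tau(1) y]
  let ?x = "gshift d (snd (snd y)) (sqrt (fst y)) (fst (snd y))"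
  let ?g = "%z. ennreal (wgt d (gshift d ?x (sqrt (T - fst y)) z) powr (s * q))"
  have g[measurable]: "?g \<in> borel_measurable (gauss d)" using measurable_gauss_id by measurable
  have "(nint (gauss_time d) (%th. ennreal (abs (XH h th y) powr q))) <= (nint (gauss_time d) (%th. ennreal (K powr q) * ?g (fst th)))"
  proof (rule nn_integral_mono)
   fix th
   have "abs (XH h th y) powr q <= (K * wgt d (gshift d ?x (sqrt (T - fst y)) (fst th)) powr s) powr q"
    unfolding XH_def using h(2) q by (intro powr_mono2) auto
   then show "ennreal (abs (XH h th y) powr q) <= ennreal (K powr q) * ?g (fst th)"
    using h(3) by (simp add: powr_mult powr_powr ennreal_leI flip: ennreal_mult)
  qed
  also have "... = (nint (gauss d) (%z. ennreal (K powr q) * ?g z))"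
  proof -
   have "(%th. ennreal (K powr q) * ?g (fst th)) \<in> borel_measurable (gauss d \<Otimes>\<^sub>M unit_time)" by measurable
   from U.nn_integral_fst[OF this] show ?thesis by (simp add: gauss_time_def U.emeasure_space_1)
  qed
  also have "... = ennreal (K powr q) * (nint (gauss d) (%z. ?g z))" by (rule nn_integral_cmult[OF g])
  also have "... <= ennreal (K powr q) * ennreal (?c * wgt d ?x powr (s * q))"
   using s q t by (intro mult_left_mono nn_wgt_gauss d) auto
  also have "... = ennreal (abs (lift D y) powr q)"
   using h(3) c q by (simp add: lift_def D_def abs_mult powr_mult powr_powr ennreal_mult[symmetric] mult_ac)
  finally show "(nint (gauss_time d) (%th. ennreal (abs (XH h th y) powr q))) <= ennreal (abs (lift D y) powr q)" .
 qed
 also have "... <= ennreal ((K * ?c powr (1 / q) * (m * ?c * V) powr (1 / q)) powr q)" by (rule Lq_leD(3)[OF L])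
 finally show ?thesis .
qed

end

text \<open>Both \<open>f\<close> and \<open>h\<close> are already realisations of networks and
  \<open>u\<close> solves the equation for them exactly; the passage from the original data is a
  separate perturbation argument.\<close>

locale mlp_setting = sampling_setting +
 fixes a f :: "real => real" and F0 h u and jw Nf Nh W M :: nat and L K V C :: real
 assumes L: "L >= 0" "!!v w. abs (f v - f w) <= L * abs (v - w)"
  and f_net: "!!v. f v = F0 (%_. v)" "snet a 1 Nf W F0"
  and h_net: "adm0 h" "snet a d Nh W h"
  and J_net: "snet a 1 2 jw (%x. x 0)" "jw <= W"
  and u: "adm u" "mild f h u"
  and K: "K >= 0" "!!t x. t \<in> {0..T} ==> abs (u t x) <= K * wgt d x powr s" "!!x. abs (h x) <= K * wgt d x powr s" "abs (f 0) <= K"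
  and V: "V >= 0" "(nint nu (%x. ennreal (wgt d x powr (s * q)))) <= ennreal V"
  and M: "M >= 1" and C: "mc_const q C"
begin

text \<open>Cancels the factor \<open>T powr (q - 1)\<close> of \<open>nn_XS_le\<close>, so that the
  \<open>q\<close>-th root of what remains is exactly \<open>1 / sqrt M\<close>.\<close>

definition lam :: real where "lam = T powr (q - 1) * real M powr (q / 2)"
text \<open>A common bound for the total masses of \<open>time_exp lam\<close> and of the point mass
  \<open>time_0\<close>.\<close>

definition mass :: real where "mass = max 1 (T * exp (lam * T))"
definition R :: real where "R = sqrt (real M)"
definition B :: real where "B = 1 + 2 * C + 2 * C * L + L"
text \<open>Bounds in norm everything that grows at most like \<open>K\<close> times the weight. The
  extra root of \<open>wgt_const\<close> is there for the samples of the terminal value, which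
  involve a second Gaussian average.\<close>

definition A :: real where
 "A = K * wgt_const (s * q) (sqrt T) powr (1 / q) * (mass * wgt_const (s * q) (sqrt T) * V) powr (1 / q)"

definition good :: "nat => (real => (nat => real) => real) => bool" where
 "good l X \<longleftrightarrow> cadm X \<and> (\<forall>t. snet a d (Nh + l * Nf) ((3 * M) ^ l * W) (X t))"

definition err :: "real measure => (real => (nat => real) => real) => real => bool" where
 "err tau X b \<longleftrightarrow> Lq_le (Ym tau) q (lift (%t x. X t x - clamp u t x)) b"

lemma R: "R >= 1" using M by (simp add: R_def)

lemma C0: "C >= 0" using C by (simp add: mc_const_def)

lemma lam: "lam > 0" using T M by (simp add: lam_def)

lemma A_nonneg: "A >= 0" using K by (simp add: A_def)

lemma Lq_A:
 assumes "cadm D" "!!t x. t \<in> {0..T} ==> abs (D t x) <= K * wgt d x powr s" "tm tau" "emeasure tau (space tau) <= ennreal mass"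
 shows "Lq_le (Ym tau) q (lift D) A"
proof (rule Lq_le_mono[OF Lq_lift_wgt[OF assms(1,2) K(1) assms(3,4) _ V(2,1)]])
 have "1 <= wgt_const (s * q) (sqrt T) powr (1 / q)" using wgt_const_ge_1 q by (simp add: ge_one_powr_ge_zero)
 from mult_left_mono[OF this K(1)]
 have "K * 1 * (mass * wgt_const (s * q) (sqrt T) * V) powr (1 / q) <= A"
  unfolding A_def by (intro mult_right_mono) auto
 then show "K * (mass * wgt_const (s * q) (sqrt T) * V) powr (1 / q) <= A" by simp
qed (use q in \<open>auto simp: mass_def\<close>)

lemma mass_time_exp: "emeasure (time_exp lam) (space (time_exp lam)) <= ennreal mass"
proof -
 have "emeasure (time_exp lam) (space (time_exp lam)) = (nint (time_exp lam) (%t. 1))" by simp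
 also have "... = (nint lborel (%t. ennreal (exp (lam * t)) * 1 * indicator {0..T} t))" by (rule nn_time_exp) simp
 also have "... <= (nint lborel (%t. ennreal (exp (lam * T)) * indicator {0..T} t))"
  using lam by (intro nn_integral_mono) (auto simp: indicator_def intro!: ennreal_leI)
 also have "... = ennreal (T * exp (lam * T))" using T by (subst nn_integral_cmult) (auto simp: ennreal_mult mult_ac)
 also have "... <= ennreal mass" by (intro ennreal_leI) (simp add: mass_def)
 finally show ?thesis .
qed

lemma mass_time_0: "emeasure time_0 (space time_0) <= ennreal mass"
proof -
 have "emeasure time_0 (space time_0) = (nint time_0 (%t. 1))" by simp
 also have "... = 1" by (rule nn_time_0) simp
 also have "... <= ennreal mass" using ennreal_leI[of 1 mass] by (simp add: mass_def)
 finally show ?thesis .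
qed

lemma srcb_exp: "srcb lam (time_exp lam) (1 / R)"
proof -
 have "srcb lam (time_exp lam) ((T powr (q - 1) * (1 / lam)) powr (1 / q))"
  by (rule srcbI[OF tm_time_exp]) (use lam tail_time_exp[OF _ lam] in auto)
 also have "(T powr (q - 1) * (1 / lam)) powr (1 / q) = (real M powr (- (q / 2))) powr (1 / q)"
  using T by (simp add: lam_def powr_minus_divide)
 also have "... = real M powr (- (1 / 2))" unfolding powr_powr using q by simp
 also have "... = 1 / R" by (simp add: R_def powr_minus_divide powr_half_sqrt)
 finally show ?thesis .
qed

text \<open>The price of the final step: the point mass at time 0 yields no contraction, so the
  missing factor \<open>R\<close> is put back.\<close>

definition sg :: real where "sg = max 1 (T powr ((q - 1) / q)) * R"

lemma sg: "sg >= 1"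
proof -
 have "1 * 1 <= sg" unfolding sg_def using R by (intro mult_mono) auto
 then show ?thesis by simp
qed

lemma srcb_0: "srcb lam time_0 (sg / R)"
proof (rule srcb_mono)
 show "srcb lam time_0 ((T powr (q - 1) * 1) powr (1 / q))"
  by (rule srcbI[OF tm_time_0]) (use tail_time_0[OF _ lam] in auto)
 show "(T powr (q - 1) * 1) powr (1 / q) <= sg / R" using R T by (simp add: sg_def powr_powr)
qed

lemma Nf: "Nf >= 1" using f_net(2) by (auto simp: snet_def)

lemma good_0: "good 0 (%_ _. 0)"
 using snet_affine[OF h_net(2), of 0 0] cadm_const[of 0] by (simp add: good_def)

lemma source_telescope:
 assumes X: "!!l. l < n ==> cadm (X l)" and t: "t \<in> {0..T}" and n: "(n::nat) >= 1"
 shows "(\<Sum>l<n. source d T (%t x. f (X l t x) - (if l = 0 then 0 else f (X (l - 1) t x))) t x) = source d T (%t x. f (X (n - 1) t x)) t x"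
 using n X
proof (induction n rule: dec_induct)
 case (step n)
 have a: "adm (%t x. f (X l t x))" if "l < Suc n" for l by (intro cadm_adm cadm_Lipschitz[OF step(4)[OF that] L(2)])
 show ?case using step(1,3,4) source_diff[OF a[of n] a[of "n - 1"] t, of x] by simp
qed simp

lemma snet_f: "snet a d N w g ==> W <= w ==> snet a d (N + Nf - 1) w (%x. f (g x))"
 using snet_comp[OF _ f_net(2), of d N w g] f_net(1) by (simp add: max_absorb1)

lemma W_le: "W <= (3 * M) ^ l * W" using M by simp

text \<open>After extension to a common depth, level \<open>m\<close> contributes
  \<open>M ^ (n - m)\<close> copies of width \<open>2 * (3 * M) ^ m * W\<close>, twice the width
  \<open>3 ^ m * M ^ n * W\<close> reached so far. Each level therefore triples the width,
  independently of its sample number.\<close>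

lemma mlp_net_step:
 assumes X: "!!l. l < n ==> good l (X l)" and m: "m <= n"
 shows "snet a d (Nh + n * Nf) (3 ^ m * M ^ n * W) (%x. avgH zh (M ^ n) h t x +
   (\<Sum>l<m. avgS (zs l) (M ^ (n - l)) (%t x. f (X l t x) - (if l = 0 then 0 else f (X (l - 1) t x))) t x))"
 using m
proof (induction m)
 case 0
 have "snet a d (Nh + n * Nf) W h" using snet_extend[OF J_net(1) h_net(2) _ J_net(2)] by simp
 from snet_sum[of "M ^ n" a d _ _ "%i x. h (gshift d x (sqrt (T - t)) (fst (zh i)))" "%_. 1", OF _ snet_shift[OF this]]
 have "snet a d (Nh + n * Nf) (M ^ n * W) (%x. \<Sum>i<M ^ n. h (gshift d x (sqrt (T - t)) (fst (zh i))))" using M by simp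
 from snet_affine[OF this, of "1 / real (M ^ n)" 0] show ?case by (simp add: avgH_def)
next
 case (Suc m)
 let ?D = "%t x. f (X m t x) - (if m = 0 then 0 else f (X (m - 1) t x))"
 let ?w = "(3 * M) ^ m * W"
 have N: "Nh + l * Nf + Nf - 1 <= Nh + n * Nf" if "l < n" for l
  using mult_le_mono1[of "Suc l" n Nf] that by simp
 have ext: "snet a d (Nh + n * Nf) ((3 * M) ^ l * W) (%x. f (X l r x))" if "l < n" for l r
 proof (rule snet_extend[OF J_net(1) snet_f[OF _ W_le] N[OF that]])
  show "snet a d (Nh + l * Nf) ((3 * M) ^ l * W) (X l r)" using X[OF that] by (simp add: good_def)
  show "jw <= (3 * M) ^ l * W" using J_net(2) W_le[of l] by (rule order_trans)
 qed
 have D: "snet a d (Nh + n * Nf) (2 * ?w) (?D r)" for r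
 proof (cases m)
  case 0
  then show ?thesis using snet_mono[OF ext[of 0 r], of "2 * W"] Suc(2) by simp
 next
  case (Suc k)
  have "snet a d (Nh + n * Nf) (?w + (3 * M) ^ k * W) (%x. 1 * f (X m r x) + (-1) * f (X k r x))"
   by (rule snet_add[OF ext ext]) (use Suc \<open>Suc m <= n\<close> in auto)
  moreover have "(3 * M) ^ k * W <= ?w" using M by (simp add: Suc)
  ultimately show ?thesis using snet_mono[of a d _ _ _ "2 * ?w"] Suc by simp
 qed
 let ?N = "M ^ (n - m)"
 have sh: "snet a d (Nh + n * Nf) (2 * ?w) (%x. source_arg d T ?D t x z)" for z
  unfolding source_arg_def by (rule snet_shift[OF D])
 have "snet a d (Nh + n * Nf) (?N * (2 * ?w)) (%x. \<Sum>i<?N. (T - t) * source_arg d T ?D t x (zs m i))"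
  by (rule snet_sum[OF _ sh]) (use M in simp)
 from snet_affine[OF this, of "1 / real ?N" 0]
 have S: "snet a d (Nh + n * Nf) (?N * (2 * ?w)) (avgS (zs m) ?N ?D t)" by (simp add: avgS_def[abs_def])
 have "M ^ n = ?N * M ^ m" using Suc(2) by (simp flip: power_add)
 then have w: "?N * (2 * ?w) = 2 * (3 ^ m * M ^ n * W)" by (simp add: power_mult_distrib mult_ac)
 from snet_add[OF Suc.IH S, of 1 1] Suc(2)
 have "snet a d (Nh + n * Nf) (3 ^ m * M ^ n * W + 2 * (3 ^ m * M ^ n * W)) (%x. avgH zh (M ^ n) h t x +
   (\<Sum>l<m. avgS (zs l) (M ^ (n - l)) (%t x. f (X l t x) - (if l = 0 then 0 else f (X (l - 1) t x))) t x) + avgS (zs m) ?N ?D t x)"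
  unfolding w by simp
 moreover have "3 ^ m * M ^ n * W + 2 * (3 ^ m * M ^ n * W) = 3 ^ Suc m * M ^ n * W" by simp
 ultimately show ?case by (simp only: sum.lessThan_Suc add.assoc)
qed

text \<open>Telescoping over the levels leaves three kinds of error: sampling the terminal value,
  sampling each increment \<open>D l\<close>, and the bias between \<open>f (X (n - 1))\<close> and
  \<open>f u\<close>. The time measure \<open>tau\<close> is free, since the step is needed for the
  weighted norm and, at the end, for time 0.\<close>

lemma mlp_step:
 assumes n: "n >= 1" and sb: "srcb lam tau (sg' / R)" and mass: "emeasure tau (space tau) <= ennreal mass" and sg': "sg' >= 1"
  and X: "!!l. l < n ==> good l (X l)" and X0: "X 0 = (%_ _. 0)"
  and e: "!!l. l < n ==> err (time_exp lam) (X l) (A * (B / R) ^ l)"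
 shows "\<exists>Y. good n Y \<and> err tau Y (sg' * A * (B / R) ^ n)"
proof -
 have tau: "tm tau" using sb by (simp add: srcb_def)
 have q1: "q >= 1" and q0: "q > 0" using q by auto
 let ?mu = "Ym (time_exp lam)"
 let ?u = "clamp u"
 define D where "D l = (%t x. f (X l t x) - (if l = 0 then 0 else f (X (l - 1) t x)))" for l
 \<comment> \<open>Level 0 is the constant \<open>f 0\<close>. Higher increments are at most
   \<open>L\<close> times the errors of the two neighbouring levels, joined through
   \<open>u\<close>.\<close>
 define b where "b l = A * (if l = 0 then 1 else L * ((B / R) ^ l + (B / R) ^ (l - 1)))" for l
 have cu: "cadm ?u" by (rule cadm_clamp[OF u(1)])
 have cX: "cadm (X l)" if "l < n" for l using X[OF that] by (simp add: good_def)
 have cfX: "cadm (%t x. f (X l t x))" if "l < n" for l by (rule cadm_Lipschitz[OF cX[OF that] L(2)])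
 have cD: "cadm (D l)" if l: "l < n" for l
 proof (cases "l = 0")
  case True
  then show ?thesis using cfX[OF l] by (simp add: D_def)
 next
  case False
  then show ?thesis using cadm_diff[OF cfX[OF l] cfX[of "l - 1"]] l by (simp add: D_def)
 qed
 have bD: "Lq_le ?mu q (lift (D l)) (b l)" if l: "l < n" for l
 proof (cases "l = 0")
  case True
  have "Lq_le ?mu q (lift (%t x. f 0)) A"
  proof (rule Lq_A[OF cadm_const _ tm_time_exp mass_time_exp])
   show "abs (f 0) <= K * wgt d x powr s" for x
    using K(4) mult_left_mono[OF wgt_powr_ge_1[of x] K(1)] by simp
  qed
  then show ?thesis using True X0 by (simp add: D_def b_def)
 next
  case False
  let ?g = "%l y. lift (%t x. X l t x - ?u t x) y"
  have "Lq_le ?mu q (%y. L * (?g l y - ?g (l - 1) y)) (abs L * (A * (B / R) ^ l + A * (B / R) ^ (l - 1)))"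
   using e[OF l] e[of "l - 1"] l q1 unfolding err_def by (intro Lq_le_cmult Lq_le_diff) auto
  then have "Lq_le ?mu q (lift (D l)) (abs L * (A * (B / R) ^ l + A * (B / R) ^ (l - 1)))"
  proof (rule Lq_le_dom[OF _ lift_meas[OF cD[OF l] tm_time_exp] _ q0])
   show "abs (lift (D l) y) <= abs (L * (?g l y - ?g (l - 1) y))" for y
    using False L by (simp add: lift_def D_def abs_mult)
  qed
  then show ?thesis using False L(1) by (simp add: b_def algebra_simps)
 qed
 have b0: "b l >= 0" if "l < n" for l using Lq_leD(2)[OF bD[OF that]] .
 have ex: "\<exists>zs. (\<forall>i<M ^ (n - l). zs i \<in> space (gauss_time d)) \<and>
   Lq_le (Ym tau) q (lift (%t x. avgS zs (M ^ (n - l)) (D l) t x - source d T (D l) t x)) (C * (sg' / R * b l) / R ^ (n - l))"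
  if l: "l < n" for l
 proof -
  have "0 <= sg' / R * b l" using b0[OF l] R sg' by simp
  moreover have "1 <= M ^ (n - l)" using M by simp
  moreover have r: "sqrt (real (M ^ (n - l))) = R ^ (n - l)" by (simp add: R_def real_sqrt_power)
  ultimately show ?thesis
   using avgS_error[OF C cD[OF l] tau _ sb[unfolded srcb_def, THEN conjunct2, THEN conjunct2, rule_format, OF cD[OF l] bD[OF l]], of "M ^ (n - l)"]
   unfolding r by simp
 qed
 have "\<exists>zs. \<forall>l\<in>{..<n}. (\<forall>i<M ^ (n - l). zs l i \<in> space (gauss_time d)) \<and>
   Lq_le (Ym tau) q (lift (%t x. avgS (zs l) (M ^ (n - l)) (D l) t x - source d T (D l) t x)) (C * (sg' / R * b l) / R ^ (n - l))"
  by (rule bchoice) (intro ballI ex, simp)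
 then obtain zs where zs: "!!l i. l < n ==> i < M ^ (n - l) ==> zs l i \<in> space (gauss_time d)"
   "!!l. l < n ==> Lq_le (Ym tau) q (lift (%t x. avgS (zs l) (M ^ (n - l)) (D l) t x - source d T (D l) t x)) (C * (sg' / R * b l) / R ^ (n - l))"
  by auto
 have "(nint (Ym tau) (%y. nint (gauss_time d) (%th. ennreal (abs (XH h th y) powr q)))) <= ennreal (A powr q)"
  unfolding A_def by (rule nn_XH_le[OF h_net(1) K(3,1) tau mass _ V(2,1)]) (simp add: mass_def)
 from avgH_error[OF C h_net(1) tau A_nonneg this, of "M ^ n"] obtain zh
  where zh: "Lq_le (Ym tau) q (lift (%t x. avgH zh (M ^ n) h t x - heat d (T - t) h x)) (C * A / R ^ n)"
  using M by (auto simp: R_def real_sqrt_power)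
 define E where "E = (%t x. f (X (n - 1) t x) - f (?u t x))"
 have n1: "n - 1 < n" using n by simp
 have cE: "cadm E" unfolding E_def by (intro cadm_diff cfX[OF n1] cadm_Lipschitz[OF cu L(2)])
 have "Lq_le ?mu q (%y. L * lift (%t x. X (n - 1) t x - ?u t x) y) (abs L * (A * (B / R) ^ (n - 1)))"
  using e[OF n1] unfolding err_def by (rule Lq_le_cmult)
 then have "Lq_le ?mu q (lift E) (abs L * (A * (B / R) ^ (n - 1)))"
 proof (rule Lq_le_dom[OF _ lift_meas[OF cE tm_time_exp] _ q0])
  show "abs (lift E y) <= abs (L * lift (%t x. X (n - 1) t x - ?u t x) y)" for y
   using L by (simp add: lift_def E_def abs_mult)
 qed
 from Lq_source[OF sb cE this]
 have sE: "Lq_le (Ym tau) q (lift (source d T E)) (sg' / R * (L * (A * (B / R) ^ (n - 1))))" using L(1) by simp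
 define Y where "Y = (%t x. avgH zh (M ^ n) h t x + (\<Sum>l<n. avgS (zs l) (M ^ (n - l)) (D l) t x))"
 have cY: "cadm Y"
  unfolding Y_def by (intro cadm_add cadm_avgH h_net(1) cadm_sum cadm_avgS cD zs(1)) auto
 have Yu: "Y t x - ?u t x = (avgH zh (M ^ n) h t x - heat d (T - t) h x) +
   (\<Sum>l<n. avgS (zs l) (M ^ (n - l)) (D l) t x - source d T (D l) t x) + source d T E t x" if t: "t \<in> {0..T}" for t x
 proof -
  have "?u t x = heat d (T - t) h x + source d T (%t x. f (u t x)) t x" using u(2) t by (simp add: mild_def)
  also have "source d T (%t x. f (u t x)) t x = source d T (%t x. f (?u t x)) t x" by (rule source_cong[OF _ t]) simp
  finally have 1: "?u t x = heat d (T - t) h x + source d T (%t x. f (?u t x)) t x" .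
  have "source d T E t x = source d T (%t x. f (X (n - 1) t x)) t x - source d T (%t x. f (?u t x)) t x"
   unfolding E_def by (rule source_diff[OF cadm_adm[OF cfX[OF n1]] cadm_adm[OF cadm_Lipschitz[OF cu L(2)]] t])
  moreover have "(\<Sum>l<n. source d T (D l) t x) = source d T (%t x. f (X (n - 1) t x)) t x"
   unfolding D_def by (rule source_telescope[OF cX t n])
  ultimately show ?thesis using 1 by (simp add: Y_def sum_subtractf)
 qed
 \<comment> \<open>The terminal sampling error, the sampling errors of the levels, and the bias,
   arranged as in \<open>mlp_arith\<close>.\<close>
 define tot where "tot = C * A / R ^ n + (\<Sum>l<n. C * (sg' / R * b l) / R ^ (n - l)) + sg' / R * (L * (A * (B / R) ^ (n - 1)))"
 have "Lq_le (Ym tau) q (%y. lift (%t x. avgH zh (M ^ n) h t x - heat d (T - t) h x) y +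
   (\<Sum>l<n. lift (%t x. avgS (zs l) (M ^ (n - l)) (D l) t x - source d T (D l) t x) y) + lift (source d T E) y) tot"
  unfolding tot_def by (intro Lq_le_add zh sE Lq_le_sum zs(2) q1) auto
 then have "Lq_le (Ym tau) q (lift (%t x. Y t x - ?u t x)) tot"
 proof (rule Lq_le_dom[OF _ lift_meas[OF cadm_diff[OF cY cu] tau] _ q0])
  fix y assume "y \<in> space (Ym tau)"
  from Yu[OF Ym_space[OF tau this]]
  show "abs (lift (%t x. Y t x - ?u t x) y) <= abs (lift (%t x. avgH zh (M ^ n) h t x - heat d (T - t) h x) y +
   (\<Sum>l<n. lift (%t x. avgS (zs l) (M ^ (n - l)) (D l) t x - source d T (D l) t x) y) + lift (source d T E) y)"
   by (simp add: lift_def)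
 qed
 moreover have "tot <= sg' * A * (B / R) ^ n"
 proof -
  let ?g = "%l. C * (1 / R * (if l = 0 then 1 else L * ((B / R) ^ l + (B / R) ^ (l - 1)))) / R ^ (n - l)"
  have "C * A / R ^ n <= sg' * A * (C / R ^ n)"
   using mult_right_mono[OF sg', of "A * (C / R ^ n)"] A_nonneg C0 R by (simp add: mult_ac)
  moreover have "(\<Sum>l<n. C * (sg' / R * b l) / R ^ (n - l)) = sg' * A * (\<Sum>l<n. ?g l)"
   unfolding sum_distrib_left b_def by (intro sum.cong refl) simp
  ultimately have "tot <= sg' * A * (C / R ^ n + (\<Sum>l<n. ?g l) + 1 / R * (L * (B / R) ^ (n - 1)))"
   unfolding tot_def by (simp add: algebra_simps)
  also have "... <= sg' * A * (B / R) ^ n"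
   using A_nonneg sg' by (intro mult_left_mono mlp_arith R C0 L(1) B_def n) auto
  finally show ?thesis .
 qed
 ultimately have "err tau Y (sg' * A * (B / R) ^ n)" unfolding err_def using Lq_le_mono q0 by blast
 moreover have "snet a d (Nh + n * Nf) ((3 * M) ^ n * W) (Y t)" for t
  using mlp_net_step[OF X order_refl, where zh = zh and zs = zs and t = t] by (simp add: Y_def D_def power_mult_distrib)
 ultimately show ?thesis using cY unfolding good_def by blast
qed

text \<open>The whole sequence is carried along because a new level draws on all lower ones. The
  zero function may start it: its error is the norm of \<open>u\<close>, bounded by
  \<open>A\<close>.\<close>

lemma mlp_sequence:
 "\<exists>X. X 0 = (%_ _. 0) \<and> (\<forall>l\<le>n. good l (X l) \<and> err (time_exp lam) (X l) (A * (B / R) ^ l))"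
proof (induction n)
 case 0
 have "Lq_le (Ym (time_exp lam)) q (%y. (-1) * lift (clamp u) y) (abs (-1) * A)"
  by (rule Lq_le_cmult[OF Lq_A[OF cadm_clamp[OF u(1)] _ tm_time_exp mass_time_exp]]) (simp add: K(2))
 then have "err (time_exp lam) (%_ _. 0) A" by (simp add: err_def lift_def[abs_def])
 then show ?case using good_0 by (intro exI[of _ "%_ _ _. 0"]) simp
next
 case (Suc n)
 then obtain X where X: "X 0 = (%_ _. 0)" "!!l. l <= n ==> good l (X l)" "!!l. l <= n ==> err (time_exp lam) (X l) (A * (B / R) ^ l)" by blast
 have "\<exists>Y. good (Suc n) Y \<and> err (time_exp lam) Y (1 * A * (B / R) ^ Suc n)"
  by (rule mlp_step[where X = X, OF _ _ mass_time_exp]) (use X srcb_exp in auto)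
 then obtain Y where Y: "good (Suc n) Y" "err (time_exp lam) Y (A * (B / R) ^ Suc n)" by auto
 show ?case
  by (rule exI[of _ "X(Suc n := Y)"]) (use X Y in \<open>auto simp: le_Suc_eq\<close>)
qed

theorem mlp_exists:
 assumes n: "n >= 1"
 shows "\<exists>g. snet a d (Nh + n * Nf) ((3 * M) ^ n * W) g \<and> continuous_on UNIV g \<and>
  (nint nu (%x. ennreal (abs (u 0 x - g x) powr q))) <= ennreal ((sg * A * (B / R) ^ n) powr q)"
proof -
 obtain X where X: "X 0 = (%_ _. 0)" "!!l. l <= n ==> good l (X l)" "!!l. l <= n ==> err (time_exp lam) (X l) (A * (B / R) ^ l)"
  using mlp_sequence[of n] by blast
 have "\<exists>Y. good n Y \<and> err time_0 Y (sg * A * (B / R) ^ n)"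
  by (rule mlp_step[where X = X, OF n srcb_0 mass_time_0 sg]) (use X in auto)
 then obtain Y where Y: "good n Y" "err time_0 Y (sg * A * (B / R) ^ n)" by blast
 let ?E = "%t x. Y t x - clamp u t x"
 have cE: "cadm ?E" using Y(1) by (intro cadm_diff cadm_clamp u) (simp add: good_def)
 interpret G: prob_space "gauss d" by (rule prob_space_gauss)
 have "(nint nu (%x. ennreal (abs (u 0 x - Y 0 x) powr q))) = QQ ?E 0"
  unfolding QQ_def
  by (intro nn_integral_cong) (use T in \<open>simp add: space_nu restrict_Rd G.emeasure_space_1 abs_minus_commute\<close>)
 also have "... = (nint time_0 (%t. QQ ?E t))" by (rule nn_time_0[OF QQ_meas[OF cE], symmetric])
 also have "... = (nint (Ym time_0) (%y. ennreal (abs (lift ?E y) powr q)))" by (rule nn_lift[OF cE tm_time_0, symmetric])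
 also have "... <= ennreal ((sg * A * (B / R) ^ n) powr q)" using Y(2) unfolding err_def by (rule Lq_leD(3))
 finally have *: "(nint nu (%x. ennreal (abs (u 0 x - Y 0 x) powr q))) <= ennreal ((sg * A * (B / R) ^ n) powr q)" .
 have "continuous_on UNIV (%x. (%p. Y (fst p) (snd p)) (0, x))"
  by (rule continuous_on_compose2[of UNIV "%p. Y (fst p) (snd p)"])
   (use Y(1) in \<open>auto simp: good_def cadm_def intro!: continuous_on_Pair continuous_on_const continuous_on_id\<close>)
 then show ?thesis using * Y(1) unfolding good_def by auto
qed

end

section \<open>Choice of the number of levels\<close>

text \<open>The largest integer \<open>M\<close> with \<open>M powr (q / 2) <= m\<close>, for
  \<open>q > 0\<close>. This keeps \<open>lam\<close> of order \<open>m\<close>, hence the mass of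
  the weight exponential in \<open>m\<close>, although \<open>M\<close> is unbounded.\<close>

definition Msel :: "real => nat => nat" where
 "Msel q m = nat \<lfloor>real m powr (2 / q)\<rfloor>"

text \<open>\<open>1 / Gsel q c n\<close> is the error of \<open>n\<close> levels with the basic sample size \<open>Msel q n\<close>, up to a constant.\<close>

definition Gsel :: "real => real => nat => real" where
 "Gsel q c m = (sqrt (real (Msel q m)) / c) ^ m"

lemma Msel_le: "real (Msel q m) <= real m powr (2 / q)"
 unfolding Msel_def by simp

lemma Msel_gt: "real m powr (2 / q) < real (Msel q m) + 1"
 unfolding Msel_def by (simp add: of_nat_nat)

lemma Msel_ge_1: "q > 0 ==> m >= 1 ==> Msel q m >= 1"
 unfolding Msel_def by (simp add: le_nat_iff le_floor_iff ge_one_powr_ge_zero)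

lemma Msel_powr_le:
 assumes "q > 0" shows "real (Msel q m) powr (q / 2) <= real m"
proof -
 have "real (Msel q m) powr (q / 2) <= (real m powr (2 / q)) powr (q / 2)"
  using assms Msel_le by (intro powr_mono2) auto
 then show ?thesis using assms by (simp add: powr_powr)
qed

lemma Msel_le_self:
 assumes q: "q >= 2" shows "real (Msel q m) <= real m"
proof (cases "Msel q m = 0")
 case False
 then have "real (Msel q m) powr 1 <= real (Msel q m) powr (q / 2)" using q by (intro powr_mono) auto
 then show ?thesis using Msel_powr_le[of q m] q by simp
qed simp

lemma Msel_Suc_le:
 assumes q: "q >= 2" and m: "m >= 1" shows "real (Msel q (Suc m)) <= 4 * real (Msel q m)"
proof -
 have "real (Msel q (Suc m)) <= (2 * real m) powr (2 / q)"
  using Msel_le[of q "Suc m"] powr_mono2[of "2 / q" "real (Suc m)" "2 * real m"] m q by simp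
 also have "... = 2 powr (2 / q) * real m powr (2 / q)" by (simp add: powr_mult)
 also have "... <= 2 powr 1 * real m powr (2 / q)" using q by (intro mult_right_mono powr_mono) auto
 also have "... <= 2 * (real (Msel q m) + 1)" using Msel_gt[of m q] by simp
 finally show ?thesis using Msel_ge_1[of q m] q m by simp
qed

lemma Msel_at_top:
 assumes "q > 0" shows "filterlim (%m. real (Msel q m)) at_top sequentially"
proof (rule filterlim_at_top_mono)
 define e where "e = 2 / q"
 have "e > 0" using assms by (simp add: e_def)
 then have "filterlim (%m. real m powr e - 1) at_top sequentially" by real_asymp
 then show "filterlim (%m. real m powr (2 / q) - 1) at_top sequentially" by (simp add: e_def)
 show "\<forall>\<^sub>F m in sequentially. real m powr (2 / q) - 1 <= real (Msel q m)"
  using Msel_gt[of _ q] by (intro always_eventually allI) (simp add: less_imp_le algebra_simps)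
qed

lemma Gsel_0[simp]: "Gsel q c 0 = 1" by (simp add: Gsel_def)

lemma Gsel_pos:
 assumes "q > 0" "c > 0" shows "Gsel q c m > 0"
 using Msel_ge_1[OF assms(1), of m] assms by (cases m) (auto simp: Gsel_def)

text \<open>The least admissible \<open>n >= 1\<close>. Minimality bounds the predecessor by
  \<open>X\<close>, through which the cost of \<open>n\<close> levels is measured; for
  \<open>n = 1\<close> this uses \<open>Gsel q c 0 = 1\<close>.\<close>

lemma Gsel_crossing:
 assumes q: "q >= 2" and c: "c >= 1" and X: "X >= 1"
 shows "\<exists>n\<ge>1. X <= Gsel q c n \<and> Gsel q c (n - 1) <= X"
proof -
 obtain k0 where k0: "X < 2 ^ k0" using real_arch_pow[of 2 X] by auto
 have "\<forall>\<^sub>F m in sequentially. (2 * c)\<^sup>2 <= real (Msel q m)"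
  using Msel_at_top[of q] q by (simp add: filterlim_at_top)
 then obtain N where N: "!!m. m >= N ==> (2 * c)\<^sup>2 <= real (Msel q m)" by (auto simp: eventually_sequentially)
 define n0 where "n0 = Max {1, N, k0}"
 have n0: "n0 >= 1" "n0 >= N" "n0 >= k0" by (auto simp: n0_def)
 have "2 * c <= sqrt (real (Msel q n0))" by (rule real_le_rsqrt[OF N[OF n0(2)]])
 then have "2 <= sqrt (real (Msel q n0)) / c" using c by (simp add: field_simps)
 then have "2 ^ n0 <= Gsel q c n0" unfolding Gsel_def by (intro power_mono) auto
 moreover have "(2::real) ^ k0 <= 2 ^ n0" using n0 by (intro power_increasing) auto
 ultimately have ex: "n0 >= 1 \<and> X <= Gsel q c n0" using k0 n0 by linarith
 define n where "n = (LEAST n. n >= 1 \<and> X <= Gsel q c n)"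
 have n: "n >= 1" "X <= Gsel q c n" using LeastI[of "%n. n >= 1 \<and> X <= Gsel q c n", OF ex] by (auto simp: n_def)
 have "Gsel q c (n - 1) <= X"
 proof (cases "n = 1")
  case False
  then have "n - 1 < n" "n - 1 >= 1" using n by auto
  then show ?thesis using not_less_Least[of "n - 1" "%n. n >= 1 \<and> X <= Gsel q c n"] by (simp add: n_def)
 qed (use X in simp)
 then show ?thesis using n by blast
qed

text \<open>\<open>M powr (dl * m)\<close> with \<open>M = Msel q m\<close> tending to infinity beats every exponential in \<open>m\<close>.\<close>

lemma Gsel_complexity:
 assumes q: "q >= 2" and c: "c >= 1" and dl: "dl > 0"
 shows "\<exists>eta\<ge>0. \<forall>m. real (m + 2) * (3 * real (Msel q (Suc m))) ^ (2 * Suc m) <= eta * Gsel q c m powr (2 * (2 + dl))"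
proof -
 define e where "e = 2 * (2 + dl)"
 let ?l = "%m. real (m + 2) * (3 * real (Msel q (Suc m))) ^ (2 * Suc m)"
 let ?G = "%m. Gsel q c m powr e"
 have Gp: "?G m > 0" for m using Gsel_pos[of q c m] q c by simp
 have "filterlim (%m. real (Msel q m) powr dl) at_top sequentially"
  using filterlim_compose[OF _ Msel_at_top[of q], of "%x. x powr dl" at_top] real_powr_at_top[OF dl] q by simp
 \<comment> \<open>The number 1152 is \<open>8 * 144\<close>: \<open>144 = (3 * 4)^2\<close> arises
   when \<open>M\<close> at \<open>m + 1\<close> is replaced by four times \<open>M\<close> at
   \<open>m\<close>, and \<open>8 ^ m\<close> bounds the cubic factor in
   \<open>m + 2\<close>.\<close>
 then have "\<forall>\<^sub>F m in sequentially. 1152 * c powr e <= real (Msel q m) powr dl" by (simp add: filterlim_at_top)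
 then obtain N where N: "!!m. m >= N ==> 1152 * c powr e <= real (Msel q m) powr dl" by (auto simp: eventually_sequentially)
 have large: "?l m <= 72 * ?G m" if m: "m >= Suc N" for m
 proof -
  let ?M = "real (Msel q m)"
  have M: "?M >= 1" using Msel_ge_1[of q m] m q by simp
  have cube: "y * ((3 * y) ^ 2 * z) = 9 * y ^ 3 * z" for y z :: real
   by (simp add: power_mult_distrib power2_eq_square power3_eq_cube)
  have m2: "real (m + 2) <= 2 * 2 ^ m" by (induction m) auto
  have "(3 * real (Msel q (Suc m))) ^ (2 * Suc m) = (3 * real (Msel q (Suc m))) ^ 2 * (3 * real (Msel q (Suc m))) ^ (2 * m)"
   by (simp only: mult_Suc_right power_add)
  also have "... <= (3 * real (m + 2)) ^ 2 * (3 * (4 * ?M)) ^ (2 * m)"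
   using Msel_le_self[OF q, of "Suc m"] Msel_Suc_le[OF q, of m] m by (intro mult_mono power_mono) auto
  also have "(3 * (4 * ?M)) ^ (2 * m) = (144 * ?M ^ 2) ^ m" by (simp add: power_mult power_mult_distrib)
  finally have "?l m <= real (m + 2) * ((3 * real (m + 2)) ^ 2 * (144 * ?M ^ 2) ^ m)"
   by (intro mult_left_mono) auto
  also have "... = 9 * real (m + 2) ^ 3 * (144 * ?M ^ 2) ^ m" by (rule cube)
  also have "... <= 9 * (2 * 2 ^ m) ^ 3 * (144 * ?M ^ 2) ^ m"
   using m2 by (intro mult_right_mono mult_left_mono power_mono) auto
  also have "... = 72 * (1152 * ?M ^ 2) ^ m"
  proof -
   have "((2::real) ^ m) ^ 3 = (2 ^ 3) ^ m" by (simp only: power_mult[symmetric] mult.commute)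
   then have "((2::real) ^ m) ^ 3 = 8 ^ m" by simp
   moreover have "1152 * ?M ^ 2 = 8 * (144 * ?M ^ 2)" by simp
   then have "(1152 * ?M ^ 2) ^ m = 8 ^ m * (144 * ?M ^ 2) ^ m" by (simp only: power_mult_distrib)
   moreover have "(2 * 2 ^ m) ^ 3 = 8 * ((2::real) ^ m) ^ 3" by (simp only: power_mult_distrib) simp
   ultimately have "9 * (2 * 2 ^ m) ^ 3 * (144 * ?M ^ 2) ^ m = 9 * (8 * 8 ^ m) * (144 * ?M ^ 2) ^ m"
    and "72 * (1152 * ?M ^ 2) ^ m = 72 * (8 ^ m * (144 * ?M ^ 2) ^ m)" by (simp_all only:)
   then show ?thesis by (simp only:)
  qed
  also have "(1152 * ?M ^ 2) ^ m <= (?M ^ 2 * ?M powr dl / c powr e) ^ m"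
  proof (rule power_mono)
   have "1152 * ?M ^ 2 * c powr e <= ?M ^ 2 * ?M powr dl"
    using mult_left_mono[OF N[of m], of "?M ^ 2"] m by (simp add: mult_ac)
   then show "1152 * ?M ^ 2 <= ?M ^ 2 * ?M powr dl / c powr e" using c by (simp add: le_divide_eq)
  qed auto
  also have "... = ?G m"
  proof -
   have "1 / 2 * e = 2 + dl" by (simp add: e_def)
   then have "sqrt ?M powr e = ?M powr (2 + dl)"
    using powr_powr[of ?M "1 / 2" e] powr_half_sqrt[of ?M] by (simp only: of_nat_0_le_iff)
   also have "... = ?M ^ 2 * ?M powr dl" using M by (simp add: powr_add)
   finally have "?M ^ 2 * ?M powr dl / c powr e = (sqrt ?M / c) powr e" using c by (simp add: powr_divide)
   also have "... ^ m = ((sqrt ?M / c) ^ m) powr e"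
    using M c by (simp add: powr_realpow[symmetric] powr_powr mult.commute)
   finally show ?thesis by (simp add: Gsel_def)
  qed
  finally show ?thesis by simp
 qed
 \<comment> \<open>The finitely many indices not covered by \<open>large\<close> are paid for in the
   constant.\<close>
 define eta where "eta = 72 + (\<Sum>m<Suc N. ?l m / ?G m)"
 have "?l m <= eta * ?G m" for m
 proof (cases "m < Suc N")
  case True
  have "?l m / ?G m <= (\<Sum>m<Suc N. ?l m / ?G m)"
   using True by (intro member_le_sum) auto
  then have "?l m / ?G m <= eta" by (simp add: eta_def)
  then show ?thesis using Gp[of m] by (simp add: divide_le_eq)
 next
  case False
  have "72 <= eta" unfolding eta_def by (simp add: sum_nonneg)
  then have "72 * ?G m <= eta * ?G m" by (intro mult_right_mono) auto
  moreover have "?l m <= 72 * ?G m" by (rule large) (use False in simp)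
  ultimately show ?thesis by (rule order_trans[rotated])
 qed
 moreover have "eta >= 0" unfolding eta_def by (intro add_nonneg_nonneg sum_nonneg) auto
 ultimately show ?thesis unfolding e_def by blast
qed

definition mlp_c1 :: "real => real => real => real" where
 "mlp_c1 q s T = max 1 (T powr ((q - 1) / q)) * wgt_const (s * q) (sqrt T) powr (1 / q) * wgt_const (s * q) (sqrt T) * max 1 T"

text \<open>Everything raised to the power \<open>n\<close>: \<open>2 ^ n\<close> for the lost
  factor \<open>R\<close>, a power of \<open>exp (T powr q)\<close> for the mass of the weight, and
  the base \<open>B\<close> of the recursion. What does not depend on \<open>n\<close> is in
  \<open>mlp_c1\<close>.\<close>

definition mlp_c3 :: "real => real => real => real => real" where
 "mlp_c3 q T C L = 2 * exp (T powr q) * (1 + 2 * C + 2 * C * L + L)"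

context mlp_setting
begin

lemma mlp_error_bound:
 assumes n: "real M powr (q / 2) <= real n"
 shows "sg * A * (B / R) ^ n <= K * V powr (1 / q) * mlp_c1 q s T * (mlp_c3 q T C L / sqrt (real M)) ^ n"
proof -
 let ?w = "wgt_const (s * q) (sqrt T)"
 have w: "?w >= 1" by (rule wgt_const_ge_1)
 have B0: "B >= 0" using C0 L(1) by (simp add: B_def)
 have c3: "mlp_c3 q T C L = 2 * exp (T powr q) * B" by (simp add: mlp_c3_def B_def)
 have m1: "mass >= 1" by (simp add: mass_def)
 have "lam * T = T powr q * real M powr (q / 2)"
  using T powr_add[of T "q - 1" 1] by (simp add: lam_def mult_ac)
 also have "... <= T powr q * real n" by (intro mult_left_mono n) simp
 finally have "exp (lam * T) <= exp (T powr q) ^ n" by (simp add: exp_of_nat_mult[symmetric] mult.commute)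
 moreover have "1 <= exp (T powr q) ^ n" by (intro one_le_power) simp
 ultimately have "mass <= max 1 T * exp (T powr q) ^ n"
  unfolding mass_def using T by (auto intro!: mult_mono order_trans[OF _ mult_mono[of 1 "max 1 T" 1]])
 then have mm: "mass * ?w <= max 1 T * exp (T powr q) ^ n * ?w" using w by (intro mult_right_mono) auto
 have mw: "mass * ?w >= 1" using mult_mono[of 1 mass 1 ?w] m1 w by simp
 have "(mass * ?w * V) powr (1 / q) = (mass * ?w) powr (1 / q) * V powr (1 / q)" by (rule powr_mult)
 also have "... <= (mass * ?w) powr 1 * V powr (1 / q)" using mw q by (intro mult_right_mono powr_mono) auto
 also have "... <= (max 1 T * exp (T powr q) ^ n * ?w) * V powr (1 / q)"
  using mm mw by (intro mult_right_mono) auto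
 finally have A: "A <= K * ?w powr (1 / q) * (max 1 T * exp (T powr q) ^ n * ?w * V powr (1 / q))"
  unfolding A_def using K(1) by (intro mult_left_mono) auto
 \<comment> \<open>The factor \<open>R\<close> inside \<open>sg\<close> is estimated generously by
   \<open>2 ^ n\<close>.\<close>
 have "real M powr 1 <= real M powr (q / 2)" using M q by (intro powr_mono) auto
 then have "real M <= real n" using n M by simp
 moreover have "sqrt (real M) <= real M" using M by (simp add: real_sqrt_le_iff real_le_lsqrt power2_eq_square)
 moreover have "real n <= 2 ^ n" by (simp add: less_imp_le)
 ultimately have "sqrt (real M) <= 2 ^ n" by linarith
 then have "sg <= max 1 (T powr ((q - 1) / q)) * 2 ^ n"
  unfolding sg_def R_def by (intro mult_left_mono) auto
 then have "sg * A <= (max 1 (T powr ((q - 1) / q)) * 2 ^ n) * (K * ?w powr (1 / q) * (max 1 T * exp (T powr q) ^ n * ?w * V powr (1 / q)))"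
  using A A_nonneg sg by (intro mult_mono) auto
 then have "sg * A * (B / R) ^ n <= (max 1 (T powr ((q - 1) / q)) * 2 ^ n) * (K * ?w powr (1 / q) * (max 1 T * exp (T powr q) ^ n * ?w * V powr (1 / q))) * (B / R) ^ n"
  using B0 R by (intro mult_right_mono) auto
 also have "... = K * V powr (1 / q) * mlp_c1 q s T * (mlp_c3 q T C L / sqrt (real M)) ^ n"
  by (simp add: mlp_c1_def c3 R_def[symmetric] power_mult_distrib power_divide mult_ac)
 finally show ?thesis .
qed

end

lemma mlp_c1_ge_1: assumes "q > 0" shows "mlp_c1 q s T >= 1"
proof -
 have w: "wgt_const (s * q) (sqrt T) >= 1" by (rule wgt_const_ge_1)
 then have "1 <= wgt_const (s * q) (sqrt T) powr (1 / q)" using assms by (simp add: ge_one_powr_ge_zero)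
 then have "1 * 1 * 1 * 1 <= mlp_c1 q s T" unfolding mlp_c1_def using w by (intro mult_mono) auto
 then show ?thesis by simp
qed

lemma mlp_c3_ge_1: assumes "C >= 0" "L >= 0" shows "mlp_c3 q T C L >= 1"
proof -
 have "1 * 1 * 1 <= mlp_c3 q T C L" unfolding mlp_c3_def using assms by (intro mult_mono) auto
 then show ?thesis by simp
qed

section \<open>Passage from the networks to the given data\<close>

lemma adm_weaken:
 assumes H: "heat_setting d T s" and s: "s <= s'" and F: "heat_setting.adm d T s F"
 shows "heat_setting.adm d T s' F"
proof -
 interpret A: heat_setting d T s by (rule H)
 interpret A': heat_setting d T s' using A.d A.T A.s s by unfold_locales auto
 obtain K where K: "K >= 0" "!!t x. t \<in> {0..T} ==> abs (F t x) <= K * wgt d x powr s" by (rule A.admD[OF F]) blast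
 show ?thesis
 proof (rule A'.admI[OF A.adm_cont_split[OF F]])
  fix t x assume "t \<in> {0..T}"
  from K(2)[OF this, of x] show "abs (F t x) <= K * wgt d x powr s'"
   using mult_left_mono[OF powr_mono[OF s wgt_ge_1[OF A.d]] K(1), of x] by linarith
 qed
qed

lemma adm0_weaken:
 assumes H: "heat_setting d T s" and s: "s <= s'" and F: "heat_setting.adm0 d s h"
 shows "heat_setting.adm0 d s' h"
proof -
 interpret A: heat_setting d T s by (rule H)
 interpret A': heat_setting d T s' using A.d A.T A.s s by unfold_locales auto
 obtain K where K: "!!x. abs (h x) <= K * wgt d x powr s" using F unfolding A.adm0_def by blast
 have "abs (h x) <= abs K * wgt d x powr s'" for x
  using K[of x] mult_left_mono[OF powr_mono[OF s wgt_ge_1[OF A.d]], of "abs K" x] mult_right_mono[OF abs_ge_self[of K] powr_ge_zero, of "wgt d x" s] by linarith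
 then show ?thesis using F unfolding A.adm0_def A'.adm0_def by blast
qed

lemma vec1_in_Rd[simp]: "vec1 v \<in> Rd (Suc 0)" by (simp add: vec1_def Rd_def)

lemma enorm_vec1[simp]: "enorm (Suc 0) (vec1 v) = abs v" by (simp add: enorm_def vec1_def)

lemma continuous_on_Rd_restrict:
 assumes "continuous_on (Rd d) g" shows "continuous_on UNIV (%x. g (restrict x {..<d}))"
 by (rule continuous_on_compose2[OF assms]) (auto intro!: continuous_intros)

text \<open>The condition \<open>e >= k / 2\<close> lets \<open>real d powr e\<close> absorb the
  part of the weight that consists of \<open>sqrt d\<close>.\<close>

lemma nn_wgt_moment:
 assumes nu: "(%x. x) \<in> borel_measurable nu" "prob_space nu" and d: "d >= 1" and k: "k >= 0" and kap: "kap >= 0" and e: "e >= k / 2"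
  and m: "(nint nu (%y. ennreal (enorm d y powr k))) <= ennreal (kap * real d powr e)"
 shows "(nint nu (%x. ennreal (wgt d x powr k))) <= ennreal (2 powr k * (1 + kap) * real d powr e)"
proof -
 interpret prob_space nu by (rule nu(2))
 have [measurable]: "(%x. enorm d x) \<in> borel_measurable nu"
  by (rule borel_measurable_continuous_on[OF continuous_on_enorm[OF continuous_on_id] nu(1)])
 have w: "wgt d x powr k <= 2 powr k * real d powr (k / 2) + 2 powr k * enorm d x powr k" for x
 proof -
  have "wgt d x powr k <= (2 * max (sqrt (real d)) (enorm d x)) powr k"
   using k wgt_ge_1[OF d, of x] by (intro powr_mono2) (auto simp: wgt_def)
  also have "... = 2 powr k * max (sqrt (real d)) (enorm d x) powr k" by (simp add: powr_mult)
  also have "max (sqrt (real d)) (enorm d x) powr k <= sqrt (real d) powr k + enorm d x powr k" by (simp add: max_def)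
  also have "sqrt (real d) powr k = real d powr (k / 2)" by (simp add: powr_half_sqrt[symmetric] powr_powr)
  finally show ?thesis by (simp add: distrib_left)
 qed
 have "(nint nu (%x. ennreal (wgt d x powr k))) <= (nint nu (%x. ennreal (2 powr k * real d powr (k / 2)) + ennreal (2 powr k) * ennreal (enorm d x powr k)))"
  using w by (intro nn_integral_mono) (auto simp: ennreal_mult[symmetric] ennreal_plus[symmetric] simp del: ennreal_plus intro!: ennreal_leI)
 also have "... = ennreal (2 powr k * real d powr (k / 2)) + ennreal (2 powr k) * (nint nu (%x. ennreal (enorm d x powr k)))"
  by (simp add: nn_integral_add nn_integral_cmult emeasure_space_1)
 also have "... <= ennreal (2 powr k * real d powr e) + ennreal (2 powr k) * ennreal (kap * real d powr e)"
  using d e by (intro add_mono mult_left_mono m ennreal_leI powr_mono) auto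
 also have "... = ennreal (2 powr k * (1 + kap) * real d powr e)"
  using kap by (simp add: ennreal_mult[symmetric] ennreal_plus[symmetric] distrib_left distrib_right mult_ac del: ennreal_plus)
 finally show ?thesis .
qed

locale ann_setting =
 fixes L kap al0 al1 bt0 bt1 T q :: real and p r :: nat
  and a :: "real => real"
  and f :: "nat => (nat => real) => real"
  and nu :: "nat => (nat => real) measure"
  and J :: ann
  and F :: "nat => real => ann"
 assumes pos: "L > 0" "kap > 0" "al0 > 0" "al1 > 0" "bt0 > 0" "bt1 > 0" "T > 0"
  and pr: "p >= 1" "r >= 1"
  and q: "q >= 2"
  and f_cont: "!!d. continuous_on (Rd (max d 1)) (f d)"
  and nu_prob: "!!d. d >= 1 ==> prob_space (nu d)"
  and nu_sets: "!!d. d >= 1 ==> sets (nu d) = sets (PiM {..<d} (%_. lborel))"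
  and nu_moment: "!!d. d >= 1 ==>
    (nint (nu d) (%y. ennreal (enorm d y powr (real p ^ 2 * q))))
     <= ennreal (kap * real d powr (real r * real p ^ 2 * q))"
  and J: "is_ann J" "ann_H J = 1" "ann_I J = 1" "ann_O J = 1"
      "!!v. realize1 a J (vec1 v) = v"
  and F_ann: "!!d eps. eps \<in> {0<..1} ==> is_ann (F d eps) \<and> ann_I (F d eps) = max d 1 \<and>
    ann_O (F d eps) = 1 \<and> continuous_on (Rd (max d 1)) (realize1 a (F d eps))"
  and F_size: "!!d eps. eps \<in> {0<..1} ==>
    eps powr (if d = 0 then al0 else al1) * real (ann_L (F d eps))
     + eps powr (if d = 0 then bt0 else bt1) * real (ann_Dmax (F d eps))
    <= kap * real (max d 1) ^ p"
  and F_approx: "!!d eps x. eps \<in> {0<..1} ==> x \<in> Rd (max d 1) ==>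
    eps * abs (realize1 a (F d eps) x) + abs (f d x - realize1 a (F d eps) x)
     <= eps * kap * real (max d 1) ^ p * (1 + enorm (max d 1) x) ^ p"
  and lip: "!!v w eps. eps \<in> {0<..1} ==>
    max (abs (f 0 (vec1 v) - f 0 (vec1 w)))
      (abs (realize1 a (F 0 eps) (vec1 v) - realize1 a (F 0 eps) (vec1 w))) <= L * abs (v - w)"
begin

abbreviation f0 :: "real => real" where "f0 v \<equiv> f 0 (vec1 v)"
abbreviation f0_net :: "real => real => real" where "f0_net eps v \<equiv> realize1 a (F 0 eps) (vec1 v)"
abbreviation h :: "nat => (nat => real) => real" where "h d x \<equiv> f d (restrict x {..<d})"

lemma heat: "d >= 1 ==> s >= 0 ==> heat_setting d T s"
 using pos by unfold_locales auto

text \<open>Two consequences of one assumption on the networks: a growth bound uniform in the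
  accuracy, and the approximation error.\<close>

lemma relative_error_bounds:
 fixes y z e b :: real
 assumes "e \<in> {0<..1}" "e * abs y + abs (z - y) <= e * b"
 shows "abs y <= b" "abs (z - y) <= e * b"
proof -
 have "e * abs y <= e * b" using assms(2) by linarith
 then show "abs y <= b" using assms(1) by simp
 have "0 <= e * abs y" using assms(1) by simp
 then show "abs (z - y) <= e * b" using assms(2) by linarith
qed

lemma f0_bounds:
 assumes "eps \<in> {0<..1}"
 shows "abs (f0_net eps v) <= kap * (1 + abs v) ^ p" "abs (f0 v - f0_net eps v) <= eps * (kap * (1 + abs v) ^ p)"
 using relative_error_bounds[OF assms, of "f0_net eps v" "f0 v" "kap * (1 + abs v) ^ p"] F_approx[OF assms, of "vec1 v" 0]
 by (simp_all add: mult.assoc)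

lemma f0_lip: "abs (f0 v - f0 w) <= L * abs (v - w)" and f0_net_lip: "eps \<in> {0<..1} ==> abs (f0_net eps v - f0_net eps w) <= L * abs (v - w)"
 using lip[of 1 v w] lip[of eps v w] by auto

lemma f0_0: "abs (f0 0) <= kap" and f0_net_0: "eps \<in> {0<..1} ==> abs (f0_net eps 0) <= kap"
proof -
 show "abs (f0_net eps 0) <= kap" if "eps \<in> {0<..1}" using f0_bounds(1)[OF that, of 0] by simp
 show "abs (f0 0) <= kap" using F_approx[of 1 "vec1 0" 0] by simp
qed

lemma net_restrict:
 assumes "d >= 1" "eps \<in> {0<..1}" shows "realize1 a (F d eps) (restrict x {..<d}) = realize1 a (F d eps) x"
 using F_ann[OF assms(2), of d] assms(1) by (intro snet_dep[OF snet_of_ann[where a = a]]) auto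

lemma h_bounds:
 assumes d: "d >= 1" and e: "eps \<in> {0<..1}"
 shows "abs (realize1 a (F d eps) x) <= kap * real d ^ p * wgt d x powr real p"
  and "abs (h d x - realize1 a (F d eps) x) <= eps * (kap * real d ^ p * wgt d x powr real p)"
  and "abs (h d x) <= kap * real d ^ p * wgt d x powr real p"
proof -
 have m: "max d 1 = d" using d by simp
 have w: "(1 + enorm d x) ^ p <= wgt d x powr real p" for x
  using wgt_ge_one_plus[OF d, of x] wgt_ge_1[OF d, of x] by (simp add: powr_realpow power_mono)
 have *: "e * abs (realize1 a (F d e) x) + abs (h d x - realize1 a (F d e) x) <= e * (kap * real d ^ p * wgt d x powr real p)" if e: "e \<in> {0<..1}" for e
 proof -
  have "e * abs (realize1 a (F d e) x) + abs (h d x - realize1 a (F d e) x) <= e * kap * real d ^ p * (1 + enorm d (restrict x {..<d})) ^ p"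
   using F_approx[OF e, of _ d, unfolded m, OF restrict_in_Rd, of x] net_restrict[OF d e, of x] by simp
  also have "... <= e * kap * real d ^ p * wgt d x powr real p"
   using w[of "restrict x {..<d}"] e pos by (intro mult_left_mono) auto
  finally show ?thesis by (simp add: mult.assoc)
 qed
 show "abs (realize1 a (F d eps) x) <= kap * real d ^ p * wgt d x powr real p" and "abs (h d x - realize1 a (F d eps) x) <= eps * (kap * real d ^ p * wgt d x powr real p)"
  using relative_error_bounds[OF e *[OF e]] by auto
 show "abs (h d x) <= kap * real d ^ p * wgt d x powr real p" using *[of 1] by simp
qed

lemma adm0_h: assumes d: "d >= 1" shows "heat_setting.adm0 d (real p) (h d)"
proof -
 interpret heat_setting d T "real p" by (rule heat[OF d]) simp
 have "continuous_on UNIV (h d)"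
  using continuous_on_Rd_restrict[of d "f d"] f_cont[of d] d by (simp add: max_absorb1)
 then show ?thesis unfolding adm0_def using h_bounds(3)[OF d, of 1] by (intro conjI exI[of _ "kap * real d ^ p"]) auto
qed

lemma adm0_net: assumes d: "d >= 1" and e: "eps \<in> {0<..1}" shows "heat_setting.adm0 d (real p) (realize1 a (F d eps))"
proof -
 interpret heat_setting d T "real p" by (rule heat[OF d]) simp
 have "continuous_on UNIV (%x. realize1 a (F d eps) (restrict x {..<d}))"
  using continuous_on_Rd_restrict[of d "realize1 a (F d eps)"] F_ann[OF e, of d] d by (simp add: max_absorb1)
 then have "continuous_on UNIV (realize1 a (F d eps))" by (simp add: net_restrict[OF d e])
 then show ?thesis unfolding adm0_def using h_bounds(1)[OF d e] by (intro conjI exI[of _ "kap * real d ^ p"]) auto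
qed

definition u :: "nat => real => (nat => real) => real" where
 "u d = (SOME u. heat_setting.adm d T (real p) u \<and> heat_setting.mild d T f0 (h d) u)"

lemma u: assumes d: "d >= 1" shows "heat_setting.adm d T (real p) (u d)" "heat_setting.mild d T f0 (h d) (u d)"
proof -
 interpret heat_setting d T "real p" by (rule heat[OF d]) simp
 from someI_ex[OF mild_exists[OF adm0_h[OF d] f0_lip]]
 show "adm (u d)" "mild f0 (h d) (u d)" by (auto simp: u_def)
qed

text \<open>\<open>K1\<close> bounds the solutions for the given data as well as for the networks.
  Like \<open>K2\<close> it is free of \<open>d\<close>, because \<open>stab_const\<close> depends
  only on the horizon, the growth exponent and the Lipschitz constant.\<close>

definition K1 :: real where "K1 = 2 * kap * heat_setting.stab_const T (real p) L + kap + 1"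
definition K2 :: real where "K2 = 2 * heat_setting.stab_const T (real p * real p) L * kap * (1 + K1) ^ p"

lemma stab_pos: "s >= 0 ==> heat_setting.stab_const T s L > 0"
proof -
 assume "s >= 0"
 then interpret heat_setting 1 T s by (rule heat[rotated]) simp
 show "stab_const L > 0" by (rule stab_const_pos)
qed

lemma K1_ge_1: "K1 >= 1" using pos stab_pos[of "real p"] by (simp add: K1_def)

lemma K2_pos: "K2 > 0" using pos stab_pos[of "real p * real p"] K1_ge_1 by (simp add: K2_def)

lemma mild_le:
 assumes d: "d >= 1" and v: "heat_setting.adm d T (real p) v" "heat_setting.mild d T g k v"
  and k: "heat_setting.adm0 d (real p) k" "!!x. abs (k x) <= kap * real d ^ p * wgt d x powr real p"
  and g: "!!v w. abs (g v - g w) <= L * abs (v - w)" "abs (g 0) <= kap" and t: "t \<in> {0..T}"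
 shows "abs (v t x) <= K1 * real d ^ p * wgt d x powr real p"
proof -
 interpret heat_setting d T "real p" by (rule heat[OF d]) simp
 have d1: "1 <= real d ^ p" using d by simp
 have g0: "abs (g 0) <= kap * real d ^ p" using g(2) mult_left_mono[OF d1, of kap] pos by linarith
 have "abs (v t x) <= stab_const L * (kap * real d ^ p + abs (g 0)) * wgt d x powr real p"
  by (rule mild_bound[OF v k _ g(1) t]) (use pos in simp)
 also have "... <= stab_const L * (kap * real d ^ p + kap * real d ^ p) * wgt d x powr real p"
  using g0 pos stab_const_pos[of L] by (intro mult_right_mono mult_left_mono add_mono) auto
 also have "... = (2 * kap * stab_const L) * (real d ^ p * wgt d x powr real p)" by simp
 also have "... <= K1 * (real d ^ p * wgt d x powr real p)"
  using pos by (intro mult_right_mono) (auto simp: K1_def)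
 finally show ?thesis by (simp add: mult.assoc)
qed

text \<open>The nonlinearities differ along \<open>u\<close> by a polynomial of degree
  \<open>p\<close> in \<open>u\<close>, which itself grows like the weight to the power
  \<open>p\<close> with a factor \<open>d ^ p\<close>. Stability is therefore applied in the class
  with exponent \<open>p * p\<close>.\<close>

lemma perturbation:
 assumes d: "d >= 1" and e: "eps \<in> {0<..1}"
 shows "\<exists>v. heat_setting.adm d T (real p) v \<and> heat_setting.mild d T (f0_net eps) (realize1 a (F d eps)) v \<and>
  (\<forall>t\<in>{0..T}. \<forall>x. abs (v t x) <= K1 * real d ^ p * wgt d x powr real p) \<and>
  (\<forall>x. abs (u d 0 x - v 0 x) <= K2 * eps * real d ^ (p * p) * wgt d x powr (real p * real p))"
proof -
 interpret A: heat_setting d T "real p" by (rule heat[OF d]) simp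
 interpret B: heat_setting d T "real p * real p" by (rule heat[OF d]) simp
 let ?g = "realize1 a (F d eps)" and ?D = "real d ^ p" and ?w = "%x. wgt d x powr real p"
 have pp: "real p <= real p * real p" using pr by simp
 have d1: "1 <= ?D" using d by simp
 have w1: "1 <= ?w x" for x by (rule A.wgt_powr_ge_1)
 obtain v where v: "A.adm v" "A.mild (f0_net eps) ?g v"
  using A.mild_exists[OF adm0_net[OF d e] f0_net_lip[OF e]] by blast
 have vb: "abs (v t x) <= K1 * ?D * ?w x" if "t \<in> {0..T}" for t x
  by (rule mild_le[OF d v adm0_net[OF d e] h_bounds(1)[OF d e] f0_net_lip[OF e] f0_net_0[OF e] that])
 have ub: "abs (u d t x) <= K1 * ?D * ?w x" if "t \<in> {0..T}" for t x
  by (rule mild_le[OF d u[OF d] adm0_h[OF d] h_bounds(3)[OF d e] f0_lip f0_0 that])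
 let ?c = "eps * kap * (1 + K1) ^ p * real d ^ (p * p)"
 have K1p: "1 <= (1 + K1) ^ p" using K1_ge_1 by simp
 have c0: "?c >= 0" using e pos K1_ge_1 by simp
 have "abs (u d 0 x - v 0 x) <= B.stab_const L * (?c + ?c) * wgt d x powr (real p * real p)" for x
 proof (rule B.mild_stability[of "u d" f0 "h d" v "f0_net eps" ?g])
  show "B.adm (u d)" by (rule adm_weaken[OF A.heat_setting_axioms pp u(1)[OF d]])
  show "B.adm v" by (rule adm_weaken[OF A.heat_setting_axioms pp v(1)])
  show "B.adm0 (h d)" by (rule adm0_weaken[OF A.heat_setting_axioms pp adm0_h[OF d]])
  show "B.adm0 ?g" by (rule adm0_weaken[OF A.heat_setting_axioms pp adm0_net[OF d e]])
  show "B.mild f0 (h d) (u d)" by (rule u(2)[OF d])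
  show "B.mild (f0_net eps) ?g v" by (rule v(2))
  show "B.adm (%t x. f0 (u d t x))"
   by (rule adm_weaken[OF A.heat_setting_axioms pp A.adm_Lipschitz[OF u(1)[OF d] f0_lip]])
  show "abs (f0_net eps v - f0_net eps w) <= L * abs (v - w)" for v w by (rule f0_net_lip[OF e])
  show "abs (h d x - ?g x) <= ?c * wgt d x powr (real p * real p)" for x
  proof -
   have "abs (h d x - ?g x) <= eps * kap * 1 * ?D * ?w x" using h_bounds(2)[OF d e, of x] by (simp add: mult.assoc)
   also have "... <= eps * kap * (1 + K1) ^ p * real d ^ (p * p) * wgt d x powr (real p * real p)"
    using K1p e pos d pr wgt_ge_1[OF d, of x] K1_ge_1 by (intro mult_mono powr_mono power_increasing) auto
   finally show ?thesis .
  qed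
  show "abs (f0 (u d t x) - f0_net eps (u d t x)) <= ?c * wgt d x powr (real p * real p)" if t: "t \<in> {0..T}" for t x
  proof -
   have "1 * 1 <= ?D * ?w x" using d1 w1 by (intro mult_mono) auto
   then have "1 + abs (u d t x) <= (1 + K1) * (?D * ?w x)" using ub[OF t, of x] by (simp add: algebra_simps)
   then have "(1 + abs (u d t x)) ^ p <= ((1 + K1) * (?D * ?w x)) ^ p" by (intro power_mono) auto
   also have "... = (1 + K1) ^ p * (real d ^ (p * p) * wgt d x powr (real p * real p))"
    by (simp add: power_mult_distrib power_mult powr_realpow[symmetric] powr_powr)
   finally have "eps * (kap * (1 + abs (u d t x)) ^ p) <= eps * (kap * ((1 + K1) ^ p * (real d ^ (p * p) * wgt d x powr (real p * real p))))"
    using e pos by (intro mult_left_mono) auto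
   then show ?thesis using f0_bounds(2)[OF e, of "u d t x"] by (simp add: mult.assoc)
  qed
  show "(0::real) \<in> {0..T}" using pos by simp
 qed (use c0 in auto)
 then have "\<forall>x. abs (u d 0 x - v 0 x) <= K2 * eps * real d ^ (p * p) * wgt d x powr (real p * real p)"
  by (simp add: K2_def mult_ac)
 then show ?thesis using v vb by blast
qed

end

section \<open>Accuracy and cost of the approximating networks\<close>

context ann_setting
begin

definition Vc :: real where "Vc = 2 powr (real p ^ 2 * q) * (1 + kap)"
definition cMC :: real where "cMC = (SOME C. mc_const q C)"
definition c3 :: real where "c3 = mlp_c3 q T cMC L"
text \<open>The factor 2 reserves half of the accuracy for multilevel Picard: its error is at most
  \<open>eps / 2\<close> once \<open>Gsel q c3 n\<close> exceeds \<open>X0\<close> times a power of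
  \<open>d\<close> over \<open>eps\<close>.\<close>

definition X0 :: real where "X0 = 2 * K1 * Vc powr (1 / q) * mlp_c1 q (real p) T"
text \<open>Makes the perturbation error at most half of the accuracy; the summand 1 ensures
  \<open>eps0 <= 1\<close>.\<close>

definition eps0 :: real where "eps0 = 1 / (2 * K2 * Vc powr (1 / q) + 1)"
text \<open>Dominates \<open>p * p + r * p^2\<close>, the powers of \<open>d\<close> from the
  perturbation and from the moment of \<open>nu\<close>, so dividing the accuracy by
  \<open>d powr E2\<close> removes the dimension from the error.\<close>

definition E2 :: real where "E2 = (real r * real p + real p + 1) * real p"
definition gam :: real where "gam = max al0 al1 + 2 * max bt0 bt1"
definition Kw :: real where "Kw = kap + real (ann_Dmax J) + 1"

lemma cMC: "mc_const q cMC" unfolding cMC_def using someI_ex[OF mc_const_exists[OF q]] .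

lemma cMC_nonneg: "cMC >= 0" using cMC by (simp add: mc_const_def)

lemma Vc_ge_1: "Vc >= 1"
proof -
 have "1 * 1 <= Vc" unfolding Vc_def using pos q by (intro mult_mono) (auto simp: ge_one_powr_ge_zero)
 then show ?thesis by simp
qed

lemma c3_ge_1: "c3 >= 1" unfolding c3_def using mlp_c3_ge_1 cMC_nonneg pos by simp

lemma X0_ge_1: "X0 >= 1"
proof -
 have "1 * 1 * 1 * 1 <= X0" unfolding X0_def
  using K1_ge_1 Vc_ge_1 mlp_c1_ge_1[of q "real p" T] q by (intro mult_mono) (auto simp: ge_one_powr_ge_zero)
 then show ?thesis by simp
qed

lemma eps0: "0 < eps0" "eps0 <= 1" "K2 * Vc powr (1 / q) * eps0 <= 1 / 2"
proof -
 have p: "K2 * Vc powr (1 / q) >= 0" using K2_pos by simp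
 then have p1: "2 * K2 * Vc powr (1 / q) + 1 > 0" "2 * K2 * Vc powr (1 / q) + 1 >= 1" by linarith+
 show "0 < eps0" "eps0 <= 1" using p1 by (simp_all add: eps0_def)
 show "K2 * Vc powr (1 / q) * eps0 <= 1 / 2" using p1 p by (simp add: eps0_def field_simps)
qed

lemma network_size:
 assumes e: "e \<in> {0<..1}"
 shows "real (ann_L (F d e)) <= kap * real (max d 1) ^ p * e powr (- max al0 al1)"
  and "real (ann_Dmax (F d e)) <= kap * real (max d 1) ^ p * e powr (- max bt0 bt1)"
proof -
 have gen: "x <= b * e powr (- y)" if "e powr z * x <= b" "z <= y" "x >= 0" for x b y z :: real
 proof -
  have "e powr y * x <= e powr z * x" using e that by (intro mult_right_mono powr_mono') auto
  then have "e powr y * x * e powr (- y) <= b * e powr (- y)" using that by (intro mult_right_mono) auto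
  then show ?thesis using e by (simp add: powr_minus field_simps)
 qed
 note F_size[OF e, of d]
 moreover have "0 <= e powr z * real n" for z n by simp
 ultimately have 1: "e powr (if d = 0 then al0 else al1) * real (ann_L (F d e)) <= kap * real (max d 1) ^ p"
  and 2: "e powr (if d = 0 then bt0 else bt1) * real (ann_Dmax (F d e)) <= kap * real (max d 1) ^ p"
  by (smt (verit))+
 show "real (ann_L (F d e)) <= kap * real (max d 1) ^ p * e powr (- max al0 al1)"
  by (rule gen[OF 1]) auto
 show "real (ann_Dmax (F d e)) <= kap * real (max d 1) ^ p * e powr (- max bt0 bt1)"
  by (rule gen[OF 2]) auto
qed

lemma moment:
 assumes d: "d >= 1"
 shows "(nint (nu d) (%x. ennreal (wgt d x powr (real p * real p * q)))) <= ennreal (Vc * real d powr (real r * real p ^ 2 * q))"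
proof -
 interpret S: sampling_setting d T 0 q "nu d"
  using heat[OF d, of 0] q nu_prob[OF d] nu_sets[OF d] by (simp add: sampling_setting_def sampling_setting_axioms_def)
 have "real p ^ 2 * q / 2 <= real r * real p ^ 2 * q"
  using pr q by (auto simp: field_simps intro!: mult_right_mono)
 from nn_wgt_moment[OF S.nu_id nu_prob[OF d] d _ _ this nu_moment[OF d]] show ?thesis
  using q pos by (simp add: Vc_def power2_eq_square)
qed

text \<open>One half of \<open>eps\<close> goes to replacing the data by networks of accuracy
  \<open>e\<close>, the other half to the multilevel scheme for them. The cost is left in terms of
  \<open>m\<close>: the networks have to be fixed before \<open>delta\<close>, which enters only
  when this expression is estimated.\<close>

lemma approximation:
 assumes d: "d >= 1" and eps: "eps \<in> {0<..1}"
 shows "\<exists>Ph m. is_ann Ph \<and> ann_I Ph = d \<and> ann_O Ph = 1 \<and> continuous_on (Rd d) (realize1 a Ph) \<and>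
  (nint (nu d) (%x. ennreal (abs (u d 0 x - realize1 a Ph x) powr q))) <= ennreal (eps powr q) \<and>
  Gsel q c3 m <= X0 * real d powr (real p + real r * real p ^ 2) / eps \<and>
  real (ann_P Ph) <= 2 * kap * Kw\<^sup>2 * (real (m + 2) * (3 * real (Msel q (Suc m))) ^ (2 * Suc m)) * real d ^ (3 * p) * (eps * eps0 / real d powr E2) powr (- gam)"
proof -
 have q0: "q > 0" and q1: "q >= 1" using q by auto
 have d0: "real d >= 1" using d by simp
 have dp: "real d ^ p >= 1" using d0 by simp
 \<comment> \<open>The accuracy of the data networks; it lies in \<open>(0, 1]\<close> and makes the
   replacement error at most \<open>eps / 2\<close>.\<close>
 define e where "e = eps * eps0 / real d powr E2"
 have dE: "real d powr E2 >= 1" using d0 by (simp add: ge_one_powr_ge_zero E2_def)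
 have e: "e \<in> {0<..1}"
 proof -
  have "eps * eps0 <= 1 * real d powr E2" using eps eps0 dE mult_mono[of eps 1 eps0 1] by auto
  then show ?thesis using eps eps0 dE d0 by (simp add: e_def divide_le_eq)
 qed
 obtain v where v: "heat_setting.adm d T (real p) v" "heat_setting.mild d T (f0_net e) (realize1 a (F d e)) v"
  and vb: "!!t x. t \<in> {0..T} ==> abs (v t x) <= K1 * real d ^ p * wgt d x powr real p"
  and uv: "!!x. abs (u d 0 x - v 0 x) <= K2 * e * real d ^ (p * p) * wgt d x powr (real p * real p)"
  using perturbation[OF d e] by blast
 define X where "X = X0 * real d powr (real p + real r * real p ^ 2) / eps"
 have "1 * 1 <= X0 * real d powr (real p + real r * real p ^ 2)"
  using X0_ge_1 d0 by (intro mult_mono) (auto simp: ge_one_powr_ge_zero)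
 then have X1: "X >= 1" unfolding X_def using eps by (simp add: le_divide_eq)
 obtain n where n: "n >= 1" "X <= Gsel q c3 n" "Gsel q c3 (n - 1) <= X"
  using Gsel_crossing[OF q c3_ge_1 X1] by blast
 define M where "M = Msel q n"
 define W where "W = Max {ann_Dmax (F d e), ann_Dmax (F 0 e), ann_Dmax J, 1}"
 have W: "ann_Dmax (F d e) <= W" "ann_Dmax (F 0 e) <= W" "ann_Dmax J <= W" "1 <= W" by (auto simp: W_def)
 have M1: "M >= 1" unfolding M_def by (rule Msel_ge_1[OF q0 n(1)])
 define V where "V = Vc * real d powr (real r * real p ^ 2 * q)"
 have V0: "V >= 0" using Vc_ge_1 by (simp add: V_def)
 have Vq: "V powr (1 / q) = Vc powr (1 / q) * real d powr (real r * real p ^ 2)"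
  using q0 by (simp add: V_def powr_mult powr_powr)
 have d1: "max d 1 = d" using d by simp
 interpret S: sampling_setting d T "real p" q "nu d"
  using heat[OF d, of "real p"] q nu_prob[OF d] nu_sets[OF d] by (simp add: sampling_setting_def sampling_setting_axioms_def)
 interpret N: mlp_setting d T "real p" q "nu d" a "f0_net e" "realize1 a (F 0 e)" "realize1 a (F d e)" v "ann_Dmax J"
  "ann_L (F 0 e)" "ann_L (F d e)" W M L "K1 * real d ^ p" V cMC
 proof unfold_locales
  show "L >= 0" using pos by simp
  show "abs (f0_net e v - f0_net e w) <= L * abs (v - w)" for v w by (rule f0_net_lip[OF e])
  have F0: "is_ann (F 0 e)" "ann_I (F 0 e) = 1" "ann_O (F 0 e) = 1" using F_ann[OF e, of 0] by auto
  note s0 = snet_of_ann[OF F0, of a]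
  show "f0_net e v = realize1 a (F 0 e) (%_. v)" for v by (rule snet_dep[OF s0]) (simp add: vec1_def)
  show "snet a 1 (ann_L (F 0 e)) W (realize1 a (F 0 e))" by (rule snet_mono[OF s0 W(2)])
  show "S.adm0 (realize1 a (F d e))" by (rule adm0_net[OF d e])
  show "snet a d (ann_L (F d e)) W (realize1 a (F d e))"
   using F_ann[OF e, of d, unfolded d1] by (intro snet_mono[OF snet_of_ann W(1)]) auto
  show "snet a 1 2 (ann_Dmax J) (%x. x 0)" by (rule snet_identity[OF J])
  show "ann_Dmax J <= W" by (rule W(3))
  show "S.adm v" "S.mild (f0_net e) (realize1 a (F d e)) v" by (rule v)+
  show "K1 * real d ^ p >= 0" using K1_ge_1 by simp
  show "abs (v t x) <= K1 * real d ^ p * wgt d x powr real p" if "t \<in> {0..T}" for t x by (rule vb[OF that])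
  have K: "kap <= K1" using pos stab_pos[of "real p"] by (simp add: K1_def)
  show "abs (realize1 a (F d e) x) <= K1 * real d ^ p * wgt d x powr real p" for x
   using h_bounds(1)[OF d e, of x] K mult_right_mono[OF mult_right_mono[OF K, of "real d ^ p"], of "wgt d x powr real p"] by simp
  show "abs (f0_net e 0) <= K1 * real d ^ p"
   using f0_net_0[OF e] mult_mono[OF K dp] pos K1_ge_1 by simp
  show "V >= 0" by (rule V0)
  show "(nint (nu d) (%x. ennreal (wgt d x powr (real p * q)))) <= ennreal V"
  proof -
   have "real p * q <= real p * real p * q" using pr q0 by simp
   then have "(nint (nu d) (%x. ennreal (wgt d x powr (real p * q)))) <= (nint (nu d) (%x. ennreal (wgt d x powr (real p * real p * q))))"
    by (intro nn_integral_mono ennreal_leI powr_mono wgt_ge_1[OF d])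
   then show ?thesis using moment[OF d] unfolding V_def by (rule order_trans)
  qed
  show "M >= 1" by (rule M1)
  show "mc_const q cMC" by (rule cMC)
 qed
 obtain g where g: "snet a d (ann_L (F d e) + n * ann_L (F 0 e)) ((3 * M) ^ n * W) g" "continuous_on UNIV g"
  "(nint (nu d) (%x. ennreal (abs (v 0 x - g x) powr q))) <= ennreal ((N.sg * N.A * (N.B / N.R) ^ n) powr q)"
  using N.mlp_exists[OF n(1)] by blast
 have Mn: "real M powr (q / 2) <= real n" unfolding M_def by (rule Msel_powr_le[OF q0])
 have mlp: "N.sg * N.A * (N.B / N.R) ^ n <= eps / 2"
 proof -
  have "N.sg * N.A * (N.B / N.R) ^ n <= K1 * real d ^ p * V powr (1 / q) * mlp_c1 q (real p) T * (c3 / sqrt (real M)) ^ n"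
   using N.mlp_error_bound[OF Mn] by (simp add: c3_def)
  also have "... = X * eps / 2 * (c3 / sqrt (real M)) ^ n"
   using eps d0 by (simp add: X_def X0_def Vq powr_add powr_realpow)
  also have "(c3 / sqrt (real M)) ^ n = 1 / Gsel q c3 n" by (simp add: Gsel_def M_def power_divide)
  also have "X * eps / 2 * (1 / Gsel q c3 n) <= eps / 2"
   using n(2) X1 eps mult_right_mono[OF n(2), of eps] by (simp add: divide_le_eq mult.commute)
  finally show ?thesis .
 qed
 have cont: "continuous_on UNIV (%x. w 0 x)" if "S.adm w" for w
  using pos by (intro continuous_on_compose2[OF S.adm_cont_split[OF that], of UNIV "%x. (0, x)", simplified]) (auto intro!: continuous_on_Pair continuous_on_const continuous_on_id)
 have meas: "w \<in> borel_measurable (nu d)" if "continuous_on UNIV w" for w :: "(nat => real) => real"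
  by (rule borel_measurable_continuous_on[OF that S.nu_id])
 have "Lq_le (nu d) q (%x. v 0 x - g x) (eps / 2)"
  unfolding Lq_le_def
 proof (intro conjI)
  show "(%x. v 0 x - g x) \<in> borel_measurable (nu d)" by (intro meas continuous_on_diff cont v g)
  show "0 <= eps / 2" using eps by simp
  have "0 <= N.sg * N.A * (N.B / N.R) ^ n"
   using N.sg N.A_nonneg N.R N.C0 N.L(1) by (simp add: N.B_def)
  then have "(N.sg * N.A * (N.B / N.R) ^ n) powr q <= (eps / 2) powr q" using mlp q0 by (intro powr_mono2) auto
  with g(3) show "(nint (nu d) (%x. ennreal (abs (v 0 x - g x) powr q))) <= ennreal ((eps / 2) powr q)"
   using ennreal_leI order_trans by blast
 qed
 moreover have "Lq_le (nu d) q (%x. u d 0 x - v 0 x) (eps / 2)"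
 proof -
  define c where "c = K2 * e * real d ^ (p * p)"
  have c0: "c >= 0" using K2_pos e by (simp add: c_def)
  have m: "(%x. u d 0 x - v 0 x) \<in> borel_measurable (nu d)" by (intro meas continuous_on_diff cont v u[OF d])
  have wm: "(%x. wgt d x) \<in> borel_measurable (nu d)" by (rule borel_measurable_wgt[OF S.nu_id])
  have "(nint (nu d) (%x. ennreal (abs (u d 0 x - v 0 x) powr q))) <= (nint (nu d) (%x. ennreal (c powr q) * ennreal (wgt d x powr (real p * real p * q))))"
  proof (rule nn_integral_mono)
   fix x
   have "abs (u d 0 x - v 0 x) powr q <= (c * wgt d x powr (real p * real p)) powr q"
    using uv[of x] q0 by (intro powr_mono2) (auto simp: c_def)
   also have "... = c powr q * wgt d x powr (real p * real p * q)" by (simp add: powr_mult powr_powr)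
   finally show "ennreal (abs (u d 0 x - v 0 x) powr q) <= ennreal (c powr q) * ennreal (wgt d x powr (real p * real p * q))"
    by (simp add: ennreal_leI flip: ennreal_mult)
  qed
  also have "... = ennreal (c powr q) * (nint (nu d) (%x. ennreal (wgt d x powr (real p * real p * q))))"
   by (intro nn_integral_cmult measurable_compose[OF wm]) measurable
  also have "... <= ennreal (c powr q) * ennreal V" using moment[OF d] by (intro mult_left_mono) (auto simp: V_def)
  also have "... = ennreal ((c * V powr (1 / q)) powr q)" using V0 q0 by (simp add: powr_mult powr_powr ennreal_mult)
  also have "... <= ennreal ((eps / 2) powr q)"
  proof (intro ennreal_leI powr_mono2)
   have "real d powr (real p * real p + real r * real p ^ 2) <= real d powr E2"
    using d0 by (intro powr_mono) (auto simp: E2_def algebra_simps power2_eq_square)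
   then have dd: "real d powr (real p * real p + real r * real p ^ 2) / real d powr E2 <= 1" using dE by (simp add: divide_le_eq)
   have "c * V powr (1 / q) = (K2 * Vc powr (1 / q) * eps0) * eps * (real d powr (real p * real p + real r * real p ^ 2) / real d powr E2)"
    using d0 by (simp add: c_def e_def Vq powr_add powr_realpow[symmetric])
   also have "... <= (1 / 2) * eps * 1"
    using eps0 K2_pos dd eps by (intro mult_mono) auto
   finally show "c * V powr (1 / q) <= eps / 2" by simp
  qed (use c0 q0 in auto)
  finally show ?thesis using m eps by (simp add: Lq_le_def)
 qed
 ultimately have "Lq_le (nu d) q (%x. (u d 0 x - v 0 x) + (v 0 x - g x)) (eps / 2 + eps / 2)"
  by (intro Lq_le_add q1)
 then have err: "(nint (nu d) (%x. ennreal (abs (u d 0 x - g x) powr q))) <= ennreal (eps powr q)"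
  using Lq_leD(3) by fastforce
 \<comment> \<open>The width of an \<open>snet\<close> says nothing about its input layer, hence the
   maximum with \<open>d\<close>.\<close>
 define W' where "W' = max d ((3 * M) ^ n * W)"
 have W'1: "1 <= W'" using d by (simp add: W'_def)
 obtain Ph where Ph: "is_ann Ph" "ann_I Ph = d" "ann_O Ph = 1" "realize1 a Ph = g"
   "ann_P Ph <= (ann_L (F d e) + n * ann_L (F 0 e)) * (W' * (W' + 1))"
  using ann_of_snet[OF g(1), of W'] W'1 by (auto simp: W'_def)
 \<comment> \<open>It is \<open>Gsel\<close> at \<open>n - 1\<close> that is bounded from above, so
   sizes are expressed through this predecessor.\<close>
 obtain m where m: "n = Suc m" using n(1) by (cases n) auto
 let ?al = "e powr (- max al0 al1)" and ?be = "e powr (- max bt0 bt1)"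
 have "1 = e powr 0" using e by simp
 also have "... <= ?be" using e pos by (intro powr_mono') auto
 finally have be1: "?be >= 1" .
 have depth: "real (ann_L (F d e) + n * ann_L (F 0 e)) <= real (m + 2) * (kap * real d ^ p * ?al)"
 proof -
  have "real (ann_L (F 0 e)) <= kap * 1 * ?al" using network_size(1)[OF e, of 0] by simp
  also have "... <= kap * real d ^ p * ?al" using dp pos by (intro mult_right_mono mult_left_mono) auto
  finally have "real n * real (ann_L (F 0 e)) <= real n * (kap * real d ^ p * ?al)" by (intro mult_left_mono) auto
  moreover have "real (ann_L (F d e)) <= kap * real d ^ p * ?al" using network_size(1)[OF e, of d] by (simp only: d1)
  ultimately show ?thesis by (simp add: m algebra_simps)
 qed
 have b1: "real d ^ p * ?be >= 1" using mult_mono[OF dp be1] by simp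
 have Wle: "real W <= Kw * real d ^ p * ?be"
 proof -
  have "real (ann_Dmax (F d e)) <= kap * real d ^ p * ?be" using network_size(2)[OF e, of d] by (simp only: d1)
  also have "... <= Kw * real d ^ p * ?be" by (intro mult_right_mono) (auto simp: Kw_def)
  finally have 1: "real (ann_Dmax (F d e)) <= Kw * real d ^ p * ?be" .
  have "real (ann_Dmax (F 0 e)) <= kap * 1 * ?be" using network_size(2)[OF e, of 0] by simp
  also have "... <= Kw * real d ^ p * ?be" using dp pos by (intro mult_right_mono mult_mono) (auto simp: Kw_def)
  finally have 2: "real (ann_Dmax (F 0 e)) <= Kw * real d ^ p * ?be" .
  have "real (ann_Dmax J) * 1 <= Kw * (real d ^ p * ?be)" using b1 pos by (intro mult_mono) (auto simp: Kw_def)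
  then have 3: "real (ann_Dmax J) <= Kw * real d ^ p * ?be" by (simp add: mult.assoc)
  have "1 * 1 <= Kw * (real d ^ p * ?be)" using b1 pos by (intro mult_mono) (auto simp: Kw_def)
  then have 4: "1 <= Kw * real d ^ p * ?be" by (simp add: mult.assoc)
  have "W \<in> {ann_Dmax (F d e), ann_Dmax (F 0 e), ann_Dmax J, 1}" unfolding W_def by (rule Max_in) auto
  then show ?thesis using 1 2 3 4 by auto
 qed
 have M3: "1 <= (3 * real M) ^ n" using M1 by (intro one_le_power) auto
 have width: "real W' <= (3 * real M) ^ n * (Kw * real d ^ p * ?be)"
 proof -
  have "real d * 1 <= real d ^ p * ?be" using pr d0 be1 by (intro mult_mono self_le_power) auto
  also have "... <= Kw * (real d ^ p * ?be)" using b1 pos mult_right_mono[of 1 Kw "real d ^ p * ?be"] by (simp add: Kw_def)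
  also have "... <= (3 * real M) ^ n * (Kw * (real d ^ p * ?be))"
   using mult_right_mono[OF M3, of "Kw * (real d ^ p * ?be)"] pos by (simp add: Kw_def)
  finally have "real d <= (3 * real M) ^ n * (Kw * real d ^ p * ?be)" by (simp add: mult.assoc)
  moreover have "real ((3 * M) ^ n * W) = (3 * real M) ^ n * real W" by simp
  then have "real ((3 * M) ^ n * W) <= (3 * real M) ^ n * (Kw * real d ^ p * ?be)"
   using mult_left_mono[OF Wle, of "(3 * real M) ^ n"] by simp
  ultimately show ?thesis unfolding W'_def of_nat_max by (rule max.boundedI)
 qed
 have "real (ann_P Ph) <= real ((ann_L (F d e) + n * ann_L (F 0 e)) * (W' * (W' + 1)))" using Ph(5) by linarith
 also have "... = real (ann_L (F d e) + n * ann_L (F 0 e)) * (real W' * (real W' + 1))"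
  by (simp only: of_nat_mult of_nat_add of_nat_1)
 also have "... <= real (ann_L (F d e) + n * ann_L (F 0 e)) * (real W' * (real W' + real W'))"
  using W'1 by (intro mult_left_mono add_left_mono) auto
 also have "... = 2 * real (ann_L (F d e) + n * ann_L (F 0 e)) * (real W')\<^sup>2" by (simp add: power2_eq_square)
 also have "... <= 2 * (real (m + 2) * (kap * real d ^ p * ?al)) * ((3 * real M) ^ n * (Kw * real d ^ p * ?be))\<^sup>2"
  using depth width pos by (intro mult_mono power_mono) auto
 also have "... = 2 * kap * Kw\<^sup>2 * (real (m + 2) * (3 * real M) ^ (2 * n)) * (real d ^ p * (real d ^ p)\<^sup>2) * (?al * ?be\<^sup>2)"
  by (simp add: power_mult_distrib power_mult[symmetric] mult.commute[of 2 n] mult_ac)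
 also have "real d ^ p * (real d ^ p)\<^sup>2 = real d ^ (3 * p)" by (simp add: power_mult[symmetric] power_add[symmetric])
 also have "?al * ?be\<^sup>2 = e powr (- gam)"
  using e by (simp add: gam_def power2_eq_square powr_add[symmetric])
 finally have P: "real (ann_P Ph) <= 2 * kap * Kw\<^sup>2 * (real (m + 2) * (3 * real M) ^ (2 * n)) * real d ^ (3 * p) * e powr (- gam)" .
 have "continuous_on (Rd d) (realize1 a Ph)" using g(2) Ph(4) continuous_on_subset by blast
 then show ?thesis
  using Ph(1-4) err n(3) P unfolding M_def m X_def e_def by (intro exI[of _ Ph] exI[of _ m]) simp
qed

text \<open>By \<open>Gsel_complexity\<close> the size of \<open>m + 1\<close> levels is bounded by
  \<open>Gsel q c3 m\<close> to the power \<open>2 * (2 + dl)\<close>, and the hypothesis on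
  \<open>m\<close> turns this into powers of \<open>d\<close> and \<open>eps\<close>. The accuracy
  of the data networks contributes the exponent \<open>gam\<close>, together with
  \<open>d powr (E2 * gam)\<close>.\<close>

lemma complexity:
 "\<exists>eta :: real => real. \<forall>dl>0. \<forall>d\<ge>1. \<forall>eps\<in>{0<..1}. \<forall>m. Gsel q c3 m <= X0 * real d powr (real p + real r * real p ^ 2) / eps -->
   2 * kap * Kw\<^sup>2 * (real (m + 2) * (3 * real (Msel q (Suc m))) ^ (2 * Suc m)) * real d ^ (3 * p) * (eps * eps0 / real d powr E2) powr (- gam)
   <= eta dl * real d powr (3 * real p + 2 * (2 + dl) * (2 * real r * real p + real p + 2) * real p + E2 * gam)
     * eps powr (- (2 * (2 + dl) + gam))"
proof -
 have "\<forall>dl\<in>{0<..}. \<exists>eta\<ge>0. \<forall>m. real (m + 2) * (3 * real (Msel q (Suc m))) ^ (2 * Suc m) <= eta * Gsel q c3 m powr (2 * (2 + dl))"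
  using Gsel_complexity[OF q c3_ge_1] by simp
 then obtain eta1 where eta1: "!!dl. dl > 0 ==> eta1 dl >= 0"
  "!!dl m. dl > 0 ==> real (m + 2) * (3 * real (Msel q (Suc m))) ^ (2 * Suc m) <= eta1 dl * Gsel q c3 m powr (2 * (2 + dl))"
  by (metis greaterThan_iff)
 define eta where "eta dl = 2 * kap * Kw\<^sup>2 * (eta1 dl * X0 powr (2 * (2 + dl))) * eps0 powr (- gam)" for dl
 show ?thesis
 proof (intro exI[of _ eta] allI ballI impI)
  fix dl :: real and d m :: nat and eps :: real
  assume dl: "dl > 0" and d: "d >= 1" and eps: "eps \<in> {0<..1}"
   and G: "Gsel q c3 m <= X0 * real d powr (real p + real r * real p ^ 2) / eps"
  define E1 where "E1 = real p + real r * real p ^ 2"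
  define k where "k = 2 * (2 + dl)"
  have k: "k > 0" using dl by (simp add: k_def)
  have d0: "real d >= 1" using d by simp
  have e0: "eps > 0" using eps by simp
  have "real (m + 2) * (3 * real (Msel q (Suc m))) ^ (2 * Suc m) <= eta1 dl * Gsel q c3 m powr k"
   unfolding k_def by (rule eta1(2)[OF dl])
  also have "... <= eta1 dl * (X0 * real d powr E1 / eps) powr k"
   using G k Gsel_pos[of q c3 m] q c3_ge_1 eta1(1)[OF dl] by (intro mult_left_mono powr_mono2) (auto simp: E1_def)
  also have "(X0 * real d powr E1 / eps) powr k = X0 powr k * real d powr (E1 * k) * eps powr (- k)"
   using e0 by (simp add: powr_divide powr_mult powr_powr powr_minus_divide)
  finally have 1: "real (m + 2) * (3 * real (Msel q (Suc m))) ^ (2 * Suc m) <= eta1 dl * (X0 powr k * real d powr (E1 * k) * eps powr (- k))" .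
  have 2: "(eps * eps0 / real d powr E2) powr (- gam) = eps powr (- gam) * eps0 powr (- gam) * real d powr (E2 * gam)"
  proof -
   have "(eps * eps0 / real d powr E2) powr (- gam) = eps powr (- gam) * eps0 powr (- gam) / real d powr (E2 * (- gam))"
    by (simp add: powr_divide powr_mult powr_powr)
   then show ?thesis by (simp add: powr_minus_divide)
  qed
  have "2 * kap * Kw\<^sup>2 * (real (m + 2) * (3 * real (Msel q (Suc m))) ^ (2 * Suc m)) * real d ^ (3 * p) * (eps * eps0 / real d powr E2) powr (- gam)
   <= 2 * kap * Kw\<^sup>2 * (eta1 dl * (X0 powr k * real d powr (E1 * k) * eps powr (- k))) * real d ^ (3 * p) * (eps * eps0 / real d powr E2) powr (- gam)"
   using pos by (intro mult_right_mono mult_left_mono 1) auto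
  also have "... = eta dl * (real d powr (3 * real p) * real d powr (E1 * k) * real d powr (E2 * gam)) * (eps powr (- k) * eps powr (- gam))"
   unfolding 2 eta_def k_def using d0 by (simp add: powr_realpow[symmetric] mult_ac)
  also have "... = eta dl * real d powr (3 * real p + E1 * k + E2 * gam) * eps powr (- (k + gam))"
   by (simp add: powr_add[symmetric])
  also have "... <= eta dl * real d powr (3 * real p + 2 * (2 + dl) * (2 * real r * real p + real p + 2) * real p + E2 * gam) * eps powr (- (k + gam))"
  proof (intro mult_right_mono mult_left_mono powr_mono add_right_mono add_left_mono)
   \<comment> \<open>The exponent of \<open>d\<close> obtained here is smaller than the one in the
     claim, and \<open>real d >= 1\<close>.\<close>
   have "E1 <= (2 * real r * real p + real p + 2) * real p"
    by (auto simp: E1_def algebra_simps power2_eq_square)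
   from mult_left_mono[OF this, of k] k
   show "E1 * k <= 2 * (2 + dl) * (2 * real r * real p + real p + 2) * real p" by (simp add: k_def mult_ac)
   show "eta dl >= 0" unfolding eta_def using eta1(1)[OF dl] pos by auto
  qed (use d0 in auto)
  finally show "2 * kap * Kw\<^sup>2 * (real (m + 2) * (3 * real (Msel q (Suc m))) ^ (2 * Suc m)) * real d ^ (3 * p) * (eps * eps0 / real d powr E2) powr (- gam)
   <= eta dl * real d powr (3 * real p + 2 * (2 + dl) * (2 * real r * real p + real p + 2) * real p + E2 * gam) * eps powr (- (2 * (2 + dl) + gam))"
   by (simp add: k_def)
 qed
qed

lemma viscosity_solution:
 assumes d: "d >= 1"
 shows "is_pg_visc_solution d T f0 (f d) (u d)"
  and "is_pg_visc_solution d T f0 (f d) v ==> t \<in> {0..T} ==> x \<in> Rd d ==> v t x = u d t x"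
proof -
 have c: "continuous_on (Rd d) (f d)" using f_cont[of d] d by (simp add: max_absorb1)
 have b: "abs (f d x) <= kap * real d ^ p * wgt d x powr real p" if "x \<in> Rd d" for x
  using h_bounds(3)[OF d, of 1 x] restrict_Rd[OF that] by simp
 note * = visc_exists_unique[OF d pos(7) _ f0_lip c b u[OF d]]
 show "is_pg_visc_solution d T f0 (f d) (u d)" by (rule *) auto
 show "is_pg_visc_solution d T f0 (f d) v ==> t \<in> {0..T} ==> x \<in> Rd d ==> v t x = u d t x" by (rule *) auto
qed

end

theorem mainTheorem1:
  fixes L \<kappa> \<alpha>0 \<alpha>1 \<beta>0 \<beta>1 T q :: real and p r :: nat
    and a :: "real \<Rightarrow> real"
    and f :: "nat \<Rightarrow> (nat \<Rightarrow> real) \<Rightarrow> real"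
    and \<nu> :: "nat \<Rightarrow> (nat \<Rightarrow> real) measure"
    and J :: ann
    and F :: "nat \<Rightarrow> real \<Rightarrow> ann"
  assumes pos: "L > 0" "\<kappa> > 0" "\<alpha>0 > 0" "\<alpha>1 > 0" "\<beta>0 > 0" "\<beta>1 > 0" "T > 0"
    and pr: "p \<ge> 1" "r \<ge> 1"
    and q: "q \<ge> 2"
    and a_cont: "continuous_on UNIV a"
    and f_cont: "\<And>d. continuous_on (Rd (max d 1)) (f d)"
    and \<nu>_prob: "\<And>d. d \<ge> 1 \<Longrightarrow> prob_space (\<nu> d)"
    and \<nu>_sets: "\<And>d. d \<ge> 1 \<Longrightarrow> sets (\<nu> d) = sets (PiM {..<d} (\<lambda>_. lborel))"
    and \<nu>_moment: "\<And>d. d \<ge> 1 \<Longrightarrow>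
        (\<integral>\<^sup>+ y. ennreal (enorm d y powr (real p ^ 2 * q)) \<partial>(\<nu> d))
          \<le> ennreal (\<kappa> * real d powr (real r * real p ^ 2 * q))"
    and J: "is_ann J" "ann_H J = 1" "ann_I J = 1" "ann_O J = 1"
           "\<And>v. realize1 a J (vec1 v) = v"
    and F_ann: "\<And>d \<epsilon>. \<epsilon> \<in> {0<..1} \<Longrightarrow> is_ann (F d \<epsilon>) \<and> ann_I (F d \<epsilon>) = max d 1 \<and>
        ann_O (F d \<epsilon>) = 1 \<and> continuous_on (Rd (max d 1)) (realize1 a (F d \<epsilon>))"
    and F_size: "\<And>d \<epsilon>. \<epsilon> \<in> {0<..1} \<Longrightarrow>
        \<epsilon> powr (if d = 0 then \<alpha>0 else \<alpha>1) * real (ann_L (F d \<epsilon>))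
          + \<epsilon> powr (if d = 0 then \<beta>0 else \<beta>1) * real (ann_Dmax (F d \<epsilon>))
        \<le> \<kappa> * real (max d 1) ^ p"
    and F_approx: "\<And>d \<epsilon> x. \<epsilon> \<in> {0<..1} \<Longrightarrow> x \<in> Rd (max d 1) \<Longrightarrow>
        \<epsilon> * \<bar>realize1 a (F d \<epsilon>) x\<bar> + \<bar>f d x - realize1 a (F d \<epsilon>) x\<bar>
          \<le> \<epsilon> * \<kappa> * real (max d 1) ^ p * (1 + enorm (max d 1) x) ^ p"
    and lip: "\<And>v w \<epsilon>. \<epsilon> \<in> {0<..1} \<Longrightarrow>
        max \<bar>f 0 (vec1 v) - f 0 (vec1 w)\<bar>
            \<bar>realize1 a (F 0 \<epsilon>) (vec1 v) - realize1 a (F 0 \<epsilon>) (vec1 w)\<bar> \<le> L * \<bar>v - w\<bar>"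
  shows "\<exists>u :: nat \<Rightarrow> real \<Rightarrow> (nat \<Rightarrow> real) \<Rightarrow> real.
     (\<forall>d\<ge>1. is_pg_visc_solution d T (\<lambda>y. f 0 (vec1 y)) (f d) (u d) \<and>
        (\<forall>v. is_pg_visc_solution d T (\<lambda>y. f 0 (vec1 y)) (f d) v \<longrightarrow>
             (\<forall>t\<in>{0..T}. \<forall>x\<in>Rd d. v t x = u d t x))) \<and>
     (\<exists>(U :: nat \<Rightarrow> real \<Rightarrow> ann) (\<eta> :: real \<Rightarrow> real).
       \<forall>d \<epsilon> \<delta>. d \<ge> 1 \<longrightarrow> \<epsilon> \<in> {0<..1} \<longrightarrow> \<delta> > 0 \<longrightarrow>
         is_ann (U d \<epsilon>) \<and> ann_I (U d \<epsilon>) = d \<and> ann_O (U d \<epsilon>) = 1 \<and>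
         continuous_on (Rd d) (realize1 a (U d \<epsilon>)) \<and>
         real (ann_P (U d \<epsilon>)) \<le> \<eta> \<delta>
            * real d powr (3 * real p + 2 * (2 + \<delta>) * (2 * real r * real p + real p + 2) * real p
                 + (real r * real p + real p + 1) * real p * (max \<alpha>0 \<alpha>1 + 2 * max \<beta>0 \<beta>1))
            * \<epsilon> powr (- (2 * (2 + \<delta>) + max \<alpha>0 \<alpha>1 + 2 * max \<beta>0 \<beta>1)) \<and>
         (\<integral>\<^sup>+ x. ennreal (\<bar>u d 0 x - realize1 a (U d \<epsilon>) x\<bar> powr q) \<partial>(\<nu> d)) \<le> ennreal (\<epsilon> powr q))"
proof -
  interpret S: ann_setting L \<kappa> \<alpha>0 \<alpha>1 \<beta>0 \<beta>1 T q p r a f \<nu> J F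
    by (rule ann_setting.intro) fact+
  from S.complexity obtain \<eta> :: "real \<Rightarrow> real" where \<eta>: "\<forall>\<delta>>0. \<forall>d\<ge>1. \<forall>\<epsilon>\<in>{0<..1}. \<forall>m.
     Gsel q S.c3 m \<le> S.X0 * real d powr (real p + real r * real p ^ 2) / \<epsilon> \<longrightarrow>
     2 * \<kappa> * S.Kw\<^sup>2 * (real (m + 2) * (3 * real (Msel q (Suc m))) ^ (2 * Suc m)) * real d ^ (3 * p) * (\<epsilon> * S.eps0 / real d powr S.E2) powr (- S.gam)
     \<le> \<eta> \<delta> * real d powr (3 * real p + 2 * (2 + \<delta>) * (2 * real r * real p + real p + 2) * real p + S.E2 * S.gam)
         * \<epsilon> powr (- (2 * (2 + \<delta>) + S.gam))"
    by (elim exE) (rule that)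
  \<comment> \<open>The size bound is demanded for all \<open>\<delta>\<close> simultaneously, so
    that the network chosen below depends on \<open>d\<close> and \<open>\<epsilon>\<close>
    alone.\<close>
  let ?U = "\<lambda>d \<epsilon> \<Phi>. is_ann \<Phi> \<and> ann_I \<Phi> = d \<and> ann_O \<Phi> = 1 \<and> continuous_on (Rd d) (realize1 a \<Phi>) \<and>
    (\<integral>\<^sup>+x. ennreal (\<bar>S.u d 0 x - realize1 a \<Phi> x\<bar> powr q) \<partial>\<nu> d) \<le> ennreal (\<epsilon> powr q) \<and>
    (\<forall>\<delta>>0. real (ann_P \<Phi>) \<le> \<eta> \<delta> * real d powr (3 * real p + 2 * (2 + \<delta>) * (2 * real r * real p + real p + 2) * real p + S.E2 * S.gam)
         * \<epsilon> powr (- (2 * (2 + \<delta>) + S.gam)))"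
  define U where "U d \<epsilon> = (SOME \<Phi>. ?U d \<epsilon> \<Phi>)" for d \<epsilon>
  have U: "?U d \<epsilon> (U d \<epsilon>)" if d: "d \<ge> 1" and \<epsilon>: "\<epsilon> \<in> {0<..1}" for d \<epsilon>
  proof -
    obtain \<Phi> m where \<Phi>: "is_ann \<Phi>" "ann_I \<Phi> = d" "ann_O \<Phi> = 1" "continuous_on (Rd d) (realize1 a \<Phi>)"
      "(\<integral>\<^sup>+x. ennreal (\<bar>S.u d 0 x - realize1 a \<Phi> x\<bar> powr q) \<partial>\<nu> d) \<le> ennreal (\<epsilon> powr q)"
      and m: "Gsel q S.c3 m \<le> S.X0 * real d powr (real p + real r * real p ^ 2) / \<epsilon>"
      and P: "real (ann_P \<Phi>) \<le> 2 * \<kappa> * S.Kw\<^sup>2 * (real (m + 2) * (3 * real (Msel q (Suc m))) ^ (2 * Suc m)) * real d ^ (3 * p) * (\<epsilon> * S.eps0 / real d powr S.E2) powr (- S.gam)"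
      using S.approximation[OF d \<epsilon>] by (elim exE conjE) (rule that)
    have "?U d \<epsilon> \<Phi>" by (intro conjI allI impI \<Phi>, rule order_trans[OF P]) (rule \<eta>[rule_format, OF _ d \<epsilon> m])
    from someI[of "?U d \<epsilon>" \<Phi>, OF this] show ?thesis unfolding U_def .
  qed
  show ?thesis
  proof (intro exI[of _ S.u] exI[of _ U] exI[of _ \<eta>] conjI allI impI ballI, goal_cases)
    case (1 d)
    then show ?case by (rule S.viscosity_solution)
  next
    case (2 d v t x)
    then show ?case by (intro S.viscosity_solution)
  next
    case (7 d \<epsilon> \<delta>)
    have "\<forall>\<delta>>0. real (ann_P (U d \<epsilon>)) \<le> \<eta> \<delta> * real d powr (3 * real p + 2 * (2 + \<delta>) * (2 * real r * real p + real p + 2) * real p + S.E2 * S.gam)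
         * \<epsilon> powr (- (2 * (2 + \<delta>) + S.gam))"
      using U[OF 7(1,2)] by (elim conjE)
    with 7(3) show ?case by (simp only: S.E2_def S.gam_def add.assoc)
  qed (blast dest: U)+
qed

end
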